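(* Let $\mathcal W=(\mathcal W_1,\mathcal W_2,\mathcal W_3)$ be a 3D white noise on $\mathbb T^2$, and let $\theta$ be the (almost sure) limit in $\mathcal D'(\mathbb T^2)$, as $\varepsilon\to0$, of $\theta^\varepsilon:=\xi^\varepsilon\times\overline{\xi^\varepsilon}$. Then, almost surely, for every $\kappa\in(0,\frac12)$, $\theta\in E_{-\kappa}$. Furthermore, for every $\kappa\in(0,\frac12)$ there is a constant $C>0$ such that almost surely, for all $\varepsilon\ge0$ and $j=1,2,3$, $$|\theta_j^\varepsilon|_{-\kappa}\le C\,|\mathcal W_{j_1}|_{-1-\frac\kappa4}\,|\mathcal W_{j_2}|_{-1-\frac\kappa4},$$ $$|\theta_j^\varepsilon-\theta_j|_{-\kappa}\le C\Big(|\mathcal W_{j_1}^\varepsilon-\mathcal W_{j_1}|_{-1-\frac\kappa4}|\mathcal W_{j_2}|_{-1-\frac\kappa4}+|\mathcal W_{j_2}^\varepsilon-\mathcal W_{j_2}|_{-1-\frac\kappa4}|\mathcal W_{j_1}|_{-1-\frac\kappa4}\Big),$$ where $j_1\equiv j+1$, $j_2\equiv j+2\pmod 3$ with $j_1,j_2\in\{1,2,3\}$, and $\theta^0:=\theta$, $\mathcal W^0:=\mathcal W$.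
   Context: $\mathbb T^2=[-\pi,\pi]^2$ with opposite faces identified. $\times$ is the complex-bilinear cross product in $\mathbb C^3$. Green functions: $K$ is the real-valued mean-zero Green function of $-\Delta$ on $\mathbb T^2$ ($-\Delta K=\delta_0-(4\pi^2)^{-1}$); $G:=2\partial_zK=\partial_1K-i\partial_2K$, $\partial_z=\frac12(\partial_1-i\partial_2)$. White noise: $\mathcal W_j=\eta_j+\mathrm{Re}\big[\sum_{k\in\mathbb Z^2\setminus\{0\}}\eta_{kj}e^{i(k,x)}\big]$, $j=1,2,3$ (convergence in $\mathcal D'(\mathbb T^2)$), with $\eta_j$ i.i.d. standard real Gaussian and $\eta_{kj}$ i.i.d. standard complex Gaussian variables. $\mathcal W_j^\varepsilon=\rho_\varepsilon*\mathcal W_j$ with the standard mollifier $\rho_\varepsilon(x)=\varepsilon^{-2}\rho(x/\varepsilon)$, $\xi^\varepsilon_k=2i\,G*\mathcal W_k^\varepsilon$, $\xi^\varepsilon=(\xi_1^\varepsilon,\xi_2^\varepsilon,\xi_3^\varepsilon)$, $\varepsilon>0$. Spaces: for $\varphi\in C_c^\infty(B_1(0))$ ($B_1(0)\subset\mathbb R^2$ open unit ball), $\lambda\in(0,1]$, $x\in\mathbb T^2$, let $\varphi_x^\lambda(y)=\lambda^{-2}\varphi((y-x)/\lambda)$, extended periodically. Let $\mathscr B^r=\{\varphi\in C_c^\infty(B_1(0)):\|\partial^k\varphi\|_\infty\le1,\ |k|\le r\}$. For $\alpha<0$, $|f|_\alpha=\sup_{x\in\mathbb T^2,\lambda\in(0,1],\varphi\in\mathscr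 B^{[-\alpha+1]}}\lambda^{-\alpha}|f(\varphi_x^\lambda)|$. The little space $\mathcal Z^\alpha(\mathbb T^2)$ is the closure of $C^\infty(\mathbb T^2)$ in the space of distributions with $|f|_\alpha<\infty$ (complex-valued: $|f|_\alpha^2=|\mathrm{Re} f|_\alpha^2+|\mathrm{Im} f|_\alpha^2$). $E_\nu$ is the space of $f=(f_1,f_2,f_3)$ with $f_k\in\mathcal Z^\nu(\mathbb T^2)$ complex-valued, with norm $\|f\|_\nu^2=\sum_k|f_k|_\nu^2$. *)

theory Defs
  imports "HOL-Probability.Probability"
begin

text \<open>
  Functions on the torus are functions on \<^typ>\<open>real^2\<close> that are \<open>2\<pi>\<close>-periodic in both
  coordinates; integrals over the torus are Lebesgue integrals over the fundamental square.
\<close>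

definition torus :: "(real^2) set" where
  "torus = cbox (\<chi> i. - pi) (\<chi> i. pi)"

definition periodic2 :: "(real^2 \<Rightarrow> 'b) \<Rightarrow> bool" where
  "periodic2 f \<longleftrightarrow> (\<forall>x i. f (x + axis i (2 * pi)) = f x)"

definition partial :: "2 \<Rightarrow> (real^2 \<Rightarrow> 'b::real_normed_vector) \<Rightarrow> real^2 \<Rightarrow> 'b" where
  "partial i f x = frechet_derivative f (at x) (axis i 1)"

text \<open>Multi-indices are encoded as lists of directions, the order being the length.\<close>

definition partials :: "2 list \<Rightarrow> (real^2 \<Rightarrow> 'b::real_normed_vector) \<Rightarrow> real^2 \<Rightarrow> 'b" where
  "partials is f = foldr partial is f"

definition smooth :: "(real^2 \<Rightarrow> 'b::real_normed_vector) \<Rightarrow> bool" where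
  "smooth f \<longleftrightarrow> (\<forall>is x. partials is f differentiable (at x))"

definition smooth_torus :: "(real^2 \<Rightarrow> 'b::real_normed_vector) set" where
  "smooth_torus = {f. smooth f \<and> periodic2 f}"

text \<open>
  A distribution on the torus is a continuous linear functional on the real-valued smooth
  functions.  Its values are real, or complex for a complex-valued distribution: a complex-linear
  functional on the complex-valued smooth functions is determined by its restriction to the
  real-valued ones.  Values of the functional outside \<^term>\<open>smooth_torus\<close> are irrelevant.
  Continuity is the bound by finitely many of the seminorms \<open>\<parallel>\<partial>\<^sup>k \<phi>\<parallel>\<close>.
\<close>

type_synonym 'b functional = "(real^2 \<Rightarrow> real) \<Rightarrow> 'b"

definition distribution :: "'b::real_normed_vector functional \<Rightarrow> bool" where
  "distribution T \<longleftrightarrow>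
     (\<forall>\<phi>\<in>smooth_torus. \<forall>\<psi>\<in>smooth_torus. T (\<lambda>x. \<phi> x + \<psi> x) = T \<phi> + T \<psi>) \<and>
     (\<forall>\<phi>\<in>smooth_torus. \<forall>c. T (\<lambda>x. c * \<phi> x) = c *\<^sub>R T \<phi>) \<and>
     (\<exists>N C. \<forall>\<phi>\<in>smooth_torus. \<forall>b.
        (\<forall>is x. length is \<le> N \<longrightarrow> \<bar>partials is \<phi> x\<bar> \<le> b) \<longrightarrow> norm (T \<phi>) \<le> C * b)"

definition dist_of :: "(real^2 \<Rightarrow> 'b::{banach, second_countable_topology}) \<Rightarrow> 'b functional" where
  "dist_of f \<phi> = (LINT x:torus|lborel. \<phi> x *\<^sub>R f x)"

definition dist_diff :: "'b::real_normed_vector functional \<Rightarrow> 'b functional \<Rightarrow> 'b functional" where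
  "dist_diff S T \<phi> = S \<phi> - T \<phi>"

definition dist_partial :: "2 \<Rightarrow> 'b::real_normed_vector functional \<Rightarrow> 'b functional" where
  "dist_partial i T \<phi> = - T (partial i \<phi>)"

definition dist_conv :: "'b functional \<Rightarrow> (real^2 \<Rightarrow> real) \<Rightarrow> real^2 \<Rightarrow> 'b" where
  "dist_conv T f x = T (\<lambda>y. f (x - y))"

text \<open>
  For compactly supported \<open>f\<close> the sum below is pointwise finite; if moreover the support has
  diameter less than \<open>2\<pi>\<close>, it is the periodic extension of \<open>f\<close>.
\<close>

definition periodize :: "(real^2 \<Rightarrow> real) \<Rightarrow> real^2 \<Rightarrow> real" where
  "periodize f y = (\<Sum>\<^sub>\<infinity>n\<in>(UNIV :: (int^2) set). f (y + (\<chi> i. 2 * pi * of_int (n $ i))))"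


text \<open>The norms \<open>|f|\<^sub>\<alpha>\<close> for \<open>\<alpha> < 0\<close>, with values in \<open>[0,\<infinity>]\<close>.\<close>

definition scaled_test :: "(real^2 \<Rightarrow> real) \<Rightarrow> real^2 \<Rightarrow> real \<Rightarrow> real^2 \<Rightarrow> real" where
  "scaled_test \<phi> x l = periodize (\<lambda>y. \<phi> ((1 / l) *\<^sub>R (y - x)) / l\<^sup>2)"

definition unit_tests :: "nat \<Rightarrow> (real^2 \<Rightarrow> real) set" where
  "unit_tests r = {\<phi>. smooth \<phi> \<and> closure {x. \<phi> x \<noteq> 0} \<subseteq> ball 0 1 \<and>
     (\<forall>is x. length is \<le> r \<longrightarrow> \<bar>partials is \<phi> x\<bar> \<le> 1)}"

definition real_norm :: "real \<Rightarrow> real functional \<Rightarrow> ennreal" where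
  "real_norm \<alpha> f =
     (SUP x\<in>torus. SUP l\<in>{0<..1}. SUP \<phi>\<in>unit_tests (nat \<lfloor>- \<alpha> + 1\<rfloor>).
        ennreal (l powr (- \<alpha>) * \<bar>f (scaled_test \<phi> x l)\<bar>))"

definition ennreal_hypot :: "ennreal \<Rightarrow> ennreal \<Rightarrow> ennreal" where
  "ennreal_hypot a b =
     (if a = \<infinity> \<or> b = \<infinity> then \<infinity> else ennreal (sqrt ((enn2real a)\<^sup>2 + (enn2real b)\<^sup>2)))"

definition complex_norm :: "real \<Rightarrow> complex functional \<Rightarrow> ennreal" where
  "complex_norm \<alpha> f =
     ennreal_hypot (real_norm \<alpha> (\<lambda>\<phi>. Re (f \<phi>))) (real_norm \<alpha> (\<lambda>\<phi>. Im (f \<phi>)))"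

definition little_space :: "real \<Rightarrow> complex functional set" where
  "little_space \<alpha> = {f. distribution f \<and> complex_norm \<alpha> f < \<infinity> \<and>
     (\<forall>e>0. \<exists>g\<in>smooth_torus. complex_norm \<alpha> (dist_diff f (dist_of g)) < ennreal e)}"

definition E_space :: "real \<Rightarrow> (3 \<Rightarrow> complex functional) set" where
  "E_space \<nu> = {f. \<forall>k. f k \<in> little_space \<nu>}"


definition is_green :: "(real^2 \<Rightarrow> real) \<Rightarrow> bool" where
  "is_green K \<longleftrightarrow> periodic2 K \<and> set_integrable lborel torus K \<and>
     (LINT x:torus|lborel. K x) = 0 \<and>
     (\<forall>\<phi>\<in>smooth_torus. dist_of K (\<lambda>x. - (\<Sum>i\<in>UNIV. partial i (partial i \<phi>) x)) =
        \<phi> 0 - (1 / (4 * pi\<^sup>2)) * (LINT x:torus|lborel. \<phi> x))"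

definition green_dz :: "(real^2 \<Rightarrow> real) \<Rightarrow> complex functional" where
  "green_dz K \<phi> = complex_of_real (dist_partial 1 (dist_of K) \<phi>)
     - \<i> * complex_of_real (dist_partial 2 (dist_of K) \<phi>)"


text \<open>
  A standard complex Gaussian variable has independent standard real Gaussian real and imaginary
  parts.  This is the normalisation for which the series below is white noise: the coefficients
  of \<open>cos (k,x)\<close> and \<open>sin (k,x)\<close>, which collect the modes \<open>k\<close> and \<open>-k\<close>, then have
  variance 2, so that the covariance is \<open>4\<pi>\<^sup>2 \<delta>\<^sub>0\<close>.
\<close>

definition std_gaussian :: "'m measure \<Rightarrow> ('m \<Rightarrow> real) \<Rightarrow> bool" where
  "std_gaussian M X \<longleftrightarrow> distributed M lborel X (\<lambda>x. ennreal (std_normal_density x))"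

definition std_complex_gaussian :: "'m measure \<Rightarrow> ('m \<Rightarrow> complex) \<Rightarrow> bool" where
  "std_complex_gaussian M X \<longleftrightarrow>
     prob_space.indep_var M borel (\<lambda>\<omega>. Re (X \<omega>)) borel (\<lambda>\<omega>. Im (X \<omega>)) \<and>
     std_gaussian M (\<lambda>\<omega>. Re (X \<omega>)) \<and> std_gaussian M (\<lambda>\<omega>. Im (X \<omega>))"

definition freq :: "int^2 \<Rightarrow> real^2 \<Rightarrow> real" where
  "freq k x = (\<Sum>i\<in>UNIV. of_int (k $ i) * x $ i)"

text \<open>
  The index \<open>k = 0\<close> of the independent family carries the real variables \<open>\<eta>0 j\<close>.  Convergence
  of the series in the space of distributions is convergence against every test function.
\<close>

definition white_noise_3d :: "'m measure \<Rightarrow> ('m \<Rightarrow> 3 \<Rightarrow> real functional) \<Rightarrow> bool" where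
  "white_noise_3d M W \<longleftrightarrow> prob_space M \<and>
     (\<exists>(\<eta>0 :: 3 \<Rightarrow> 'm \<Rightarrow> real) (\<eta> :: int^2 \<Rightarrow> 3 \<Rightarrow> 'm \<Rightarrow> complex).
        (\<forall>j. std_gaussian M (\<eta>0 j)) \<and>
        (\<forall>k j. k \<noteq> 0 \<longrightarrow> std_complex_gaussian M (\<eta> k j)) \<and>
        prob_space.indep_vars M (\<lambda>_. borel)
          (\<lambda>(k, j). if k = 0 then (\<lambda>\<omega>. complex_of_real (\<eta>0 j \<omega>)) else \<eta> k j) UNIV \<and>
        (AE \<omega> in M. \<forall>j. distribution (W \<omega> j) \<and>
           (\<forall>\<phi>\<in>smooth_torus.
              ((\<lambda>k. dist_of (\<lambda>x. Re (\<eta> k j \<omega> * cis (freq k x))) \<phi>) has_sum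
                 (W \<omega> j \<phi> - dist_of (\<lambda>x. \<eta>0 j \<omega>) \<phi>)) (UNIV - {0}))))"


definition is_mollifier :: "(real^2 \<Rightarrow> real) \<Rightarrow> bool" where
  "is_mollifier \<rho> \<longleftrightarrow> smooth \<rho> \<and> bounded {x. \<rho> x \<noteq> 0} \<and> (\<forall>x. 0 \<le> \<rho> x) \<and>
     (LINT x|lborel. \<rho> x) = 1"

definition mollify :: "(real^2 \<Rightarrow> real) \<Rightarrow> real \<Rightarrow> real functional \<Rightarrow> real^2 \<Rightarrow> real" where
  "mollify \<rho> \<epsilon> T = dist_conv T (periodize (\<lambda>x. \<rho> ((1 / \<epsilon>) *\<^sub>R x) / \<epsilon>\<^sup>2))"

definition mollified_dist :: "(real^2 \<Rightarrow> real) \<Rightarrow> real \<Rightarrow> real functional \<Rightarrow> real functional" where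
  "mollified_dist \<rho> \<epsilon> T = (if \<epsilon> = 0 then T else dist_of (mollify \<rho> \<epsilon> T))"

definition xi ::
  "(real^2 \<Rightarrow> real) \<Rightarrow> (real^2 \<Rightarrow> real) \<Rightarrow> (3 \<Rightarrow> real functional) \<Rightarrow> real \<Rightarrow> real^2 \<Rightarrow> complex^3" where
  "xi K \<rho> W \<epsilon> x = (\<chi> k. 2 * \<i> * dist_conv (green_dz K) (mollify \<rho> \<epsilon> (W k)) x)"

definition ccross :: "complex^3 \<Rightarrow> complex^3 \<Rightarrow> complex^3" where
  "ccross a b = vector [a$2 * b$3 - a$3 * b$2, a$3 * b$1 - a$1 * b$3, a$1 * b$2 - a$2 * b$1]"

definition theta_eps ::
  "(real^2 \<Rightarrow> real) \<Rightarrow> (real^2 \<Rightarrow> real) \<Rightarrow> (3 \<Rightarrow> real functional) \<Rightarrow> real \<Rightarrow> 3 \<Rightarrow> complex functional" where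
  "theta_eps K \<rho> W \<epsilon> j =
     dist_of (\<lambda>x. ccross (xi K \<rho> W \<epsilon> x) (\<chi> k. cnj (xi K \<rho> W \<epsilon> x $ k)) $ j)"

definition theta_limit ::
  "(real^2 \<Rightarrow> real) \<Rightarrow> (real^2 \<Rightarrow> real) \<Rightarrow> (3 \<Rightarrow> real functional) \<Rightarrow> (3 \<Rightarrow> complex functional) \<Rightarrow> bool" where
  "theta_limit K \<rho> W \<theta> \<longleftrightarrow>
     (\<forall>j. distribution (\<theta> j) \<and>
        (\<forall>\<phi>\<in>smooth_torus. ((\<lambda>\<epsilon>. theta_eps K \<rho> W \<epsilon> j \<phi>) \<longlongrightarrow> \<theta> j \<phi>) (at_right 0)))"

text \<open>
  The component indices live in the type \<^typ>\<open>3\<close> of integers modulo 3, so the cyclic successors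
  of \<open>j\<close> are \<open>j + 1\<close> and \<open>j + 2\<close>.  The next definition gives \<open>\<theta>\<^sup>\<epsilon>\<close> for all \<open>\<epsilon> \<ge> 0\<close>, with
  \<open>\<theta>\<^sup>0 = \<theta>\<close>.
\<close>

definition theta_ext ::
  "(real^2 \<Rightarrow> real) \<Rightarrow> (real^2 \<Rightarrow> real) \<Rightarrow> (3 \<Rightarrow> real functional) \<Rightarrow> (3 \<Rightarrow> complex functional)
     \<Rightarrow> real \<Rightarrow> 3 \<Rightarrow> complex functional" where
  "theta_ext K \<rho> W \<theta> \<epsilon> = (if \<epsilon> = 0 then \<theta> else theta_eps K \<rho> W \<epsilon>)"

end

theory Submission
  imports Defs
begin

text \<open>
  Put \<open>u = K * W\<^sub>j\<^sub>1\<close> and \<open>v = K * W\<^sub>j\<^sub>2\<close>. For smooth noise, \<open>\<theta>\<^sub>j = 8 \<i> det (\<nabla>u, \<nabla>v)\<close>, a Jacobian, which is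
  why it has a limit although neither factor is a function: in \<open>\<integral> \<phi> det (\<nabla>u, \<nabla>v)\<close> one derivative can be
  moved from either factor onto \<open>\<phi>\<close>.

  To exploit this, let \<open>E\<close> be a smooth function equal to \<open>log \<bar>x\<bar> / (2 \<pi>)\<close> off a ball. Then
  \<open>\<delta> = \<Delta>E\<close> and \<open>E (2 x) - E x - log 2 / (2 \<pi>)\<close> are compactly supported, and the rescalings of the
  latter have as Laplacians the differences of the consecutive dyadic mollifiers \<open>4\<^sup>n \<delta> (2\<^sup>n x)\<close>. The
  potentials \<open>u\<^sub>n\<close>, \<open>v\<^sub>n\<close> of the noises mollified at scale \<open>2\<^sup>-\<^sup>n\<close> thus change, from \<open>n\<close> to \<open>n + 1\<close>, by
  pairings of the noise with test functions of scale \<open>2\<^sup>-\<^sup>n\<close>. If the noise has regularity \<open>-1 - \<delta>\<close>,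
  these increments are of order \<open>2\<^sup>-\<^sup>n\<^sup>(\<^sup>1\<^sup>-\<^sup>\<delta>\<^sup>)\<close>, the gradients of \<open>u\<^sub>n\<close>, \<open>v\<^sub>n\<close> of order \<open>2\<^sup>n\<^sup>\<delta>\<close>, and the increments of
  \<open>\<integral> \<phi> det (\<nabla>u\<^sub>n, \<nabla>v\<^sub>n)\<close> are summable. Splitting the sum at the scale of \<open>\<phi>\<close> gives the regularity
  \<open>- \<kappa>\<close> with constants bilinear in the norms of the noises.

  White noise has the required regularity almost surely because its values on the tests of scale
  \<open>2\<^sup>-\<^sup>n\<close> centred at a dyadic grid grow at most like \<open>n 2\<^sup>n\<close>, by Bessel's inequality and Gaussian
  exponential moments.
\<close>

section \<open>Smooth functions on the plane\<close>

text \<open>One constant \<open>C\<close> has to serve all realisations and all \<epsilon>, so the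
  analysis is done for fixed distributions and probability enters only through the finiteness of
  their norms. Uniformity in \<epsilon> comes from the positivity of \<rho>: mollification averages
  translates with a probability density and preserves bounds against scaled tests. The bracket
  itself is built with one dyadic kernel independent of \<rho>; it is the classical Jacobian on
  smooth functions and is continuous under mollification, which identifies it with the limit of
  \<open>theta_eps\<close>. The kernel comes from the logarithm and not from \<open>K\<close>
  because its dyadic increments have compact support and can be paired with the noise;
  \<open>K\<close> meets only the coarsest level. Noise of order \<open>- 1 - \<delta>\<close> gives
  a bracket of order \<open>- 2 * \<delta>\<close>, but \<open>\<kappa> = 4 * \<delta>\<close>: the
  spare \<open>2 * \<delta>\<close> pays for a rate of approximation by smooth functions, hence for
  the little space. The range of \<kappa> gives \<open>\<delta> < 1 / 8\<close>, well inside the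
  range \<open>\<delta> < 1 / 2\<close> in which the series converges.\<close>

lemma partials_simps [simp]:
  "partials [] f = f" "partials (i # is) f = partial i (partials is f)"
  by (auto simp: partials_def)

lemma partials_append: "partials (is @ js) f = partials is (partials js f)"
  by (simp add: partials_def)

text \<open>Smoothness by coinduction: a class of differentiable functions stable under
  \<open>partial\<close> consists of smooth functions, so closure properties need no formula for
  higher derivatives. The induction runs from the right because the last entry of the list is the
  derivative taken first.\<close>

lemma smooth_coinduct:
  assumes "P f"
    and "\<And>f. P f \<Longrightarrow> (\<forall>x. f differentiable (at x)) \<and> (\<forall>i. P (partial i f))"
  shows "smooth f"
proof -
  have "P f \<Longrightarrow> (\<forall>x. partials is f differentiable (at x)) \<and> P (partials is f)" for "is" f
  proof (induction "is" arbitrary: f rule: rev_induct)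
    case Nil
    then show ?case using assms(2) by simp
  next
    case (snoc i "is")
    then show ?case using assms(2) by (simp add: partials_append)
  qed
  then show ?thesis using assms(1) by (simp add: smooth_def)
qed

lemma smooth_differentiable: "smooth f \<Longrightarrow> f differentiable (at x)"
  unfolding smooth_def by (metis partials_simps(1))

lemma smooth_partial: "smooth f \<Longrightarrow> smooth (partial i f)"
  unfolding smooth_def by (metis partials_append partials_simps)

lemma smooth_partials: "smooth f \<Longrightarrow> smooth (partials is f)"
  by (induction "is") (auto simp: smooth_partial)

lemma smooth_continuous: "smooth f \<Longrightarrow> continuous_on A f"
  by (meson continuous_at_imp_continuous_on differentiable_imp_continuous_within smooth_differentiable)

lemma smooth_measurable [measurable_dest]: "smooth f \<Longrightarrow> f \<in> borel_measurable borel"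
  by (rule borel_measurable_continuous_onI[OF smooth_continuous])

lemma frechet_derivative_partial:
  fixes f :: "real^2 \<Rightarrow> 'b::real_normed_vector"
  assumes "f differentiable (at x)"
  shows "(f has_derivative (\<lambda>v. \<Sum>i\<in>UNIV. v $ i *\<^sub>R partial i f x)) (at x)"
proof -
  have d: "(f has_derivative frechet_derivative f (at x)) (at x)"
    using assms frechet_derivative_works by blast
  then interpret linear "frechet_derivative f (at x)"
    using has_derivative_linear by blast
  have "frechet_derivative f (at x) v = (\<Sum>i\<in>UNIV. v $ i *\<^sub>R partial i f x)" for v
  proof -
    have "v = (\<Sum>i\<in>UNIV. v $ i *\<^sub>R axis i 1)"
      by (simp add: basis_expansion flip: scalar_mult_eq_scaleR)
    then have "frechet_derivative f (at x) v
        = frechet_derivative f (at x) (\<Sum>i\<in>UNIV. v $ i *\<^sub>R axis i 1)" by simp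
    then show ?thesis by (simp add: sum scale partial_def)
  qed
  then have "frechet_derivative f (at x) = (\<lambda>v. \<Sum>i\<in>UNIV. v $ i *\<^sub>R partial i f x)" by auto
  with d show ?thesis by simp
qed

lemma smooth_has_derivative:
  "smooth f \<Longrightarrow> (f has_derivative (\<lambda>v. \<Sum>i\<in>UNIV. v $ i *\<^sub>R partial i f x)) (at x)"
  by (simp add: frechet_derivative_partial smooth_differentiable)

lemma partialI: "(f has_derivative D) (at x) \<Longrightarrow> partial i f x = D (axis i 1)"
  unfolding partial_def by (metis frechet_derivative_at)

lemma axis_nth_sum [simp]:
  "(\<Sum>j\<in>UNIV. (axis i (1::real) :: real^2) $ j *\<^sub>R (c j :: 'b::real_vector)) = c i"
  by (simp add: axis_def if_distrib[of "\<lambda>t. t *\<^sub>R _"] cong: if_cong)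

lemma axis_nth_sum_real [simp]:
  "(\<Sum>j\<in>UNIV. (axis i (1::real) :: real^2) $ j * (c j :: real)) = c i"
  using axis_nth_sum[of i c] by simp

lemma partial_const [simp]: "partial i (\<lambda>x. c) = (\<lambda>x. 0)"
  by (rule ext) (subst partialI[OF has_derivative_const], simp)

lemma partial_add:
  assumes "smooth f" "smooth g"
  shows "partial i (\<lambda>x. f x + g x) = (\<lambda>x. partial i f x + partial i g x)"
  by (rule ext) (subst partialI[OF has_derivative_add[OF smooth_has_derivative smooth_has_derivative]],
      use assms in simp_all)

lemma partial_bounded_linear:
  assumes "bounded_linear L" "smooth f"
  shows "partial i (\<lambda>x. L (f x)) = (\<lambda>x. L (partial i f x))"
  by (rule ext) (subst partialI[OF bounded_linear.has_derivative[OF assms(1) smooth_has_derivative]],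
      use assms in simp_all)

lemma partial_mult:
  fixes f g :: "real^2 \<Rightarrow> real"
  assumes "smooth f" "smooth g"
  shows "partial i (\<lambda>x. f x * g x) = (\<lambda>x. f x * partial i g x + partial i f x * g x)"
  by (rule ext) (subst partialI[OF has_derivative_mult[OF smooth_has_derivative smooth_has_derivative]],
      use assms in simp_all)

lemma partial_affine:
  fixes f :: "real^2 \<Rightarrow> 'b::real_normed_vector"
  assumes "smooth f"
  shows "partial i (\<lambda>x. f (c *\<^sub>R x + a)) = (\<lambda>x. c *\<^sub>R partial i f (c *\<^sub>R x + a))"
proof
  fix x
  have "((\<lambda>x. c *\<^sub>R x + a) has_derivative (\<lambda>v. c *\<^sub>R v)) (at x)"
    by (auto intro!: derivative_eq_intros)
  then have "((\<lambda>x. f (c *\<^sub>R x + a)) has_derivative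
      (\<lambda>v. \<Sum>i\<in>UNIV. (c *\<^sub>R v) $ i *\<^sub>R partial i f (c *\<^sub>R x + a))) (at x)"
    using has_derivative_compose[OF _ smooth_has_derivative[OF assms]] by blast
  then have "((\<lambda>x. f (c *\<^sub>R x + a)) has_derivative
      (\<lambda>v. c *\<^sub>R (\<Sum>i\<in>UNIV. v $ i *\<^sub>R partial i f (c *\<^sub>R x + a)))) (at x)"
    by (simp add: scaleR_sum_right)
  from partialI[OF this]
  show "partial i (\<lambda>x. f (c *\<^sub>R x + a)) x = c *\<^sub>R partial i f (c *\<^sub>R x + a)"
    by (simp only: axis_nth_sum)
qed

lemma smooth_const [simp, intro]: "smooth (\<lambda>x. c)"
  by (rule smooth_coinduct[of "\<lambda>f. \<exists>c. f = (\<lambda>x. c)"]) auto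

lemma smooth_add [intro]:
  assumes "smooth f" "smooth g" shows "smooth (\<lambda>x. f x + g x)"
proof (rule smooth_coinduct[of "\<lambda>h. \<exists>f g. smooth f \<and> smooth g \<and> h = (\<lambda>x. f x + g x)"])
  fix h assume "\<exists>f g. smooth f \<and> smooth g \<and> h = (\<lambda>x. f x + g x)"
  then obtain f g where h: "smooth f" "smooth g" "h = (\<lambda>x. f x + g x)" by blast
  show "(\<forall>x. h differentiable at x) \<and> (\<forall>i. \<exists>f g. smooth f \<and> smooth g \<and> partial i h = (\<lambda>x. f x + g x))"
  proof (intro conjI allI)
    show "h differentiable at x" for x
      unfolding h(3) by (intro differentiable_add smooth_differentiable h)
    show "\<exists>f g. smooth f \<and> smooth g \<and> partial i h = (\<lambda>x. f x + g x)" for i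
      by (rule exI[of _ "partial i f"], rule exI[of _ "partial i g"])
         (simp add: h partial_add smooth_partial)
  qed
qed (rule exI[of _ f], rule exI[of _ g], simp add: assms)

lemma smooth_bounded_linear:
  assumes "bounded_linear L" "smooth f" shows "smooth (\<lambda>x. L (f x))"
proof (rule smooth_coinduct[of "\<lambda>h. \<exists>f. smooth f \<and> h = (\<lambda>x. L (f x))"])
  fix h assume "\<exists>f. smooth f \<and> h = (\<lambda>x. L (f x))"
  then obtain f where h: "smooth f" "h = (\<lambda>x. L (f x))" by blast
  show "(\<forall>x. h differentiable at x) \<and> (\<forall>i. \<exists>f. smooth f \<and> partial i h = (\<lambda>x. L (f x)))"
  proof (intro conjI allI)
    show "h differentiable at x" for x
      unfolding h(2) by (rule differentiableI[OF bounded_linear.has_derivative[OF assms(1)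
          smooth_has_derivative[OF h(1)]]])
    show "\<exists>f. smooth f \<and> partial i h = (\<lambda>x. L (f x))" for i
      by (rule exI[of _ "partial i f"]) (simp add: h partial_bounded_linear[OF assms(1)] smooth_partial)
  qed
qed (rule exI[of _ f], simp add: assms)

lemma smooth_sum: "finite A \<Longrightarrow> (\<And>a. a \<in> A \<Longrightarrow> smooth (f a)) \<Longrightarrow> smooth (\<lambda>x. \<Sum>a\<in>A. f a x)"
  by (induction A rule: finite_induct) auto

lemma partial_sum:
  "finite A \<Longrightarrow> (\<And>a. a \<in> A \<Longrightarrow> smooth (f a)) \<Longrightarrow>
    partial i (\<lambda>x. \<Sum>a\<in>A. f a x) = (\<lambda>x. \<Sum>a\<in>A. partial i (f a) x)"
  by (induction A rule: finite_induct) (auto simp: partial_add smooth_sum)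

lemma smooth_cmult: "smooth f \<Longrightarrow> smooth (\<lambda>x. c * f x :: real)"
  by (rule smooth_bounded_linear[OF bounded_linear_mult_right])

lemma smooth_minus: "smooth f \<Longrightarrow> smooth (\<lambda>x. - f x)"
  by (rule smooth_bounded_linear[OF bounded_linear_minus[OF bounded_linear_ident]])

lemma smooth_diff [intro]: "smooth f \<Longrightarrow> smooth g \<Longrightarrow> smooth (\<lambda>x. f x - g x)"
  using smooth_add[OF _ smooth_minus, of f g] by simp

lemma partial_minus: "smooth f \<Longrightarrow> partial i (\<lambda>x. - f x) = (\<lambda>x. - partial i f x)"
  by (rule partial_bounded_linear[OF bounded_linear_minus[OF bounded_linear_ident]])

lemma partial_diff:
  "smooth f \<Longrightarrow> smooth g \<Longrightarrow> partial i (\<lambda>x. f x - g x) = (\<lambda>x. partial i f x - partial i g x)"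
  using partial_add[OF _ smooth_minus, of f g] by (simp add: partial_minus)

lemma partial_cmult: "smooth f \<Longrightarrow> partial i (\<lambda>x. c * f x :: real) = (\<lambda>x. c * partial i f x)"
  by (rule partial_bounded_linear[OF bounded_linear_mult_right])

text \<open>The product rule turns one product into two, so single products are not stable under
  \<open>partial\<close>; finite sums of products, encoded as lists of pairs, are.\<close>

lemma smooth_mult [intro]:
  fixes f g :: "real^2 \<Rightarrow> real"
  assumes "smooth f" "smooth g"
  shows "smooth (\<lambda>x. f x * g x)"
proof -
  define P where "P h \<longleftrightarrow> (\<exists>ps. (\<forall>p\<in>set ps. smooth (fst p) \<and> smooth (snd p)) \<and>
      h = (\<lambda>x. \<Sum>p\<leftarrow>ps. fst p x * snd p x))" for h :: "real^2 \<Rightarrow> real"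
  have diff: "(\<lambda>x. \<Sum>p\<leftarrow>ps. fst p x * snd p x :: real) differentiable (at x)"
    if "\<forall>p\<in>set ps. smooth (fst p) \<and> smooth (snd p)" for ps x
    using that by (induction ps) (simp_all add: smooth_differentiable differentiable_add differentiable_mult)
  have der: "\<exists>qs. (\<forall>p\<in>set qs. smooth (fst p) \<and> smooth (snd p)) \<and>
      partial i (\<lambda>x. \<Sum>p\<leftarrow>ps. fst p x * snd p x :: real) = (\<lambda>x. \<Sum>p\<leftarrow>qs. fst p x * snd p x)"
    if "\<forall>p\<in>set ps. smooth (fst p) \<and> smooth (snd p)" for ps i
    using that
  proof (induction ps)
    case Nil
    then show ?case by (intro exI[of _ "[]"]) simp
  next
    case (Cons p ps)
    then obtain qs where qs: "\<forall>p\<in>set qs. smooth (fst p) \<and> smooth (snd p)"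
      "partial i (\<lambda>x. \<Sum>p\<leftarrow>ps. fst p x * snd p x :: real) = (\<lambda>x. \<Sum>p\<leftarrow>qs. fst p x * snd p x)"
      by auto
    have p: "smooth (fst p)" "smooth (snd p)" using Cons by auto
    have "partial i (\<lambda>x. \<Sum>p\<leftarrow>p#ps. fst p x * snd p x :: real) x
       = partial i (\<lambda>x. fst p x * snd p x) x + partial i (\<lambda>x. \<Sum>p\<leftarrow>ps. fst p x * snd p x :: real) x" for x
      using has_derivative_add[OF frechet_derivative_partial[of "\<lambda>x. fst p x * snd p x" x]
          frechet_derivative_partial[OF diff[of ps x]]] Cons.prems p
      by (simp add: partialI smooth_differentiable differentiable_mult)
    then show ?case using qs p
      by (intro exI[of _ "(fst p, partial i (snd p)) # (partial i (fst p), snd p) # qs"])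
        (auto simp: partial_mult smooth_partial)
  qed
  show ?thesis
  proof (rule smooth_coinduct[of P])
    show "P (\<lambda>x. f x * g x)"
      unfolding P_def by (rule exI[of _ "[(f, g)]"]) (use assms in simp)
  next
    fix h assume "P h"
    then show "(\<forall>x. h differentiable at x) \<and> (\<forall>i. P (partial i h))"
      unfolding P_def using diff der by blast
  qed
qed

lemma smooth_affine:
  assumes "smooth f" shows "smooth (\<lambda>x. f (c *\<^sub>R x + a))"
proof -
  define P where "P h \<longleftrightarrow> (\<exists>f d. smooth f \<and> h = (\<lambda>x. d *\<^sub>R f (c *\<^sub>R x + a)))" for h :: "real^2 \<Rightarrow> 'a"
  have d: "(\<lambda>x. f (c *\<^sub>R x + a)) differentiable (at x)" if "smooth f" for f :: "real^2 \<Rightarrow> 'a" and x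
    by (rule differentiable_compose[OF smooth_differentiable[OF that]])
       (auto intro!: derivative_intros)
  show ?thesis
  proof (rule smooth_coinduct[of P])
    show "P (\<lambda>x. f (c *\<^sub>R x + a))"
      unfolding P_def by (intro exI[of _ f] exI[of _ 1]) (use assms in simp)
  next
    fix h assume "P h"
    then obtain f d where h: "smooth f" "h = (\<lambda>x. d *\<^sub>R f (c *\<^sub>R x + a))" unfolding P_def by blast
    have "partial i h = (\<lambda>x. (d * c) *\<^sub>R partial i f (c *\<^sub>R x + a))" for i
    proof
      fix x
      have "(h has_derivative (\<lambda>v. d *\<^sub>R (\<Sum>j\<in>UNIV. v $ j *\<^sub>R partial j (\<lambda>x. f (c *\<^sub>R x + a)) x))) (at x)"
        unfolding h(2) by (intro has_derivative_scaleR_right frechet_derivative_partial d h)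
      from partialI[OF this] show "partial i h x = (d * c) *\<^sub>R partial i f (c *\<^sub>R x + a)"
        unfolding axis_nth_sum by (simp add: partial_affine h)
    qed
    then show "(\<forall>x. h differentiable at x) \<and> (\<forall>i. P (partial i h))"
      unfolding P_def using h smooth_partial d[OF h(1)] by (auto intro!: derivative_intros)
  qed
qed

lemma partials_affine:
  assumes "smooth f"
  shows "partials is (\<lambda>x. f (c *\<^sub>R x + a)) = (\<lambda>x. c ^ length is *\<^sub>R partials is f (c *\<^sub>R x + a))"
proof (induction "is")
  case (Cons i "is")
  then show ?case
    using partial_bounded_linear[OF bounded_linear_scaleR_right, of "\<lambda>x. partials is f (c *\<^sub>R x + a)" i
        "c ^ length is"]
    by (simp add: smooth_affine smooth_partials assms partial_affine mult.commute)
qed simp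

lemma partials_bounded_linear:
  "bounded_linear L \<Longrightarrow> smooth f \<Longrightarrow> partials is (\<lambda>x. L (f x)) = (\<lambda>x. L (partials is f x))"
  by (induction "is") (auto simp: partial_bounded_linear smooth_partials)

lemma partials_cmult: "smooth f \<Longrightarrow> partials is (\<lambda>x. c * f x :: real) = (\<lambda>x. c * partials is f x)"
  by (rule partials_bounded_linear[OF bounded_linear_mult_right])

lemma partials_diff:
  "smooth f \<Longrightarrow> smooth g \<Longrightarrow> partials is (\<lambda>x. f x - g x) = (\<lambda>x. partials is f x - partials is g x)"
  by (induction "is") (auto simp: partial_diff smooth_partials)

lemma smooth_reflect: "smooth f \<Longrightarrow> smooth (\<lambda>y. f (x - y))"
  using smooth_affine[of f "-1" x] by simp

lemma partials_reflect: "smooth f \<Longrightarrow> partials is (\<lambda>y. f (x - y)) = (\<lambda>y. (-1) ^ length is *\<^sub>R partials is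
    f (x - y))"
  using partials_affine[of f "is" "-1" x] by simp

lemma smooth_translate: "smooth f \<Longrightarrow> smooth (\<lambda>y. f (y + x))"
  using smooth_affine[of f 1 x] by simp

lemma partials_translate: "smooth f \<Longrightarrow> partials is (\<lambda>y. f (y + x)) = (\<lambda>y. partials is f (y + x))"
  using partials_affine[of f "is" 1 x] by simp

lemma has_derivative_along_axis:
  fixes f :: "real^2 \<Rightarrow> real"
  assumes "smooth f"
  shows "((\<lambda>s. f (x + s *\<^sub>R axis i 1)) has_real_derivative partial i f (x + s *\<^sub>R axis i 1)) (at s)"
proof -
  have "((\<lambda>s. x + s *\<^sub>R axis i 1) has_derivative (\<lambda>t. t *\<^sub>R axis i 1)) (at s)"
    by (auto intro!: derivative_eq_intros)
  from has_derivative_compose[OF this smooth_has_derivative[OF assms]]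
  have "((\<lambda>s. f (x + s *\<^sub>R axis i 1)) has_derivative
     (\<lambda>t. \<Sum>j\<in>UNIV. (t *\<^sub>R axis i 1 :: real^2) $ j *\<^sub>R partial j f (x + s *\<^sub>R axis i 1))) (at s)" .
  moreover have "(\<lambda>t. \<Sum>j\<in>UNIV. (t *\<^sub>R axis i 1 :: real^2) $ j *\<^sub>R partial j f (x + s *\<^sub>R axis i 1))
      = (\<lambda>t. t * partial i f (x + s *\<^sub>R axis i 1))"
    by (simp only: vector_scaleR_component flip: scaleR_scaleR scaleR_sum_right) (simp only:
        axis_nth_sum_real real_scaleR_def mult.assoc flip: sum_distrib_left)
  moreover have "(\<lambda>t. t * partial i f (x + s *\<^sub>R axis i 1)) = (*) (partial i f (x + s *\<^sub>R axis i 1))"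
    by (simp add: fun_eq_iff mult.commute)
  ultimately show ?thesis unfolding has_field_derivative_def by metis
qed

text \<open>The left-hand side is symmetric in \<open>i\<close> and \<open>j\<close>, while the mean
  value theorem, applied along one axis and then the other, yields a mixed derivative in a definite
  order. Comparing both orders gives \<open>partial_commute\<close>.\<close>

lemma second_difference_mean_value:
  fixes f :: "real^2 \<Rightarrow> real"
  assumes "smooth f" "0 < h"
  shows "\<exists>y. dist y x \<le> 2 * h \<and>
    f (x + h *\<^sub>R axis i 1 + h *\<^sub>R axis j 1) - f (x + h *\<^sub>R axis i 1) - f (x + h *\<^sub>R axis j 1) + f x
      = h * h * partial j (partial i f) y"
proof -
  define g where "g s = f ((x + h *\<^sub>R axis j 1) + s *\<^sub>R axis i 1) - f (x + s *\<^sub>R axis i 1)" for s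
  have "\<exists>s. 0 < s \<and> s < h \<and> g h - g 0 = (h - 0) *
      (partial i f ((x + h *\<^sub>R axis j 1) + s *\<^sub>R axis i 1) - partial i f (x + s *\<^sub>R axis i 1))"
    unfolding g_def by (rule MVT2[OF assms(2)]) (intro DERIV_diff has_derivative_along_axis assms)
  then obtain s where s: "0 < s" "s < h" "g h - g 0 = h *
      (partial i f ((x + h *\<^sub>R axis j 1) + s *\<^sub>R axis i 1) - partial i f (x + s *\<^sub>R axis i 1))" by auto
  have "\<exists>t. 0 < t \<and> t < h \<and> partial i f ((x + s *\<^sub>R axis i 1) + h *\<^sub>R axis j 1)
        - partial i f ((x + s *\<^sub>R axis i 1) + 0 *\<^sub>R axis j 1)
      = (h - 0) * partial j (partial i f) ((x + s *\<^sub>R axis i 1) + t *\<^sub>R axis j 1)"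
    by (rule MVT2[OF assms(2)]) (intro has_derivative_along_axis smooth_partial assms)
  then obtain t where t: "0 < t" "t < h" "partial i f ((x + s *\<^sub>R axis i 1) + h *\<^sub>R axis j 1)
        - partial i f (x + s *\<^sub>R axis i 1)
      = h * partial j (partial i f) ((x + s *\<^sub>R axis i 1) + t *\<^sub>R axis j 1)" by auto
  have "norm (s *\<^sub>R axis i 1 + t *\<^sub>R axis j (1::real) :: real^2) \<le> s + t"
    using s t by (intro norm_triangle_le) simp
  then show ?thesis using s t
    by (intro exI[of _ "x + s *\<^sub>R axis i 1 + t *\<^sub>R axis j 1"])
       (simp add: g_def dist_norm algebra_simps)
qed

lemma partial_commute:
  fixes f :: "real^2 \<Rightarrow> real"
  assumes "smooth f"
  shows "partial i (partial j f) = partial j (partial i f)"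
proof (rule ext, rule ccontr)
  fix x
  let ?A = "partial i (partial j f)" and ?B = "partial j (partial i f)"
  assume "?A x \<noteq> ?B x"
  define e where "e = \<bar>?A x - ?B x\<bar> / 2"
  have e: "0 < e" using \<open>?A x \<noteq> ?B x\<close> by (simp add: e_def)
  have cont: "isCont ?A x" "isCont ?B x"
    using smooth_continuous[of _ UNIV] assms smooth_partial
    by (metis continuous_on_eq_continuous_at open_UNIV UNIV_I)+
  obtain d where d: "0 < d" "\<And>y. dist y x < d \<Longrightarrow> dist (?A y) (?A x) < e"
    using cont(1) e unfolding continuous_at_eps_delta by blast
  obtain d' where d': "0 < d'" "\<And>y. dist y x < d' \<Longrightarrow> dist (?B y) (?B x) < e"
    using cont(2) e unfolding continuous_at_eps_delta by blast
  \<comment> \<open>The intermediate points lie within \<open>2 * h\<close> of \<open>x\<close>,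
    hence the division by 3.\<close>
  define h where "h = min d d' / 3"
  have h: "0 < h" "2 * h < d" "2 * h < d'" using d d' by (auto simp: h_def)
  obtain y where y: "dist y x \<le> 2 * h" "f (x + h *\<^sub>R axis i 1 + h *\<^sub>R axis j 1) - f (x + h *\<^sub>R axis i 1)
      - f (x + h *\<^sub>R axis j 1) + f x = h * h * ?B y"
    using second_difference_mean_value[OF assms h(1)] by blast
  obtain z where z: "dist z x \<le> 2 * h" "f (x + h *\<^sub>R axis j 1 + h *\<^sub>R axis i 1) - f (x + h *\<^sub>R axis j 1)
      - f (x + h *\<^sub>R axis i 1) + f x = h * h * ?A z"
    using second_difference_mean_value[OF assms h(1)] by blast
  have "h * h * ?B y = h * h * ?A z" unfolding y(2)[symmetric] z(2)[symmetric] by (simp add: algebra_simps)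
  then have eq: "?B y = ?A z" using h by simp
  have "\<bar>?A z - ?A x\<bar> < e" "\<bar>?B y - ?B x\<bar> < e"
    using d(2)[of z] d'(2)[of y] y z h by (auto simp: dist_real_def)
  moreover have "\<bar>?A x - ?B x\<bar> \<le> \<bar>?A z - ?A x\<bar> + \<bar>?A z - ?B x\<bar>" by linarith
  moreover have "2 * e = \<bar>?A x - ?B x\<bar>" by (simp add: e_def)
  ultimately show False unfolding eq by linarith
qed

section \<open>The period lattice and its fundamental cell\<close>

definition lattice_vec :: "int^2 \<Rightarrow> real^2" where
  "lattice_vec n = (\<chi> i. 2 * pi * of_int (n $ i))"

lemma lattice_vec_add [simp]: "lattice_vec (m + n) = lattice_vec m + lattice_vec n"
  by (simp add: lattice_vec_def vec_eq_iff algebra_simps)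

lemma lattice_vec_zero [simp]: "lattice_vec 0 = 0"
  by (simp add: lattice_vec_def vec_eq_iff)

lemma lattice_vec_minus [simp]: "lattice_vec (- n) = - lattice_vec n"
  by (simp add: lattice_vec_def vec_eq_iff)

lemma lattice_vec_axis: "lattice_vec (axis i 1) = axis i (2 * pi)"
  by (simp add: lattice_vec_def vec_eq_iff axis_def)

lemma periodic2_lattice:
  assumes "periodic2 f" shows "f (x + lattice_vec n) = f x"
proof -
  have one: "f (x + axis i (2 * pi * of_int m)) = f x" for i m x
  proof (induction m rule: int_induct[of _ 0])
    case base
    then show ?case by (simp add: axis_def vec_eq_iff flip: zero_vec_def)
  next
    case (step1 m)
    have "x + axis i (2 * pi * of_int (m + 1)) = (x + axis i (2 * pi * of_int m)) + axis i (2 * pi)"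
      by (simp add: axis_def vec_eq_iff algebra_simps)
    then show ?case using assms step1 unfolding periodic2_def by metis
  next
    case (step2 m)
    have "x + axis i (2 * pi * of_int m) = (x + axis i (2 * pi * of_int (m - 1))) + axis i (2 * pi)"
      by (simp add: axis_def vec_eq_iff algebra_simps)
    then show ?case using assms step2 unfolding periodic2_def by metis
  qed
  have "x + lattice_vec n = x + axis 1 (2 * pi * of_int (n $ 1)) + axis 2 (2 * pi * of_int (n $ 2))"
    by (simp add: lattice_vec_def vec_eq_iff axis_def forall_2)
  then show ?thesis using one by metis
qed

lemma periodic2_iff_lattice: "periodic2 f \<longleftrightarrow> (\<forall>x n. f (x + lattice_vec n) = f x)"
  using periodic2_lattice lattice_vec_axis unfolding periodic2_def by metis

text \<open>Half-open, so that every lattice orbit meets it exactly once; it differs from the closed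
  square \<open>torus\<close> by a null set.\<close>

definition cell :: "(real^2) set" where
  "cell = {x. \<forall>i. - pi \<le> x $ i \<and> x $ i < pi}"

definition cell_index :: "real^2 \<Rightarrow> int^2" where
  "cell_index x = (\<chi> i. - \<lfloor>(x $ i + pi) / (2 * pi)\<rfloor>)"

lemma add_lattice_mem_cell_iff: "x + lattice_vec n \<in> cell \<longleftrightarrow> n = cell_index x"
proof -
  have "(- pi \<le> a + 2 * pi * of_int m \<and> a + 2 * pi * of_int m < pi) \<longleftrightarrow> m = - \<lfloor>(a + pi) / (2 * pi)\<rfloor>"
    for a :: real and m :: int
  proof -
    have "(- pi \<le> a + 2 * pi * of_int m \<and> a + 2 * pi * of_int m < pi) \<longleftrightarrow>
      of_int (- m) \<le> (a + pi) / (2 * pi) \<and> (a + pi) / (2 * pi) < of_int (- m) + 1"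
      by (auto simp: field_simps)
    also have "\<dots> \<longleftrightarrow> \<lfloor>(a + pi) / (2 * pi)\<rfloor> = - m"
      by (simp only: floor_eq_iff)
    finally show ?thesis by auto
  qed
  then show ?thesis by (auto simp: cell_def cell_index_def lattice_vec_def vec_eq_iff)
qed

lemma cell_subset_torus: "cell \<subseteq> torus"
  by (auto simp: cell_def torus_def mem_box_cart less_imp_le)

lemma compact_torus: "compact torus"
  by (simp add: torus_def)

lemma exists_lattice_torus: "\<exists>n. x + lattice_vec n \<in> torus"
  using add_lattice_mem_cell_iff cell_subset_torus by blast

lemma cell_measurable [measurable]: "cell \<in> sets borel"
  unfolding cell_def by measurable

lemma torus_measurable [measurable]: "torus \<in> sets borel"
  unfolding torus_def by simp

lemma AE_torus_cell: "AE x in lborel. x \<in> torus \<longleftrightarrow> x \<in> cell"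
proof -
  let ?b = "box (\<chi> i. - pi) (\<chi> i. pi) :: (real^2) set"
  have "emeasure lborel (torus - ?b) = emeasure lborel torus - emeasure lborel ?b"
    by (rule emeasure_Diff) (auto simp: torus_def box_subset_cbox emeasure_lborel_box_eq)
  also have "\<dots> = 0"
    unfolding torus_def emeasure_lborel_cbox_eq emeasure_lborel_box_eq by simp
  finally have "AE x in lborel. x \<notin> torus - ?b"
    by (intro AE_not_in) (auto simp: null_sets_def torus_def)
  then show ?thesis
    by eventually_elim (use cell_subset_torus in \<open>auto simp: torus_def cell_def mem_box_cart less_imp_le\<close>)
qed

lemma set_integral_torus_cell:
  fixes f :: "real^2 \<Rightarrow> 'b::{banach, second_countable_topology}"
  assumes "f \<in> borel_measurable borel"
  shows "(LINT x:torus|lborel. f x) = (LINT x:cell|lborel. f x)"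
  unfolding set_lebesgue_integral_def
  by (rule integral_cong_AE) (use AE_torus_cell assms in \<open>auto simp: indicator_def elim!: eventually_mono\<close>)

lemma nn_integral_lborel_translate:
  fixes g :: "'a::euclidean_space \<Rightarrow> ennreal"
  assumes [measurable]: "g \<in> borel_measurable borel"
  shows "(\<integral>\<^sup>+x. g (x + a) \<partial>lborel) = (\<integral>\<^sup>+x. g x \<partial>lborel)"
  by (subst (2) lborel_distr_plus[of a, symmetric]) (simp add: nn_integral_distr add.commute)

text \<open>Every point has exactly one translate in \<open>cell\<close>. Inserting the sum of the
  corresponding indicators and exchanging sum and integral by Tonelli moves all translates of
  \<open>cell\<close> back to \<open>cell\<close>.\<close>

lemma nn_integral_unfold:
  assumes [measurable]: "g \<in> borel_measurable borel"
  shows "(\<integral>\<^sup>+x. g x \<partial>lborel) = (\<integral>\<^sup>+x\<in>cell. (\<integral>\<^sup>+n. g (x + lattice_vec n) \<partial>count_space UNIV) \<partial>lborel)"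
proof -
  have "(\<integral>\<^sup>+x. g x \<partial>lborel) = (\<integral>\<^sup>+x. (\<integral>\<^sup>+n. g x * indicator cell (x + lattice_vec n) \<partial>count_space UNIV)
      \<partial>lborel)"
  proof (rule nn_integral_cong)
    fix x
    have "(\<integral>\<^sup>+n. g x * indicator cell (x + lattice_vec n) \<partial>count_space UNIV)
       = (\<integral>\<^sup>+n. g x * indicator {cell_index x} n \<partial>count_space UNIV)"
      by (rule nn_integral_cong) (auto simp: indicator_def add_lattice_mem_cell_iff)
    then show "g x = (\<integral>\<^sup>+n. g x * indicator cell (x + lattice_vec n) \<partial>count_space UNIV)"
      by (simp add: nn_integral_cmult_indicator)
  qed
  also have "\<dots> = (\<integral>\<^sup>+n. (\<integral>\<^sup>+x. g x * indicator cell (x + lattice_vec n) \<partial>lborel) \<partial>count_space UNIV)"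
    by (rule nn_integral_count_space_nn_integral) auto
  also have "\<dots> = (\<integral>\<^sup>+n. (\<integral>\<^sup>+x. g (x - lattice_vec n) * indicator cell x \<partial>lborel) \<partial>count_space UNIV)"
  proof (rule nn_integral_cong)
    fix n
    have "(\<integral>\<^sup>+x. g ((x + lattice_vec n) - lattice_vec n) * indicator cell (x + lattice_vec n) \<partial>lborel)
       = (\<integral>\<^sup>+x. g (x - lattice_vec n) * indicator cell x \<partial>lborel)"
      by (rule nn_integral_lborel_translate) measurable
    then show "(\<integral>\<^sup>+x. g x * indicator cell (x + lattice_vec n) \<partial>lborel)
       = (\<integral>\<^sup>+x. g (x - lattice_vec n) * indicator cell x \<partial>lborel)" by simp
  qed
  also have "\<dots> = (\<integral>\<^sup>+x. (\<integral>\<^sup>+n. g (x - lattice_vec n) * indicator cell x \<partial>count_space UNIV) \<partial>lborel)"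
    by (rule nn_integral_count_space_nn_integral[symmetric]) auto
  also have "\<dots> = (\<integral>\<^sup>+x\<in>cell. (\<integral>\<^sup>+n. g (x - lattice_vec n) \<partial>count_space UNIV) \<partial>lborel)"
    by (rule nn_integral_cong) (simp add: nn_integral_multc)
  also have "\<dots> = (\<integral>\<^sup>+x\<in>cell. (\<integral>\<^sup>+n. g (x + lattice_vec n) \<partial>count_space UNIV) \<partial>lborel)"
  proof (rule nn_integral_cong)
    fix x
    have "bij_betw uminus UNIV (UNIV :: (int^2) set)"
      by (rule bij_betw_byWitness[of _ uminus]) auto
    from nn_integral_bij_count_space[OF this, of "\<lambda>n. g (x + lattice_vec n)"]
    show "(\<integral>\<^sup>+n. g (x - lattice_vec n) \<partial>count_space UNIV) * indicator cell x
        = (\<integral>\<^sup>+n. g (x + lattice_vec n) \<partial>count_space UNIV) * indicator cell x" by simp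
  qed
  finally show ?thesis .
qed

text \<open>Unfolding of \<open>F\<close> cut off to a shifted cell: again exactly one translate
  survives, and periodicity makes its value \<open>F x\<close>.\<close>

lemma nn_integral_cell_translate:
  fixes F :: "real^2 \<Rightarrow> ennreal"
  assumes [measurable]: "F \<in> borel_measurable borel" and per: "periodic2 F"
  shows "(\<integral>\<^sup>+x\<in>cell. F (x + h) \<partial>lborel) = (\<integral>\<^sup>+x\<in>cell. F x \<partial>lborel)"
proof -
  have "(\<integral>\<^sup>+x\<in>cell. F (x + h) \<partial>lborel) = (\<integral>\<^sup>+x. F (x + h) * indicator cell ((x + h) - h) \<partial>lborel)"
    by simp
  also have "\<dots> = (\<integral>\<^sup>+x. F x * indicator cell (x - h) \<partial>lborel)"
    by (rule nn_integral_lborel_translate) measurable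
  also have "\<dots> = (\<integral>\<^sup>+x\<in>cell. (\<integral>\<^sup>+n. F (x + lattice_vec n) * indicator cell (x + lattice_vec n - h)
      \<partial>count_space UNIV) \<partial>lborel)"
    by (rule nn_integral_unfold) measurable
  also have "\<dots> = (\<integral>\<^sup>+x\<in>cell. F x \<partial>lborel)"
  proof (rule nn_integral_cong)
    fix x
    have "(\<integral>\<^sup>+n. F (x + lattice_vec n) * indicator cell (x + lattice_vec n - h) \<partial>count_space UNIV)
       = (\<integral>\<^sup>+n. F x * indicator {cell_index (x - h)} n \<partial>count_space UNIV)"
      using add_lattice_mem_cell_iff[of "x - h"]
      by (intro nn_integral_cong) (auto simp: indicator_def periodic2_lattice[OF per] algebra_simps)
    then show "(\<integral>\<^sup>+n. F (x + lattice_vec n) * indicator cell (x + lattice_vec n - h) \<partial>count_space UNIV)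
        * indicator cell x
      = F x * indicator cell x"
      by (simp add: nn_integral_cmult_indicator)
  qed
  finally show ?thesis .
qed

section \<open>Lattice translates and periodization\<close>

lemma periodic2_bounded:
  fixes f :: "real^2 \<Rightarrow> 'b::real_normed_vector"
  assumes "continuous_on UNIV f" "periodic2 f"
  obtains B where "0 \<le> B" "\<And>x. norm (f x) \<le> B"
proof -
  have "bounded (f ` torus)"
    by (intro compact_imp_bounded compact_continuous_image compact_torus continuous_on_subset[OF
        assms(1)]) auto
  then obtain B where B: "\<And>x. x \<in> torus \<Longrightarrow> norm (f x) \<le> B" by (auto simp: bounded_iff)
  have "norm (f x) \<le> max B 0" for x
    using exists_lattice_torus[of x] B periodic2_lattice[OF assms(2)] by (metis max.coboundedI1)
  then show ?thesis using that[of "max B 0"] by auto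
qed

lemma set_integrable_torus:
  fixes f :: "real^2 \<Rightarrow> 'b::{banach, second_countable_topology}"
  assumes "continuous_on UNIV f"
  shows "set_integrable lborel torus f"
  unfolding set_integrable_def
  by (rule borel_integrable_compact[OF compact_torus]) (rule continuous_on_subset[OF assms], simp)

lemma measure_torus: "measure lborel torus = 4 * pi\<^sup>2"
  unfolding torus_def by (subst content_cbox_cart) (auto simp: power2_eq_square interval_ne_empty_cart)

lemma emeasure_torus_finite: "emeasure lborel torus < \<infinity>"
  unfolding torus_def by (rule emeasure_lborel_cbox_finite)

lemma set_integral_torus_const: "(LINT x:torus|lborel. (c::real)) = 4 * pi\<^sup>2 * c"
  unfolding set_lebesgue_integral_def using measure_torus emeasure_torus_finite by simp

lemma set_integral_torus_mono:
  fixes f g :: "real^2 \<Rightarrow> real"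
  assumes "set_integrable lborel torus f" "set_integrable lborel torus g" "\<And>x. f x \<le> g x"
  shows "(LINT x:torus|lborel. f x) \<le> (LINT x:torus|lborel. g x)"
  by (rule set_integral_mono) (use assms in auto)

lemma set_integral_cell_nn:
  fixes g :: "real^2 \<Rightarrow> real"
  assumes [measurable]: "g \<in> borel_measurable borel" and "\<And>x. 0 \<le> g x"
  shows "(LINT x:cell|lborel. g x) = enn2real (\<integral>\<^sup>+x\<in>cell. ennreal (g x) \<partial>lborel)"
proof -
  have "(LINT x:cell|lborel. g x) = enn2real (\<integral>\<^sup>+x. ennreal (indicator cell x *\<^sub>R g x) \<partial>lborel)"
    unfolding set_lebesgue_integral_def
    by (rule integral_eq_nn_integral) (use assms(2) in auto)
  also have "(\<integral>\<^sup>+x. ennreal (indicator cell x *\<^sub>R g x) \<partial>lborel) = (\<integral>\<^sup>+x\<in>cell. ennreal (g x) \<partial>lborel)"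
    by (rule nn_integral_cong) (auto simp: indicator_def)
  finally show ?thesis .
qed

lemma torus_integral_translate:
  fixes f :: "real^2 \<Rightarrow> real"
  assumes "continuous_on UNIV f" "periodic2 f"
  shows "(LINT x:torus|lborel. f (x + h)) = (LINT x:torus|lborel. f x)"
proof -
  obtain B where B: "\<And>x. norm (f x) \<le> B" using periodic2_bounded[OF assms] by blast
  have [measurable]: "f \<in> borel_measurable borel" by (rule borel_measurable_continuous_onI[OF assms(1)])
  have c: "continuous_on UNIV (\<lambda>x. f (x + h))"
    by (intro continuous_on_compose2[OF assms(1)] continuous_intros) auto
  \<comment> \<open>Adding the bound \<open>B\<close> makes the integrands nonnegative, so that the
    translation rule for nonnegative integrals applies.\<close>
  have shift: "(LINT x:cell|lborel. g x + B) = (LINT x:torus|lborel. g x) + 4 * pi\<^sup>2 * B"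
    if "continuous_on UNIV g" for g :: "real^2 \<Rightarrow> real"
  proof -
    have [measurable]: "g \<in> borel_measurable borel" by (rule borel_measurable_continuous_onI[OF that])
    have "(LINT x:cell|lborel. g x + B) = (LINT x:torus|lborel. g x + B)"
      by (rule set_integral_torus_cell[symmetric]) measurable
    then show ?thesis
      using set_integral_add(2)[OF set_integrable_torus[OF that] set_integrable_torus[OF continuous_on_const]]
      by (simp add: set_integral_torus_const)
  qed
  have nn: "0 \<le> f x + B" for x using B[of x] by (simp add: abs_le_iff)
  have "periodic2 (\<lambda>x. ennreal (f x + B))" using assms(2) by (simp add: periodic2_def)
  then have "(\<integral>\<^sup>+x\<in>cell. ennreal (f (x + h) + B) \<partial>lborel) = (\<integral>\<^sup>+x\<in>cell. ennreal (f x + B) \<partial>lborel)"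
    by (intro nn_integral_cell_translate) measurable
  then have "(LINT x:cell|lborel. f (x + h) + B) = (LINT x:cell|lborel. f x + B)"
    by (simp add: set_integral_cell_nn nn)
  then show ?thesis using shift[OF c] shift[OF assms(1)] by simp
qed

lemma lborel_integral_affine:
  fixes f :: "real^2 \<Rightarrow> real"
  assumes [measurable]: "f \<in> borel_measurable borel" and "c \<noteq> 0"
  shows "(LINT x|lborel. f x) = c\<^sup>2 * (LINT x|lborel. f (t + c *\<^sub>R x))"
  by (subst lborel_affine[OF assms(2), of t])
     (simp add: integral_density integral_distr power2_abs)

lemma torus_integral_reflect:
  fixes f :: "real^2 \<Rightarrow> real"
  assumes [measurable]: "f \<in> borel_measurable borel"
  shows "(LINT x:torus|lborel. f (- x)) = (LINT x:torus|lborel. f x)"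
proof -
  have "- x \<in> torus \<longleftrightarrow> x \<in> torus" for x
    by (auto simp: torus_def mem_box_cart minus_le_iff)
  then have "indicator torus (- x) = (indicator torus x :: real)" for x
    by (simp add: indicator_def)
  then show ?thesis
    using lborel_integral_affine[of "\<lambda>x. indicator torus x *\<^sub>R f x" "-1" 0]
    by (simp add: set_lebesgue_integral_def)
qed

lemma continuous_reflect: "continuous_on UNIV f \<Longrightarrow> continuous_on UNIV (\<lambda>y. f (x - y :: real^2))"
  by (rule continuous_on_compose2[of UNIV f]) (auto intro: continuous_intros)

lemma periodic2_reflect: "periodic2 f \<Longrightarrow> periodic2 (\<lambda>y. f (x - y))"
  unfolding periodic2_iff_lattice by (metis (no_types, opaque_lifting) diff_diff_eq2 diff_minus_eq_add
      lattice_vec_minus add.commute add_diff_eq)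

lemma periodic2_translate: "periodic2 f \<Longrightarrow> periodic2 (\<lambda>y. f (y + x))"
  by (simp add: periodic2_def ac_simps) (metis add.assoc add.commute)

lemma torus_integral_reflect_translate:
  fixes f :: "real^2 \<Rightarrow> real"
  assumes "continuous_on UNIV f" "periodic2 f"
  shows "(LINT y:torus|lborel. f (x - y)) = (LINT y:torus|lborel. f y)"
proof -
  have "(LINT y:torus|lborel. f (x - y)) = (LINT y:torus|lborel. (\<lambda>y. f (x + y)) (- y))" by simp
  also have "\<dots> = (LINT y:torus|lborel. f (y + x))"
    by (subst torus_integral_reflect)
       (auto simp: add.commute intro!: borel_measurable_continuous_onI continuous_on_compose2[OF
           assms(1)] continuous_intros)
  finally show ?thesis using torus_integral_translate[OF assms] by simp
qed

lemma finite_bounded_lattice: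
  assumes "bounded S" "bounded B"
  shows "finite {n. \<exists>x\<in>B. x + lattice_vec n \<in> S}"
proof -
  obtain a where a: "\<And>x. x \<in> S \<Longrightarrow> norm x \<le> a" using assms(1) by (auto simp: bounded_iff)
  obtain b where b: "\<And>x. x \<in> B \<Longrightarrow> norm x \<le> b" using assms(2) by (auto simp: bounded_iff)
  define m where "m = \<lceil>a + b\<rceil>"
  have "{n. \<exists>x\<in>B. x + lattice_vec n \<in> S} \<subseteq> (\<lambda>(p, q). vector [p, q]) ` ({- m..m} \<times> {- m..m})"
  proof clarify
    fix n :: "int^2" and x assume x: "x \<in> B" "x + lattice_vec n \<in> S"
    have "norm (lattice_vec n) \<le> norm (x + lattice_vec n) + norm x"
      by (metis add_diff_cancel_left' norm_triangle_ineq4)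
    also have "\<dots> \<le> a + b" using a[OF x(2)] b[OF x(1)] by simp
    finally have "norm (lattice_vec n) \<le> a + b" .
    then have *: "\<bar>2 * pi * of_int (n $ i)\<bar> \<le> a + b" for i
      using component_le_norm_cart[of "lattice_vec n" i] by (simp add: lattice_vec_def)
    have "\<bar>n $ i\<bar> \<le> m" for i
    proof -
      have "\<bar>of_int (n $ i)\<bar> \<le> \<bar>2 * pi * of_int (n $ i) :: real\<bar>"
        using pi_gt3 by (simp add: abs_mult mult_le_cancel_right1)
      with *[of i] have "of_int \<bar>n $ i\<bar> \<le> a + b" by simp
      then show ?thesis unfolding m_def by linarith
    qed
    then have "n $ 1 \<in> {- m..m}" "n $ 2 \<in> {- m..m}" by (simp_all add: abs_le_iff minus_le_iff)
    moreover have "n = vector [n $ 1, n $ 2]" by (simp add: vec_eq_iff forall_2)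
    ultimately show "n \<in> (\<lambda>(p, q). vector [p, q]) ` ({- m..m} \<times> {- m..m})"
      by (intro image_eqI[of _ _ "(n $ 1, n $ 2)"]) auto
  qed
  then show ?thesis by (rule finite_subset) simp
qed

lemma periodize_lattice: "periodize f y = (\<Sum>\<^sub>\<infinity>n\<in>UNIV. f (y + lattice_vec n))"
  by (simp add: periodize_def lattice_vec_def)

lemma periodize_sum:
  assumes "finite N" "\<And>n. n \<notin> N \<Longrightarrow> f (y + lattice_vec n) = 0"
  shows "periodize f y = (\<Sum>n\<in>N. f (y + lattice_vec n))"
proof -
  have "periodize f y = (\<Sum>\<^sub>\<infinity>n\<in>N. f (y + lattice_vec n))"
    unfolding periodize_lattice by (rule infsum_cong_neutral) (use assms in auto)
  then show ?thesis using assms(1) by simp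
qed

text \<open>One finite index set serves all functions supported in \<open>S\<close>, in particular a
  function together with its derivatives or with its positive and negative parts.\<close>

lemma periodize_local_sum:
  assumes "bounded S" "bounded B"
  obtains N where "finite N"
    "\<And>f y. {x. f x \<noteq> 0} \<subseteq> S \<Longrightarrow> y \<in> B \<Longrightarrow> periodize f y = (\<Sum>n\<in>N. f (y + lattice_vec n))"
  using finite_bounded_lattice[OF assms] by (rule that) (rule periodize_sum, use
      finite_bounded_lattice[OF assms] in auto)

lemma periodic2_periodize: "periodic2 (periodize f)"
  unfolding periodic2_iff_lattice
proof (intro allI)
  fix x m
  have "bij (\<lambda>n. m + n :: int^2)" by (rule bij_plus)
  then have "(\<Sum>\<^sub>\<infinity>n\<in>UNIV. f (x + lattice_vec (m + n))) = (\<Sum>\<^sub>\<infinity>n\<in>UNIV. f (x + lattice_vec n))"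
    by (rule infsum_reindex_bij_betw)
  then show "periodize f (x + lattice_vec m) = periodize f x"
    by (simp add: periodize_lattice add.assoc)
qed

lemma periodize_mult:
  assumes "periodic2 g"
  shows "periodize (\<lambda>y. f y * g y) x = periodize f x * g x"
  by (simp add: periodize_lattice periodic2_lattice[OF assms] infsum_cmult_left')

lemma continuous_periodize:
  assumes "continuous_on UNIV f" "bounded {x. f x \<noteq> 0}"
  shows "continuous_on UNIV (periodize f)"
proof (rule continuous_at_imp_continuous_on, rule)
  fix x
  obtain N where N: "finite N" "\<And>y. y \<in> ball x 1 \<Longrightarrow> periodize f y = (\<Sum>n\<in>N. f (y + lattice_vec n))"
    using periodize_local_sum[OF assms(2) bounded_ball[of x 1]] by (metis order_refl)
  have c: "continuous_on UNIV (\<lambda>y. \<Sum>n\<in>N. f (y + lattice_vec n))"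
    by (intro continuous_intros continuous_on_compose2[OF assms(1)]) auto
  have "continuous_on (ball x 1) (periodize f)"
    by (rule continuous_on_eq[OF continuous_on_subset[OF c]]) (simp_all add: N(2))
  then show "isCont (periodize f) x"
    by (simp add: continuous_on_eq_continuous_at)
qed

text \<open>Made for periodizations, which agree on each unit ball with a finite sum of translates.
  The local description itself is the class stable under \<open>partial\<close>.\<close>

lemma smooth_local:
  fixes f :: "real^2 \<Rightarrow> 'b::real_normed_vector"
  assumes "\<And>x. \<exists>g. smooth g \<and> (\<forall>y\<in>ball x 1. f y = g y)"
  shows "smooth f"
proof (rule smooth_coinduct[of "\<lambda>f. \<forall>x. \<exists>g. smooth g \<and> (\<forall>y\<in>ball x 1. f y = g y)"])
  fix f :: "real^2 \<Rightarrow> 'b" assume P: "\<forall>x. \<exists>g. smooth g \<and> (\<forall>y\<in>ball x 1. f y = g y)"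
  have D: "(f has_derivative (\<lambda>v. \<Sum>i\<in>UNIV. v $ i *\<^sub>R partial i g y)) (at y)"
    if "smooth g" "\<forall>y\<in>ball x 1. f y = g y" "y \<in> ball x 1" for g x y
    by (rule has_derivative_transform_within_open[OF smooth_has_derivative[OF that(1)], where s = "ball x 1"])
       (use that in auto)
  show "(\<forall>x. f differentiable at x) \<and> (\<forall>i x. \<exists>g. smooth g \<and> (\<forall>y\<in>ball x 1. partial i f y = g y))"
  proof (intro conjI allI)
    fix x
    obtain g where g: "smooth g" "\<forall>y\<in>ball x 1. f y = g y" using P by blast
    show "f differentiable at x" using D[OF g, of x] by (auto intro: differentiableI)
    fix i
    have "partial i f y = partial i g y" if "y \<in> ball x 1" for y
      using partialI[OF D[OF g that]] axis_nth_sum by metis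
    then show "\<exists>g. smooth g \<and> (\<forall>y\<in>ball x 1. partial i f y = g y)"
      using smooth_partial[OF g(1)] by blast
  qed
qed (use assms in blast)

lemma partial_local:
  fixes f g :: "real^2 \<Rightarrow> 'b::real_normed_vector"
  assumes "smooth g" "\<And>y. y \<in> ball x 1 \<Longrightarrow> f y = g y"
  shows "partial i f x = partial i g x"
proof -
  have "(f has_derivative (\<lambda>v. \<Sum>i\<in>UNIV. v $ i *\<^sub>R partial i g x)) (at x)"
    by (rule has_derivative_transform_within_open[OF smooth_has_derivative[OF assms(1)], where s = "ball
        x 1"])
       (use assms(2) in auto)
  from partialI[OF this] show ?thesis by (simp only: axis_nth_sum)
qed

lemma partial_support:
  fixes f :: "real^2 \<Rightarrow> real"
  assumes "smooth f"
  shows "{x. partial i f x \<noteq> 0} \<subseteq> closure {x. f x \<noteq> 0}"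
proof (rule ccontr)
  assume "\<not> ?thesis"
  then obtain x where x: "partial i f x \<noteq> 0" "x \<notin> closure {x. f x \<noteq> 0}" by blast
  have "((\<lambda>x. 0) has_derivative (\<lambda>v. \<Sum>i\<in>UNIV. v $ i *\<^sub>R partial i f x)) (at x)"
    by (rule has_derivative_transform_within_open[OF smooth_has_derivative[OF assms],
          where s = "- closure {x. f x \<noteq> 0}"])
       (use x closure_subset[of "{x. f x \<noteq> 0}"] in auto)
  from partialI[OF this, of i] have "partial i f x = 0" by simp
  with x show False by simp
qed

lemma partials_support:
  fixes f :: "real^2 \<Rightarrow> real"
  assumes "smooth f"
  shows "{x. partials is f x \<noteq> 0} \<subseteq> closure {x. f x \<noteq> 0}"
proof (induction "is")
  case (Cons i "is")
  then have "closure {x. partials is f x \<noteq> 0} \<subseteq> closure {x. f x \<noteq> 0}"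
    by (simp add: closure_minimal)
  then show ?case using partial_support[OF smooth_partials[OF assms], of i "is"] by auto
qed (simp add: closure_subset)

lemma bounded_partial_support:
  fixes f :: "real^2 \<Rightarrow> real"
  shows "smooth f \<Longrightarrow> bounded {x. f x \<noteq> 0} \<Longrightarrow> bounded {x. partial i f x \<noteq> 0}"
  by (rule bounded_subset[OF bounded_closure partial_support])

lemma smooth_periodize:
  assumes "smooth f" "bounded {x. f x \<noteq> 0}"
  shows "smooth (periodize f)"
proof (rule smooth_local)
  fix x
  obtain N where N: "finite N" "\<And>y. y \<in> ball x 1 \<Longrightarrow> periodize f y = (\<Sum>n\<in>N. f (y + lattice_vec n))"
    using periodize_local_sum[OF assms(2) bounded_ball[of x 1]] by (metis order_refl)
  then show "\<exists>g. smooth g \<and> (\<forall>y\<in>ball x 1. periodize f y = g y)"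
    by (intro exI[of _ "\<lambda>y. \<Sum>n\<in>N. f (y + lattice_vec n)"]) (auto intro!: smooth_sum smooth_translate assms)
qed

lemma partial_periodize:
  assumes "smooth f" "bounded {x. f x \<noteq> 0}"
  shows "partial i (periodize f) = periodize (partial i f)"
proof
  fix x
  obtain N where N: "finite N" "\<And>f' y. {x. f' x \<noteq> 0} \<subseteq> closure {x. f x \<noteq> 0} \<Longrightarrow> y \<in> ball x 1 \<Longrightarrow>
      periodize f' y = (\<Sum>n\<in>N. f' (y + lattice_vec n))"
    using periodize_local_sum[OF bounded_closure[OF assms(2)] bounded_ball[of x 1]] by metis
  have "partial i (periodize f) x = partial i (\<lambda>y. \<Sum>n\<in>N. f (y + lattice_vec n)) x"
    by (rule partial_local) (auto intro!: smooth_sum smooth_translate assms N closure_subset)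
  also have "\<dots> = (\<Sum>n\<in>N. partial i f (x + lattice_vec n))"
    using partials_translate[OF assms(1), of "[i]"] smooth_translate[OF assms(1)] by (subst
        partial_sum[OF N(1)]) auto
  also have "\<dots> = periodize (partial i f) x"
    by (rule N(2)[symmetric]) (use partial_support[OF assms(1)] in auto)
  finally show "partial i (periodize f) x = periodize (partial i f) x" .
qed

lemma partials_periodize:
  assumes "smooth f" "bounded {x. f x \<noteq> 0}"
  shows "partials is (periodize f) = periodize (partials is f)"
proof (induction "is")
  case (Cons i "is")
  have "bounded {x. partials is f x \<noteq> 0}"
    by (rule bounded_subset[OF bounded_closure[OF assms(2)] partials_support[OF assms(1)]])
  then show ?case using Cons partial_periodize[OF smooth_partials[OF assms(1)]] by simp
qed simp

lemma periodize_in_smooth_torus: "smooth f \<Longrightarrow> bounded {x. f x \<noteq> 0} \<Longrightarrow> periodize f \<in> smooth_torus"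
  by (simp add: smooth_torus_def smooth_periodize periodic2_periodize)

lemma integrable_bounded_support:
  fixes f :: "real^2 \<Rightarrow> real"
  assumes "continuous_on UNIV f" "bounded {x. f x \<noteq> 0}"
  shows "integrable lborel f"
proof -
  have "integrable lborel (\<lambda>x. indicator (closure {x. f x \<noteq> 0}) x *\<^sub>R f x)"
    by (rule borel_integrable_compact) (use assms in \<open>auto simp: compact_closure intro: continuous_on_subset\<close>)
  moreover have "(\<lambda>x. indicator (closure {x. f x \<noteq> 0}) x *\<^sub>R f x) = f"
    using closure_subset[of "{x. f x \<noteq> 0}"] by (auto simp: indicator_def fun_eq_iff)
  ultimately show ?thesis by simp
qed

text \<open>For nonnegative functions this is the unfolding of the plane over \<open>cell\<close>;
  the general case subtracts the positive and negative parts, which inherit continuity and bounded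
  support.\<close>

lemma torus_integral_periodize:
  fixes f :: "real^2 \<Rightarrow> real"
  assumes "continuous_on UNIV f" "bounded {x. f x \<noteq> 0}"
  shows "(LINT x:torus|lborel. periodize f x) = (LINT x|lborel. f x)"
proof -
  have nonneg: "(LINT x:torus|lborel. periodize g x) = (LINT x|lborel. g x)"
    if g: "continuous_on UNIV g" "bounded {x. g x \<noteq> 0}" "\<And>x. 0 \<le> g x" for g :: "real^2 \<Rightarrow> real"
  proof -
    have [measurable]: "g \<in> borel_measurable borel" "periodize g \<in> borel_measurable borel"
      using g continuous_periodize borel_measurable_continuous_onI by blast+
    have sum: "(\<integral>\<^sup>+n. ennreal (g (x + lattice_vec n)) \<partial>count_space UNIV) = ennreal (periodize g x)" for x
    proof -
      obtain N where N: "finite N" "\<And>n. n \<notin> N \<Longrightarrow> g (x + lattice_vec n) = 0"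
        using finite_bounded_lattice[OF g(2), of "{x}"] by (auto simp: bounded_insert)
      have "(\<integral>\<^sup>+n. ennreal (g (x + lattice_vec n)) \<partial>count_space UNIV)
          = (\<Sum>n\<in>N. ennreal (g (x + lattice_vec n)))"
        by (rule nn_integral_count_space'[OF N(1)]) (use N in auto)
      then show ?thesis using periodize_sum[of N g x, OF N] g(3) by (simp add: sum_ennreal)
    qed
    have "(LINT x|lborel. g x) = enn2real (\<integral>\<^sup>+x. ennreal (g x) \<partial>lborel)"
      by (rule integral_eq_nn_integral) (use g in auto)
    also have "\<dots> = enn2real (\<integral>\<^sup>+x\<in>cell. ennreal (periodize g x) \<partial>lborel)"
      by (subst nn_integral_unfold) (auto simp: sum)
    also have "\<dots> = (LINT x:cell|lborel. periodize g x)"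
      using g(3) by (subst set_integral_cell_nn) (auto simp: periodize_lattice intro: infsum_nonneg)
    also have "\<dots> = (LINT x:torus|lborel. periodize g x)"
      by (rule set_integral_torus_cell[symmetric]) measurable
    finally show ?thesis by simp
  qed
  define p q where "p x = max (f x) 0" and "q x = max (- f x) 0" for x
  have f: "f x = p x - q x" for x by (simp add: p_def q_def max_def)
  have pq: "0 \<le> p x" "0 \<le> q x" for x by (simp_all add: p_def q_def)
  have c: "continuous_on UNIV p" "continuous_on UNIV q"
    unfolding p_def q_def by (intro continuous_intros assms(1))+
  have b: "bounded {x. p x \<noteq> 0}" "bounded {x. q x \<noteq> 0}"
    by (rule bounded_subset[OF assms(2)]; auto simp: p_def q_def)+
  have "periodize f x = periodize p x - periodize q x" for x
  proof -
    obtain N where N: "finite N" "\<And>h y. {x. h x \<noteq> 0} \<subseteq> {x. f x \<noteq> 0} \<Longrightarrow> y \<in> {x} \<Longrightarrow> 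
        periodize h y = (\<Sum>n\<in>N. h (y + lattice_vec n))"
      using periodize_local_sum[OF assms(2), of "{x}"] by (metis bounded_insert bounded_empty)
    have "periodize f x = (\<Sum>n\<in>N. f (x + lattice_vec n))" "periodize p x = (\<Sum>n\<in>N. p (x + lattice_vec n))"
      "periodize q x = (\<Sum>n\<in>N. q (x + lattice_vec n))"
      by (rule N(2); auto simp: p_def q_def max_def split: if_splits)+
    then show ?thesis by (simp add: f sum_subtractf)
  qed
  then have "(LINT x:torus|lborel. periodize f x) = (LINT x|lborel. p x) - (LINT x|lborel. q x)"
    using set_integral_diff(2)[OF set_integrable_torus[OF continuous_periodize] set_integrable_torus[OF
        continuous_periodize], OF c(1) b(1) c(2) b(2)]
    by (simp add: nonneg[OF c(1) b(1) pq(1)] nonneg[OF c(2) b(2) pq(2)])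
  also have "\<dots> = (LINT x|lborel. f x)"
    unfolding f using integrable_bounded_support[OF c(1) b(1)] integrable_bounded_support[OF c(2) b(2)]
        by simp
  finally show ?thesis .
qed

lemma abs_periodize_le:
  assumes "bounded {x. f x \<noteq> 0}"
  shows "\<bar>periodize f x\<bar> \<le> periodize (\<lambda>x. \<bar>f x\<bar>) x"
proof -
  obtain N where N: "finite N" "\<And>n. n \<notin> N \<Longrightarrow> f (x + lattice_vec n) = 0"
    using finite_bounded_lattice[OF assms, of "{x}"] by (auto simp: bounded_insert)
  then show ?thesis by (simp add: periodize_sum[OF N(1)] sum_abs)
qed

lemma torus_integral_abs_periodize_le:
  fixes f :: "real^2 \<Rightarrow> real"
  assumes "continuous_on UNIV f" "bounded {x. f x \<noteq> 0}"
  shows "(LINT x:torus|lborel. \<bar>periodize f x\<bar>) \<le> (LINT x|lborel. \<bar>f x\<bar>)"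
proof -
  have c: "continuous_on UNIV (\<lambda>x. \<bar>f x\<bar>)" "bounded {x. \<bar>f x\<bar> \<noteq> 0}"
    using assms by (auto intro: continuous_intros)
  have "(LINT x:torus|lborel. \<bar>periodize f x\<bar>) \<le> (LINT x:torus|lborel. periodize (\<lambda>x. \<bar>f x\<bar>) x)"
    by (intro set_integral_torus_mono set_integrable_torus continuous_intros continuous_periodize c
        assms abs_periodize_le)
  then show ?thesis by (simp add: torus_integral_periodize[OF c])
qed

section \<open>Distributions and convolution\<close>

lemma smooth_torusI: "smooth f \<Longrightarrow> periodic2 f \<Longrightarrow> f \<in> smooth_torus"
  by (simp add: smooth_torus_def)

lemma smooth_torusD: "f \<in> smooth_torus \<Longrightarrow> smooth f" "f \<in> smooth_torus \<Longrightarrow> periodic2 f"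
  by (simp_all add: smooth_torus_def)

lemma smooth_torus_continuous: "f \<in> smooth_torus \<Longrightarrow> continuous_on A f"
  by (simp add: smooth_torusD smooth_continuous)

lemma periodic2_partial: "smooth f \<Longrightarrow> periodic2 f \<Longrightarrow> periodic2 (partial i f)"
  unfolding periodic2_def
proof (intro allI)
  fix x j
  assume f: "smooth f" and p: "\<forall>x i. f (x + axis i (2 * pi)) = f x"
  then have "(\<lambda>y. f (y + axis j (2 * pi))) = f" by auto
  with partials_translate[OF f, of "[i]" "axis j (2 * pi)"]
  show "partial i f (x + axis j (2 * pi)) = partial i f x" by (simp add: fun_eq_iff)
qed

lemma partial_smooth_torus: "f \<in> smooth_torus \<Longrightarrow> partial i f \<in> smooth_torus"
  by (simp add: smooth_torus_def smooth_partial periodic2_partial)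

lemma partials_smooth_torus: "f \<in> smooth_torus \<Longrightarrow> partials is f \<in> smooth_torus"
  by (induction "is") (auto simp: partial_smooth_torus)

lemma smooth_torus_const [simp]: "(\<lambda>x. c) \<in> smooth_torus"
  by (simp add: smooth_torus_def periodic2_def)

lemma smooth_torus_add: "f \<in> smooth_torus \<Longrightarrow> g \<in> smooth_torus \<Longrightarrow> (\<lambda>x. f x + g x) \<in> smooth_torus"
  by (simp add: smooth_torus_def periodic2_def smooth_add)

lemma smooth_torus_diff: "f \<in> smooth_torus \<Longrightarrow> g \<in> smooth_torus \<Longrightarrow> (\<lambda>x. f x - g x) \<in> smooth_torus"
  by (simp add: smooth_torus_def periodic2_def smooth_diff)

lemma smooth_torus_minus: "f \<in> smooth_torus \<Longrightarrow> (\<lambda>x. - f x) \<in> smooth_torus"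
  by (simp add: smooth_torus_def periodic2_def smooth_minus)

lemma smooth_torus_mult:
  "f \<in> smooth_torus \<Longrightarrow> g \<in> smooth_torus \<Longrightarrow> (\<lambda>x. f x * g x :: real) \<in> smooth_torus"
  by (simp add: smooth_torus_def periodic2_def smooth_mult)

lemma smooth_torus_cmult: "f \<in> smooth_torus \<Longrightarrow> (\<lambda>x. c * f x :: real) \<in> smooth_torus"
  by (simp add: smooth_torus_mult)

lemma smooth_torus_sum: "finite A \<Longrightarrow> (\<And>a. a \<in> A \<Longrightarrow> f a \<in> smooth_torus) \<Longrightarrow> (\<lambda>x. \<Sum>a\<in>A. f a x) \<in> smooth_torus"
  by (simp add: smooth_torus_def periodic2_def smooth_sum)

lemma smooth_torus_reflect: "f \<in> smooth_torus \<Longrightarrow> (\<lambda>y. f (x - y)) \<in> smooth_torus"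
  by (simp add: smooth_torus_def smooth_reflect periodic2_reflect)

lemma smooth_torus_bounded:
  assumes "f \<in> smooth_torus" obtains B where "0 \<le> B" "\<And>x. norm (f x) \<le> B"
  using periodic2_bounded[OF smooth_torus_continuous[OF assms] smooth_torusD(2)[OF assms]] by blast

lemma onorm_partial_sum_le:
  fixes c :: "2 \<Rightarrow> real"
  assumes "\<And>i. \<bar>c i\<bar> \<le> B"
  shows "onorm (\<lambda>v::real^2. \<Sum>i\<in>UNIV. v $ i *\<^sub>R c i) \<le> 2 * B"
proof (rule onorm_bound)
  show "0 \<le> 2 * B" using assms[of 1] by simp
  fix v :: "real^2"
  have "norm (\<Sum>i\<in>UNIV. v $ i *\<^sub>R c i) \<le> (\<Sum>i\<in>(UNIV::2 set). norm v * B)"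
    by (rule sum_norm_le) (use assms component_le_norm_cart[of v] in \<open>auto simp: abs_mult intro!: mult_mono\<close>)
  then show "norm (\<Sum>i\<in>UNIV. v $ i *\<^sub>R c i) \<le> 2 * B * norm v" by (simp add: mult_ac)
qed

lemma lipschitz_of_partials_bound:
  fixes f :: "real^2 \<Rightarrow> real"
  assumes "smooth f" "\<And>i x. \<bar>partial i f x\<bar> \<le> B"
  shows "\<bar>f x - f y\<bar> \<le> 2 * B * norm (x - y)"
proof -
  have "onorm (\<lambda>v::real^2. \<Sum>i\<in>UNIV. v $ i *\<^sub>R partial i f x) \<le> 2 * B" for x
    by (rule onorm_partial_sum_le) (rule assms(2))
  from differentiable_bound[OF convex_UNIV smooth_has_derivative[OF assms(1)] this UNIV_I UNIV_I]
  show ?thesis by simp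
qed

lemma smooth_torus_lipschitz:
  fixes f :: "real^2 \<Rightarrow> real"
  assumes "f \<in> smooth_torus"
  obtains L where "0 \<le> L" "\<And>x y. \<bar>f x - f y\<bar> \<le> L * norm (x - y)"
proof -
  have "\<forall>i. \<exists>B. 0 \<le> B \<and> (\<forall>x. norm (partial i f x) \<le> B)"
    by (intro allI) (rule smooth_torus_bounded[OF partial_smooth_torus[OF assms]], blast)
  then obtain B where B: "\<And>i. 0 \<le> B i" "\<And>i x. norm (partial i f x) \<le> B i" by metis
  have "\<bar>partial i f x\<bar> \<le> (\<Sum>i\<in>UNIV. B i)" for i x
    using B(2)[of i x] member_le_sum[of i UNIV B] B(1) by fastforce
  then show ?thesis
    using that[of "2 * (\<Sum>i\<in>UNIV. B i)"] lipschitz_of_partials_bound[OF smooth_torusD(1)[OF assms]] B(1)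
    by (simp add: sum_nonneg)
qed

text \<open>The mean value inequality for \<open>f\<close> minus its first-order part, whose
  derivative is a difference of gradients and hence Lipschitz. The constant is uniform in
  \<open>x\<close>, so the remainder can be fed to a distribution.\<close>

lemma smooth_torus_taylor:
  fixes f :: "real^2 \<Rightarrow> real"
  assumes "f \<in> smooth_torus"
  obtains L where "0 \<le> L"
    "\<And>x h. \<bar>f (x + h) - f x - (\<Sum>i\<in>UNIV. h $ i * partial i f x)\<bar> \<le> L * (norm h)\<^sup>2"
proof -
  have "\<forall>i. \<exists>L. 0 \<le> L \<and> (\<forall>x y. \<bar>partial i f x - partial i f y\<bar> \<le> L * norm (x - y))"
    by (intro allI) (rule smooth_torus_lipschitz[OF partial_smooth_torus[OF assms]], blast)
  then obtain L' where L': "\<And>i. 0 \<le> L' i" "\<And>i x y. \<bar>partial i f x - partial i f y\<bar> \<le> L' i * norm (x - y)"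
    by metis
  define L where "L = (\<Sum>i\<in>UNIV. L' i)"
  have L: "0 \<le> L" "\<bar>partial i f x - partial i f y\<bar> \<le> L * norm (x - y)" for i x y
  proof -
    show "0 \<le> L" by (simp add: L_def sum_nonneg L')
    have "L' i \<le> L" unfolding L_def using member_le_sum[of i UNIV L'] L'(1) by simp
    then show "\<bar>partial i f x - partial i f y\<bar> \<le> L * norm (x - y)"
      using L'(2)[of i x y] by (meson mult_right_mono norm_ge_zero order_trans)
  qed
  show ?thesis
  proof (rule that[of "2 * L"])
    fix x h :: "real^2"
    define G where "G y = f y - (\<Sum>i\<in>UNIV. (y - x) $ i *\<^sub>R partial i f x)" for y
    have D: "(G has_derivative (\<lambda>v. \<Sum>i\<in>UNIV. v $ i *\<^sub>R (partial i f y - partial i f x))) (at y within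
        cball x (norm h))" for y
    proof -
      have "(G has_derivative (\<lambda>v. (\<Sum>i\<in>UNIV. v $ i *\<^sub>R partial i f y) - (\<Sum>i\<in>UNIV. v $ i *\<^sub>R partial i f
          x))) (at y)"
        unfolding G_def
        by (intro has_derivative_diff smooth_has_derivative smooth_torusD assms has_derivative_sum
            has_derivative_scaleR_left)
           (auto intro!: derivative_eq_intros bounded_linear_imp_has_derivative bounded_linear_vec_nth)
      then show ?thesis
        by (simp add: sum_subtractf right_diff_distrib has_derivative_at_withinI)
    qed
    have on: "onorm (\<lambda>v. \<Sum>i\<in>UNIV. v $ i *\<^sub>R (partial i f y - partial i f x)) \<le> 2 * (L * norm h)"
      if "y \<in> cball x (norm h)" for y
      using that L by (intro onorm_partial_sum_le order_trans[OF L(2)] mult_left_mono) (auto simp: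
          dist_norm norm_minus_commute)
    have "norm (G (x + h) - G x) \<le> 2 * (L * norm h) * norm ((x + h) - x)"
      by (rule differentiable_bound[OF convex_cball D on]) (auto simp: dist_norm)
    then show "\<bar>f (x + h) - f x - (\<Sum>i\<in>UNIV. h $ i * partial i f x)\<bar> \<le> 2 * L * (norm h)\<^sup>2"
      by (simp add: G_def power2_eq_square mult_ac)
  qed (use L in simp)
qed

lemma distribution_add:
  "distribution T \<Longrightarrow> f \<in> smooth_torus \<Longrightarrow> g \<in> smooth_torus \<Longrightarrow> T (\<lambda>x. f x + g x) = T f + T g"
  by (simp add: distribution_def)

lemma distribution_cmult:
  "distribution T \<Longrightarrow> f \<in> smooth_torus \<Longrightarrow> T (\<lambda>x. c * f x) = c *\<^sub>R T f"
  by (simp add: distribution_def)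

lemma distribution_minus: "distribution T \<Longrightarrow> f \<in> smooth_torus \<Longrightarrow> T (\<lambda>x. - f x) = - T f"
  using distribution_cmult[of T f "- 1"] by simp

lemma distribution_diff:
  "distribution T \<Longrightarrow> f \<in> smooth_torus \<Longrightarrow> g \<in> smooth_torus \<Longrightarrow> T (\<lambda>x. f x - g x) = T f - T g"
  using distribution_add[of T f "\<lambda>x. - g x"] by (simp add: distribution_minus smooth_torus_minus)

lemma distribution_zero: "distribution T \<Longrightarrow> T (\<lambda>x. 0) = 0"
  using distribution_cmult[of T "\<lambda>x. 0" 0] by simp

lemma distribution_sum:
  "finite A \<Longrightarrow> distribution T \<Longrightarrow> (\<And>a. a \<in> A \<Longrightarrow> f a \<in> smooth_torus) \<Longrightarrow>
    T (\<lambda>x. \<Sum>a\<in>A. f a x) = (\<Sum>a\<in>A. T (f a))"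
proof (induction A rule: finite_induct)
  case (insert a A)
  then show ?case
    using distribution_add[of T "f a" "\<lambda>x. \<Sum>a\<in>A. f a x"] by (simp add: smooth_torus_sum)
qed (simp add: distribution_zero)

lemma distribution_bound:
  assumes "distribution T"
  shows "\<exists>N C. 0 \<le> C \<and> (\<forall>f\<in>smooth_torus. \<forall>b. (\<forall>is x. length is \<le> N \<longrightarrow> \<bar>partials is f x\<bar> \<le> b) \<longrightarrow>
    norm (T f) \<le> C * b)"
proof -
  obtain N C where NC: "\<forall>f\<in>smooth_torus. \<forall>b. (\<forall>is x. length is \<le> N \<longrightarrow> \<bar>partials is f x\<bar> \<le> b) \<longrightarrow>
    norm (T f) \<le> C * b"
    using assms unfolding distribution_def by auto
  show ?thesis
  proof (intro exI[of _ N] exI[of _ "max C 0"] conjI ballI allI impI)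
    fix f :: "real^2 \<Rightarrow> real" and b
    assume *: "f \<in> smooth_torus" "\<forall>is x. length is \<le> N \<longrightarrow> \<bar>partials is f x\<bar> \<le> b"
    have "\<bar>f 0\<bar> \<le> b" using *(2)[rule_format, of "[]" 0] by simp
    then have "0 \<le> b" by linarith
    then show "norm (T f) \<le> max C 0 * b"
      using NC[rule_format, OF *(1), of b] *(2) by (meson max.cobounded1 mult_right_mono order_trans)
  qed simp
qed

lemma finite_index_lists: "finite {is :: 2 list. length is \<le> N}"
  using finite_lists_length_le[of "UNIV :: 2 set" N] by simp

lemma uniform_bound_index_lists:
  fixes P :: "2 list \<Rightarrow> real \<Rightarrow> bool"
  assumes "\<And>is. \<exists>B\<ge>0. P is B" "\<And>is B B'. P is B \<Longrightarrow> B \<le> B' \<Longrightarrow> P is B'"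
  shows "\<exists>B\<ge>0. \<forall>is. length is \<le> N \<longrightarrow> P is B"
proof -
  obtain B where B: "\<And>is. 0 \<le> B is" "\<And>is. P is (B is)" using assms(1) by metis
  show ?thesis
  proof (intro exI[of _ "\<Sum>is\<in>{is. length is \<le> N}. B is"] conjI allI impI)
    fix "is" :: "2 list" assume "length is \<le> N"
    then show "P is (\<Sum>is\<in>{is. length is \<le> N}. B is)"
      using finite_index_lists B by (intro assms(2)[OF B(2)[of "is"]] member_le_sum) auto
  qed (simp add: sum_nonneg B)
qed

lemma partials_partial_commute:
  fixes f :: "real^2 \<Rightarrow> real"
  shows "smooth f \<Longrightarrow> partials is (partial i f) = partial i (partials is f)"
  by (induction "is") (auto simp: partial_commute smooth_partials)

text \<open>The first-order remainders of \<open>f\<close> and of its derivatives up to the order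
  \<open>N\<close> of \<open>T\<close> are quadratic in \<open>h\<close>, uniformly in the point;
  continuity of \<open>T\<close> transfers this to the remainder of the convolution.\<close>

lemma dist_conv_has_derivative:
  fixes T :: "real functional"
  assumes T: "distribution T" and f: "f \<in> smooth_torus"
  shows "(dist_conv T f has_derivative (\<lambda>v. \<Sum>i\<in>UNIV. v $ i *\<^sub>R dist_conv T (partial i f) x)) (at x)"
proof -
  obtain N C where C: "0 \<le> C" "\<forall>f\<in>smooth_torus. \<forall>b.
      (\<forall>is x. length is \<le> N \<longrightarrow> \<bar>partials is f x\<bar> \<le> b) \<longrightarrow> norm (T f) \<le> C * b"
    using distribution_bound[OF T] by blast
  define P where "P is L \<longleftrightarrow> (\<forall>x h. \<bar>partials is f (x + h) - partials is f x -
      (\<Sum>i\<in>UNIV. h $ i * partial i (partials is f) x)\<bar> \<le> L * (norm h)\<^sup>2)" for "is" L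
  have P1: "\<exists>B\<ge>0. P is B" for "is"
    unfolding P_def by (rule smooth_torus_taylor[OF partials_smooth_torus[OF f]]) blast
  have P2: "P is B'" if "P is B" "B \<le> B'" for "is" B B'
    using that unfolding P_def by (meson mult_right_mono order_trans zero_le_power2)
  obtain L where L: "0 \<le> L" "\<And>is. length is \<le> N \<Longrightarrow> P is L"
  proof -
    have "\<exists>B\<ge>0. \<forall>is. length is \<le> N \<longrightarrow> P is B"
      by (rule uniform_bound_index_lists) (fact P1, fact P2)
    then show thesis using that by auto
  qed
  have rem: "\<bar>dist_conv T f (x + h) - dist_conv T f x - (\<Sum>i\<in>UNIV. h $ i *\<^sub>R dist_conv T (partial i f) x)\<bar>
      \<le> C * (L * (norm h)\<^sup>2)" for h
  proof -
    define R where "R y = f (x + h - y) - f (x - y) - (\<Sum>i\<in>UNIV. h $ i * partial i f (x - y))" for y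
    have sm: "(\<lambda>y. f (x + h - y)) \<in> smooth_torus" "(\<lambda>y. f (x - y)) \<in> smooth_torus"
      "(\<lambda>y. h $ i * partial i f (x - y)) \<in> smooth_torus"
      "(\<lambda>y. partial i f (x - y)) \<in> smooth_torus"
      "(\<lambda>y. \<Sum>i\<in>UNIV. h $ i * partial i f (x - y)) \<in> smooth_torus" for i
      by (intro smooth_torus_reflect smooth_torus_cmult smooth_torus_sum partial_smooth_torus f finite)+
    have R: "R \<in> smooth_torus" unfolding R_def by (intro smooth_torus_diff sm)
    have "T R = dist_conv T f (x + h) - dist_conv T f x - (\<Sum>i\<in>UNIV. h $ i *\<^sub>R dist_conv T (partial i f) x)"
      unfolding R_def dist_conv_def
      by (simp only: distribution_diff[OF T] smooth_torus_diff sm distribution_sum[OF finite T]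
          distribution_cmult[OF T])
    moreover have "norm (T R) \<le> C * (L * (norm h)\<^sup>2)"
    proof (rule C(2)[rule_format, OF R])
      fix "is" :: "2 list" and y :: "real^2" assume len: "length is \<le> N"
      have s: "smooth (\<lambda>y. f (x + h - y))" "smooth (\<lambda>y. f (x - y))" "smooth (\<lambda>y. h $ i * partial i f (x - y))"
        "smooth (\<lambda>y. \<Sum>i\<in>UNIV. h $ i * partial i f (x - y))" "smooth (\<lambda>y. partial i f (x - y))" for i
        using sm smooth_torusD by blast+
      have ps: "partials is (\<lambda>y. \<Sum>i\<in>UNIV. h $ i * partial i f (x - y))
          = (\<lambda>y. \<Sum>i\<in>UNIV. h $ i * partials is (\<lambda>y. partial i f (x - y)) y)"
      proof (induction "is")
        case (Cons j "is")
        have "smooth (\<lambda>y. h $ i * partials is (\<lambda>y. partial i f (x - y)) y)" for i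
          by (intro smooth_cmult smooth_partials s)
        then show ?case using Cons s by (simp add: partial_sum partial_cmult smooth_partials)
      qed simp
      have "partials is R y = (-1) ^ length is * (partials is f (x + h - y) - partials is f (x - y)
          - (\<Sum>i\<in>UNIV. h $ i * partial i (partials is f) (x - y)))"
        unfolding R_def using f smooth_torusD(1)[OF f]
        by (simp add: partials_diff s smooth_diff ps partials_reflect smooth_partial
              partials_partial_commute right_diff_distrib sum_distrib_left mult_ac)
      then have "\<bar>partials is R y\<bar> = \<bar>partials is f (x + h - y) - partials is f (x - y)
          - (\<Sum>i\<in>UNIV. h $ i * partial i (partials is f) (x - y))\<bar>"
        by (simp add: abs_mult power_abs add_diff_eq add.commute[of h])
      moreover have "x + h - y = (x - y) + h" by simp
      ultimately show "\<bar>partials is R y\<bar> \<le> L * (norm h)\<^sup>2" using L(2)[OF len] unfolding P_def by metis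
    qed
    ultimately show ?thesis by simp
  qed
  have "((\<lambda>h. norm (dist_conv T f (x + h) - dist_conv T f x - (\<Sum>i\<in>UNIV. h $ i *\<^sub>R dist_conv T (partial i
      f) x)) / norm h) \<longlongrightarrow> 0) (at 0)"
  proof (rule tendsto_sandwich[of "\<lambda>h. 0" _ _ "\<lambda>h. C * L * norm h"])
    show "\<forall>\<^sub>F h in at 0. norm (dist_conv T f (x + h) - dist_conv T f x - (\<Sum>i\<in>UNIV. h $ i *\<^sub>R dist_conv T
        (partial i f) x)) / norm h \<le> C * L * norm h"
      using rem by (intro always_eventually allI) (auto simp: divide_le_eq power2_eq_square mult_ac)
    show "((\<lambda>h::real^2. C * L * norm h) \<longlongrightarrow> 0) (at 0)"
      by (auto intro!: tendsto_eq_intros)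
  qed (auto intro!: always_eventually)
  then show ?thesis
    unfolding has_derivative_at
    by (intro conjI) (auto intro!: bounded_linear_sum bounded_linear_mult_const bounded_linear_vec_nth)
qed

lemma partial_dist_conv:
  fixes T :: "real functional"
  assumes "distribution T" "f \<in> smooth_torus"
  shows "partial i (dist_conv T f) = dist_conv T (partial i f)"
proof
  fix x
  from partialI[OF dist_conv_has_derivative[OF assms]]
  show "partial i (dist_conv T f) x = dist_conv T (partial i f) x" by (simp only: axis_nth_sum)
qed

lemma smooth_dist_conv:
  fixes T :: "real functional"
  assumes "distribution T" "f \<in> smooth_torus"
  shows "smooth (dist_conv T f)"
proof (rule smooth_coinduct[of "\<lambda>h. \<exists>f\<in>smooth_torus. h = dist_conv T f"])
  fix h assume "\<exists>f\<in>smooth_torus. h = dist_conv T f"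
  then obtain f where h: "f \<in> smooth_torus" "h = dist_conv T f" by blast
  show "(\<forall>x. h differentiable at x) \<and> (\<forall>i. \<exists>f\<in>smooth_torus. partial i h = dist_conv T f)"
  proof (intro conjI allI)
    show "h differentiable at x" for x
      unfolding h(2) by (rule differentiableI[OF dist_conv_has_derivative[OF assms(1) h(1)]])
    show "\<exists>f\<in>smooth_torus. partial i h = dist_conv T f" for i
      by (rule bexI[of _ "partial i f"]) (simp_all add: h partial_dist_conv[OF assms(1)] partial_smooth_torus)
  qed
qed (use assms in blast)

lemma dist_conv_smooth_torus:
  fixes T :: "real functional"
  assumes "distribution T" "f \<in> smooth_torus"
  shows "dist_conv T f \<in> smooth_torus"
proof -
  have "dist_conv T f (x + axis i (2 * pi)) = dist_conv T f x" for x i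
    using periodic2_translate[OF smooth_torusD(2)[OF assms(2)]] smooth_torusD(2)[OF assms(2)]
    unfolding dist_conv_def periodic2_def by (simp add: diff_add_eq[symmetric])
  then show ?thesis using smooth_dist_conv[OF assms] by (simp add: smooth_torus_def periodic2_def)
qed

lemma partials_dist_conv:
  fixes T :: "real functional"
  assumes "distribution T" "f \<in> smooth_torus"
  shows "partials is (dist_conv T f) = dist_conv T (partials is f)"
  by (induction "is") (simp_all add: partial_dist_conv[OF assms(1)] partials_smooth_torus assms)

lemma set_integrable_mult_bounded:
  fixes f \<phi> :: "real^2 \<Rightarrow> real"
  assumes "set_integrable lborel torus f" "continuous_on UNIV \<phi>"
  shows "set_integrable lborel torus (\<lambda>x. \<phi> x * f x)"
proof -
  have "bounded (\<phi> ` torus)"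
    by (intro compact_imp_bounded compact_continuous_image compact_torus continuous_on_subset[OF
        assms(2)]) auto
  then obtain B where B: "\<And>x. x \<in> torus \<Longrightarrow> \<bar>\<phi> x\<bar> \<le> B" by (auto simp: bounded_iff)
  have [measurable]: "\<phi> \<in> borel_measurable borel" by (rule borel_measurable_continuous_onI[OF assms(2)])
  have *: "integrable lborel (\<lambda>x. indicator torus x * f x)" using assms(1) by (simp add: set_integrable_def)
  then have [measurable]: "(\<lambda>x. indicator torus x * f x) \<in> borel_measurable borel" by auto
  have "integrable lborel (\<lambda>x. \<phi> x * (indicator torus x * f x))"
  proof (rule Bochner_Integration.integrable_bound[of _ "\<lambda>x. B * (indicator torus x * f x)"])
    show "AE x in lborel. norm (\<phi> x * (indicator torus x * f x)) \<le> norm (B * (indicator torus x * f x))"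
    proof (rule AE_I2)
      fix x
      show "norm (\<phi> x * (indicator torus x * f x)) \<le> norm (B * (indicator torus x * f x))"
        using B[of x] by (cases "x \<in> torus") (auto simp: abs_mult intro!: mult_right_mono)
    qed
  qed (use * in auto)
  then show ?thesis by (simp add: set_integrable_def mult_ac)
qed

lemma abs_dist_of_le:
  fixes f \<phi> :: "real^2 \<Rightarrow> real"
  assumes "set_integrable lborel torus f" "continuous_on UNIV \<phi>" "\<And>x. \<bar>\<phi> x\<bar> \<le> b"
  shows "\<bar>LINT x:torus|lborel. \<phi> x * f x\<bar> \<le> (LINT x:torus|lborel. \<bar>f x\<bar>) * b"
proof -
  have "\<bar>LINT x:torus|lborel. \<phi> x * f x\<bar> \<le> (LINT x:torus|lborel. \<bar>\<phi> x * f x\<bar>)"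
    using set_integral_norm_bound[OF set_integrable_mult_bounded[OF assms(1,2)]] by simp
  also have "\<dots> \<le> (LINT x:torus|lborel. b * \<bar>f x\<bar>)"
    using set_integrable_abs[OF set_integrable_mult_bounded[OF assms(1,2)]] set_integrable_abs[OF
        assms(1)] assms(3)
    by (intro set_integral_torus_mono) (auto simp: abs_mult intro!: mult_right_mono)
  finally show ?thesis by (simp add: mult.commute)
qed

lemma distribution_dist_of:
  fixes f :: "real^2 \<Rightarrow> real"
  assumes "set_integrable lborel torus f"
  shows "distribution (dist_of f)"
  unfolding distribution_def
proof (intro conjI ballI allI)
  fix \<phi> \<psi> :: "real^2 \<Rightarrow> real" assume "\<phi> \<in> smooth_torus" "\<psi> \<in> smooth_torus"
  then have "set_integrable lborel torus (\<lambda>x. \<phi> x * f x)" "set_integrable lborel torus (\<lambda>x. \<psi> x * f x)"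
    using set_integrable_mult_bounded[OF assms] smooth_torus_continuous by blast+
  then show "dist_of f (\<lambda>x. \<phi> x + \<psi> x) = dist_of f \<phi> + dist_of f \<psi>"
    by (simp add: dist_of_def distrib_right)
next
  show "\<exists>N C. \<forall>\<phi>\<in>smooth_torus. \<forall>b. (\<forall>is x. length is \<le> N \<longrightarrow> \<bar>partials is \<phi> x\<bar> \<le> b) \<longrightarrow>
      norm (dist_of f \<phi>) \<le> C * b"
  proof (intro exI[of _ "0::nat"] exI[of _ "LINT x:torus|lborel. \<bar>f x\<bar>"] ballI allI impI)
    fix \<phi> :: "real^2 \<Rightarrow> real" and b
    assume "\<phi> \<in> smooth_torus" "\<forall>is x. length is \<le> 0 \<longrightarrow> \<bar>partials is \<phi> x\<bar> \<le> b"
    then show "norm (dist_of f \<phi>) \<le> (LINT x:torus|lborel. \<bar>f x\<bar>) * b"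
      using abs_dist_of_le[OF assms smooth_torus_continuous, of \<phi> b] by (simp add: dist_of_def)
  qed
qed (simp add: dist_of_def mult.assoc)

lemma conv_dist_of: "dist_conv (dist_of f) g x = (LINT y:torus|lborel. g (x - y) * f y)"
  for f g :: "real^2 \<Rightarrow> real"
  by (simp add: dist_conv_def dist_of_def)

lemma conv_commute:
  fixes f g :: "real^2 \<Rightarrow> real"
  assumes "continuous_on UNIV f" "periodic2 f" "continuous_on UNIV g" "periodic2 g"
  shows "dist_conv (dist_of f) g = dist_conv (dist_of g) f"
proof
  fix x
  have c: "continuous_on UNIV (\<lambda>y. g y * f (x - y))"
    by (intro continuous_intros assms continuous_reflect)
  have p: "periodic2 (\<lambda>y. g y * f (x - y))"
    using periodic2_reflect[OF assms(2), of x] assms(4) by (simp add: periodic2_def)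
  show "dist_conv (dist_of f) g x = dist_conv (dist_of g) f x"
    using torus_integral_reflect_translate[OF c p, of x] by (simp add: conv_dist_of mult.commute)
qed

lemma abs_conv_le:
  fixes f g :: "real^2 \<Rightarrow> real"
  assumes "set_integrable lborel torus f" "continuous_on UNIV g" "\<And>x. \<bar>g x\<bar> \<le> b"
  shows "\<bar>dist_conv (dist_of f) g x\<bar> \<le> (LINT x:torus|lborel. \<bar>f x\<bar>) * b"
  unfolding conv_dist_of by (rule abs_dist_of_le[OF assms(1) continuous_reflect[OF assms(2)] assms(3)])

text \<open>Rounding the integration variable turns a convolution integral into a finite sum,
  through which a distribution passes by linearity. This takes the place of a Fubini theorem between
  a distribution and an integral.\<close>

definition grid_round :: "real \<Rightarrow> real^2 \<Rightarrow> real^2" where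
  "grid_round d x = (\<chi> i. d * of_int \<lfloor>x $ i / d\<rfloor>)"

lemma norm_grid_round_le:
  assumes "0 < d" shows "norm (x - grid_round d x) \<le> 2 * d"
proof -
  have "\<bar>(x - grid_round d x) $ i\<bar> \<le> d" for i
  proof -
    have "x $ i - d * of_int \<lfloor>x $ i / d\<rfloor> = d * (x $ i / d - of_int \<lfloor>x $ i / d\<rfloor>)"
      using assms by (simp add: field_simps)
    moreover have "\<bar>x $ i / d - of_int \<lfloor>x $ i / d\<rfloor>\<bar> \<le> 1" by linarith
    ultimately show ?thesis using assms
      by (simp add: grid_round_def abs_mult mult_le_cancel_left1)
  qed
  then have "(\<Sum>i\<in>UNIV. \<bar>(x - grid_round d x) $ i\<bar>) \<le> (\<Sum>i\<in>(UNIV::2 set). d)"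
    by (intro sum_mono)
  then show ?thesis using norm_le_l1_cart[of "x - grid_round d x"] by simp
qed

lemma grid_round_measurable [measurable]: "grid_round d \<in> borel_measurable borel"
  unfolding grid_round_def
  by (subst borel_measurable_euclidean_space) (auto simp: Basis_vec_def inner_axis)

lemma finite_grid_round_image:
  assumes "0 < d" "bounded S" shows "finite (grid_round d ` S)"
proof -
  obtain b where b: "\<And>x. x \<in> S \<Longrightarrow> norm x \<le> b" using assms(2) by (auto simp: bounded_iff)
  define m where "m = \<lceil>b / d\<rceil> + 1"
  have "grid_round d ` S \<subseteq> (\<lambda>(p, q). vector [d * of_int p, d * of_int q]) ` ({- m..m} \<times> {- m..m})"
  proof clarify
    fix x assume x: "x \<in> S"
    have "\<lfloor>x $ i / d\<rfloor> \<in> {- m..m}" for i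
    proof -
      have "\<bar>x $ i / d\<bar> \<le> b / d"
        using b[OF x] component_le_norm_cart[of x i] assms(1) by (simp add: divide_right_mono)
      then show ?thesis unfolding m_def atLeastAtMost_iff by linarith
    qed
    then show "grid_round d x \<in> (\<lambda>(p, q). vector [d * of_int p, d * of_int q]) ` ({- m..m} \<times> {- m..m})"
      by (intro image_eqI[of _ _ "(\<lfloor>x $ 1 / d\<rfloor>, \<lfloor>x $ 2 / d\<rfloor>)"]) (auto simp: vec_eq_iff forall_2
          grid_round_def)
  qed
  then show ?thesis by (rule finite_subset) simp
qed

text \<open>Nodes and weights do not depend on \<Phi>, so the same quadrature serves a function and
  all its derivatives. The weight \<open>w v\<close> is the integral of \<open>g\<close> over the
  points of \<open>torus\<close> that round to \<open>v\<close>.\<close>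

lemma grid_integral_sum:
  fixes g :: "real^2 \<Rightarrow> real"
  assumes "set_integrable lborel torus g" "0 < d"
  shows "\<exists>V w. finite V \<and> (\<forall>\<Phi>. (LINT x:torus|lborel. \<Phi> (grid_round d x) * g x) = (\<Sum>v\<in>V. w v * \<Phi> v))"
proof -
  define V where "V = grid_round d ` torus"
  define w where "w v = (LINT x:torus|lborel. indicator {x. grid_round d x = v} x * g x)" for v
  have V: "finite V" unfolding V_def by (rule finite_grid_round_image[OF assms(2) compact_imp_bounded[OF
      compact_torus]])
  have "(LINT x:torus|lborel. \<Phi> (grid_round d x) * g x) = (\<Sum>v\<in>V. w v * \<Phi> v)" for \<Phi> :: "real^2 \<Rightarrow> real"
  proof -
    have int: "integrable lborel (\<lambda>x. indicator torus x *\<^sub>R (indicator {x. grid_round d x = v} x * g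
        x))" for v
    proof -
      have "integrable lborel (\<lambda>x. indicator {x. grid_round d x = v} x *\<^sub>R (indicator torus x *\<^sub>R g x))"
        by (rule integrable_mult_indicator) (use assms in \<open>auto simp: set_integrable_def\<close>)
      then show ?thesis by (simp add: mult_ac)
    qed
    have eq: "indicator torus x *\<^sub>R (\<Phi> (grid_round d x) * g x)
        = (\<Sum>v\<in>V. \<Phi> v * (indicator torus x *\<^sub>R (indicator {x. grid_round d x = v} x * g x)))" for x
    proof (cases "x \<in> torus")
      case True
      then have "(\<Sum>v\<in>V. \<Phi> v * (indicator torus x *\<^sub>R (indicator {x. grid_round d x = v} x * g x)))
        = (\<Sum>v\<in>V. if v = grid_round d x then \<Phi> v * g x else 0)"
        by (intro sum.cong) (auto simp: indicator_def)
      then show ?thesis using True V by (simp add: V_def)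
    qed simp
    show ?thesis
      unfolding set_lebesgue_integral_def eq using int
      by (subst Bochner_Integration.integral_sum) (auto simp: w_def set_lebesgue_integral_def mult.commute)
  qed
  with V show ?thesis by blast
qed

lemma conv_grid_error:
  fixes f g :: "real^2 \<Rightarrow> real"
  assumes "set_integrable lborel torus g" "0 < d" "continuous_on UNIV f" "\<And>x y. \<bar>f x - f y\<bar> \<le> L * norm
      (x - y)" "0 \<le> L"
  shows "\<bar>(LINT x:torus|lborel. f (z - x) * g x) - (LINT x:torus|lborel. f (z - grid_round d x) * g x)\<bar>
     \<le> (LINT x:torus|lborel. \<bar>g x\<bar>) * (L * (2 * d))"
proof -
  have [measurable]: "f \<in> borel_measurable borel" by (rule borel_measurable_continuous_onI[OF assms(3)])
  have i1: "set_integrable lborel torus (\<lambda>x. f (z - x) * g x)"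
    by (rule set_integrable_mult_bounded[OF assms(1) continuous_reflect[OF assms(3)]])
  have le: "\<bar>f (z - x) - f (z - grid_round d x)\<bar> \<le> L * (2 * d)" for x
    using assms(4)[of "z - x" "z - grid_round d x"] norm_grid_round_le[OF assms(2), of x] assms(5)
    by (auto simp: norm_minus_commute intro: order_trans mult_left_mono)
  have iabs: "integrable lborel (\<lambda>x. (L * (2 * d)) * (indicator torus x *\<^sub>R \<bar>g x\<bar>))"
    using set_integrable_abs[OF assms(1)] by (simp add: set_integrable_def)
  have gm [measurable]: "(\<lambda>x. indicator torus x *\<^sub>R g x) \<in> borel_measurable borel"
    using assms(1) by (auto simp: set_integrable_def)
  have bound: "\<bar>indicator torus x *\<^sub>R ((f (z - x) - f (z - grid_round d x)) * g x)\<bar>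
      \<le> (L * (2 * d)) * (indicator torus x *\<^sub>R \<bar>g x\<bar>)" for x
    using le[of x] by (cases "x \<in> torus") (auto simp: abs_mult intro!: mult_right_mono)
  have "integrable lborel (\<lambda>x. (f (z - x) - f (z - grid_round d x)) * (indicator torus x *\<^sub>R g x))"
  proof (rule Bochner_Integration.integrable_bound[OF iabs])
    show "AE x in lborel. norm ((f (z - x) - f (z - grid_round d x)) * (indicator torus x *\<^sub>R g x))
        \<le> norm ((L * (2 * d)) * (indicator torus x *\<^sub>R \<bar>g x\<bar>))"
    proof (rule AE_I2)
      fix x
      have "(f (z - x) - f (z - grid_round d x)) * (indicator torus x *\<^sub>R g x)
         = indicator torus x *\<^sub>R ((f (z - x) - f (z - grid_round d x)) * g x)" by simp
      then show "norm ((f (z - x) - f (z - grid_round d x)) * (indicator torus x *\<^sub>R g x))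
        \<le> norm ((L * (2 * d)) * (indicator torus x *\<^sub>R \<bar>g x\<bar>))"
        using order_trans[OF bound[of x] abs_ge_self] by (simp only: Real_Vector_Spaces.real_norm_def)
    qed
  qed measurable
  then have i2: "set_integrable lborel torus (\<lambda>x. (f (z - x) - f (z - grid_round d x)) * g x)"
    by (simp add: set_integrable_def mult_ac)
  have i3: "set_integrable lborel torus (\<lambda>x. f (z - grid_round d x) * g x)"
    using set_integral_diff(1)[OF i1 i2] by (simp add: left_diff_distrib)
  have "(LINT x:torus|lborel. f (z - x) * g x) - (LINT x:torus|lborel. f (z - grid_round d x) * g x)
     = (LINT x:torus|lborel. (f (z - x) - f (z - grid_round d x)) * g x)"
    using set_integral_diff(2)[OF i1 i3] by (simp add: left_diff_distrib)
  also have "\<bar>\<dots>\<bar> \<le> (LINT x|lborel. \<bar>indicator torus x *\<^sub>R ((f (z - x) - f (z - grid_round d x)) * g x)\<bar>)"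
    unfolding set_lebesgue_integral_def by (rule integral_abs_bound)
  also have "\<dots> \<le> (LINT x|lborel. (L * (2 * d)) * (indicator torus x *\<^sub>R \<bar>g x\<bar>))"
    by (rule integral_mono[OF integrable_abs[OF i2[unfolded set_integrable_def]] iabs bound])
  finally show ?thesis by (simp add: set_lebesgue_integral_def mult.commute)
qed

text \<open>Both sides are compared with the same finite sum. On the left this is the quadrature
  error of one function, on the right that of all derivatives up to the order of \<open>T\<close>;
  both are linear in the mesh, which is arbitrary.\<close>

lemma conv_dist_conv:
  fixes f g :: "real^2 \<Rightarrow> real" and T :: "real functional"
  assumes T: "distribution T" and f: "f \<in> smooth_torus" and g: "set_integrable lborel torus g"
  shows "dist_conv (dist_of g) (dist_conv T f) = dist_conv T (dist_conv (dist_of g) f)"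
proof
  fix z
  let ?G = "LINT x:torus|lborel. \<bar>g x\<bar>"
  let ?lhs = "dist_conv (dist_of g) (dist_conv T f) z" and ?rhs = "dist_conv T (dist_conv (dist_of g) f) z"
  have G: "0 \<le> ?G" unfolding set_lebesgue_integral_def by (rule integral_nonneg_AE) auto
  have Dg: "distribution (dist_of g)" by (rule distribution_dist_of[OF g])
  obtain N C where C: "0 \<le> C" "\<forall>f\<in>smooth_torus. \<forall>b.
      (\<forall>is x. length is \<le> N \<longrightarrow> \<bar>partials is f x\<bar> \<le> b) \<longrightarrow> norm (T f) \<le> C * b"
    using distribution_bound[OF T] by blast
  define P where "P is L \<longleftrightarrow> (\<forall>x y. \<bar>partials is f x - partials is f y\<bar> \<le> L * norm (x - y))" for "is" L
  have "\<exists>B\<ge>0. \<forall>is. length is \<le> N \<longrightarrow> P is B"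
  proof (rule uniform_bound_index_lists)
    show "\<exists>B\<ge>0. P is B" for "is"
      unfolding P_def by (rule smooth_torus_lipschitz[OF partials_smooth_torus[OF f]]) blast
    show "P is B'" if "P is B" "B \<le> B'" for "is" B B'
      using that unfolding P_def by (meson mult_right_mono order_trans norm_ge_zero)
  qed
  then obtain L where L: "0 \<le> L" "\<And>is. length is \<le> N \<Longrightarrow> P is L" by auto
  obtain L' where L': "0 \<le> L'" "\<And>x y. \<bar>dist_conv T f x - dist_conv T f y\<bar> \<le> L' * norm (x - y)"
    using smooth_torus_lipschitz[OF dist_conv_smooth_torus[OF T f]] by blast
  have main: "\<bar>?lhs - ?rhs\<bar> \<le> (?G * (L' * 2) + C * (?G * (L * 2))) * d" if d: "0 < d" for d
  proof -
    obtain V w where V: "finite V" "\<And>\<Phi>. (LINT x:torus|lborel. \<Phi> (grid_round d x) * g x) = (\<Sum>v\<in>V. w v * \<Phi> v)"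
      using grid_integral_sum[OF g d] by blast
    have 1: "\<bar>?lhs - (\<Sum>v\<in>V. w v * dist_conv T f (z - v))\<bar> \<le> ?G * (L' * (2 * d))"
      using conv_grid_error[OF g d smooth_torus_continuous[OF dist_conv_smooth_torus[OF T f]] L'(2)
          L'(1), of z]
      unfolding conv_dist_of V(2)[of "\<lambda>v. dist_conv T f (z - v)"] .
    define F where "F y = dist_conv (dist_of g) f (z - y)" for y
    define S where "S y = (\<Sum>v\<in>V. w v * f ((z - v) - y))" for y
    have FS: "F \<in> smooth_torus" "S \<in> smooth_torus"
      unfolding F_def S_def
      by (intro smooth_torus_reflect dist_conv_smooth_torus Dg f smooth_torus_sum smooth_torus_cmult V(1))+
    have TS: "T S = (\<Sum>v\<in>V. w v * dist_conv T f (z - v))"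
    proof -
      have "T S = (\<Sum>v\<in>V. T (\<lambda>y. w v * f ((z - v) - y)))"
        unfolding S_def by (rule distribution_sum[OF V(1) T]) (intro smooth_torus_cmult
            smooth_torus_reflect f)
      also have "\<dots> = (\<Sum>v\<in>V. w v * T (\<lambda>y. f ((z - v) - y)))"
        by (intro sum.cong refl) (simp add: distribution_cmult[OF T] smooth_torus_reflect f)
      finally show ?thesis by (simp add: dist_conv_def)
    qed
    have "norm (T (\<lambda>y. F y - S y)) \<le> C * (?G * (L * (2 * d)))"
    proof (rule C(2)[rule_format])
      show "(\<lambda>y. F y - S y) \<in> smooth_torus" by (intro smooth_torus_diff FS)
      fix "is" :: "2 list" and y assume len: "length is \<le> N"
      let ?p = "partials is f"
      have p: "?p \<in> smooth_torus" by (rule partials_smooth_torus[OF f])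
      have pS: "partials is S = (\<lambda>y. \<Sum>v\<in>V. w v * ((-1) ^ length is * ?p ((z - v) - y)))"
      proof -
        have *: "smooth (\<lambda>y. w v * f ((z - v) - y))" for v
          by (intro smooth_cmult smooth_reflect smooth_torusD f)
        have "partials is (\<lambda>y. \<Sum>v\<in>V. w v * f ((z - v) - y)) = (\<lambda>y. \<Sum>v\<in>V. partials is (\<lambda>y. w v * f ((z -
            v) - y)) y)"
          by (induction "is") (simp_all add: partial_sum[OF V(1)] smooth_partials *)
        then show ?thesis
          unfolding S_def by (simp add: partials_cmult smooth_reflect smooth_torusD f partials_reflect)
      qed
      have "partials is (\<lambda>y. F y - S y) y = partials is F y - partials is S y"
        using FS by (simp add: partials_diff smooth_torusD)
      also have "partials is F y = (-1) ^ length is * dist_conv (dist_of g) ?p (z - y)"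
        unfolding F_def using partials_reflect[OF smooth_dist_conv[OF Dg f]]
        by (simp add: partials_dist_conv[OF Dg f])
      also have "partials is S y = (-1) ^ length is * (\<Sum>v\<in>V. w v * ?p ((z - y) - v))"
        unfolding pS by (simp add: sum_distrib_left mult_ac diff_diff_eq add.commute)
      finally have "\<bar>partials is (\<lambda>y. F y - S y) y\<bar>
          = \<bar>dist_conv (dist_of g) ?p (z - y) - (\<Sum>v\<in>V. w v * ?p ((z - y) - v))\<bar>"
        by (simp add: abs_mult power_abs flip: right_diff_distrib)
      also have "\<dots> \<le> ?G * (L * (2 * d))"
        using conv_grid_error[OF g d smooth_torus_continuous[OF p] _ L(1), of "z - y"] L(2)[OF len]
        unfolding conv_dist_of P_def V(2)[of "\<lambda>v. ?p ((z - y) - v)"] by blast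
      finally show "\<bar>partials is (\<lambda>y. F y - S y) y\<bar> \<le> ?G * (L * (2 * d))" .
    qed
    moreover have "T F = ?rhs" unfolding F_def[abs_def] by (rule dist_conv_def[symmetric])
    then have "T (\<lambda>y. F y - S y) = ?rhs - (\<Sum>v\<in>V. w v * dist_conv T f (z - v))"
      using distribution_diff[OF T FS] TS by simp
    ultimately have "\<bar>?rhs - (\<Sum>v\<in>V. w v * dist_conv T f (z - v))\<bar> \<le> C * (?G * (L * (2 * d)))" by simp
    with 1 have "\<bar>?lhs - ?rhs\<bar> \<le> ?G * (L' * (2 * d)) + C * (?G * (L * (2 * d)))" by linarith
    then show ?thesis by (simp add: algebra_simps)
  qed
  have "?lhs - ?rhs = 0"
  proof (rule ccontr)
    assume ne: "?lhs - ?rhs \<noteq> 0"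
    define K where "K = ?G * (L' * 2) + C * (?G * (L * 2))"
    have K: "0 \<le> K" unfolding K_def using G L L' C by simp
    \<comment> \<open>A mesh proportional to the supposed discrepancy makes the error at most half
      of it; \<open>K + 1\<close> keeps the denominator positive.\<close>
    have "\<bar>?lhs - ?rhs\<bar> \<le> K * (\<bar>?lhs - ?rhs\<bar> / (2 * (K + 1)))"
      using main[of "\<bar>?lhs - ?rhs\<bar> / (2 * (K + 1))"] ne K unfolding K_def by simp
    also have "\<dots> \<le> \<bar>?lhs - ?rhs\<bar> / 2" using K by (simp add: field_simps)
    finally show False using ne by simp
  qed
  then show "?lhs = ?rhs" by simp
qed

lemma dist_conv_conv:
  fixes f g :: "real^2 \<Rightarrow> real" and T :: "real functional"
  assumes T: "distribution T" and f: "f \<in> smooth_torus" and g: "g \<in> smooth_torus"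
  shows "dist_conv (dist_of (dist_conv T f)) g = dist_conv (dist_of f) (dist_conv T g)"
proof -
  have fg: "dist_conv (dist_of f) g = dist_conv (dist_of g) f"
    by (rule conv_commute) (use f g in \<open>auto simp: smooth_torusD smooth_torus_continuous\<close>)
  have "dist_conv (dist_of (dist_conv T f)) g = dist_conv (dist_of g) (dist_conv T f)"
    by (rule conv_commute)
       (use dist_conv_smooth_torus[OF T f] g in \<open>auto simp: smooth_torusD smooth_torus_continuous\<close>)
  also have "\<dots> = dist_conv T (dist_conv (dist_of g) f)"
    by (rule conv_dist_conv[OF T f set_integrable_torus[OF smooth_torus_continuous[OF g]]])
  also have "\<dots> = dist_conv (dist_of f) (dist_conv T g)"
    unfolding fg[symmetric]
    by (rule conv_dist_conv[OF T g set_integrable_torus[OF smooth_torus_continuous[OF f]], symmetric])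
  finally show ?thesis .
qed

text \<open>By translation invariance the convolution of \<open>f\<close> with 1 is constant; its
  derivative, which vanishes, is the convolution of \<open>partial i f\<close> with 1.\<close>

lemma torus_integral_partial:
  fixes f :: "real^2 \<Rightarrow> real"
  assumes "f \<in> smooth_torus"
  shows "(LINT x:torus|lborel. partial i f x) = 0"
proof -
  have D: "distribution (dist_of (\<lambda>x. 1 :: real))"
    by (rule distribution_dist_of[OF set_integrable_torus]) simp
  have *: "dist_conv (dist_of (\<lambda>x. 1 :: real)) g x = (LINT y:torus|lborel. g y)"
    if "g \<in> smooth_torus" for g :: "real^2 \<Rightarrow> real" and x
    using torus_integral_reflect_translate[OF smooth_torus_continuous smooth_torusD(2), OF that that] by
        (simp add: conv_dist_of)
  have "dist_conv (dist_of (\<lambda>x. 1 :: real)) f = (\<lambda>x. LINT y:torus|lborel. f y)"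
    using *[OF assms] by auto
  then have "partial i (dist_conv (dist_of (\<lambda>x. 1 :: real)) f) = (\<lambda>x. 0)" by simp
  then show ?thesis
    using *[OF partial_smooth_torus[OF assms]] by (simp add: partial_dist_conv[OF D assms] fun_eq_iff)
qed

section \<open>The dyadic kernels\<close>

text \<open>\<open>D n\<close> stands for the \<open>n\<close>-th derivative of \<open>D 0\<close>
  on \<open>A\<close>. Carrying the whole sequence as data makes compositions with functions of one
  variable smooth without iterating a derivative operator.\<close>

definition derivative_seq :: "(nat \<Rightarrow> real \<Rightarrow> real) \<Rightarrow> real set \<Rightarrow> bool" where
  "derivative_seq D A \<longleftrightarrow> (\<forall>n. \<forall>t\<in>A. (D n has_real_derivative D (Suc n) t) (at t))"

lemma compose_has_derivative:
  assumes "(g has_real_derivative g') (at (f x))" "smooth f"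
  shows "((\<lambda>x. g (f x)) has_derivative (\<lambda>v. \<Sum>i\<in>UNIV. v $ i *\<^sub>R (g' * partial i f x))) (at x)"
proof -
  have "((\<lambda>x. g (f x)) has_derivative (\<lambda>v. g' * (\<Sum>i\<in>UNIV. v $ i *\<^sub>R partial i f x))) (at x)"
    using has_derivative_compose[OF smooth_has_derivative[OF assms(2)]] assms(1)
    unfolding has_field_derivative_def by blast
  then show ?thesis by (simp add: sum_distrib_left mult_ac)
qed

lemma partial_compose:
  assumes "derivative_seq D A" "smooth f" "\<And>x. f x \<in> A"
  shows "partial i (\<lambda>x. D n (f x)) = (\<lambda>x. D (Suc n) (f x) * partial i f x)"
proof
  fix x
  have "(D n has_real_derivative D (Suc n) (f x)) (at (f x))"
    using assms by (simp add: derivative_seq_def)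
  from partialI[OF compose_has_derivative[OF this assms(2)]]
  show "partial i (\<lambda>x. D n (f x)) x = D (Suc n) (f x) * partial i f x" by (simp only: axis_nth_sum)
qed

text \<open>The class stable under \<open>partial\<close> consists of finite sums of a smooth
  function times some \<open>D n\<close> of \<open>f\<close>: the chain rule raises \<open>n\<close>
  and multiplies the smooth factor by \<open>partial i f\<close>.\<close>

lemma smooth_compose:
  assumes D: "derivative_seq D A" and f: "smooth f" "\<And>x. f x \<in> A"
  shows "smooth (\<lambda>x. D n (f x))"
proof -
  define Q where "Q ps x = (\<Sum>p\<leftarrow>ps. fst p x * D (snd p) (f x))" for ps :: "((real^2 \<Rightarrow> real) \<times> nat) list" and x
  define P where "P h \<longleftrightarrow> (\<exists>ps. (\<forall>p\<in>set ps. smooth (fst p)) \<and> h = Q ps)" for h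
  have diff1: "(\<lambda>x. D n (f x)) differentiable (at x)" for n x
    using compose_has_derivative[OF _ f(1), of "D n" "D (Suc n) (f x)" x] D f(2)
    by (auto simp: derivative_seq_def intro: differentiableI)
  have diff: "Q ps differentiable (at x)" if "\<forall>p\<in>set ps. smooth (fst p)" for ps x
    unfolding Q_def[abs_def] using that
    by (induction ps) (simp_all add: smooth_differentiable differentiable_add differentiable_mult diff1)
  have der: "\<exists>qs. (\<forall>p\<in>set qs. smooth (fst p)) \<and> partial i (Q ps) = Q qs"
    if "\<forall>p\<in>set ps. smooth (fst p)" for ps i
    using that
  proof (induction ps)
    case Nil
    have "partial i (Q []) = Q []" unfolding Q_def[abs_def] by simp
    then show ?case by (intro exI[of _ "[]"]) simp
  next
    case (Cons p ps)
    then obtain qs where qs: "\<forall>p\<in>set qs. smooth (fst p)" "partial i (Q ps) = Q qs" by auto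
    have p: "smooth (fst p)" using Cons by simp
    let ?h = "\<lambda>x. fst p x * D (snd p) (f x)"
    have "partial i (Q (p # ps)) x = partial i ?h x + partial i (Q ps) x" for x
    proof -
      have "((\<lambda>x. ?h x + Q ps x) has_derivative
          (\<lambda>v. (\<Sum>i\<in>UNIV. v $ i *\<^sub>R partial i ?h x) + (\<Sum>i\<in>UNIV. v $ i *\<^sub>R partial i (Q ps) x))) (at x)"
        by (intro has_derivative_add frechet_derivative_partial diff differentiable_mult
            smooth_differentiable p diff1)
           (use Cons.prems in simp)
      from partialI[OF this, of i] show ?thesis
        by (simp add: Q_def[abs_def])
    qed
    moreover have "partial i ?h x = fst p x * (D (Suc (snd p)) (f x) * partial i f x) + partial i (fst
        p) x * D (snd p) (f x)" for x
    proof -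
      have "(?h has_derivative (\<lambda>v. fst p x * (\<Sum>i\<in>UNIV. v $ i *\<^sub>R partial i (\<lambda>x. D (snd p) (f x)) x)
          + (\<Sum>i\<in>UNIV. v $ i *\<^sub>R partial i (fst p) x) * D (snd p) (f x))) (at x)"
        by (intro has_derivative_mult frechet_derivative_partial smooth_differentiable p diff1)
      from partialI[OF this, of i] show ?thesis by (simp add: partial_compose[OF D f])
    qed
    ultimately have "partial i (Q (p # ps)) x
        = Q ((\<lambda>x. fst p x * partial i f x, Suc (snd p)) # (partial i (fst p), snd p) # qs) x" for x
      by (simp add: qs Q_def)
    then have "partial i (Q (p # ps))
        = Q ((\<lambda>x. fst p x * partial i f x, Suc (snd p)) # (partial i (fst p), snd p) # qs)" by blast
    then show ?case using qs p f
      by (intro exI[of _ "(\<lambda>x. fst p x * partial i f x, Suc (snd p)) # (partial i (fst p), snd p) # qs"])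
         (auto simp: smooth_partial intro!: smooth_mult)
  qed
  show ?thesis
  proof (rule smooth_coinduct[of P])
    show "P (\<lambda>x. D n (f x))"
      unfolding P_def by (rule exI[of _ "[(\<lambda>x. 1, n)]"]) (simp add: Q_def[abs_def])
  next
    fix h assume "P h"
    then obtain ps where "\<forall>p\<in>set ps. smooth (fst p)" "h = Q ps" unfolding P_def by blast
    then show "(\<forall>x. h differentiable at x) \<and> (\<forall>i. P (partial i h))"
      using diff der unfolding P_def by simp
  qed
qed

text \<open>The derivatives of \<open>exp (- (1 / t))\<close> are polynomials in
  \<open>1 / t\<close> times the same exponential: differentiating
  \<open>p (1 / t) * exp (- (1 / t))\<close> replaces \<open>p\<close> by \<open>p - p'\<close>
  times the monomial \<open>[:0, 0, 1:]\<close>, which is the factor \<open>1 / t\<^sup>2\<close> of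
  the chain rule.\<close>

fun bump_poly :: "nat \<Rightarrow> real poly" where
  "bump_poly 0 = 1"
| "bump_poly (Suc n) = [:0, 0, 1:] * (bump_poly n - pderiv (bump_poly n))"

definition bump_deriv :: "nat \<Rightarrow> real \<Rightarrow> real" where
  "bump_deriv n t = (if 0 < t then poly (bump_poly n) (1 / t) * exp (- (1 / t)) else 0)"

lemma tendsto_poly_exp_at_top: "((\<lambda>x::real. poly p x * exp (- x)) \<longlongrightarrow> 0) at_top"
proof -
  have "((\<lambda>x::real. \<Sum>i\<le>degree p. coeff p i * (x ^ i / exp x)) \<longlongrightarrow> (\<Sum>i\<le>degree p. coeff p i * 0)) at_top"
    by (intro tendsto_sum tendsto_mult tendsto_const tendsto_power_div_exp_0)
  then show ?thesis by (simp add: poly_altdef sum_distrib_right sum_divide_distrib exp_minus field_simps)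
qed

lemma derivative_seq_bump: "derivative_seq bump_deriv UNIV"
  unfolding derivative_seq_def
proof (intro allI ballI)
  fix n and t :: real
  consider "t < 0" | "t = 0" | "0 < t" by linarith
  then show "(bump_deriv n has_real_derivative bump_deriv (Suc n) t) (at t)"
  proof cases
    case 1
    have "((\<lambda>_. 0) has_real_derivative 0) (at t)" by simp
    then have "(bump_deriv n has_real_derivative 0) (at t)"
      by (rule has_field_derivative_transform_within_open[of _ _ _ "{..<0}"]) (use 1 in \<open>auto simp:
          bump_deriv_def\<close>)
    then show ?thesis using 1 by (simp add: bump_deriv_def)
  next
    case 3
    let ?p = "bump_poly n"
    have "((\<lambda>t. poly ?p (1 / t) * exp (- (1 / t))) has_real_derivative
        poly (pderiv ?p) (1 / t) * (- (1 / t\<^sup>2)) * exp (- (1 / t)) + exp (- (1 / t)) * (1 / t\<^sup>2) * poly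
            ?p (1 / t)) (at t)"
      using 3 by (auto intro!: derivative_eq_intros DERIV_chain'[OF _ poly_DERIV] simp: power2_eq_square
          field_simps)
    then have "(bump_deriv n has_real_derivative
        poly (pderiv ?p) (1 / t) * (- (1 / t\<^sup>2)) * exp (- (1 / t)) + exp (- (1 / t)) * (1 / t\<^sup>2) * poly
            ?p (1 / t)) (at t)"
      by (rule has_field_derivative_transform_within_open[of _ _ _ "{0<..}"]) (use 3 in \<open>auto simp:
          bump_deriv_def\<close>)
    then show ?thesis using 3 by (simp add: bump_deriv_def algebra_simps power2_eq_square)
  next
    case 2
    have "((\<lambda>h. bump_deriv n h / h) \<longlongrightarrow> 0) (at_right 0)"
    \<comment> \<open>Division by \<open>h\<close> is absorbed as one more factor
      \<open>1 / h\<close> in the polynomial, which the exponential still beats.\<close>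
    proof -
      have "((\<lambda>h. poly ([:0, 1:] * bump_poly n) (1 / h) * exp (- (1 / h))) \<longlongrightarrow> 0) (at_right 0)"
        using filterlim_compose[OF tendsto_poly_exp_at_top, of "\<lambda>h. 1 / h" "at_right 0" "[:0, 1:] *
            bump_poly n"] filterlim_inverse_at_top_right
        by (simp add: inverse_eq_divide)
      then show ?thesis
        by (rule Lim_transform_eventually) (auto simp: eventually_at_right_field bump_deriv_def intro:
            exI[of _ 1])
    qed
    moreover have "((\<lambda>h. bump_deriv n h / h) \<longlongrightarrow> 0) (at_left 0)"
      by (rule Lim_transform_eventually[OF tendsto_const]) (auto simp: eventually_at_left_field
          bump_deriv_def intro: exI[of _ "-1"])
    ultimately have "((\<lambda>h. bump_deriv n h / h) \<longlongrightarrow> 0) (at 0)"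
      by (simp add: filterlim_split_at)
    then show ?thesis using 2 by (simp add: has_field_derivative_iff bump_deriv_def)
  qed
qed

definition ln_deriv :: "nat \<Rightarrow> real \<Rightarrow> real" where
  "ln_deriv n t = (if n = 0 then ln t else (-1) ^ (n - 1) * fact (n - 1) * inverse (t ^ n))"

lemma derivative_seq_ln: "derivative_seq ln_deriv {0<..}"
  unfolding derivative_seq_def
proof (intro allI ballI)
  fix n and t :: real assume t: "t \<in> {0<..}"
  show "(ln_deriv n has_real_derivative ln_deriv (Suc n) t) (at t)"
  proof (cases n)
    case 0
    then show ?thesis using t by (auto simp: ln_deriv_def[abs_def] inverse_eq_divide intro!:
        derivative_eq_intros)
  next
    case (Suc m)
    have "((\<lambda>t. t ^ Suc m) has_real_derivative real (Suc m) * t ^ m) (at t)"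
      using DERIV_pow[of "Suc m" t] by simp
    then have "((\<lambda>t. (-1) ^ m * fact m * inverse (t ^ Suc m)) has_real_derivative
        (-1) ^ m * fact m * - (inverse (t ^ Suc m) * (real (Suc m) * t ^ m) * inverse (t ^ Suc m))) (at t)"
      by (intro DERIV_cmult DERIV_inverse') (use t in auto)
    moreover have "(-1) ^ m * fact m * - (inverse (t ^ Suc m) * (real (Suc m) * t ^ m) * inverse (t ^ Suc m))
       = (-1) ^ Suc m * fact (Suc m) * inverse (t ^ Suc (Suc m))"
      using t by (simp add: field_simps)
    ultimately have "((\<lambda>t. (-1) ^ m * fact m * inverse (t ^ Suc m)) has_real_derivative
        (-1) ^ Suc m * fact (Suc m) * inverse (t ^ Suc (Suc m))) (at t)" by (simp only:)
    then show ?thesis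
      unfolding ln_deriv_def[abs_def] Suc by (simp del: power_Suc fact_Suc)
  qed
qed

definition sqnorm :: "real^2 \<Rightarrow> real" where
  "sqnorm x = (\<Sum>i\<in>UNIV. x $ i * x $ i)"

lemma sqnorm_eq: "sqnorm x = (norm x)\<^sup>2"
  by (simp add: sqnorm_def power2_norm_eq_inner inner_vec_def)

lemma coord_has_derivative: "((\<lambda>x::real^2. x $ j) has_derivative (\<lambda>v. v $ j)) (at x)"
  by (rule bounded_linear_imp_has_derivative[OF bounded_linear_vec_nth])

lemma partial_coord: "partial i (\<lambda>x. x $ j) = (\<lambda>x. if i = j then 1 else 0)"
  by (rule ext, subst partialI[OF coord_has_derivative]) (simp add: axis_def)

lemma smooth_coord: "smooth (\<lambda>x. x $ j)"
proof (rule smooth_coinduct[of "\<lambda>h. h = (\<lambda>x. x $ j) \<or> (\<exists>c. h = (\<lambda>x. c))"])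
  fix h :: "real^2 \<Rightarrow> real" assume "h = (\<lambda>x. x $ j) \<or> (\<exists>c. h = (\<lambda>x. c))"
  then show "(\<forall>x. h differentiable at x) \<and> (\<forall>i. partial i h = (\<lambda>x. x $ j) \<or> (\<exists>c. partial i h = (\<lambda>x. c)))"
    using differentiableI[OF coord_has_derivative] by (auto simp: partial_coord)
qed simp

lemma smooth_sqnorm: "smooth sqnorm"
  unfolding sqnorm_def[abs_def] by (intro smooth_sum smooth_mult smooth_coord) simp

lemma partial_sqnorm: "partial i sqnorm = (\<lambda>x. 2 * x $ i)"
proof -
  have "partial i (\<lambda>x. x $ j * x $ j) = (\<lambda>x. if i = j then 2 * x $ i else 0)" for j
    by (auto simp: partial_mult[OF smooth_coord smooth_coord] partial_coord)
  then show ?thesis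
    unfolding sqnorm_def[abs_def]
    by (subst partial_sum) (auto intro!: smooth_mult smooth_coord)
qed

definition reg_sqnorm :: "real^2 \<Rightarrow> real" where
  "reg_sqnorm x = sqnorm x + bump_deriv 0 (1 / 4 - sqnorm x)"

text \<open>\<open>reg_sqnorm\<close> is positive and equals \<open>\<bar>x\<bar>\<^sup>2\<close> for \<open>\<bar>x\<bar> \<ge> 1 / 2\<close>, so \<open>log_kernel\<close> agrees there with the
fundamental solution of the Laplacian.\<close>

definition log_kernel :: "real^2 \<Rightarrow> real" where
  "log_kernel x = ln (reg_sqnorm x) / (4 * pi)"

lemma bump_deriv_eq_0: "t \<le> 0 \<Longrightarrow> bump_deriv n t = 0"
  by (simp add: bump_deriv_def)

lemma reg_sqnorm_pos: "0 < reg_sqnorm x"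
proof (cases "sqnorm x = 0")
  case True
  then show ?thesis by (simp add: reg_sqnorm_def bump_deriv_def)
next
  case False
  then show ?thesis by (simp add: reg_sqnorm_def bump_deriv_def sqnorm_eq add_pos_nonneg)
qed

lemma smooth_bump_arg: "smooth (\<lambda>x. 1 / 4 - sqnorm x)"
  by (intro smooth_diff smooth_const smooth_sqnorm)

lemma partial_bump_arg: "partial i (\<lambda>x. 1 / 4 - sqnorm x) = (\<lambda>x. - 2 * x $ i)"
  by (simp add: partial_diff smooth_sqnorm partial_sqnorm)

lemma smooth_bump_sqnorm: "smooth (\<lambda>x. bump_deriv n (1 / 4 - sqnorm x))"
  by (rule smooth_compose[OF derivative_seq_bump smooth_bump_arg]) simp

lemma partial_bump_sqnorm:
  "partial i (\<lambda>x. bump_deriv n (1 / 4 - sqnorm x)) = (\<lambda>x. bump_deriv (Suc n) (1 / 4 - sqnorm x) * (- 2 *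
      x $ i))"
  by (subst partial_compose[OF derivative_seq_bump smooth_bump_arg]) (simp_all add: partial_bump_arg)

lemma smooth_reg_sqnorm: "smooth reg_sqnorm"
  unfolding reg_sqnorm_def[abs_def] by (intro smooth_add smooth_sqnorm smooth_bump_sqnorm)

lemma partial_reg_sqnorm:
  "partial i reg_sqnorm = (\<lambda>x. 2 * x $ i * (1 - bump_deriv 1 (1 / 4 - sqnorm x)))"
  unfolding reg_sqnorm_def[abs_def]
  by (subst partial_add[OF smooth_sqnorm smooth_bump_sqnorm]) (simp add: partial_sqnorm
      partial_bump_sqnorm algebra_simps)

lemma smooth_ln_reg: "smooth (\<lambda>x. ln_deriv n (reg_sqnorm x))"
  by (rule smooth_compose[OF derivative_seq_ln smooth_reg_sqnorm]) (simp add: reg_sqnorm_pos)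

lemma log_kernel_alt: "log_kernel = (\<lambda>x. (1 / (4 * pi)) * ln_deriv 0 (reg_sqnorm x))"
  by (simp add: log_kernel_def ln_deriv_def fun_eq_iff)

lemma smooth_log_kernel: "smooth log_kernel"
  unfolding log_kernel_alt by (rule smooth_cmult[OF smooth_ln_reg])

lemma partial_ln_reg:
  "partial i (\<lambda>x. ln_deriv n (reg_sqnorm x)) = (\<lambda>x. ln_deriv (Suc n) (reg_sqnorm x) * (2 * x $ i * (1 -
      bump_deriv 1 (1 / 4 - sqnorm x))))"
  by (subst partial_compose[OF derivative_seq_ln smooth_reg_sqnorm]) (simp_all add: reg_sqnorm_pos
      partial_reg_sqnorm)

lemma partial_log_kernel:
  "partial i log_kernel = (\<lambda>x. (1 / (4 * pi)) * (ln_deriv 1 (reg_sqnorm x) * (2 * x $ i * (1 -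
      bump_deriv 1 (1 / 4 - sqnorm x)))))"
  unfolding log_kernel_alt by (subst partial_cmult[OF smooth_ln_reg]) (simp add: partial_ln_reg)

definition laplacian :: "(real^2 \<Rightarrow> real) \<Rightarrow> real^2 \<Rightarrow> real" where
  "laplacian f x = (\<Sum>i\<in>UNIV. partial i (partial i f) x)"

lemma smooth_laplacian: "smooth f \<Longrightarrow> smooth (laplacian f)"
  unfolding laplacian_def[abs_def] by (intro smooth_sum smooth_partial) auto

lemma partial_partial_log_kernel:
  "partial i (partial i log_kernel) x = (1 / (4 * pi)) *
    (ln_deriv 2 (reg_sqnorm x) * (2 * x $ i * (1 - bump_deriv 1 (1 / 4 - sqnorm x)))\<^sup>2
     + ln_deriv 1 (reg_sqnorm x) * (2 * (1 - bump_deriv 1 (1 / 4 - sqnorm x))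
         + 4 * (x $ i)\<^sup>2 * bump_deriv 2 (1 / 4 - sqnorm x)))"
proof -
  have s: "smooth (\<lambda>x. 1 - bump_deriv 1 (1 / 4 - sqnorm x))" "smooth (\<lambda>x. 2 * x $ i)"
    by (intro smooth_diff smooth_const smooth_bump_sqnorm smooth_cmult smooth_coord)+
  have d: "partial i (\<lambda>x. 1 - bump_deriv 1 (1 / 4 - sqnorm x)) = (\<lambda>x. bump_deriv 2 (1 / 4 - sqnorm x) *
      (2 * x $ i))"
    by (subst partial_diff[OF smooth_const smooth_bump_sqnorm]) (simp add: partial_bump_sqnorm numeral_2_eq_2)
  have d2: "partial i (\<lambda>x. 2 * x $ i) = (\<lambda>x. 2)"
    by (subst partial_cmult[OF smooth_coord]) (simp add: partial_coord)
  show ?thesis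
    unfolding partial_log_kernel
    by (subst partial_cmult[OF smooth_mult[OF smooth_ln_reg smooth_mult[OF s(2,1)]]],
        subst partial_mult[OF smooth_ln_reg smooth_mult[OF s(2,1)]],
        subst partial_mult[OF s(2,1)], unfold d d2 partial_ln_reg)
       (simp add: numeral_2_eq_2[symmetric] power2_eq_square algebra_simps)
qed

text \<open>Outside the disc of radius 1/2 the kernel is the logarithm of
  \<open>s = sqnorm x\<close> up to a factor, and its Laplacian is
  \<open>4 * s * ln'' s + 4 * ln' s = 0\<close>. The second 4 is 2 for each of two coordinates,
  which is where the dimension enters.\<close>

lemma laplacian_log_kernel_eq_0:
  assumes "1 / 4 \<le> sqnorm x" shows "laplacian log_kernel x = 0"
proof -
  have r: "reg_sqnorm x = sqnorm x" using assms by (simp add: reg_sqnorm_def bump_deriv_eq_0)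
  have "laplacian log_kernel x = (\<Sum>i\<in>UNIV. (1 / (4 * pi)) *
     (ln_deriv 2 (sqnorm x) * (4 * (x $ i * x $ i)) + ln_deriv 1 (sqnorm x) * 2))"
    unfolding laplacian_def partial_partial_log_kernel r using assms
    by (simp add: bump_deriv_eq_0 power2_eq_square mult_ac)
  also have "\<dots> = (1 / (4 * pi)) * (ln_deriv 2 (sqnorm x) * (4 * sqnorm x) + ln_deriv 1 (sqnorm x) * 4)"
    by (simp add: sum.distrib sum_distrib_left sqnorm_def flip: sum_divide_distrib)
  also have "\<dots> = 0" using assms by (simp add: ln_deriv_def field_simps power2_eq_square)
  finally show ?thesis .
qed

section \<open>The mass of \<open>delta_kernel\<close>\<close>

abbreviation vec2 :: "real \<times> real \<Rightarrow> real^2" where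
  "vec2 p \<equiv> vector [fst p, snd p]"

lemma vec2_measurable [measurable]: "vec2 \<in> borel_measurable (lborel \<Otimes>\<^sub>M lborel)"
proof -
  have "continuous_on UNIV vec2"
    unfolding continuous_on_componentwise[of UNIV vec2]
    by (auto simp: Basis_vec_def inner_axis forall_2 intro!: continuous_intros)
  then have "vec2 \<in> borel_measurable borel" by (rule borel_measurable_continuous_onI)
  then show ?thesis by (simp add: lborel_prod)
qed

lemma lborel_vec2: "distr (lborel \<Otimes>\<^sub>M lborel) borel vec2 = lborel"
proof (rule lborel_eqI[symmetric])
  fix l u :: "real^2" assume lu: "\<And>b. b \<in> Basis \<Longrightarrow> l \<bullet> b \<le> u \<bullet> b"
  have le: "l $ i \<le> u $ i" for i
    using lu[of "axis i 1"] by (auto simp: Basis_vec_def inner_axis)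
  have "vec2 -` box l u = box (l $ 1) (u $ 1) \<times> box (l $ 2) (u $ 2)"
    by (auto simp: mem_box_cart forall_2)
  then have "emeasure (distr (lborel \<Otimes>\<^sub>M lborel) borel vec2) (box l u)
      = emeasure (lborel \<Otimes>\<^sub>M lborel) (box (l $ 1) (u $ 1) \<times> box (l $ 2) (u $ 2))"
    by (subst emeasure_distr) (auto simp: space_pair_measure)
  also have "\<dots> = emeasure lborel (box (l $ 1) (u $ 1)) * emeasure lborel (box (l $ 2) (u $ 2))"
    by (rule lborel.emeasure_pair_measure_Times) auto
  also have "\<dots> = ennreal ((u $ 1 - l $ 1) * (u $ 2 - l $ 2))"
    using le by (simp add: ennreal_mult)
  also have "(u $ 1 - l $ 1) * (u $ 2 - l $ 2) = (\<Prod>b\<in>Basis. (u - l) \<bullet> b)"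
  proof -
    have "(Basis :: (real^2) set) = (\<lambda>i. axis i 1) ` UNIV" by (auto simp: Basis_vec_def)
    then have "(\<Prod>b\<in>Basis. (u - l) \<bullet> b) = (\<Prod>b\<in>range (\<lambda>i::2. axis i 1). (u - l) \<bullet> b)" by simp
    also have "\<dots> = (\<Prod>i\<in>UNIV. (u - l) $ i)"
      by (subst prod.reindex) (auto simp: inj_on_def axis_eq_axis inner_axis)
    finally show ?thesis by (simp add: UNIV_2)
  qed
  finally show "emeasure (distr (lborel \<Otimes>\<^sub>M lborel) borel vec2) (box l u) = ennreal (\<Prod>b\<in>Basis. (u - l) \<bullet> b)" .
qed simp

definition delta_kernel :: "real^2 \<Rightarrow> real" where
  "delta_kernel = laplacian log_kernel"

definition step_kernel :: "real^2 \<Rightarrow> real" where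
  "step_kernel x = log_kernel (2 *\<^sub>R x) - log_kernel x - ln 4 / (4 * pi)"

lemma smooth_delta_kernel: "smooth delta_kernel"
  by (simp add: delta_kernel_def smooth_laplacian smooth_log_kernel)

lemma smooth_step_kernel: "smooth step_kernel"
  using smooth_affine[OF smooth_log_kernel, of 2 0]
  unfolding step_kernel_def[abs_def] by (intro smooth_diff smooth_log_kernel smooth_const) simp

lemma log_kernel_outside: "1 / 2 \<le> norm x \<Longrightarrow> log_kernel x = ln (sqnorm x) / (4 * pi)"
proof -
  assume "1 / 2 \<le> norm x"
  then have "(1 / 2)\<^sup>2 \<le> sqnorm x" unfolding sqnorm_eq by (rule power_mono) simp
  then show ?thesis by (simp add: log_kernel_def reg_sqnorm_def bump_deriv_eq_0 power2_eq_square)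
qed

lemma delta_kernel_support: "{x. delta_kernel x \<noteq> 0} \<subseteq> cball 0 (1 / 2)"
proof clarify
  fix x assume "delta_kernel x \<noteq> 0"
  then have "sqnorm x < 1 / 4" unfolding delta_kernel_def using laplacian_log_kernel_eq_0 by (meson not_le)
  then have "(norm x)\<^sup>2 \<le> (1 / 2)\<^sup>2" by (simp add: sqnorm_eq power2_eq_square)
  then show "x \<in> cball 0 (1 / 2)" by (simp add: power2_le_iff_abs_le)
qed

lemma step_kernel_support: "{x. step_kernel x \<noteq> 0} \<subseteq> cball 0 (1 / 2)"
proof (rule ccontr)
  assume "\<not> ?thesis"
  then obtain x where x: "step_kernel x \<noteq> 0" "x \<notin> cball 0 (1 / 2)" by blast
  from x(2) have x2: "1 / 2 < norm x" by simp
  have "sqnorm (2 *\<^sub>R x) = 4 * sqnorm x" by (simp add: sqnorm_eq power_mult_distrib)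
  moreover have "0 < sqnorm x" using x2 by (auto simp: sqnorm_eq)
  ultimately have "step_kernel x = 0"
    using x2 by (simp add: step_kernel_def log_kernel_outside ln_mult add_divide_distrib)
  with x show False by simp
qed

lemma laplacian_step_kernel: "laplacian step_kernel x = 4 * delta_kernel (2 *\<^sub>R x) - delta_kernel x"
proof -
  have s: "smooth (\<lambda>x. log_kernel (2 *\<^sub>R x))" "smooth (\<lambda>x. log_kernel (2 *\<^sub>R x) - log_kernel x)"
    using smooth_affine[OF smooth_log_kernel, of 2 0] smooth_log_kernel by auto
  have "partials [i, i] step_kernel = (\<lambda>x. 4 * partials [i, i] log_kernel (2 *\<^sub>R x) - partials [i, i]
      log_kernel x)" for i
    using partials_affine[OF smooth_log_kernel, of "[i, i]" 2 0]
    unfolding step_kernel_def[abs_def]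
    by (subst partials_diff[OF s(2) smooth_const], subst partials_diff[OF s(1) smooth_log_kernel]) simp
  then show ?thesis
    by (simp add: laplacian_def delta_kernel_def sum_subtractf sum_distrib_left)
qed

text \<open>The divergence theorem on a square, one coordinate at a time, by Fubini and the
  fundamental theorem of calculus. It reduces the mass of \<open>delta_kernel\<close> to the
  gradient of \<open>log_kernel\<close> on the boundary, where the logarithm is unperturbed.\<close>

lemma integral_partial_box:
  fixes F :: "real^2 \<Rightarrow> real"
  assumes F: "smooth F"
  defines "B \<equiv> {x::real^2. \<forall>i. - 1 \<le> x $ i \<and> x $ i \<le> 1}"
  shows "(LINT x|lborel. indicator B x * partial 1 F x) = (LINT b|lborel. indicator {-1..1} b * (F
      (vector [1, b]) - F (vector [-1, b])))"
    and "(LINT x|lborel. indicator B x * partial 2 F x) = (LINT a|lborel. indicator {-1..1} a * (F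
        (vector [a, 1]) - F (vector [a, -1])))"
    and "integrable lborel (\<lambda>x. indicator B x * partial i F x)"
proof -
  have B: "B = cbox (\<chi> i. - 1) (\<chi> i. 1)" by (auto simp: B_def mem_box_cart)
  have [measurable]: "partial i F \<in> borel_measurable borel" "B \<in> sets borel" for i
    using smooth_measurable[OF smooth_partial[OF F]] by (simp_all add: B)
  have int: "integrable lborel (\<lambda>x. indicator B x * partial i F x)" for i
    using borel_integrable_compact[of B "partial i F"] smooth_continuous[OF smooth_partial[OF F]]
    by (simp add: B)
  then show "integrable lborel (\<lambda>x. indicator B x * partial i F x)" .
  have int': "integrable (lborel \<Otimes>\<^sub>M lborel) (\<lambda>p. indicator B (vec2 p) * partial i F (vec2 p))" for i
    using int[of i] by (subst (asm) lborel_vec2[symmetric], subst (asm) integrable_distr_eq) auto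
  have eq: "(LINT x|lborel. indicator B x * partial i F x)
      = (LINT p|(lborel \<Otimes>\<^sub>M lborel). indicator B (vec2 p) * partial i F (vec2 p))" for i
    by (subst lborel_vec2[symmetric], subst integral_distr) auto
  have ind: "indicator B (vector [a, b]) = (indicator {-1..1} a * indicator {-1..1} b :: real)" for a b
    by (auto simp: B_def indicator_def forall_2)
  have line1: "(vector [a, b] :: real^2) = vector [0, b] + a *\<^sub>R axis 1 (1::real)"
    and line2: "(vector [a, b] :: real^2) = vector [a, 0] + b *\<^sub>R axis 2 (1::real)" for a b :: real
    by (simp_all add: vec_eq_iff forall_2 axis_def)
  have "continuous_on UNIV (\<lambda>a. vector [0, b] + a *\<^sub>R axis 1 (1::real) :: real^2)"
    "continuous_on UNIV (\<lambda>b. vector [a, 0] + b *\<^sub>R axis 2 (1::real) :: real^2)" for a b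
    by (intro continuous_intros)+
  then have cont: "continuous_on UNIV (\<lambda>a. vector [a, b] :: real^2)" "continuous_on UNIV (\<lambda>b. vector [a,
      b] :: real^2)" for a b
    by (simp_all only: line1[symmetric] line2[symmetric])
  have "continuous_on UNIV (\<lambda>a. partial i F (vector [a, b]))" "continuous_on UNIV (\<lambda>b. partial i F
      (vector [a, b]))" for i a b
    by (rule continuous_on_compose2[OF smooth_continuous[OF smooth_partial[OF F], of UNIV] cont(1)], simp,
        rule continuous_on_compose2[OF smooth_continuous[OF smooth_partial[OF F], of UNIV] cont(2)], simp)
  then have pc: "isCont (\<lambda>a. partial i F (vector [a, b])) t" "isCont (\<lambda>b. partial i F (vector [a, b]))
      t" for i a b t
    by (simp_all add: continuous_on_eq_continuous_at)
  have ftc1: "(LINT a|lborel. indicator {-1..1} a * partial 1 F (vector [a, b])) = F (vector [1, b]) - F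
      (vector [-1, b])" for b
    using integral_FTC_Icc_real[of "-1" 1 "\<lambda>a. F (vector [a, b])" "\<lambda>a. partial 1 F (vector [a, b])"]
      has_derivative_along_axis[OF F, of "vector [0, b]" 1] pc
    unfolding line1[of _ b, symmetric] by (simp add: mult.commute)
  have ftc2: "(LINT b|lborel. indicator {-1..1} b * partial 2 F (vector [a, b])) = F (vector [a, 1]) - F
      (vector [a, -1])" for a
    using integral_FTC_Icc_real[of "-1" 1 "\<lambda>b. F (vector [a, b])" "\<lambda>b. partial 2 F (vector [a, b])"]
      has_derivative_along_axis[OF F, of "vector [a, 0]" 2] pc
    unfolding line2[of a, symmetric] by (simp add: mult.commute)
  show "(LINT x|lborel. indicator B x * partial 1 F x) = (LINT b|lborel. indicator {-1..1} b * (F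
      (vector [1, b]) - F (vector [-1, b])))"
    unfolding eq using lborel_pair.integral_snd[of "\<lambda>a b. indicator B (vec2 (a, b)) * partial 1 F (vec2
        (a, b))"] int'[of 1]
    by (simp add: ind mult_ac flip: ftc1)
       (simp add: case_prod_unfold mult.left_commute flip: ftc1)
  show "(LINT x|lborel. indicator B x * partial 2 F x) = (LINT a|lborel. indicator {-1..1} a * (F
      (vector [a, 1]) - F (vector [a, -1])))"
    unfolding eq using lborel_pair.integral_fst'[OF int'[of 2]]
    by (simp add: ind mult.assoc flip: ftc2)
qed

lemma integral_inverse_one_plus_square:
  "(LINT b|lborel. indicator {-1..1} b * (1 / (1 + b\<^sup>2) / pi)) = (1 / 2 :: real)"
proof -
  have "(LINT b|lborel. (1 / (1 + b\<^sup>2) / pi) * indicator {-1..1} b) = arctan 1 / pi - arctan (-1) / pi"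
  proof (rule integral_FTC_Icc_real)
    show "((\<lambda>x. arctan x / pi) has_real_derivative 1 / (1 + x\<^sup>2) / pi) (at x)" for x
      by (auto intro!: derivative_eq_intros simp: inverse_eq_divide)
    show "isCont (\<lambda>b. 1 / (1 + b\<^sup>2) / pi) x" for x :: real
      by (intro continuous_intros) (auto simp: add_nonneg_eq_0_iff)
  qed simp
  then show ?thesis by (simp add: mult.commute arctan_one arctan_minus)
qed

text \<open>The mass is the flux of the gradient of the logarithm through the boundary of a square.
  Each pair of opposite sides contributes the integral of \<open>1 / (1 + b\<^sup>2) / pi\<close>
  over \<open>{-1..1}\<close>, which is 1/2.\<close>

lemma integral_delta_kernel: "(LINT x|lborel. delta_kernel x) = 1"
proof -
  define B where "B = {x::real^2. \<forall>i. - 1 \<le> x $ i \<and> x $ i \<le> 1}"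
  have out: "delta_kernel x = indicator B x * partial 1 (partial 1 log_kernel) x
      + indicator B x * partial 2 (partial 2 log_kernel) x" for x
  proof (cases "x \<in> B")
    case True
    then show ?thesis by (simp add: delta_kernel_def laplacian_def sum_2)
  next
    case False
    then obtain i where "\<not> (- 1 \<le> x $ i \<and> x $ i \<le> 1)" by (auto simp: B_def)
    then have "1 < \<bar>x $ i\<bar>" by linarith
    then have "1 < norm x" using component_le_norm_cart[of x i] by simp
    then have "delta_kernel x = 0" using delta_kernel_support by force
    then show ?thesis using False by simp
  qed
  have s: "smooth (partial i log_kernel)" for i by (rule smooth_partial[OF smooth_log_kernel])
  have val: "partial i log_kernel x = x $ i / sqnorm x / (2 * pi)" if "1 \<le> sqnorm x" for i x
    using that by (simp add: partial_log_kernel reg_sqnorm_def bump_deriv_eq_0 ln_deriv_def field_simps)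
  have ge: "1 \<le> 1 + b\<^sup>2" for b :: real by simp
  have d1: "partial 1 log_kernel (vector [1, b]) - partial 1 log_kernel (vector [-1, b]) = 1 / (1 + b\<^sup>2) / pi"
    and d2: "partial 2 log_kernel (vector [b, 1]) - partial 2 log_kernel (vector [b, -1]) = 1 / (1 +
        b\<^sup>2) / pi" for b
    using ge[of b] by (simp_all add: val sqnorm_def sum_2 power2_eq_square add.commute)
  have "(LINT x|lborel. delta_kernel x) = (LINT x|lborel. indicator B x * partial 1 (partial 1 log_kernel) x)
      + (LINT x|lborel. indicator B x * partial 2 (partial 2 log_kernel) x)"
    unfolding out B_def
    by (rule Bochner_Integration.integral_add) (rule integral_partial_box(3)[OF s])+
  also have "\<dots> = 1"
    unfolding B_def integral_partial_box(1)[OF s] integral_partial_box(2)[OF s] d1 d2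
      integral_inverse_one_plus_square by simp
  finally show ?thesis .
qed

section \<open>Test functions at a given scale\<close>

lemma bounded_support_bounded:
  fixes f :: "real^2 \<Rightarrow> real"
  assumes "continuous_on UNIV f" "bounded {x. f x \<noteq> 0}"
  shows "\<exists>B\<ge>0. \<forall>x. \<bar>f x\<bar> \<le> B"
proof -
  have "bounded (f ` closure {x. f x \<noteq> 0})"
    using assms by (intro compact_imp_bounded compact_continuous_image) (auto simp: compact_closure
        intro: continuous_on_subset)
  then obtain B where B: "\<And>x. x \<in> closure {x. f x \<noteq> 0} \<Longrightarrow> \<bar>f x\<bar> \<le> B" by (auto simp: bounded_iff)
  have "\<bar>f x\<bar> \<le> max B 0" for x
  proof (cases "f x = 0")
    case False
    then have "x \<in> closure {x. f x \<noteq> 0}" using closure_subset[of "{x. f x \<noteq> 0}"] by auto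
    then show ?thesis using B[of x] by simp
  qed simp
  then show ?thesis by (intro exI[of _ "max B 0"]) simp
qed

lemma bounded_partials_support:
  fixes f :: "real^2 \<Rightarrow> real"
  shows "smooth f \<Longrightarrow> bounded {x. f x \<noteq> 0} \<Longrightarrow> bounded {x. partials is f x \<noteq> 0}"
  by (rule bounded_subset[OF bounded_closure partials_support])

lemma bounded_scaled_support:
  fixes f :: "real^2 \<Rightarrow> real"
  assumes "bounded {x. f x \<noteq> 0}" "c \<noteq> 0"
  shows "bounded {x. f (c *\<^sub>R x + a) \<noteq> 0}"
proof -
  have "{x. f (c *\<^sub>R x + a) \<noteq> 0} \<subseteq> (\<lambda>y. (1 / c) *\<^sub>R (- a + y)) ` {x. f x \<noteq> 0}"
  proof
    fix x assume "x \<in> {x. f (c *\<^sub>R x + a) \<noteq> 0}"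
    then show "x \<in> (\<lambda>y. (1 / c) *\<^sub>R (- a + y)) ` {x. f x \<noteq> 0}"
      using assms(2) by (intro image_eqI[of _ _ "c *\<^sub>R x + a"]) auto
  qed
  moreover have "bounded ((\<lambda>y. (1 / c) *\<^sub>R (- a + y)) ` {x. f x \<noteq> 0})"
    using bounded_scaling[OF bounded_translation[OF assms(1), of "- a"], of "1 / c"] by (simp add:
        image_image)
  ultimately show ?thesis by (rule bounded_subset[rotated])
qed

lemma smooth_scale: "smooth f \<Longrightarrow> smooth (\<lambda>x. f (c *\<^sub>R x))"
  using smooth_affine[of f c 0] by simp

lemma bounded_scale_support:
  fixes f :: "real^2 \<Rightarrow> real"
  shows "bounded {x. f x \<noteq> 0} \<Longrightarrow> c \<noteq> 0 \<Longrightarrow> bounded {x. f (c *\<^sub>R x) \<noteq> 0}"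
  using bounded_scaled_support[of f c 0] by simp

lemma unit_tests_support: "\<phi> \<in> unit_tests r \<Longrightarrow> bounded {x. \<phi> x \<noteq> 0}"
  unfolding unit_tests_def by (auto intro: bounded_subset[OF bounded_ball order_trans[OF closure_subset]])

lemma unit_tests_smooth: "\<phi> \<in> unit_tests r \<Longrightarrow> smooth \<phi>"
  by (simp add: unit_tests_def)

lemma scaled_test_arg:
  fixes x :: "real^2"
  shows "(\<lambda>y. \<phi> ((1 / l) *\<^sub>R (y - x)) / l\<^sup>2) = (\<lambda>y. (1 / l\<^sup>2) * \<phi> ((1 / l) *\<^sub>R y + (- (1 / l) *\<^sub>R x)))"
proof -
  have "(1 / l) *\<^sub>R (y - x) = (1 / l) *\<^sub>R y + (- (1 / l) *\<^sub>R x)" for y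
    by (simp add: scaleR_right_diff_distrib)
  then show ?thesis by simp
qed

lemma scaled_test_smooth_support:
  assumes "\<phi> \<in> unit_tests r" "0 < l"
  shows "smooth (\<lambda>y. \<phi> ((1 / l) *\<^sub>R (y - x)) / l\<^sup>2)" "bounded {y. \<phi> ((1 / l) *\<^sub>R (y - x)) / l\<^sup>2 \<noteq> 0}"
proof -
  show "smooth (\<lambda>y. \<phi> ((1 / l) *\<^sub>R (y - x)) / l\<^sup>2)"
    unfolding scaled_test_arg by (intro smooth_cmult smooth_affine unit_tests_smooth[OF assms(1)])
  have "bounded {y. \<phi> ((1 / l) *\<^sub>R y + (- (1 / l) *\<^sub>R x)) \<noteq> 0}"
    by (rule bounded_scaled_support[OF unit_tests_support[OF assms(1)]]) (use assms in auto)
  then show "bounded {y. \<phi> ((1 / l) *\<^sub>R (y - x)) / l\<^sup>2 \<noteq> 0}"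
    using assms(2) by (simp add: scaleR_right_diff_distrib)
qed

lemma scaled_test_smooth_torus: "\<phi> \<in> unit_tests r \<Longrightarrow> 0 < l \<Longrightarrow> scaled_test \<phi> x l \<in> smooth_torus"
  unfolding scaled_test_def by (rule periodize_in_smooth_torus) (rule scaled_test_smooth_support; assumption)+

lemma scaled_test_translate: "scaled_test \<phi> (x + z) l y = scaled_test \<phi> x l (y - z)"
  by (simp add: scaled_test_def periodize_lattice algebra_simps)

lemma scaled_test_lattice: "scaled_test \<phi> (x + lattice_vec n) l = scaled_test \<phi> x l"
proof
  fix y
  have "scaled_test \<phi> (x + lattice_vec n) l y = scaled_test \<phi> x l (y + lattice_vec (- n))"
    by (simp add: scaled_test_translate)
  also have "\<dots> = scaled_test \<phi> x l y"
    unfolding scaled_test_def by (rule periodic2_lattice[OF periodic2_periodize])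
  finally show "scaled_test \<phi> (x + lattice_vec n) l y = scaled_test \<phi> x l y" .
qed

text \<open>The inequality \<open>real_norm \<alpha> T \<le> ennreal A\<close> as a statement about
  reals. The centre \<open>x\<close> ranges over the whole plane, which by periodicity amounts to
  \<open>torus\<close> and lets bounds be translated freely.\<close>

definition test_bound :: "real \<Rightarrow> real functional \<Rightarrow> real \<Rightarrow> bool" where
  "test_bound \<alpha> T A \<longleftrightarrow> 0 \<le> A \<and> (\<forall>x l \<phi>. 0 < l \<longrightarrow> l \<le> 1 \<longrightarrow> \<phi> \<in> unit_tests (nat \<lfloor>- \<alpha> + 1\<rfloor>) \<longrightarrow>
     \<bar>T (scaled_test \<phi> x l)\<bar> \<le> A * l powr \<alpha>)"

lemma real_norm_le_iff:
  assumes "0 \<le> A"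
  shows "real_norm \<alpha> T \<le> ennreal A \<longleftrightarrow> test_bound \<alpha> T A"
proof -
  have one: "ennreal (l powr (- \<alpha>) * \<bar>t\<bar>) \<le> ennreal A \<longleftrightarrow> \<bar>t\<bar> \<le> A * l powr \<alpha>" if "0 < l" for l t
    using assms that by (simp add: powr_minus divide_simps mult.commute)
  have "real_norm \<alpha> T \<le> ennreal A \<longleftrightarrow> (\<forall>x\<in>torus. \<forall>l\<in>{0<..1}. \<forall>\<phi>\<in>unit_tests (nat \<lfloor>- \<alpha> + 1\<rfloor>).
     \<bar>T (scaled_test \<phi> x l)\<bar> \<le> A * l powr \<alpha>)"
    unfolding real_norm_def SUP_le_iff by (intro ball_cong refl one) auto
  also have "\<dots> \<longleftrightarrow> test_bound \<alpha> T A"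
  proof
    assume *: "\<forall>x\<in>torus. \<forall>l\<in>{0<..1}. \<forall>\<phi>\<in>unit_tests (nat \<lfloor>- \<alpha> + 1\<rfloor>).
      \<bar>T (scaled_test \<phi> x l)\<bar> \<le> A * l powr \<alpha>"
    show "test_bound \<alpha> T A"
      unfolding test_bound_def
    proof (intro conjI allI impI assms)
      fix x :: "real^2" and l :: real and \<phi>
      assume l: "0 < l" "l \<le> 1" and \<phi>: "\<phi> \<in> unit_tests (nat \<lfloor>- \<alpha> + 1\<rfloor>)"
      obtain n where "x + lattice_vec n \<in> torus" using exists_lattice_torus by blast
      then have "\<bar>T (scaled_test \<phi> (x + lattice_vec n) l)\<bar> \<le> A * l powr \<alpha>"
        using * l \<phi> by simp
      then show "\<bar>T (scaled_test \<phi> x l)\<bar> \<le> A * l powr \<alpha>" by (simp add: scaled_test_lattice)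
    qed
  qed (simp add: test_bound_def)
  finally show ?thesis .
qed

lemma real_norm_le: "test_bound \<alpha> T A \<Longrightarrow> real_norm \<alpha> T \<le> ennreal A"
  using real_norm_le_iff test_bound_def by blast

lemma real_norm_test_bound: "real_norm \<alpha> T < \<infinity> \<Longrightarrow> test_bound \<alpha> T (enn2real (real_norm \<alpha> T))"
  using real_norm_le_iff[of "enn2real (real_norm \<alpha> T)" \<alpha> T] by simp

lemma test_boundD: "test_bound \<alpha> T A \<Longrightarrow> 0 < l \<Longrightarrow> l \<le> 1 \<Longrightarrow> \<phi> \<in> unit_tests (nat \<lfloor>- \<alpha> + 1\<rfloor>) \<Longrightarrow>
     \<bar>T (scaled_test \<phi> x l)\<bar> \<le> A * l powr \<alpha>"
  by (simp add: test_bound_def)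

lemma test_bound_diff:
  assumes "test_bound \<alpha> S A" "test_bound \<alpha> T B"
  shows "test_bound \<alpha> (dist_diff S T) (A + B)"
  unfolding test_bound_def
proof (intro conjI allI impI)
  show "0 \<le> A + B" using assms by (simp add: test_bound_def)
  fix x :: "real^2" and l :: real and \<phi> assume *: "0 < l" "l \<le> 1" "\<phi> \<in> unit_tests (nat \<lfloor>- \<alpha> + 1\<rfloor>)"
  show "\<bar>dist_diff S T (scaled_test \<phi> x l)\<bar> \<le> (A + B) * l powr \<alpha>"
    using test_boundD[OF assms(1) *, of x] test_boundD[OF assms(2) *, of x]
    by (simp add: dist_diff_def distrib_right)
qed

text \<open>Without the factor \<open>c\<^sup>2\<close>, because a potential in the plane is
  rescaled through its argument alone; densities receive the factor in
  \<open>mollifier_at\<close>.\<close>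

definition scaled_kernel :: "real \<Rightarrow> (real^2 \<Rightarrow> real) \<Rightarrow> real^2 \<Rightarrow> real" where
  "scaled_kernel c \<psi> = periodize (\<lambda>y. \<psi> (c *\<^sub>R y))"

lemma scaled_kernel_smooth_torus:
  "smooth \<psi> \<Longrightarrow> bounded {x. \<psi> x \<noteq> 0} \<Longrightarrow> c \<noteq> 0 \<Longrightarrow> scaled_kernel c \<psi> \<in> smooth_torus"
  unfolding scaled_kernel_def by (intro periodize_in_smooth_torus smooth_scale bounded_scale_support)

lemma periodize_cmult: "periodize (\<lambda>y. a * f y) x = a * periodize f x"
  by (simp add: periodize_lattice infsum_cmult_right')

lemma partials_scaled_kernel:
  assumes "smooth \<psi>" "bounded {x. \<psi> x \<noteq> 0}" "c \<noteq> 0"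
  shows "partials is (scaled_kernel c \<psi>) = (\<lambda>x. c ^ length is * scaled_kernel c (partials is \<psi>) x)"
proof -
  have "partials is (scaled_kernel c \<psi>) = periodize (\<lambda>y. c ^ length is * partials is \<psi> (c *\<^sub>R y))"
    unfolding scaled_kernel_def
    using partials_periodize[OF smooth_scale[OF assms(1), of c] bounded_scale_support[OF assms(2,3)], of "is"]
      partials_affine[OF assms(1), of "is" c 0] by simp
  then show ?thesis by (simp add: fun_eq_iff periodize_cmult scaled_kernel_def)
qed

lemma periodize_reflect: "periodize f (x - y) = periodize (\<lambda>y. f (x - y)) y"
proof -
  have "bij_betw uminus UNIV (UNIV :: (int^2) set)"
    by (rule bij_betw_byWitness[of _ uminus]) auto
  from infsum_reindex_bij_betw[OF this, of "\<lambda>n. f (x - y + lattice_vec n)"]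
  show ?thesis by (simp add: periodize_lattice algebra_simps)
qed

text \<open>Convolution evaluates \<open>T\<close> at the reflected kernel, hence
  \<open>\<psi> (- x)\<close>. Dividing by \<open>a\<close> brings it into
  \<open>unit_tests\<close>, and \<open>1 / c\<^sup>2\<close> undoes the normalisation in
  \<open>scaled_test\<close>.\<close>

lemma dist_conv_scaled_kernel:
  assumes T: "distribution (T :: real functional)" and \<psi>: "smooth \<psi>" "bounded {x. \<psi> x \<noteq> 0}"
    and c: "0 < c" and a: "0 < a" "(\<lambda>x. \<psi> (- x) / a) \<in> unit_tests r"
  shows "dist_conv T (scaled_kernel c \<psi>) x = a / c\<^sup>2 * T (scaled_test (\<lambda>x. \<psi> (- x) / a) x (1 / c))"
proof -
  have "scaled_kernel c \<psi> (x - y) = a / c\<^sup>2 * scaled_test (\<lambda>x. \<psi> (- x) / a) x (1 / c) y" for y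
    unfolding scaled_kernel_def scaled_test_def periodize_reflect periodize_cmult[symmetric]
    using a(1) c by (simp add: power_divide flip: scaleR_minus_right)
  then show ?thesis
    unfolding dist_conv_def using distribution_cmult[OF T scaled_test_smooth_torus[OF a(2)], of "1 / c"
        "a / c\<^sup>2" x] c by simp
qed

text \<open>Radius 1/2 leaves the closure of the support inside the open unit ball, as
  \<open>unit_tests\<close> demands.\<close>

lemma unit_tests_normalize:
  assumes \<psi>: "smooth \<psi>" "{x. \<psi> x \<noteq> 0} \<subseteq> cball 0 (1 / 2)"
  shows "\<exists>a>0. (\<lambda>x. \<psi> (- x) / a) \<in> unit_tests r"
proof -
  have bd: "bounded {x. \<psi> x \<noteq> 0}" using \<psi>(2) bounded_cball bounded_subset by blast
  have "\<exists>B\<ge>0. \<forall>is. length is \<le> r \<longrightarrow> (\<forall>x. \<bar>partials is \<psi> x\<bar> \<le> B)"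
    by (rule uniform_bound_index_lists[of "\<lambda>is B. \<forall>x. \<bar>partials is \<psi> x\<bar> \<le> B"])
       (auto intro: order_trans bounded_support_bounded smooth_continuous smooth_partials \<psi>
           bounded_partials_support bd)
  then obtain B where B: "0 \<le> B" "\<And>is x. length is \<le> r \<Longrightarrow> \<bar>partials is \<psi> x\<bar> \<le> B" by blast
  \<comment> \<open>Adding 1 keeps the divisor positive even if \<psi> vanishes.\<close>
  define a where "a = B + 1"
  have a: "0 < a" using B(1) by (simp add: a_def)
  have eq: "(\<lambda>x. \<psi> (- x) / a) = (\<lambda>x. (1 / a) * \<psi> ((-1) *\<^sub>R x))" by auto
  have s: "smooth (\<lambda>x. \<psi> ((-1) *\<^sub>R x))" by (rule smooth_scale[OF \<psi>(1)])
  have "{x. \<psi> (- x) / a \<noteq> 0} \<subseteq> cball 0 (1 / 2)" using \<psi>(2) by (force simp: a_def)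
  then have "closure {x. \<psi> (- x) / a \<noteq> 0} \<subseteq> cball 0 (1 / 2)" by (rule closure_minimal) simp
  also have "cball 0 (1 / 2) \<subseteq> ball (0 :: real^2) 1" by auto
  finally have "closure {x. \<psi> (- x) / a \<noteq> 0} \<subseteq> ball 0 1" .
  moreover have "\<bar>partials is (\<lambda>x. \<psi> (- x) / a) x\<bar> \<le> 1" if "length is \<le> r" for "is" x
  proof -
    have "partials is (\<lambda>x. \<psi> (- x) / a) x = (1 / a) * ((-1) ^ length is * partials is \<psi> (- x))"
      unfolding eq partials_cmult[OF s] using partials_affine[OF \<psi>(1), of "is" "-1" 0] by simp
    then have "\<bar>partials is (\<lambda>x. \<psi> (- x) / a) x\<bar> = \<bar>partials is \<psi> (- x)\<bar> / a"
      using a by (simp add: abs_mult power_abs)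
    also have "\<dots> \<le> 1" using B(2)[OF that, of "- x"] a by (simp add: a_def divide_le_eq)
    finally show ?thesis .
  qed
  moreover have "smooth (\<lambda>x. \<psi> (- x) / a)" unfolding eq by (rule smooth_cmult[OF s])
  ultimately show ?thesis using a unfolding unit_tests_def by blast
qed

text \<open>\<open>a\<close> depends on \<psi> and \<alpha> only. The exponent collects
  \<open>- \<alpha>\<close> from the test at scale \<open>1 / c\<close> and \<open>- 2\<close> from
  the missing normalisation of \<open>scaled_kernel\<close>.\<close>

lemma scaled_kernel_bound:
  assumes \<psi>: "smooth \<psi>" "{x. \<psi> x \<noteq> 0} \<subseteq> cball 0 (1 / 2)"
  shows "\<exists>a>0. \<forall>T A c x. distribution T \<longrightarrow> test_bound \<alpha> T A \<longrightarrow> 1 \<le> c \<longrightarrow>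
    \<bar>dist_conv T (scaled_kernel c \<psi>) x\<bar> \<le> a * A * c powr (- 2 - \<alpha>)"
proof -
  have bd: "bounded {x. \<psi> x \<noteq> 0}" using \<psi>(2) bounded_cball bounded_subset by blast
  obtain a where a: "0 < a" "(\<lambda>x. \<psi> (- x) / a) \<in> unit_tests (nat \<lfloor>- \<alpha> + 1\<rfloor>)"
    using unit_tests_normalize[OF \<psi>] by blast
  have "\<bar>dist_conv T (scaled_kernel c \<psi>) x\<bar> \<le> a * A * c powr (- 2 - \<alpha>)"
    if T: "distribution T" "test_bound \<alpha> T A" and c: "1 \<le> c" for T A c x
  proof -
    have "\<bar>T (scaled_test (\<lambda>x. \<psi> (- x) / a) x (1 / c))\<bar> \<le> A * (1 / c) powr \<alpha>"
      by (rule test_boundD[OF T(2)]) (use c a in auto)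
    then have "a / c\<^sup>2 * \<bar>T (scaled_test (\<lambda>x. \<psi> (- x) / a) x (1 / c))\<bar> \<le> a / c\<^sup>2 * (A * (1 / c) powr \<alpha>)"
      using a c by (intro mult_left_mono) auto
    also have "\<dots> = a * A * c powr (- 2 - \<alpha>)"
      using c by (simp add: powr_diff powr_minus powr_divide powr_numeral field_simps)
    finally show ?thesis
      using dist_conv_scaled_kernel[OF T(1) \<psi>(1) bd _ a] a c by (simp add: abs_mult)
  qed
  with a show ?thesis by blast
qed

lemma conv_periodize_scaled:
  fixes f k :: "real^2 \<Rightarrow> real"
  assumes "continuous_on UNIV f" "periodic2 f" "continuous_on UNIV k" "bounded {x. k x \<noteq> 0}" "0 < c"
  shows "dist_conv (dist_of (\<lambda>x. c\<^sup>2 * scaled_kernel c k x)) f x = (LINT y|lborel. k y * f (x - (1 / c)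
      *\<^sub>R y))"
proof -
  have ck: "continuous_on UNIV (\<lambda>y. k (c *\<^sub>R y))"
    by (rule continuous_on_compose2[OF assms(3)]) (auto intro!: continuous_intros)
  have cf: "continuous_on UNIV (\<lambda>y. f (x - y))" by (rule continuous_reflect[OF assms(1)])
  have cf': "continuous_on UNIV (\<lambda>y. f (x - (1 / c) *\<^sub>R y))"
    by (rule continuous_on_compose2[OF assms(1)]) (auto intro!: continuous_intros)
  have "dist_conv (dist_of (\<lambda>x. c\<^sup>2 * scaled_kernel c k x)) f x
      = c\<^sup>2 * (LINT y:torus|lborel. periodize (\<lambda>y. k (c *\<^sub>R y)) y * f (x - y))"
    unfolding conv_dist_of scaled_kernel_def set_integral_mult_right[symmetric] by (simp add: mult_ac)
  also have "(LINT y:torus|lborel. periodize (\<lambda>y. k (c *\<^sub>R y)) y * f (x - y))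
      = (LINT y:torus|lborel. periodize (\<lambda>y. k (c *\<^sub>R y) * f (x - y)) y)"
    by (simp add: periodize_mult[OF periodic2_reflect[OF assms(2)]])
  also have "\<dots> = (LINT y|lborel. k (c *\<^sub>R y) * f (x - y))"
    by (rule torus_integral_periodize)
       (auto intro!: continuous_intros ck cf bounded_subset[OF bounded_scale_support[OF assms(4), of c]]
           simp: assms(5)[THEN less_imp_neq, symmetric])
  also have "c\<^sup>2 * \<dots> = (LINT y|lborel. k y * f (x - (1 / c) *\<^sub>R y))"
    using lborel_integral_affine[of "\<lambda>y. k y * f (x - (1 / c) *\<^sub>R y)" c 0] assms(3,5) cf'
    by (simp add: borel_measurable_continuous_onI borel_measurable_times)
  finally show ?thesis .
qed

lemma torus_integral_abs_scaled_kernel: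
  fixes k :: "real^2 \<Rightarrow> real"
  assumes "continuous_on UNIV k" "bounded {x. k x \<noteq> 0}" "0 < c"
  shows "(LINT x:torus|lborel. \<bar>c\<^sup>2 * scaled_kernel c k x\<bar>) \<le> (LINT x|lborel. \<bar>k x\<bar>)"
proof -
  have ck: "continuous_on UNIV (\<lambda>y. k (c *\<^sub>R y))"
    by (rule continuous_on_compose2[OF assms(1)]) (auto intro!: continuous_intros)
  have "(LINT x:torus|lborel. \<bar>c\<^sup>2 * scaled_kernel c k x\<bar>) = c\<^sup>2 * (LINT x:torus|lborel. \<bar>periodize (\<lambda>y.
      k (c *\<^sub>R y)) x\<bar>)"
    by (simp add: abs_mult scaled_kernel_def)
  also have "\<dots> \<le> c\<^sup>2 * (LINT y|lborel. \<bar>k (c *\<^sub>R y)\<bar>)"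
    by (intro mult_left_mono torus_integral_abs_periodize_le ck bounded_scale_support assms) (use assms
        in auto)
  also have "\<dots> = (LINT x|lborel. \<bar>k x\<bar>)"
    using lborel_integral_affine[of "\<lambda>y. \<bar>k y\<bar>" c 0]
      borel_measurable_abs[OF borel_measurable_continuous_onI[OF assms(1)]] assms(3) by simp
  finally show ?thesis .
qed

text \<open>The rate is the Lipschitz constant of \<open>f\<close> times the radius of the support
  of the rescaled kernel, weighted by the integral of \<open>\<bar>k\<bar>\<close>; so kernels of
  varying sign are admissible.\<close>

lemma conv_scaled_approx:
  fixes f k :: "real^2 \<Rightarrow> real"
  assumes f: "f \<in> smooth_torus" and k: "continuous_on UNIV k" "bounded {x. k x \<noteq> 0}" "(LINT x|lborel. k
      x) = 1"
  shows "\<exists>L\<ge>0. \<forall>c>0. \<forall>x. \<bar>dist_conv (dist_of (\<lambda>x. c\<^sup>2 * scaled_kernel c k x)) f x - f x\<bar> \<le> L / c"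
proof -
  obtain L where L: "0 \<le> L" "\<And>x y. \<bar>f x - f y\<bar> \<le> L * norm (x - y)"
    using smooth_torus_lipschitz[OF f] by blast
  obtain R where R: "\<And>x. k x \<noteq> 0 \<Longrightarrow> norm x \<le> R" using k(2) by (auto simp: bounded_iff)
  define I where "I = (LINT y|lborel. \<bar>k y\<bar>)"
  have I: "0 \<le> I" unfolding I_def by (rule integral_nonneg_AE) simp
  have ik: "integrable lborel k" by (rule integrable_bounded_support[OF k(1,2)])
  have "\<bar>dist_conv (dist_of (\<lambda>x. c\<^sup>2 * scaled_kernel c k x)) f x - f x\<bar> \<le> (L * \<bar>R\<bar> * I) / c" if c: "0 <
      c" for c x
  proof -
    have cf': "continuous_on UNIV (\<lambda>y. f (x - (1 / c) *\<^sub>R y))"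
      by (rule continuous_on_compose2[OF smooth_torus_continuous[OF f]]) (auto intro!: continuous_intros)
    have i1: "integrable lborel (\<lambda>y. k y * f (x - (1 / c) *\<^sub>R y))"
      by (rule integrable_bounded_support) (auto intro!: continuous_intros k cf' bounded_subset[OF k(2)])
    have "dist_conv (dist_of (\<lambda>x. c\<^sup>2 * scaled_kernel c k x)) f x - f x
        = (LINT y|lborel. k y * f (x - (1 / c) *\<^sub>R y)) - (LINT y|lborel. k y * f x)"
      using k(3) by (simp add: conv_periodize_scaled[OF smooth_torus_continuous[OF f]
          smooth_torusD(2)[OF f] k(1,2) c])
    also have "\<dots> = (LINT y|lborel. k y * (f (x - (1 / c) *\<^sub>R y) - f x))"
      using i1 ik by (simp add: right_diff_distrib)
    also have "\<bar>\<dots>\<bar> \<le> (LINT y|lborel. \<bar>k y * (f (x - (1 / c) *\<^sub>R y) - f x)\<bar>)"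
      by (rule integral_abs_bound)
    also have "\<dots> \<le> (LINT y|lborel. \<bar>k y\<bar> * (L * \<bar>R\<bar> / c))"
    proof (rule integral_mono)
      show "integrable lborel (\<lambda>y. \<bar>k y * (f (x - (1 / c) *\<^sub>R y) - f x)\<bar>)"
        using i1 ik by (auto simp: right_diff_distrib intro!: integrable_abs)
      show "integrable lborel (\<lambda>y. \<bar>k y\<bar> * (L * \<bar>R\<bar> / c))" using ik by simp
      fix y
      show "\<bar>k y * (f (x - (1 / c) *\<^sub>R y) - f x)\<bar> \<le> \<bar>k y\<bar> * (L * \<bar>R\<bar> / c)"
      proof (cases "k y = 0")
        case False
        have "\<bar>f (x - (1 / c) *\<^sub>R y) - f x\<bar> \<le> L * norm ((1 / c) *\<^sub>R y)"
          using L(2)[of "x - (1 / c) *\<^sub>R y" x] by simp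
        also have "\<dots> \<le> L * (\<bar>R\<bar> / c)"
          using R[OF False] c L(1) by (intro mult_left_mono) (auto simp: divide_right_mono)
        finally show ?thesis unfolding abs_mult by (intro mult_left_mono) auto
      qed simp
    qed
    also have "\<dots> = (L * \<bar>R\<bar> * I) / c" using ik by (simp add: I_def mult_ac)
    finally show ?thesis .
  qed
  then show ?thesis using L I by (intro exI[of _ "L * \<bar>R\<bar> * I"]) auto
qed

section \<open>The Jacobian form\<close>

text \<open>Takes two vector fields and not two potentials, so that fields approximating a gradient
  can be inserted and perturbed.\<close>

definition jac_form :: "(real^2 \<Rightarrow> real) \<Rightarrow> (2 \<Rightarrow> real^2 \<Rightarrow> real) \<Rightarrow> (2 \<Rightarrow> real^2 \<Rightarrow> real) \<Rightarrow> real" where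
  "jac_form \<phi> a b = (LINT x:torus|lborel. \<phi> x * (a 1 x * b 2 x - a 2 x * b 1 x))"

definition grad :: "(real^2 \<Rightarrow> real) \<Rightarrow> 2 \<Rightarrow> real^2 \<Rightarrow> real" where
  "grad f i = partial i f"

definition grad_mass :: "(real^2 \<Rightarrow> real) \<Rightarrow> real" where
  "grad_mass \<phi> = (LINT x:torus|lborel. \<bar>partial 1 \<phi> x\<bar> + \<bar>partial 2 \<phi> x\<bar>)"

lemma torus_integral_abs_le:
  fixes F :: "real^2 \<Rightarrow> real"
  assumes "continuous_on UNIV F" "\<And>x. \<bar>F x\<bar> \<le> b"
  shows "\<bar>LINT x:torus|lborel. F x\<bar> \<le> 4 * pi\<^sup>2 * b"
  using abs_dist_of_le[OF set_integrable_torus[OF continuous_on_const[of UNIV "1::real"]] assms]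
  by (simp add: set_integral_torus_const)

lemma abs_torus_integral_mult_le:
  fixes F \<phi> :: "real^2 \<Rightarrow> real"
  assumes "continuous_on UNIV \<phi>" "continuous_on UNIV F" "\<And>x. \<bar>F x\<bar> \<le> b"
  shows "\<bar>LINT x:torus|lborel. \<phi> x * F x\<bar> \<le> (LINT x:torus|lborel. \<bar>\<phi> x\<bar>) * b"
  using abs_dist_of_le[OF set_integrable_torus[OF assms(1)] assms(2,3)] by (simp add: mult.commute)

lemma jac_continuous:
  assumes "\<And>i. continuous_on UNIV (a i)" "\<And>i. continuous_on UNIV (b i)"
  shows "continuous_on UNIV (\<lambda>x. a (1::2) x * b 2 x - a 2 x * b (1::2) x :: real)"
  by (intro continuous_intros assms)

lemma abs_jac_le:
  fixes a1 a2 b1 b2 :: real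
  assumes "\<bar>a1\<bar> \<le> A" "\<bar>a2\<bar> \<le> A" "\<bar>b1\<bar> \<le> B" "\<bar>b2\<bar> \<le> B"
  shows "\<bar>a1 * b2 - a2 * b1\<bar> \<le> 2 * A * B"
proof -
  have "\<bar>a1 * b2\<bar> \<le> A * B" "\<bar>a2 * b1\<bar> \<le> A * B"
    using assms by (auto simp: abs_mult intro!: mult_mono)
  then show ?thesis by linarith
qed

lemma abs_jac_form_le:
  assumes "continuous_on UNIV \<phi>" "\<And>i. continuous_on UNIV (a i)" "\<And>i. continuous_on UNIV (b i)"
    "\<And>i x. \<bar>a i x\<bar> \<le> A" "\<And>i x. \<bar>b i x\<bar> \<le> B"
  shows "\<bar>jac_form \<phi> a b\<bar> \<le> (LINT x:torus|lborel. \<bar>\<phi> x\<bar>) * (2 * A * B)"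
  unfolding jac_form_def
  by (rule abs_torus_integral_mult_le[OF assms(1) jac_continuous[OF assms(2,3)] abs_jac_le]) (rule assms)+

lemma set_integrable_jac:
  assumes "continuous_on UNIV \<phi>" "\<And>i. continuous_on UNIV (a i)" "\<And>i. continuous_on UNIV (b i)"
  shows "set_integrable lborel torus (\<lambda>x. \<phi> x * (a (1::2) x * b 2 x - a 2 x * b (1::2) x) :: real)"
  by (intro set_integrable_torus continuous_intros assms)

lemma jac_form_diff_left:
  assumes "continuous_on UNIV \<phi>" "\<And>i. continuous_on UNIV (a i)" "\<And>i. continuous_on UNIV (a' i)" "\<And>i.
      continuous_on UNIV (b i)"
  shows "jac_form \<phi> (\<lambda>i x. a i x - a' i x) b = jac_form \<phi> a b - jac_form \<phi> a' b"
  unfolding jac_form_def using set_integral_diff(2)[OF set_integrable_jac[OF assms(1,2,4)]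
      set_integrable_jac[OF assms(1,3,4)]]
  by (simp add: algebra_simps)

lemma jac_form_swap: "jac_form \<phi> a b = - jac_form \<phi> b a"
  unfolding jac_form_def set_integral_uminus[symmetric] set_lebesgue_integral_def
  by (subst Bochner_Integration.integral_minus[symmetric]) (simp add: algebra_simps)

lemma jac_form_diff_right:
  assumes "continuous_on UNIV \<phi>" "\<And>i. continuous_on UNIV (a i)" "\<And>i. continuous_on UNIV (b i)" "\<And>i.
      continuous_on UNIV (b' i)"
  shows "jac_form \<phi> a (\<lambda>i x. b i x - b' i x) = jac_form \<phi> a b - jac_form \<phi> a b'"
  using jac_form_diff_left[OF assms(1,3,4,2)] jac_form_swap[of \<phi> a] by simp

text \<open>One field is exchanged at a time through the mixed form of \<open>a'\<close> and
  \<open>b\<close>, which is why these two carry the bound \<open>M\<close>.\<close>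

lemma jac_form_perturb:
  assumes "continuous_on UNIV \<phi>" "\<And>i. continuous_on UNIV (a i)" "\<And>i. continuous_on UNIV (b i)"
    "\<And>i. continuous_on UNIV (a' i)" "\<And>i. continuous_on UNIV (b' i)"
    "\<And>i x. \<bar>a' i x\<bar> \<le> M" "\<And>i x. \<bar>b i x\<bar> \<le> M"
    "\<And>i x. \<bar>a i x - a' i x\<bar> \<le> e" "\<And>i x. \<bar>b i x - b' i x\<bar> \<le> e"
  shows "\<bar>jac_form \<phi> a b - jac_form \<phi> a' b'\<bar> \<le> (LINT x:torus|lborel. \<bar>\<phi> x\<bar>) * (4 * M * e)"
proof -
  have "jac_form \<phi> a b - jac_form \<phi> a' b'
      = jac_form \<phi> (\<lambda>i x. a i x - a' i x) b + jac_form \<phi> a' (\<lambda>i x. b i x - b' i x)"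
    by (simp add: jac_form_diff_left jac_form_diff_right assms)
  moreover have "\<bar>jac_form \<phi> (\<lambda>i x. a i x - a' i x) b\<bar> \<le> (LINT x:torus|lborel. \<bar>\<phi> x\<bar>) * (2 * e * M)"
    by (intro abs_jac_form_le continuous_intros assms)
  moreover have "\<bar>jac_form \<phi> a' (\<lambda>i x. b i x - b' i x)\<bar> \<le> (LINT x:torus|lborel. \<bar>\<phi> x\<bar>) * (2 * M * e)"
    by (intro abs_jac_form_le continuous_intros assms)
  ultimately have "\<bar>jac_form \<phi> a b - jac_form \<phi> a' b'\<bar>
     \<le> (LINT x:torus|lborel. \<bar>\<phi> x\<bar>) * (2 * e * M) + (LINT x:torus|lborel. \<bar>\<phi> x\<bar>) * (2 * M * e)" by linarith
  then show ?thesis by (simp add: algebra_simps)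
qed

lemma grad_continuous: "f \<in> smooth_torus \<Longrightarrow> continuous_on UNIV (grad f i)"
  unfolding grad_def by (rule smooth_torus_continuous[OF partial_smooth_torus])

text \<open>The trilinear form \<open>\<integral> \<phi> det (\<nabla>w, \<nabla>v)\<close> is cyclically symmetric, so that no derivative
  needs to fall on \<open>w\<close>.\<close>

lemma jac_form_cyclic:
  assumes "\<phi> \<in> smooth_torus" "w \<in> smooth_torus" "v \<in> smooth_torus"
  shows "jac_form \<phi> (grad w) (grad v) = jac_form w (grad v) (grad \<phi>)"
proof -
  have s: "smooth \<phi>" "smooth w" "smooth v" using assms by (auto simp: smooth_torusD)
  have sp: "partial i v \<in> smooth_torus" "smooth (partial i v)" for i
    using assms(3) by (auto simp: partial_smooth_torus smooth_torusD)
  let ?F = "\<lambda>i x. \<phi> x * (w x * partial i v x)"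
  have F: "?F i \<in> smooth_torus" for i by (intro smooth_torus_mult assms sp)
  have d: "partial j (?F i) x = \<phi> x * (w x * partial j (partial i v) x + partial j w x * partial i v x)
      + partial j \<phi> x * (w x * partial i v x)" for i j x
    using partial_mult[OF s(1) smooth_mult[OF s(2) sp(2)]] partial_mult[OF s(2) sp(2)] by simp
  have "(LINT x:torus|lborel. partial 1 (?F 2) x - partial 2 (?F 1) x) = 0"
    using set_integral_diff(2)[OF set_integrable_torus set_integrable_torus,
        OF smooth_torus_continuous[OF partial_smooth_torus[OF F]] smooth_torus_continuous[OF
            partial_smooth_torus[OF F]]]
    by (simp add: torus_integral_partial[OF F])
  moreover have "partial 1 (?F 2) x - partial 2 (?F 1) x
      = \<phi> x * (grad w 1 x * grad v 2 x - grad w 2 x * grad v 1 x) - w x * (grad v 1 x * grad \<phi> 2 x -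
          grad v 2 x * grad \<phi> 1 x)" for x
    unfolding d using partial_commute[OF s(3), of 1 2] by (simp add: grad_def algebra_simps)
  ultimately show ?thesis
    unfolding jac_form_def
    using set_integral_diff(2)[OF set_integrable_jac set_integrable_jac, of \<phi> "grad w" "grad v" w "grad
        v" "grad \<phi>"]
      grad_continuous[OF assms(1)] grad_continuous[OF assms(2)] grad_continuous[OF assms(3)]
      smooth_torus_continuous[OF assms(1)] smooth_torus_continuous[OF assms(2)] by simp
qed

text \<open>After the cyclic rotation \<open>w\<close> enters through its sup norm alone. For a
  dyadic increment this is smaller than its gradient by a factor of the scale, the gain that makes
  the dyadic series summable.\<close>

lemma abs_jac_form_by_parts:
  assumes "\<phi> \<in> smooth_torus" "w \<in> smooth_torus" "v \<in> smooth_torus"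
    "\<And>x. \<bar>w x\<bar> \<le> A" "\<And>i x. \<bar>partial i v x\<bar> \<le> B"
  shows "\<bar>jac_form \<phi> (grad w) (grad v)\<bar> \<le> A * B * grad_mass \<phi>"
proof -
  have AB: "0 \<le> A" "0 \<le> B" using assms(4)[of 0] assms(5)[of 1 0] by auto
  have c: "continuous_on UNIV (partial i \<phi>)" for i
    by (rule smooth_torus_continuous[OF partial_smooth_torus[OF assms(1)]])
  have "\<bar>jac_form w (grad v) (grad \<phi>)\<bar>
      \<le> (LINT x:torus|lborel. \<bar>w x * (grad v 1 x * grad \<phi> 2 x - grad v 2 x * grad \<phi> 1 x)\<bar>)"
    unfolding jac_form_def
    using set_integral_norm_bound[OF set_integrable_jac[of w "grad v" "grad \<phi>"]]
      grad_continuous[OF assms(1)] grad_continuous[OF assms(3)] smooth_torus_continuous[OF assms(2)] by simp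
  also have "\<dots> \<le> (LINT x:torus|lborel. A * B * (\<bar>partial 1 \<phi> x\<bar> + \<bar>partial 2 \<phi> x\<bar>))"
  proof (rule set_integral_torus_mono)
    show "set_integrable lborel torus (\<lambda>x. \<bar>w x * (grad v 1 x * grad \<phi> 2 x - grad v 2 x * grad \<phi> 1 x)\<bar>)"
      using assms by (intro set_integrable_torus continuous_intros grad_continuous smooth_torus_continuous)
    show "set_integrable lborel torus (\<lambda>x. A * B * (\<bar>partial 1 \<phi> x\<bar> + \<bar>partial 2 \<phi> x\<bar>))"
      by (intro set_integrable_torus continuous_intros c)
    fix x
    have "\<bar>grad v 1 x * grad \<phi> 2 x - grad v 2 x * grad \<phi> 1 x\<bar>
        \<le> \<bar>grad v 1 x\<bar> * \<bar>grad \<phi> 2 x\<bar> + \<bar>grad v 2 x\<bar> * \<bar>grad \<phi> 1 x\<bar>"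
      by (metis abs_mult abs_triangle_ineq4)
    also have "\<dots> \<le> B * \<bar>partial 2 \<phi> x\<bar> + B * \<bar>partial 1 \<phi> x\<bar>"
      unfolding grad_def by (intro add_mono mult_right_mono assms(5) abs_ge_zero)
    finally have "\<bar>w x\<bar> * \<bar>grad v 1 x * grad \<phi> 2 x - grad v 2 x * grad \<phi> 1 x\<bar>
        \<le> A * (B * \<bar>partial 2 \<phi> x\<bar> + B * \<bar>partial 1 \<phi> x\<bar>)"
      using assms(4)[of x] AB by (intro mult_mono) auto
    then show "\<bar>w x * (grad v 1 x * grad \<phi> 2 x - grad v 2 x * grad \<phi> 1 x)\<bar>
        \<le> A * B * (\<bar>partial 1 \<phi> x\<bar> + \<bar>partial 2 \<phi> x\<bar>)"
      unfolding abs_mult[of "w x"] by (simp add: distrib_left mult.assoc add.commute)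
  qed
  also have "\<dots> = A * B * grad_mass \<phi>" by (simp add: grad_mass_def)
  finally show ?thesis by (simp add: jac_form_cyclic[OF assms(1-3)])
qed

lemma geometric_increments_limit:
  fixes x :: "nat \<Rightarrow> real"
  assumes "\<And>n. \<bar>x (Suc n) - x n\<bar> \<le> c * r ^ n" "0 \<le> r" "r < 1"
  shows "convergent x" "\<bar>lim x - x N\<bar> \<le> c / (1 - r) * r ^ N"
proof -
  have sum: "summable (\<lambda>n. c * r ^ (n + M))" for M
    using assms by (simp add: power_add summable_mult summable_mult2 summable_geometric)
  have s: "summable (\<lambda>n. x (Suc (n + M)) - x (n + M))" for M
    by (rule summable_comparison_test'[OF sum[of M], of 0]) (use assms(1) in simp)
  have tel: "(\<lambda>n. x (n + M)) \<longlonglongrightarrow> x M + (\<Sum>n. x (Suc (n + M)) - x (n + M))" for M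
  proof -
    have "(\<Sum>i<n. x (Suc (i + M)) - x (i + M)) = x (n + M) - x M" for n
      using sum_lessThan_telescope[of "\<lambda>i. x (i + M)" n] by simp
    then have "(\<lambda>n. x (n + M) - x M) \<longlonglongrightarrow> (\<Sum>n. x (Suc (n + M)) - x (n + M))"
      using summable_LIMSEQ[OF s[of M]] by simp
    from tendsto_add[OF tendsto_const[of "x M"] this] show ?thesis by simp
  qed
  show conv: "convergent x" using tel[of 0] by (auto simp: convergent_def)
  have "(\<lambda>n. x (n + N)) \<longlonglongrightarrow> lim x"
    using conv LIMSEQ_ignore_initial_segment convergent_LIMSEQ_iff by blast
  with tel[of N] have "lim x - x N = (\<Sum>n. x (Suc (n + N)) - x (n + N))"
    using LIMSEQ_unique by fastforce
  also have "\<bar>\<dots>\<bar> \<le> (\<Sum>n. c * r ^ (n + N))"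
    using norm_suminf_le[OF _ sum[of N], of "\<lambda>n. x (Suc (n + N)) - x (n + N)"] assms(1) by simp
  also have "\<dots> = c / (1 - r) * r ^ N"
    using assms suminf_geometric[of r] suminf_mult[OF summable_geometric, of r "c * r ^ N"]
    by (simp add: power_add mult_ac)
  finally show "\<bar>lim x - x N\<bar> \<le> c / (1 - r) * r ^ N" .
qed

lemma unit_test_integral_le:
  fixes f :: "real^2 \<Rightarrow> real"
  assumes "continuous_on UNIV f" "{x. f x \<noteq> 0} \<subseteq> ball 0 1" "\<And>x. \<bar>f x\<bar> \<le> 1"
  shows "(LINT x|lborel. \<bar>f x\<bar>) \<le> 4"
proof -
  \<comment> \<open>The area of this square is the bound 4.\<close>
  define B where "B = (cbox (\<chi> i. - 1) (\<chi> i. 1) :: (real^2) set)"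
  have "ball 0 1 \<subseteq> B"
  proof
    fix x :: "real^2" assume "x \<in> ball 0 1"
    then have "\<bar>x $ i\<bar> \<le> 1" for i using component_le_norm_cart[of x i] by simp
    then show "x \<in> B" by (auto simp: B_def mem_box_cart abs_le_iff minus_le_iff)
  qed
  then have le: "\<bar>f x\<bar> \<le> indicator B x" for x
    using assms(2,3) by (cases "f x = 0") (auto simp: indicator_def)
  have m: "measure lborel B = 4"
    unfolding B_def by (subst content_cbox_cart) (auto simp: UNIV_2 interval_ne_empty_cart)
  have "(LINT x|lborel. \<bar>f x\<bar>) \<le> (LINT x|lborel. indicator B x)"
  proof (rule integral_mono)
    show "integrable lborel (\<lambda>x. \<bar>f x\<bar>)"
      using integrable_bounded_support[OF assms(1) bounded_subset[OF bounded_ball assms(2)]] by simp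
    show "integrable lborel (indicator B :: _ \<Rightarrow> real)"
      unfolding B_def by (rule integrable_real_indicator[OF _ emeasure_lborel_cbox_finite]) simp
  qed (rule le)
  then show ?thesis using m by simp
qed

text \<open>Rescaling preserves the mass and each derivative costs \<open>1 / l\<close>.
  \<open>unit_tests r\<close> bounds derivatives up to order \<open>r\<close>, whence the conditions
  on \<open>r\<close>; 8 counts both first derivatives.\<close>

lemma scaled_test_mass:
  assumes \<phi>: "\<phi> \<in> unit_tests r" "0 < l"
  shows "(LINT y:torus|lborel. \<bar>scaled_test \<phi> x l y\<bar>) \<le> 4"
    and "1 \<le> r \<Longrightarrow> grad_mass (scaled_test \<phi> x l) \<le> 8 / l"
    and "2 \<le> r \<Longrightarrow> (LINT y:torus|lborel. \<bar>partial i (partial i (scaled_test \<phi> x l)) y\<bar>) \<le> 4 / l\<^sup>2"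
proof -
  have supp: "closure {x. \<phi> x \<noteq> 0} \<subseteq> ball 0 1" "smooth \<phi>" and bd: "\<And>is x. length is \<le> r \<Longrightarrow> \<bar>partials is \<phi>
      x\<bar> \<le> 1"
    using \<phi>(1) by (auto simp: unit_tests_def)
  have gen: "(LINT y:torus|lborel. \<bar>partials is (scaled_test \<phi> x l) y\<bar>) \<le> 4 / l ^ length is" if "length
      is \<le> r" for "is"
  proof -
    let ?g = "\<lambda>y. \<phi> ((1 / l) *\<^sub>R (y - x)) / l\<^sup>2"
    let ?p = "partials is \<phi>"
    have sg: "smooth ?g" "bounded {y. ?g y \<noteq> 0}" by (rule scaled_test_smooth_support[OF \<phi>])+
    have "partials is ?g y = (1 / l\<^sup>2) * ((1 / l) ^ length is * ?p ((1 / l) *\<^sub>R y + (- (1 / l) *\<^sub>R x)))" for y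
      unfolding scaled_test_arg partials_cmult[OF smooth_affine[OF supp(2)]] partials_affine[OF supp(2)]
          by simp
    then have pg: "partials is ?g y = (1 / l ^ length is) * (?p (- (1 / l) *\<^sub>R x + (1 / l) *\<^sub>R y) * (1 /
        l)\<^sup>2)" for y
      by (simp add: power_divide add.commute)
    have cp: "continuous_on UNIV ?p" by (rule smooth_continuous[OF smooth_partials[OF supp(2)]])
    have "(LINT y:torus|lborel. \<bar>partials is (scaled_test \<phi> x l) y\<bar>) \<le> (LINT y|lborel. \<bar>partials is ?g y\<bar>)"
      unfolding scaled_test_def partials_periodize[OF sg]
      by (intro torus_integral_abs_periodize_le smooth_continuous smooth_partials bounded_partials_support sg)
    also have "\<dots> = (LINT y|lborel. (1 / l ^ length is) * ((1 / l)\<^sup>2 * \<bar>?p (- (1 / l) *\<^sub>R x + (1 / l) *\<^sub>R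
        y)\<bar>))"
      unfolding pg using \<phi>(2) by (simp add: abs_mult mult_ac)
    also have "\<dots> = (1 / l ^ length is) * ((1 / l)\<^sup>2 * (LINT y|lborel. \<bar>?p (- (1 / l) *\<^sub>R x + (1 / l) *\<^sub>R
        y)\<bar>))"
      by simp
    also have "\<dots> = (1 / l ^ length is) * (LINT y|lborel. \<bar>?p y\<bar>)"
      using lborel_integral_affine[of "\<lambda>y. \<bar>?p y\<bar>" "1 / l" "- (1 / l) *\<^sub>R x"] \<phi>(2)
        borel_measurable_abs[OF borel_measurable_continuous_onI[OF cp]] by simp
    also have "\<dots> \<le> (1 / l ^ length is) * 4"
      using \<phi>(2) partials_support[OF supp(2)] supp(1) bd[OF that]
      by (intro mult_left_mono unit_test_integral_le cp) auto
    finally show ?thesis by simp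
  qed
  show "(LINT y:torus|lborel. \<bar>scaled_test \<phi> x l y\<bar>) \<le> 4" using gen[of "[]"] by simp
  have c: "continuous_on UNIV (\<lambda>y. \<bar>partial i (scaled_test \<phi> x l) y\<bar>)" for i
    by (intro continuous_intros smooth_torus_continuous partial_smooth_torus scaled_test_smooth_torus[OF \<phi>])
  show "grad_mass (scaled_test \<phi> x l) \<le> 8 / l" if "1 \<le> r"
    using gen[of "[1]"] gen[of "[2]"] that set_integral_add(2)[OF set_integrable_torus[OF c]
        set_integrable_torus[OF c]]
    by (simp add: grad_mass_def)
  show "(LINT y:torus|lborel. \<bar>partial i (partial i (scaled_test \<phi> x l)) y\<bar>) \<le> 4 / l\<^sup>2" if "2 \<le> r"
    using gen[of "[i, i]"] that by (simp add: numeral_2_eq_2)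
qed

section \<open>Dyadic potentials and their bracket\<close>

lemma periodize_lincomb:
  fixes f g :: "real^2 \<Rightarrow> real"
  assumes "bounded {x. f x \<noteq> 0}" "bounded {x. g x \<noteq> 0}"
  shows "periodize (\<lambda>y. a * f y + b * g y) x = a * periodize f x + b * periodize g x"
proof -
  let ?N = "{n. \<exists>y\<in>{x}. y + lattice_vec n \<in> {x. f x \<noteq> 0} \<union> {x. g x \<noteq> 0}}"
  have N: "finite ?N"
    by (rule finite_bounded_lattice) (use assms in auto)
  have "periodize (\<lambda>y. a * f y + b * g y) x = (\<Sum>n\<in>?N. a * f (x + lattice_vec n) + b * g (x + lattice_vec n))"
    by (rule periodize_sum[OF N]) auto
  moreover have "periodize f x = (\<Sum>n\<in>?N. f (x + lattice_vec n))"
    by (rule periodize_sum[OF N]) auto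
  moreover have "periodize g x = (\<Sum>n\<in>?N. g (x + lattice_vec n))"
    by (rule periodize_sum[OF N]) auto
  ultimately show ?thesis by (simp add: sum.distrib sum_distrib_left)
qed

lemma delta_kernel_bounded: "bounded {x. delta_kernel x \<noteq> 0}"
  using delta_kernel_support bounded_cball bounded_subset by blast

lemma step_kernel_bounded: "bounded {x. step_kernel x \<noteq> 0}"
  using step_kernel_support bounded_cball bounded_subset by blast

lemma laplacian_2: "laplacian f = (\<lambda>x. partial 1 (partial 1 f) x + partial 2 (partial 2 f) x)"
  by (simp add: laplacian_def fun_eq_iff UNIV_2)

lemma laplacian_smooth_torus: "f \<in> smooth_torus \<Longrightarrow> laplacian f \<in> smooth_torus"
  unfolding laplacian_2 by (intro smooth_torus_add partial_smooth_torus)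

lemma partial_laplacian:
  assumes "smooth f" shows "partial i (laplacian f) = laplacian (partial i f)"
proof -
  have "partial i (partial j (partial j f)) = partial j (partial j (partial i f))" for j
    using assms by (metis partial_commute smooth_partial)
  then show ?thesis
    unfolding laplacian_2 by (subst partial_add[OF smooth_partial smooth_partial, OF smooth_partial
        smooth_partial]) (use assms in auto)
qed

definition delta_at :: "nat \<Rightarrow> real^2 \<Rightarrow> real" where
  "delta_at n x = (2 ^ n)\<^sup>2 * scaled_kernel (2 ^ n) delta_kernel x"

definition step_at :: "nat \<Rightarrow> real^2 \<Rightarrow> real" where
  "step_at n = scaled_kernel (2 ^ n) step_kernel"

lemma delta_at_smooth_torus: "delta_at n \<in> smooth_torus"
  unfolding delta_at_def[abs_def]
  by (intro smooth_torus_cmult scaled_kernel_smooth_torus smooth_delta_kernel delta_kernel_bounded) simp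

lemma step_at_smooth_torus: "step_at n \<in> smooth_torus"
  unfolding step_at_def
  by (intro scaled_kernel_smooth_torus smooth_step_kernel step_kernel_bounded) simp

lemma laplacian_scaled_kernel:
  assumes "smooth \<psi>" "bounded {x. \<psi> x \<noteq> 0}" "c \<noteq> 0"
  shows "laplacian (scaled_kernel c \<psi>) x = c\<^sup>2 * scaled_kernel c (laplacian \<psi>) x"
proof -
  have b: "bounded {y. partials [i, i] \<psi> (c *\<^sub>R y) \<noteq> 0}" for i
    by (rule bounded_scale_support[OF bounded_partials_support[OF assms(1,2)] assms(3)])
  show ?thesis
    using partials_scaled_kernel[OF assms, of "[1, 1]"] partials_scaled_kernel[OF assms, of "[2, 2]"]
      periodize_lincomb[OF b[of 1] b[of 2], of 1 1 x]
    by (simp add: laplacian_2 scaled_kernel_def power2_eq_square distrib_left)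
qed

lemma delta_at_Suc: "delta_at (Suc n) x = delta_at n x + laplacian (step_at n) x"
proof -
  let ?c = "2 ^ n :: real"
  have b: "bounded {y. delta_kernel ((2 * ?c) *\<^sub>R y) \<noteq> 0}" "bounded {y. delta_kernel (?c *\<^sub>R y) \<noteq> 0}"
    by (rule bounded_scale_support[OF delta_kernel_bounded]; simp)+
  have "laplacian (step_at n) x = ?c\<^sup>2 * scaled_kernel ?c (laplacian step_kernel) x"
    unfolding step_at_def by (rule laplacian_scaled_kernel[OF smooth_step_kernel step_kernel_bounded]) simp
  also have "scaled_kernel ?c (laplacian step_kernel) x
      = periodize (\<lambda>y. 4 * delta_kernel ((2 * ?c) *\<^sub>R y) + (- 1) * delta_kernel (?c *\<^sub>R y)) x"
    unfolding scaled_kernel_def laplacian_step_kernel by simp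
  also have "\<dots> = 4 * scaled_kernel (2 * ?c) delta_kernel x - scaled_kernel ?c delta_kernel x"
    unfolding periodize_lincomb[OF b] by (simp add: scaled_kernel_def)
  finally show ?thesis by (simp add: delta_at_def power2_eq_square algebra_simps)
qed

lemma dist_conv_add:
  assumes "distribution T" "f \<in> smooth_torus" "g \<in> smooth_torus"
  shows "dist_conv T (\<lambda>x. f x + g x) x = dist_conv T f x + dist_conv T g x"
  unfolding dist_conv_def using distribution_add[OF assms(1) smooth_torus_reflect smooth_torus_reflect]
      assms by simp

lemma dist_conv_diff:
  assumes "distribution T" "f \<in> smooth_torus" "g \<in> smooth_torus"
  shows "dist_conv T (\<lambda>x. f x - g x) x = dist_conv T f x - dist_conv T g x"
  unfolding dist_conv_def using distribution_diff[OF assms(1) smooth_torus_reflect smooth_torus_reflect]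
      assms by simp

lemma laplacian_dist_conv:
  fixes T :: "real functional"
  assumes "distribution T" "f \<in> smooth_torus"
  shows "dist_conv T (laplacian f) = laplacian (dist_conv T f)"
  unfolding laplacian_2 using assms
  by (simp add: fun_eq_iff dist_conv_add partial_smooth_torus partial_dist_conv)

lemma green_integrable: "is_green K \<Longrightarrow> set_integrable lborel torus K"
  by (simp add: is_green_def)

text \<open>The mean survives because \<open>K\<close> inverts the negative Laplacian only modulo
  constants. It drops out when \<open>h\<close> is a derivative, which is the case of
  interest.\<close>

lemma green_conv_laplacian:
  assumes K: "is_green K" and h: "h \<in> smooth_torus"
  shows "dist_conv (dist_of K) (laplacian h) x = (LINT y:torus|lborel. h y) / (4 * pi\<^sup>2) - h x"
proof -
  let ?\<phi> = "\<lambda>y. h (x - y)"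
  have \<phi>: "?\<phi> \<in> smooth_torus" by (rule smooth_torus_reflect[OF h])
  have "partials [i, i] ?\<phi> y = partials [i, i] h (x - y)" for i y
    by (subst partials_reflect) (use h in \<open>auto simp: smooth_torusD\<close>)
  then have eq: "(\<lambda>y. - (\<Sum>i\<in>UNIV. partial i (partial i ?\<phi>) y)) = (\<lambda>y. - laplacian h (x - y))"
    by (simp add: laplacian_def)
  have "\<forall>\<phi>\<in>smooth_torus. dist_of K (\<lambda>x. - (\<Sum>i\<in>UNIV. partial i (partial i \<phi>) x)) =
      \<phi> 0 - (1 / (4 * pi\<^sup>2)) * (LINT x:torus|lborel. \<phi> x)"
    using K unfolding is_green_def by (elim conjE)
  from bspec[OF this \<phi>]
  have "dist_of K (\<lambda>y. - laplacian h (x - y)) = ?\<phi> 0 - 1 / (4 * pi\<^sup>2) * (LINT y:torus|lborel. ?\<phi> y)"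
    unfolding eq .
  then have "- dist_of K (\<lambda>y. laplacian h (x - y)) = h x - (LINT y:torus|lborel. h y) / (4 * pi\<^sup>2)"
    using distribution_minus[OF distribution_dist_of[OF green_integrable[OF K]] smooth_torus_reflect[OF
        laplacian_smooth_torus[OF h], of x]]
      torus_integral_reflect_translate[OF smooth_torus_continuous[OF h] smooth_torusD(2)[OF h], of x] by simp
  then show ?thesis by (simp add: dist_conv_def)
qed

text \<open>Up to an additive constant this is \<open>K\<close> convolved with
  \<open>delta_at n\<close> and \<open>T\<close>. Convolving \<open>K\<close> with the Laplacian of
  \<open>step_at m\<close> returns minus \<open>step_at m\<close> up to a constant, so all levels
  but the coarsest are local.\<close>

definition pot :: "(real^2 \<Rightarrow> real) \<Rightarrow> real functional \<Rightarrow> nat \<Rightarrow> real^2 \<Rightarrow> real" where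
  "pot K T n x = dist_conv (dist_of K) (dist_conv T (delta_at 0)) x - (\<Sum>m<n. dist_conv T (step_at m) x)"

context
  fixes K :: "real^2 \<Rightarrow> real"
  assumes K: "is_green K"
begin

lemma green_distribution: "distribution (dist_of K)"
  by (rule distribution_dist_of[OF green_integrable[OF K]])

lemma pot_smooth_torus: "distribution T \<Longrightarrow> pot K T n \<in> smooth_torus"
  unfolding pot_def[abs_def]
  by (intro smooth_torus_diff smooth_torus_sum dist_conv_smooth_torus green_distribution
      delta_at_smooth_torus step_at_smooth_torus)
     auto

lemma pot_Suc: "pot K T (Suc n) x = pot K T n x - dist_conv T (step_at n) x"
  by (simp add: pot_def)

lemma partial_pot:
  assumes T: "distribution T"
  shows "partial i (pot K T n) x = dist_conv (dist_of K) (dist_conv T (partial i (delta_at 0))) x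
     - (\<Sum>m<n. dist_conv T (partial i (step_at m)) x)"
proof -
  have s: "smooth (dist_conv (dist_of K) (dist_conv T (delta_at 0)))" "smooth (dist_conv T (step_at m))" for m
    by (intro smooth_torusD(1) dist_conv_smooth_torus green_distribution T delta_at_smooth_torus
        step_at_smooth_torus)+
  show ?thesis
    unfolding pot_def[abs_def]
    by (subst partial_diff[OF s(1) smooth_sum[OF _ s(2)]], simp, subst partial_sum[OF _ s(2)])
       (simp_all add: partial_dist_conv green_distribution T dist_conv_smooth_torus
           delta_at_smooth_torus step_at_smooth_torus)
qed

text \<open>Justifies the definition of \<open>pot\<close>: after one derivative the increments have
  mean zero, so the constants left by \<open>green_conv_laplacian\<close> vanish.\<close>

lemma partial_pot_delta:
  assumes T: "distribution T"
  shows "partial i (pot K T n) = dist_conv (dist_of K) (dist_conv T (partial i (delta_at n)))"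
proof (induction n)
  case 0
  show ?case by (simp add: partial_pot[OF T] fun_eq_iff)
next
  case (Suc n)
  let ?s = "partial i (step_at n)" and ?h = "dist_conv T (partial i (step_at n))"
  have sm: "?s \<in> smooth_torus" "partial i (delta_at n) \<in> smooth_torus" "laplacian ?s \<in> smooth_torus"
    by (intro partial_smooth_torus laplacian_smooth_torus step_at_smooth_torus delta_at_smooth_torus)+
  have h: "?h \<in> smooth_torus" by (rule dist_conv_smooth_torus[OF T sm(1)])
  have mean: "(LINT y:torus|lborel. ?h y) = 0"
    using torus_integral_partial[OF dist_conv_smooth_torus[OF T step_at_smooth_torus]]
    by (simp add: partial_dist_conv[OF T step_at_smooth_torus])
  have eq: "partial i (delta_at (Suc n)) = (\<lambda>x. partial i (delta_at n) x + laplacian ?s x)"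
  proof -
    have "delta_at (Suc n) = (\<lambda>x. delta_at n x + laplacian (step_at n) x)"
      by (simp add: delta_at_Suc fun_eq_iff)
    then show ?thesis
      using partial_add[OF smooth_torusD(1)[OF delta_at_smooth_torus] smooth_torusD(1)[OF
          laplacian_smooth_torus[OF step_at_smooth_torus]]]
        partial_laplacian[OF smooth_torusD(1)[OF step_at_smooth_torus]] by simp
  qed
  have "dist_conv T (partial i (delta_at (Suc n))) = (\<lambda>x. dist_conv T (partial i (delta_at n)) x +
      laplacian ?h x)"
    unfolding eq by (rule ext) (simp add: dist_conv_add[OF T sm(2,3)] laplacian_dist_conv[OF T sm(1)])
  then have "dist_conv (dist_of K) (dist_conv T (partial i (delta_at (Suc n)))) x
      = dist_conv (dist_of K) (dist_conv T (partial i (delta_at n))) x - ?h x" for x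
    by (simp add: dist_conv_add[OF green_distribution dist_conv_smooth_torus[OF T sm(2)]
        laplacian_smooth_torus[OF h]]
        green_conv_laplacian[OF K h] mean)
  moreover have "partial i (pot K T (Suc n)) x = partial i (pot K T n) x - ?h x" for x
    by (simp add: partial_pot[OF T])
  ultimately show ?case using Suc by (simp add: fun_eq_iff)
qed

end

text \<open>All that the bracket estimates use of a noise, with \<open>q = 2 powr \<delta>\<close>.
  They therefore apply alike to a noise, to its mollifications and to differences of these.\<close>

definition pot_bound :: "(real^2 \<Rightarrow> real) \<Rightarrow> real \<Rightarrow> real functional \<Rightarrow> real \<Rightarrow> bool" where
  "pot_bound K q T A \<longleftrightarrow> 0 \<le> A \<and> (\<forall>n x. \<bar>dist_conv T (step_at n) x\<bar> \<le> A * (q / 2) ^ n) \<and>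
     (\<forall>n i x. \<bar>partial i (pot K T n) x\<bar> \<le> A * q ^ n)"

lemma scaled_kernel_bound_dyadic:
  assumes \<psi>: "smooth \<psi>" "{x. \<psi> x \<noteq> 0} \<subseteq> cball 0 (1 / 2)"
  shows "\<exists>a>0. \<forall>T A n x. distribution T \<longrightarrow> test_bound (- 1 - \<delta>) T A \<longrightarrow>
    \<bar>dist_conv T (scaled_kernel (2 ^ n) \<psi>) x\<bar> \<le> a * A * (2 powr \<delta> / 2) ^ n"
proof -
  obtain a where a: "0 < a" "\<And>T A c x. distribution T \<Longrightarrow> test_bound (- 1 - \<delta>) T A \<Longrightarrow> 1 \<le> c \<Longrightarrow>
    \<bar>dist_conv T (scaled_kernel c \<psi>) x\<bar> \<le> a * A * c powr (- 2 - (- 1 - \<delta>))"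
    using scaled_kernel_bound[OF \<psi>, of "- 1 - \<delta>"] by blast
  have "(2 ^ n) powr (- 2 - (- 1 - \<delta>)) = (2 powr \<delta> / 2 :: real) ^ n" for n
  proof -
    have "(2 ^ n :: real) powr (- 2 - (- 1 - \<delta>)) = 2 powr (real n * (\<delta> - 1))"
      by (simp add: powr_powr flip: powr_realpow)
    also have "\<dots> = (2 powr (\<delta> - 1)) ^ n"
      by (simp add: powr_powr mult.commute flip: powr_realpow)
    finally show ?thesis by (simp add: powr_diff)
  qed
  then show ?thesis using a by (metis one_le_power one_le_numeral)
qed

text \<open>A derivative costs \<open>2 ^ n\<close>, so the gradients of the increments grow like
  \<open>q ^ n\<close>. As \<open>q > 1\<close>, their sum is dominated by its last term at the
  price of \<open>1 / (q - 1)\<close>. The coarsest level is controlled by the integral of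
  \<open>\<bar>K\<bar>\<close>.\<close>

lemma pot_bound_exists:
  assumes K: "is_green K" and \<delta>: "0 < \<delta>"
  shows "\<exists>C>0. \<forall>T A. distribution T \<longrightarrow> test_bound (- 1 - \<delta>) T A \<longrightarrow> pot_bound K (2 powr \<delta>) T (C * A)"
proof -
  define q where "q = 2 powr \<delta>"
  have q: "1 < q" using \<delta> by (simp add: q_def)
  define I where "I = (LINT x:torus|lborel. \<bar>K x\<bar>)"
  have I: "0 \<le> I" unfolding I_def set_lebesgue_integral_def by (rule integral_nonneg_AE) auto
  define P where "P \<psi> a \<longleftrightarrow> 0 < a \<and> (\<forall>T A n x. distribution T \<longrightarrow> test_bound (- 1 - \<delta>) T A \<longrightarrow>
    \<bar>dist_conv T (scaled_kernel (2 ^ n) \<psi>) x\<bar> \<le> a * A * (q / 2) ^ n)" for \<psi> a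
  have supp: "{x. partial i \<psi> x \<noteq> 0} \<subseteq> cball 0 (1 / 2)"
    if "smooth \<psi>" "{x. \<psi> x \<noteq> 0} \<subseteq> cball 0 (1 / 2)" for i and \<psi> :: "real^2 \<Rightarrow> real"
    using partial_support[OF that(1), of i] closure_minimal[OF that(2) closed_cball] by blast
  have "\<exists>a. P step_kernel a"
    unfolding P_def q_def by (rule scaled_kernel_bound_dyadic[OF smooth_step_kernel step_kernel_support])
  then obtain a where a: "P step_kernel a" by blast
  have "\<exists>b. P (partial i step_kernel) b" for i
    unfolding P_def q_def
    by (rule scaled_kernel_bound_dyadic[OF smooth_partial[OF smooth_step_kernel] supp[OF
        smooth_step_kernel step_kernel_support]])
  then obtain b where b: "\<And>i. P (partial i step_kernel) (b i)" by metis
  have "\<exists>d. P (partial i delta_kernel) d" for i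
    unfolding P_def q_def
    by (rule scaled_kernel_bound_dyadic[OF smooth_partial[OF smooth_delta_kernel] supp[OF
        smooth_delta_kernel delta_kernel_support]])
  then obtain d where d: "\<And>i. P (partial i delta_kernel) (d i)" by metis
  define e where "e = a + (b 1 + b 2) + (d 1 + d 2)"
  have pos: "0 < a" "0 < b i" "0 < d i" for i using a b d by (auto simp: P_def)
  have e: "0 < e" "a \<le> e" "b i \<le> e" "d i \<le> e" for i
    unfolding e_def using exhaust_2[of i] pos(1) pos(2)[of 1] pos(2)[of 2] pos(3)[of 1] pos(3)[of 2] by auto
  \<comment> \<open>\<open>e\<close> is for the increments, \<open>I * e\<close> for the coarsest
    level and \<open>e / (q - 1)\<close> for the geometric sum.\<close>
  define C where "C = e + I * e + e / (q - 1)"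
  have C: "0 < C" using e(1) I q by (simp add: C_def add_pos_nonneg)
  have "pot_bound K q T (C * A)" if T: "distribution T" "test_bound (- 1 - \<delta>) T A" for T A
  proof -
    have A: "0 \<le> A" using T(2) by (simp add: test_bound_def)
    have z: "\<bar>dist_conv T (step_at n) x\<bar> \<le> e * A * (q / 2) ^ n" for n x
    proof -
      have "\<bar>dist_conv T (step_at n) x\<bar> \<le> a * A * (q / 2) ^ n"
        using a T unfolding P_def step_at_def by blast
      also have "\<dots> \<le> e * A * (q / 2) ^ n" using e A q by (intro mult_right_mono) auto
      finally show ?thesis .
    qed
    have dz: "\<bar>dist_conv T (partial i (step_at n)) x\<bar> \<le> e * A * q ^ n" for i n x
    proof -
      have "partial i (step_at n) = (\<lambda>x. 2 ^ n * scaled_kernel (2 ^ n) (partial i step_kernel) x)"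
        using partials_scaled_kernel[OF smooth_step_kernel step_kernel_bounded, of "2 ^ n" "[i]"] by
            (simp add: step_at_def)
      moreover have "scaled_kernel (2 ^ n) (partial i step_kernel) \<in> smooth_torus"
        by (intro scaled_kernel_smooth_torus smooth_partial smooth_step_kernel bounded_partial_support
            step_kernel_bounded) simp
      ultimately have "dist_conv T (partial i (step_at n)) x = 2 ^ n * dist_conv T (scaled_kernel (2 ^
          n) (partial i step_kernel)) x"
        using distribution_cmult[OF T(1) smooth_torus_reflect] by (simp add: dist_conv_def)
      moreover have "\<bar>dist_conv T (scaled_kernel (2 ^ n) (partial i step_kernel)) x\<bar> \<le> b i * A * (q / 2) ^ n"
        using b T unfolding P_def by blast
      then have "2 ^ n * \<bar>dist_conv T (scaled_kernel (2 ^ n) (partial i step_kernel)) x\<bar> \<le> 2 ^ n * (b i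
          * A * (q / 2) ^ n)"
        by (intro mult_left_mono) auto
      moreover have "2 ^ n * (b i * A * (q / 2) ^ n) = b i * A * q ^ n" by (simp add: power_divide)
      moreover have "b i * A * q ^ n \<le> e * A * q ^ n" using e A q by (intro mult_right_mono) auto
      ultimately show ?thesis by (simp add: abs_mult)
    qed
    have d0: "\<bar>dist_conv T (partial i (delta_at 0)) x\<bar> \<le> e * A" for i x
    proof -
      have "delta_at 0 = scaled_kernel (2 ^ 0) delta_kernel" by (simp add: delta_at_def fun_eq_iff)
      then have "partial i (delta_at 0) = scaled_kernel (2 ^ 0) (partial i delta_kernel)"
        using partials_scaled_kernel[OF smooth_delta_kernel delta_kernel_bounded, of "2 ^ 0" "[i]"] by simp
      then have "\<bar>dist_conv T (partial i (delta_at 0)) x\<bar> \<le> d i * A * (q / 2) ^ 0"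
        using d T unfolding P_def by metis
      also have "\<dots> \<le> e * A" using e A by (simp add: mult_right_mono)
      finally show ?thesis .
    qed
    have "\<bar>partial i (pot K T n) x\<bar> \<le> C * A * q ^ n" for i n x
    proof -
      have 1: "\<bar>dist_conv (dist_of K) (dist_conv T (partial i (delta_at 0))) x\<bar> \<le> I * (e * A)"
        unfolding I_def
        by (rule abs_conv_le[OF green_integrable[OF K] smooth_torus_continuous d0])
           (intro dist_conv_smooth_torus T partial_smooth_torus delta_at_smooth_torus)
      have "\<bar>\<Sum>m<n. dist_conv T (partial i (step_at m)) x\<bar> \<le> (\<Sum>m<n. e * A * q ^ m)"
        by (rule order_trans[OF sum_abs sum_mono[OF dz]])
      also have "\<dots> = e * A * ((q ^ n - 1) / (q - 1))"
        using q by (simp add: geometric_sum flip: sum_distrib_left)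
      also have "\<dots> \<le> e * A * (q ^ n / (q - 1))"
        using q e A by (intro mult_left_mono divide_right_mono) auto
      finally have 2: "\<bar>\<Sum>m<n. dist_conv T (partial i (step_at m)) x\<bar> \<le> e / (q - 1) * A * q ^ n" by simp
      have "I * (e * A) \<le> I * e * A * q ^ n"
        using mult_left_mono[of 1 "q ^ n" "I * e * A"] I e A q by (simp add: mult_ac)
      then have "\<bar>partial i (pot K T n) x\<bar> \<le> I * e * A * q ^ n + e / (q - 1) * A * q ^ n"
        unfolding partial_pot[OF K T(1)] using 1 2 by linarith
      also have "\<dots> \<le> C * A * q ^ n"
        using e A q by (simp add: C_def algebra_simps)
      finally show ?thesis .
    qed
    moreover have "e * A * (q / 2) ^ n \<le> C * A * (q / 2) ^ n" for n
      using e A q I by (intro mult_right_mono) (auto simp: C_def)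
    ultimately show ?thesis
      unfolding pot_bound_def using z C A by (meson order_trans mult_nonneg_nonneg less_imp_le)
  qed
  then show ?thesis using C unfolding q_def by blast
qed

text \<open>\<open>brak_limit\<close> makes this a genuine limit for arguments with a
  \<open>pot_bound\<close> and \<open>q\<^sup>2 < 2\<close>.\<close>

definition brak :: "(real^2 \<Rightarrow> real) \<Rightarrow> real functional \<Rightarrow> real functional \<Rightarrow> real functional" where
  "brak K S T \<phi> = lim (\<lambda>n. jac_form \<phi> (grad (pot K S n)) (grad (pot K T n)))"

text \<open>\<open>q + 1\<close> is the constant of one increment of the Jacobians, with one
  gradient at level \<open>n\<close> and one at level \<open>n + 1\<close>;
  \<open>q\<^sup>2 / 2\<close> is the ratio of the geometric series of increments.\<close>

definition tail_const :: "real \<Rightarrow> real" where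
  "tail_const q = (q + 1) / (1 - q\<^sup>2 / 2)"

definition mollifier_at :: "(real^2 \<Rightarrow> real) \<Rightarrow> real \<Rightarrow> real^2 \<Rightarrow> real" where
  "mollifier_at k c x = c\<^sup>2 * scaled_kernel c k x"

lemma mollifier_at_smooth_torus:
  "smooth k \<Longrightarrow> bounded {x. k x \<noteq> 0} \<Longrightarrow> 0 < c \<Longrightarrow> mollifier_at k c \<in> smooth_torus"
  unfolding mollifier_at_def[abs_def] by (intro smooth_torus_cmult scaled_kernel_smooth_torus) auto

lemma delta_at_eq_mollifier: "delta_at n = mollifier_at delta_kernel (2 ^ n)"
  by (simp add: delta_at_def mollifier_at_def fun_eq_iff)

lemma dist_of_eq_conv: "T \<phi> = dist_conv T (\<lambda>y. \<phi> (- y)) 0"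
  by (simp add: dist_conv_def)

lemma smooth_torus_uminus: "f \<in> smooth_torus \<Longrightarrow> (\<lambda>y. f (- y)) \<in> smooth_torus"
  using smooth_torus_reflect[of f 0] by simp

text \<open>The mollified distribution is an average of translates of \<open>S\<close> with a
  probability density, and the bound is invariant under translation. That \<open>A\<close> is
  unchanged is the source of uniformity in \<epsilon>.\<close>

lemma test_bound_mollified:
  assumes S: "distribution S" "test_bound \<alpha> S A"
    and k: "smooth k" "bounded {x. k x \<noteq> 0}" "\<And>x. 0 \<le> k x" "(LINT x|lborel. k x) = 1" and c: "0 < c"
  shows "test_bound \<alpha> (dist_of (dist_conv S (mollifier_at k c))) A"
  unfolding test_bound_def
proof (intro conjI allI impI)
  show A: "0 \<le> A" using S(2) by (simp add: test_bound_def)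
  fix x :: "real^2" and l :: real and \<phi> assume l: "0 < l" "l \<le> 1" and \<phi>: "\<phi> \<in> unit_tests (nat \<lfloor>- \<alpha> + 1\<rfloor>)"
  let ?t = "scaled_test \<phi> x l" and ?m = "mollifier_at k c"
  have m: "?m \<in> smooth_torus" by (rule mollifier_at_smooth_torus[OF k(1,2) c])
  have t: "(\<lambda>y. ?t (- y)) \<in> smooth_torus" by (rule smooth_torus_uminus[OF scaled_test_smooth_torus[OF \<phi>
      l(1)]])
  have b: "\<bar>dist_conv S (\<lambda>y. ?t (- y)) z\<bar> \<le> A * l powr \<alpha>" for z
  proof -
    have "(\<lambda>y. ?t (- (z - y))) = scaled_test \<phi> (x + z) l"
      by (simp add: scaled_test_translate fun_eq_iff)
    then show ?thesis using test_boundD[OF S(2) l \<phi>, of "x + z"] by (simp add: dist_conv_def)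
  qed
  have "dist_of (dist_conv S ?m) ?t = dist_conv (dist_of ?m) (dist_conv S (\<lambda>y. ?t (- y))) 0"
    by (subst dist_of_eq_conv) (simp only: dist_conv_conv[OF S(1) m t])
  also have "\<bar>\<dots>\<bar> \<le> (LINT x:torus|lborel. \<bar>?m x\<bar>) * (A * l powr \<alpha>)"
    by (rule abs_conv_le[OF set_integrable_torus[OF smooth_torus_continuous[OF m]]
          smooth_torus_continuous[OF dist_conv_smooth_torus[OF S(1) t]] b])
  also have "\<dots> \<le> 1 * (A * l powr \<alpha>)"
    using torus_integral_abs_scaled_kernel[OF smooth_continuous[OF k(1)] k(2) c] k(3,4) A
    by (intro mult_right_mono) (simp_all add: mollifier_at_def)
  finally show "\<bar>dist_of (dist_conv S ?m) ?t\<bar> \<le> A * l powr \<alpha>" by simp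
qed

lemma distribution_dist_conv: "distribution S \<Longrightarrow> f \<in> smooth_torus \<Longrightarrow> distribution (dist_of (dist_conv S f))"
  for S :: "real functional"
  by (intro distribution_dist_of set_integrable_torus smooth_torus_continuous dist_conv_smooth_torus)

lemma distribution_dist_diff: "distribution S \<Longrightarrow> distribution T \<Longrightarrow> distribution (dist_diff S T)"
  for S T :: "real functional"
proof -
  assume S: "distribution S" and T: "distribution T"
  obtain N C where C: "0 \<le> C" "\<forall>f\<in>smooth_torus. \<forall>b. (\<forall>is x. length is \<le> N \<longrightarrow> \<bar>partials is f x\<bar> \<le> b) \<longrightarrow>
      norm (S f) \<le> C * b"
    using distribution_bound[OF S] by blast
  obtain N' C' where C': "0 \<le> C'" "\<forall>f\<in>smooth_torus. \<forall>b. (\<forall>is x. length is \<le> N' \<longrightarrow> \<bar>partials is f x\<bar> \<le> b)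
      \<longrightarrow> norm (T f) \<le> C' * b"
    using distribution_bound[OF T] by blast
  show ?thesis
    unfolding distribution_def
  proof (intro conjI ballI allI)
    show "\<exists>N C. \<forall>\<phi>\<in>smooth_torus. \<forall>b. (\<forall>is x. length is \<le> N \<longrightarrow> \<bar>partials is \<phi> x\<bar> \<le> b) \<longrightarrow> norm (dist_diff S
        T \<phi>) \<le> C * b"
    proof (intro exI[of _ "max N N'"] exI[of _ "C + C'"] ballI allI impI)
      fix \<phi> :: "real^2 \<Rightarrow> real" and b
      assume *: "\<phi> \<in> smooth_torus" "\<forall>is x. length is \<le> max N N' \<longrightarrow> \<bar>partials is \<phi> x\<bar> \<le> b"
      have "norm (S \<phi>) \<le> C * b" "norm (T \<phi>) \<le> C' * b" using C(2) C'(2) * by auto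
      then show "norm (dist_diff S T \<phi>) \<le> (C + C') * b"
        unfolding dist_diff_def using norm_triangle_ineq4[of "S \<phi>" "T \<phi>"] by (simp add: distrib_right)
    qed
  qed (auto simp: dist_diff_def distribution_add[OF S] distribution_add[OF T] right_diff_distrib
      distribution_cmult[OF S] distribution_cmult[OF T])
qed

lemma dyadic_scale:
  assumes "1 \<le> (x::real)" shows "\<exists>N. 2 ^ N \<le> x \<and> x < 2 ^ Suc N"
proof -
  have ex: "\<exists>n. x < 2 ^ Suc n"
    using real_arch_pow[of 2 x] by (metis lessI less_trans one_less_numeral_iff power_strict_increasing
        semiring_norm(76))
  define N where "N = (LEAST n. x < 2 ^ Suc n)"
  have "x < 2 ^ Suc N" unfolding N_def by (rule LeastI_ex[OF ex])
  moreover have "2 ^ N \<le> x"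
  proof (cases N)
    case (Suc M)
    then have "\<not> x < 2 ^ Suc M" using not_less_Least[of M "\<lambda>n. x < 2 ^ Suc n"] by (simp add: N_def)
    then show ?thesis using Suc by simp
  qed (use assms in simp)
  ultimately show ?thesis by blast
qed

section \<open>Convergence of the bracket\<close>

context
  fixes K :: "real^2 \<Rightarrow> real"
  assumes K: "is_green K"
begin

lemma grad_pot_continuous: "distribution T \<Longrightarrow> continuous_on UNIV (grad (pot K T n) i)"
  by (rule grad_continuous[OF pot_smooth_torus[OF K]])

context
  fixes q A B :: real and S T :: "real functional"
  assumes q: "1 \<le> q" "q\<^sup>2 < 2"
    and S: "distribution S" "pot_bound K q S A" and T: "distribution T" "pot_bound K q T B"
begin

lemma AB_nonneg: "0 \<le> A" "0 \<le> B"
  using S(2) T(2) by (auto simp: pot_bound_def)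

lemma tail_const_pos: "0 < tail_const q"
  unfolding tail_const_def using q by (intro divide_pos_pos) auto

text \<open>Exchanging the potentials one at a time leaves two Jacobians, each with one increment.
  Integration by parts puts the increment in sup norm, of order \<open>(q / 2) ^ n\<close>, against
  a gradient of order \<open>q ^ n\<close>; the product decays because
  \<open>q\<^sup>2 < 2\<close>.\<close>

lemma jac_increment:
  assumes \<phi>: "\<phi> \<in> smooth_torus"
  shows "\<bar>jac_form \<phi> (grad (pot K S (Suc n))) (grad (pot K T (Suc n))) - jac_form \<phi> (grad (pot K S n))
      (grad (pot K T n))\<bar>
    \<le> (q + 1) * A * B * grad_mass \<phi> * (q\<^sup>2 / 2) ^ n"
proof -
  let ?U = "pot K S n" and ?V = "pot K T n" and ?V' = "pot K T (Suc n)"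
  let ?z = "dist_conv S (step_at n)" and ?w = "dist_conv T (step_at n)"
  have sm: "?U \<in> smooth_torus" "?V \<in> smooth_torus" "?V' \<in> smooth_torus" "?z \<in> smooth_torus" "?w \<in>
      smooth_torus"
    by (intro pot_smooth_torus K dist_conv_smooth_torus step_at_smooth_torus S T)+
  note c = grad_continuous[OF sm(1)] grad_continuous[OF sm(2)] grad_continuous[OF sm(3)]
    grad_continuous[OF sm(4)] grad_continuous[OF sm(5)]
  have U': "grad (pot K S (Suc n)) = (\<lambda>i x. grad ?U i x - grad ?z i x)"
  proof -
    have eq: "pot K S (Suc n) = (\<lambda>x. ?U x - ?z x)" by (simp add: pot_Suc[OF K] fun_eq_iff)
    show ?thesis unfolding grad_def eq by (simp add: partial_diff smooth_torusD sm)
  qed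
  have V': "grad ?V' = (\<lambda>i x. grad ?V i x - grad ?w i x)"
  proof -
    have eq: "pot K T (Suc n) = (\<lambda>x. ?V x - ?w x)" by (simp add: pot_Suc[OF K] fun_eq_iff)
    show ?thesis unfolding grad_def eq by (simp add: partial_diff smooth_torusD sm)
  qed
  have "jac_form \<phi> (grad (pot K S (Suc n))) (grad ?V') = jac_form \<phi> (grad ?U) (grad ?V') - jac_form \<phi>
      (grad ?z) (grad ?V')"
    unfolding U' by (rule jac_form_diff_left) (intro smooth_torus_continuous \<phi> c)+
  \<comment> \<open>The swap brings the increment \<open>?w\<close> into the first slot, where
    \<open>abs_jac_form_by_parts\<close> needs only its sup norm, and absorbs the sign.\<close>
  moreover have "jac_form \<phi> (grad ?U) (grad ?V') = jac_form \<phi> (grad ?U) (grad ?V) + jac_form \<phi> (grad ?w)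
      (grad ?U)"
    unfolding V' using jac_form_diff_right[OF smooth_torus_continuous[OF \<phi>] c(1) c(2) c(5)]
        jac_form_swap[of \<phi> "grad ?w"] by simp
  ultimately have eq: "jac_form \<phi> (grad (pot K S (Suc n))) (grad ?V') - jac_form \<phi> (grad ?U) (grad ?V)
     = jac_form \<phi> (grad ?w) (grad ?U) - jac_form \<phi> (grad ?z) (grad ?V')" by simp
  have 1: "\<bar>jac_form \<phi> (grad ?w) (grad ?U)\<bar> \<le> (B * (q / 2) ^ n) * (A * q ^ n) * grad_mass \<phi>"
    by (rule abs_jac_form_by_parts[OF \<phi> sm(5) sm(1)]) (use S(2) T(2) in \<open>auto simp: pot_bound_def\<close>)
  have 2: "\<bar>jac_form \<phi> (grad ?z) (grad ?V')\<bar> \<le> (A * (q / 2) ^ n) * (B * q ^ Suc n) * grad_mass \<phi>"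
    by (rule abs_jac_form_by_parts[OF \<phi> sm(4) sm(3)]) (use S(2) T(2) in \<open>auto simp only: pot_bound_def\<close>)
  have "(q / 2) ^ n * q ^ n = (q\<^sup>2 / 2) ^ n" by (simp add: power2_eq_square flip: power_mult_distrib)
  then have "(B * (q / 2) ^ n) * (A * q ^ n) * grad_mass \<phi> + (A * (q / 2) ^ n) * (B * q ^ Suc n) * grad_mass \<phi>
     = (q + 1) * A * B * grad_mass \<phi> * (q\<^sup>2 / 2) ^ n" by (simp add: algebra_simps)
  with 1 2 show ?thesis unfolding eq by linarith
qed

lemma brak_limit:
  assumes \<phi>: "\<phi> \<in> smooth_torus"
  shows "(\<lambda>n. jac_form \<phi> (grad (pot K S n)) (grad (pot K T n))) \<longlonglongrightarrow> brak K S T \<phi>"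
    and "\<bar>brak K S T \<phi> - jac_form \<phi> (grad (pot K S n)) (grad (pot K T n))\<bar>
      \<le> tail_const q * A * B * grad_mass \<phi> * (q\<^sup>2 / 2) ^ n"
proof -
  have r: "0 \<le> q\<^sup>2 / 2" "q\<^sup>2 / 2 < 1" using q by auto
  show "(\<lambda>n. jac_form \<phi> (grad (pot K S n)) (grad (pot K T n))) \<longlonglongrightarrow> brak K S T \<phi>"
    using geometric_increments_limit(1)[OF jac_increment[OF \<phi>] r] unfolding brak_def by (simp add:
        convergent_LIMSEQ_iff)
  show "\<bar>brak K S T \<phi> - jac_form \<phi> (grad (pot K S n)) (grad (pot K T n))\<bar>
      \<le> tail_const q * A * B * grad_mass \<phi> * (q\<^sup>2 / 2) ^ n"
    using geometric_increments_limit(2)[OF jac_increment[OF \<phi>] r, of n] unfolding brak_def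
        tail_const_def by simp
qed

lemma jac_pot_le:
  assumes "\<phi> \<in> smooth_torus"
  shows "\<bar>jac_form \<phi> (grad (pot K S n)) (grad (pot K T n))\<bar> \<le> (LINT x:torus|lborel. \<bar>\<phi> x\<bar>) * (2 * (A * q
      ^ n) * (B * q ^ n))"
  by (rule abs_jac_form_le)
     (use S T assms in \<open>auto simp: pot_bound_def grad_def[symmetric] intro: smooth_torus_continuous
         grad_pot_continuous\<close>)

lemma distribution_brak: "distribution (brak K S T)"
  unfolding distribution_def
proof (intro conjI ballI allI)
  let ?J = "\<lambda>\<phi> n. jac_form \<phi> (grad (pot K S n)) (grad (pot K T n))"
  have int: "set_integrable lborel torus (\<lambda>x. \<phi> x * (grad (pot K S n) 1 x * grad (pot K T n) 2 x - grad
      (pot K S n) 2 x * grad (pot K T n) 1 x))"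
    if "\<phi> \<in> smooth_torus" for \<phi> n
    by (intro set_integrable_jac smooth_torus_continuous that grad_pot_continuous S T)
  {
    fix \<phi> \<psi> :: "real^2 \<Rightarrow> real" assume *: "\<phi> \<in> smooth_torus" "\<psi> \<in> smooth_torus"
    have "?J (\<lambda>x. \<phi> x + \<psi> x) n = ?J \<phi> n + ?J \<psi> n" for n
      unfolding jac_form_def using set_integral_add(2)[OF int[OF *(1)] int[OF *(2)]] by (simp add:
          distrib_right)
    then have "(\<lambda>n. ?J \<phi> n + ?J \<psi> n) \<longlonglongrightarrow> brak K S T (\<lambda>x. \<phi> x + \<psi> x)"
      using brak_limit(1)[OF smooth_torus_add[OF *]] by simp
    then show "brak K S T (\<lambda>x. \<phi> x + \<psi> x) = brak K S T \<phi> + brak K S T \<psi>"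
      using tendsto_add[OF brak_limit(1)[OF *(1)] brak_limit(1)[OF *(2)]] LIMSEQ_unique by blast
  next
    fix \<phi> :: "real^2 \<Rightarrow> real" and c assume *: "\<phi> \<in> smooth_torus"
    have "?J (\<lambda>x. c * \<phi> x) n = c * ?J \<phi> n" for n
      unfolding jac_form_def by (simp add: mult.assoc)
    then have "(\<lambda>n. c * ?J \<phi> n) \<longlonglongrightarrow> brak K S T (\<lambda>x. c * \<phi> x)"
      using brak_limit(1)[OF smooth_torus_cmult[OF *, of c]] by simp
    then show "brak K S T (\<lambda>x. c * \<phi> x) = c *\<^sub>R brak K S T \<phi>"
      using tendsto_mult[OF tendsto_const[of c] brak_limit(1)[OF *]] LIMSEQ_unique by fastforce
  next
    \<comment> \<open>Level 0 is bounded through the mass of \<phi> and the rest of the series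
      through \<open>grad_mass\<close>, so the bracket has order at most 1.\<close>
    define C where "C = 4 * pi\<^sup>2 * (2 * A * B) + tail_const q * A * B * (4 * pi\<^sup>2 * 2)"
    show "\<exists>N C. \<forall>\<phi>\<in>smooth_torus. \<forall>b. (\<forall>is x. length is \<le> N \<longrightarrow> \<bar>partials is \<phi> x\<bar> \<le> b) \<longrightarrow> norm (brak K S T
        \<phi>) \<le> C * b"
    proof (intro exI[of _ "1::nat"] exI[of _ C] ballI allI impI)
      fix \<phi> :: "real^2 \<Rightarrow> real" and b
      assume *: "\<phi> \<in> smooth_torus" "\<forall>is x. length is \<le> 1 \<longrightarrow> \<bar>partials is \<phi> x\<bar> \<le> b"
      have b: "\<bar>\<phi> x\<bar> \<le> b" "\<bar>partial i \<phi> x\<bar> \<le> b" for i x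
        using *(2)[rule_format, of "[]"] *(2)[rule_format, of "[i]"] by auto
      have c: "continuous_on UNIV \<phi>" "continuous_on UNIV (partial i \<phi>)" for i
        by (intro smooth_torus_continuous partial_smooth_torus *)+
      have "\<bar>LINT x:torus|lborel. \<bar>\<phi> x\<bar>\<bar> \<le> 4 * pi\<^sup>2 * b"
        by (rule torus_integral_abs_le) (auto intro!: continuous_intros c b)
      then have m0: "(LINT x:torus|lborel. \<bar>\<phi> x\<bar>) \<le> 4 * pi\<^sup>2 * b" by linarith
      have "\<bar>LINT x:torus|lborel. \<bar>partial 1 \<phi> x\<bar> + \<bar>partial 2 \<phi> x\<bar>\<bar> \<le> 4 * pi\<^sup>2 * (2 * b)"
      proof (rule torus_integral_abs_le)
        show "continuous_on UNIV (\<lambda>x. \<bar>partial 1 \<phi> x\<bar> + \<bar>partial 2 \<phi> x\<bar>)" by (intro continuous_intros c)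
        show "\<bar>\<bar>partial 1 \<phi> x\<bar> + \<bar>partial 2 \<phi> x\<bar>\<bar> \<le> 2 * b" for x using b(2)[of 1 x] b(2)[of 2 x] by linarith
      qed
      then have m1: "grad_mass \<phi> \<le> 4 * pi\<^sup>2 * (2 * b)" unfolding grad_mass_def by linarith
      have J: "\<bar>?J \<phi> 0\<bar> \<le> (4 * pi\<^sup>2 * b) * (2 * A * B)"
        using order_trans[OF jac_pot_le[OF *(1), of 0] mult_right_mono[OF m0]] AB_nonneg by simp
      have t: "tail_const q * A * B * grad_mass \<phi> \<le> tail_const q * A * B * (4 * pi\<^sup>2 * (2 * b))"
        using m1 tail_const_pos AB_nonneg by (intro mult_left_mono) auto
      have "\<bar>brak K S T \<phi> - ?J \<phi> 0\<bar> \<le> tail_const q * A * B * grad_mass \<phi>" using brak_limit(2)[OF *(1),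
          of 0] by simp
      with J t have "\<bar>brak K S T \<phi>\<bar> \<le> (4 * pi\<^sup>2 * b) * (2 * A * B) + tail_const q * A * B * (4 * pi\<^sup>2 *
          (2 * b))"
        by linarith
      then show "norm (brak K S T \<phi>) \<le> C * b" by (simp add: C_def algebra_simps)
    qed
  }
qed

end

end

section \<open>The bracket against scaled tests\<close>

lemma powr_dyadic_power:
  fixes \<delta> :: real
  shows "(2 powr \<delta>)\<^sup>2 ^ n = (2 ^ n) powr (2 * \<delta>)" "((2 powr \<delta>)\<^sup>2 / 2) ^ n = (2 ^ n) powr (2 * \<delta>) / 2 ^ n"
proof -
  show *: "(2 powr \<delta>)\<^sup>2 ^ n = (2 ^ n) powr (2 * \<delta>)"
    by (simp add: powr_powr mult_ac flip: powr_realpow powr_numeral)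
  show "((2 powr \<delta>)\<^sup>2 / 2) ^ n = (2 ^ n) powr (2 * \<delta>) / 2 ^ n"
    unfolding power_divide * by simp
qed

lemma two_powr_facts:
  fixes \<delta> :: real
  shows "0 < \<delta> \<Longrightarrow> \<delta> < 1 / 8 \<Longrightarrow> 1 \<le> 2 powr \<delta> \<and> (2 powr \<delta>)\<^sup>2 < 2"
proof -
  assume \<delta>: "0 < \<delta>" "\<delta> < 1 / 8"
  have "(2 powr \<delta>)\<^sup>2 = 2 powr (2 * \<delta>)" using powr_dyadic_power(1)[of \<delta> 1] by simp
  also have "\<dots> < 2 powr 1" using \<delta> by (intro powr_less_mono) auto
  finally show ?thesis using \<delta> by (simp add: ge_one_powr_ge_zero)
qed

context
  fixes K :: "real^2 \<Rightarrow> real"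
  assumes K: "is_green K"
begin

context
  fixes \<delta> A B :: real and S T :: "real functional"
  assumes \<delta>: "0 < \<delta>" "\<delta> < 1 / 8"
    and S: "distribution S" "pot_bound K (2 powr \<delta>) S A" and T: "distribution T" "pot_bound K (2 powr \<delta>) T B"
begin

lemma q_facts: "1 \<le> 2 powr \<delta>" "(2 powr \<delta>)\<^sup>2 < 2"
  using two_powr_facts[OF \<delta>] by auto

context
  fixes \<phi> :: "real^2 \<Rightarrow> real" and r :: nat and l :: real and x :: "real^2"
  assumes \<phi>: "\<phi> \<in> unit_tests r" "1 \<le> r" and l: "0 < l" "l \<le> 1"
begin

text \<open>No derivative is moved onto the test, which is good enough as long as
  \<open>2 ^ n\<close> is at most \<open>1 / l\<close>; beyond that scale
  \<open>brak_tail_le\<close> takes over.\<close>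

lemma jac_scaled_test_le:
  "\<bar>jac_form (scaled_test \<phi> x l) (grad (pot K S n)) (grad (pot K T n))\<bar> \<le> 8 * (A * B) * (2 ^ n) powr (2 * \<delta>)"
proof -
  let ?q = "2 powr \<delta>"
  note AB = AB_nonneg[OF K q_facts S T]
  have sm: "scaled_test \<phi> x l \<in> smooth_torus" by (rule scaled_test_smooth_torus[OF \<phi>(1) l(1)])
  have "\<bar>jac_form (scaled_test \<phi> x l) (grad (pot K S n)) (grad (pot K T n))\<bar>
      \<le> (LINT y:torus|lborel. \<bar>scaled_test \<phi> x l y\<bar>) * (2 * (A * ?q ^ n) * (B * ?q ^ n))"
    by (rule jac_pot_le[OF K q_facts S T sm])
  also have "\<dots> \<le> 4 * (2 * (A * ?q ^ n) * (B * ?q ^ n))"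
    using AB by (intro mult_right_mono scaled_test_mass(1)[OF \<phi>(1) l(1)]) auto
  also have "\<dots> = 8 * (A * B) * (?q\<^sup>2 ^ n)" by (simp add: power2_eq_square power_mult_distrib)
  finally show ?thesis unfolding powr_dyadic_power .
qed

lemma brak_tail_le:
  "\<bar>brak K S T (scaled_test \<phi> x l) - jac_form (scaled_test \<phi> x l) (grad (pot K S n)) (grad (pot K T n))\<bar>
    \<le> 8 * tail_const (2 powr \<delta>) * (A * B) * ((1 / l) * ((2 ^ n) powr (2 * \<delta>) / 2 ^ n))"
proof -
  let ?q = "2 powr \<delta>"
  note AB = AB_nonneg[OF K q_facts S T] tail_const_pos[OF K q_facts S T]
  have sm: "scaled_test \<phi> x l \<in> smooth_torus" by (rule scaled_test_smooth_torus[OF \<phi>(1) l(1)])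
  have "\<bar>brak K S T (scaled_test \<phi> x l) - jac_form (scaled_test \<phi> x l) (grad (pot K S n)) (grad (pot K T n))\<bar>
     \<le> tail_const ?q * A * B * grad_mass (scaled_test \<phi> x l) * (?q\<^sup>2 / 2) ^ n"
    by (rule brak_limit(2)[OF K q_facts S T sm])
  also have "\<dots> \<le> tail_const ?q * A * B * (8 / l) * (?q\<^sup>2 / 2) ^ n"
    using AB \<phi>(2) by (intro mult_right_mono mult_left_mono scaled_test_mass(2)[OF \<phi>(1) l(1)]) auto
  finally show ?thesis unfolding powr_dyadic_power by (simp add: mult_ac)
qed

text \<open>At the level where \<open>2 ^ N\<close> is comparable to \<open>1 / l\<close> the direct
  bound and the tail balance. The 8 of the tail becomes 16 because \<open>1 / l\<close> may reach
  twice \<open>2 ^ N\<close>.\<close>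

lemma brak_scaled_test_le:
  "\<bar>brak K S T (scaled_test \<phi> x l)\<bar> \<le> (8 + 16 * tail_const (2 powr \<delta>)) * (A * B) * (1 / l) powr (2 * \<delta>)"
proof -
  let ?k = "tail_const (2 powr \<delta>)"
  note AB = AB_nonneg[OF K q_facts S T] tail_const_pos[OF K q_facts S T]
  have "1 \<le> 1 / l" using l by simp
  then obtain N where N: "2 ^ N \<le> 1 / l" "1 / l < 2 ^ Suc N" using dyadic_scale by blast
  let ?y = "2 ^ N :: real"
  have "(1 / l) * (?y powr (2 * \<delta>) / ?y) \<le> (2 * ?y) * (?y powr (2 * \<delta>) / ?y)"
    using N by (intro mult_right_mono) auto
  then have "8 * ?k * (A * B) * ((1 / l) * (?y powr (2 * \<delta>) / ?y)) \<le> 8 * ?k * (A * B) * (2 * ?y powr (2 * \<delta>))"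
    using AB by (intro mult_left_mono) auto
  then have "\<bar>brak K S T (scaled_test \<phi> x l)\<bar> \<le> 8 * (A * B) * ?y powr (2 * \<delta>) + 8 * ?k * (A * B) * (2 *
      ?y powr (2 * \<delta>))"
    using jac_scaled_test_le[of N] brak_tail_le[of N] by linarith
  also have "\<dots> = (8 + 16 * ?k) * (A * B) * ?y powr (2 * \<delta>)" by (simp add: algebra_simps)
  also have "\<dots> \<le> (8 + 16 * ?k) * (A * B) * (1 / l) powr (2 * \<delta>)"
    using AB N \<delta> by (intro mult_left_mono powr_mono2) auto
  finally show ?thesis .
qed

text \<open>Giving up \<open>2 * \<delta>\<close> in the power of \<open>1 / l\<close> buys a decay
  in \<open>n\<close> that is uniform in the scale. This makes the bracket a limit in norm of smooth
  functions.\<close>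

lemma brak_approx_scaled_test_le:
  "\<bar>brak K S T (scaled_test \<phi> x l) - jac_form (scaled_test \<phi> x l) (grad (pot K S n)) (grad (pot K T n))\<bar>
    \<le> (16 + 16 * tail_const (2 powr \<delta>)) * (A * B) * (1 / l) powr (4 * \<delta>) * (2 ^ n) powr (- 2 * \<delta>)"
proof -
  let ?k = "tail_const (2 powr \<delta>)" and ?y = "2 ^ n :: real" and ?x = "1 / l"
  note AB = AB_nonneg[OF K q_facts S T] tail_const_pos[OF K q_facts S T]
  have x: "1 \<le> ?x" using l by simp
  show ?thesis
  proof (cases "?x \<le> ?y")
    case True
    \<comment> \<open>Fine levels: of the factor \<open>?x\<close> only the power
      \<open>4 * \<delta>\<close> is kept, the remaining power \<open>1 - 4 * \<delta>\<close>,
      which is positive, being estimated by \<open>?y\<close>.\<close>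
    have "?x * (?y powr (2 * \<delta>) / ?y) = ?x powr (4 * \<delta>) * ?x powr (1 - 4 * \<delta>) * (?y powr (2 * \<delta>) / ?y)"
      using x l by (simp flip: powr_add)
    also have "\<dots> \<le> ?x powr (4 * \<delta>) * ?y powr (1 - 4 * \<delta>) * (?y powr (2 * \<delta>) / ?y)"
      using True x \<delta> l by (intro mult_right_mono mult_left_mono powr_mono2) auto
    also have "\<dots> = ?x powr (4 * \<delta>) * (?y powr (1 - 4 * \<delta>) * ?y powr (2 * \<delta>) * ?y powr (- 1))"
      by (simp add: powr_minus_divide)
    also have "?y powr (1 - 4 * \<delta>) * ?y powr (2 * \<delta>) * ?y powr (- 1) = ?y powr (- 2 * \<delta>)"
      unfolding powr_add[symmetric] by simp
    finally have fin: "?x * (?y powr (2 * \<delta>) / ?y) \<le> ?x powr (4 * \<delta>) * ?y powr (- 2 * \<delta>)" .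
    have "8 * ?k * (A * B) \<le> (16 + 16 * ?k) * (A * B)" using AB by (intro mult_right_mono) auto
    then have "8 * ?k * (A * B) * (?x * (?y powr (2 * \<delta>) / ?y)) \<le> (16 + 16 * ?k) * (A * B) * (?x powr (4
        * \<delta>) * ?y powr (- 2 * \<delta>))"
      by (rule mult_mono[OF _ fin]) (use AB l in auto)
    then show ?thesis using brak_tail_le[of n] by (simp add: mult.assoc)
  next
    case False
    \<comment> \<open>Coarse levels: bracket and Jacobian are bounded separately, and the decay in
      \<open>?x\<close> is at least as good as one in \<open>?y\<close> since \<open>?x\<close> is
      the larger.\<close>
    have "?y powr (2 * \<delta>) \<le> ?x powr (2 * \<delta>)" using False \<delta> by (intro powr_mono2) auto
    then have "8 * (A * B) * ?y powr (2 * \<delta>) \<le> 8 * (A * B) * ?x powr (2 * \<delta>)"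
      using AB by (intro mult_left_mono) auto
    then have "\<bar>brak K S T (scaled_test \<phi> x l) - jac_form (scaled_test \<phi> x l) (grad (pot K S n)) (grad
        (pot K T n))\<bar>
        \<le> (16 + 16 * ?k) * (A * B) * ?x powr (2 * \<delta>)"
      using jac_scaled_test_le[of n] brak_scaled_test_le by (simp add: algebra_simps)
    also have "?x powr (2 * \<delta>) = ?x powr (4 * \<delta>) * ?x powr (- 2 * \<delta>)" using x by (simp flip: powr_add)
    also have "(16 + 16 * ?k) * (A * B) * (?x powr (4 * \<delta>) * ?x powr (- 2 * \<delta>))
        \<le> (16 + 16 * ?k) * (A * B) * (?x powr (4 * \<delta>) * ?y powr (- 2 * \<delta>))"
      using AB False \<delta> by (intro mult_left_mono powr_mono2') auto
    finally show ?thesis by (simp add: mult.assoc)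
  qed
qed

end

lemma brak_test_bound:
  "test_bound (- (4 * \<delta>)) (brak K S T) ((8 + 16 * tail_const (2 powr \<delta>)) * (A * B))"
  unfolding test_bound_def
proof (intro conjI allI impI)
  note AB = AB_nonneg[OF K q_facts S T] tail_const_pos[OF K q_facts S T]
  then show "0 \<le> (8 + 16 * tail_const (2 powr \<delta>)) * (A * B)" by auto
  fix x :: "real^2" and l :: real and \<phi>
  assume l: "0 < l" "l \<le> 1" and \<phi>: "\<phi> \<in> unit_tests (nat \<lfloor>- (- (4 * \<delta>)) + 1\<rfloor>)"
  \<comment> \<open>The regularity index still controls one derivative of the test, as the tail
    estimate requires.\<close>
  have r: "1 \<le> nat \<lfloor>- (- (4 * \<delta>)) + 1\<rfloor>" using \<delta> by (simp add: le_nat_iff le_floor_iff)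
  have "(1 / l) powr (2 * \<delta>) \<le> (1 / l) powr (4 * \<delta>)" using l \<delta> by (intro powr_mono) auto
  also have "\<dots> = l powr (- (4 * \<delta>))" using l by (simp add: powr_divide powr_minus_divide)
  finally have "(8 + 16 * tail_const (2 powr \<delta>)) * (A * B) * (1 / l) powr (2 * \<delta>)
     \<le> (8 + 16 * tail_const (2 powr \<delta>)) * (A * B) * l powr (- (4 * \<delta>))"
    using AB by (intro mult_left_mono) auto
  with brak_scaled_test_le[OF \<phi> r l] show "\<bar>brak K S T (scaled_test \<phi> x l)\<bar>
     \<le> (8 + 16 * tail_const (2 powr \<delta>)) * (A * B) * l powr (- (4 * \<delta>))" by (meson order_trans)
qed

lemma brak_approx_test_bound:
  "test_bound (- (4 * \<delta>)) (\<lambda>\<phi>. brak K S T \<phi> - jac_form \<phi> (grad (pot K S n)) (grad (pot K T n)))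
    ((16 + 16 * tail_const (2 powr \<delta>)) * (A * B) * (2 ^ n) powr (- 2 * \<delta>))"
  unfolding test_bound_def
proof (intro conjI allI impI)
  note AB = AB_nonneg[OF K q_facts S T] tail_const_pos[OF K q_facts S T]
  then show "0 \<le> (16 + 16 * tail_const (2 powr \<delta>)) * (A * B) * (2 ^ n) powr (- 2 * \<delta>)" by auto
  fix x :: "real^2" and l :: real and \<phi>
  assume l: "0 < l" "l \<le> 1" and \<phi>: "\<phi> \<in> unit_tests (nat \<lfloor>- (- (4 * \<delta>)) + 1\<rfloor>)"
  have r: "1 \<le> nat \<lfloor>- (- (4 * \<delta>)) + 1\<rfloor>" using \<delta> by (simp add: le_nat_iff le_floor_iff)
  have "(1 / l) powr (4 * \<delta>) = l powr (- (4 * \<delta>))" using l by (simp add: powr_divide powr_minus_divide)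
  then show "\<bar>brak K S T (scaled_test \<phi> x l) - jac_form (scaled_test \<phi> x l) (grad (pot K S n)) (grad
      (pot K T n))\<bar>
     \<le> (16 + 16 * tail_const (2 powr \<delta>)) * (A * B) * (2 ^ n) powr (- 2 * \<delta>) * l powr (- (4 * \<delta>))"
    using brak_approx_scaled_test_le[OF \<phi> r l, of x n] by (simp add: mult_ac)
qed

end

section \<open>Bilinearity of the bracket, its value on smooth functions and its continuity under
  mollification\<close>

lemma pot_dist_diff:
  assumes "distribution S" "distribution S'"
  shows "grad (pot K (dist_diff S S') n) = (\<lambda>i x. grad (pot K S n) i x - grad (pot K S' n) i x)"
proof -
  have c: "dist_conv (dist_diff S S') f = (\<lambda>x. dist_conv S f x - dist_conv S' f x)" for f
    by (simp add: dist_conv_def dist_diff_def fun_eq_iff)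
  have "pot K (dist_diff S S') n = (\<lambda>x. pot K S n x - pot K S' n x)"
    unfolding pot_def[abs_def] c
    by (rule ext, subst dist_conv_diff[OF green_distribution[OF K]])
       (simp_all add: dist_conv_smooth_torus assms delta_at_smooth_torus sum_subtractf)
  then show ?thesis
    unfolding grad_def by (simp add: partial_diff smooth_torusD pot_smooth_torus[OF K] assms)
qed

lemma brak_diff_left:
  assumes q: "1 \<le> q" "q\<^sup>2 < 2" and S: "distribution S" "pot_bound K q S A"
    and S': "distribution S'" "pot_bound K q S' A'" and T: "distribution T" "pot_bound K q T B"
    and \<phi>: "\<phi> \<in> smooth_torus"
  shows "brak K (dist_diff S S') T \<phi> = brak K S T \<phi> - brak K S' T \<phi>"
proof -
  have "jac_form \<phi> (grad (pot K (dist_diff S S') n)) (grad (pot K T n))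
     = jac_form \<phi> (grad (pot K S n)) (grad (pot K T n)) - jac_form \<phi> (grad (pot K S' n)) (grad (pot K T
         n))" for n
    unfolding pot_dist_diff[OF S(1) S'(1)]
    by (intro jac_form_diff_left smooth_torus_continuous \<phi> grad_pot_continuous K S S' T)
  then show ?thesis
    unfolding brak_def[of K "dist_diff S S'"]
    using limI[OF tendsto_diff[OF brak_limit(1)[OF K q S T \<phi>] brak_limit(1)[OF K q S' T \<phi>]]] by simp
qed

lemma brak_diff_right:
  assumes q: "1 \<le> q" "q\<^sup>2 < 2" and S: "distribution S" "pot_bound K q S A"
    and T: "distribution T" "pot_bound K q T B" and T': "distribution T'" "pot_bound K q T' B'"
    and \<phi>: "\<phi> \<in> smooth_torus"
  shows "brak K S (dist_diff T T') \<phi> = brak K S T \<phi> - brak K S T' \<phi>"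
proof -
  have "jac_form \<phi> (grad (pot K S n)) (grad (pot K (dist_diff T T') n))
     = jac_form \<phi> (grad (pot K S n)) (grad (pot K T n)) - jac_form \<phi> (grad (pot K S n)) (grad (pot K T'
         n))" for n
    unfolding pot_dist_diff[OF T(1) T'(1)]
    by (intro jac_form_diff_right smooth_torus_continuous \<phi> grad_pot_continuous K S T T')
  then show ?thesis
    unfolding brak_def[of K S "dist_diff T T'"]
    using limI[OF tendsto_diff[OF brak_limit(1)[OF K q S T \<phi>] brak_limit(1)[OF K q S T' \<phi>]]] by simp
qed

text \<open>The gradient of \<open>K * f\<close> for smooth \<open>f\<close>; its components are the
  real part and minus the imaginary part of \<open>G * f\<close>, see \<open>xi_eq\<close>.\<close>

definition green_grad :: "(real^2 \<Rightarrow> real) \<Rightarrow> 2 \<Rightarrow> real^2 \<Rightarrow> real" where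
  "green_grad f i = dist_conv (dist_of K) (partial i f)"

lemma green_grad_smooth_torus: "f \<in> smooth_torus \<Longrightarrow> green_grad f i \<in> smooth_torus"
  unfolding green_grad_def by (intro dist_conv_smooth_torus green_distribution K partial_smooth_torus)

lemma abs_green_conv_diff_le:
  assumes "f \<in> smooth_torus" "g \<in> smooth_torus" "\<And>x. \<bar>f x - g x\<bar> \<le> b"
  shows "\<bar>dist_conv (dist_of K) f x - dist_conv (dist_of K) g x\<bar> \<le> (LINT x:torus|lborel. \<bar>K x\<bar>) * b"
  unfolding dist_conv_diff[OF green_distribution[OF K] assms(1,2), symmetric]
  by (rule abs_conv_le[OF green_integrable[OF K] smooth_torus_continuous[OF smooth_torus_diff[OF
      assms(1,2)]] assms(3)])

lemma green_mass_nonneg: "0 \<le> (LINT x:torus|lborel. \<bar>K x\<bar>)"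
  unfolding set_lebesgue_integral_def by (rule integral_nonneg_AE) auto

text \<open>By \<open>partial_pot_delta\<close> the gradient at level \<open>n\<close> is
  \<open>K\<close> convolved with a mollification of \<open>partial i f\<close> at scale
  \<open>1 / 2 ^ n\<close>, so the rate is that of \<open>conv_scaled_approx\<close>.\<close>

lemma grad_pot_dist_of_approx:
  assumes f: "f \<in> smooth_torus"
  shows "\<exists>L\<ge>0. \<forall>n x. \<bar>grad (pot K (dist_of f) n) i x - green_grad f i x\<bar> \<le> L / 2 ^ n"
proof -
  let ?h = "partial i f"
  have h: "?h \<in> smooth_torus" by (rule partial_smooth_torus[OF f])
  have Df: "distribution (dist_of g)" if "g \<in> smooth_torus" for g :: "real^2 \<Rightarrow> real"
    by (rule distribution_dist_of[OF set_integrable_torus[OF smooth_torus_continuous[OF that]]])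
  obtain L where L: "0 \<le> L" "\<And>c x. 0 < c \<Longrightarrow> \<bar>dist_conv (dist_of (mollifier_at delta_kernel c)) ?h x - ?h
      x\<bar> \<le> L / c"
    using conv_scaled_approx[OF h smooth_continuous[OF smooth_delta_kernel] delta_kernel_bounded
        integral_delta_kernel]
    unfolding mollifier_at_def[abs_def] by blast
  have "dist_conv (dist_of f) (partial i (delta_at n)) = dist_conv (dist_of (delta_at n)) ?h" for n
  proof -
    have "dist_conv (dist_of f) (partial i (delta_at n)) = partial i (dist_conv (dist_of f) (delta_at n))"
      by (simp add: partial_dist_conv[OF Df[OF f] delta_at_smooth_torus])
    also have "dist_conv (dist_of f) (delta_at n) = dist_conv (dist_of (delta_at n)) f"
      by (rule conv_commute) (intro smooth_torus_continuous smooth_torusD f delta_at_smooth_torus)+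
    also have "partial i \<dots> = dist_conv (dist_of (delta_at n)) ?h"
      by (rule partial_dist_conv[OF Df[OF delta_at_smooth_torus] f])
    finally show ?thesis .
  qed
  then have "grad (pot K (dist_of f) n) i = dist_conv (dist_of K) (dist_conv (dist_of (delta_at n)) ?h)" for n
    by (simp add: grad_def partial_pot_delta[OF K Df[OF f]])
  moreover have "\<bar>dist_conv (dist_of K) (dist_conv (dist_of (delta_at n)) ?h) x - dist_conv (dist_of K) ?h x\<bar>
      \<le> (LINT x:torus|lborel. \<bar>K x\<bar>) * (L / 2 ^ n)" for n x
    by (rule abs_green_conv_diff_le[OF dist_conv_smooth_torus[OF Df[OF delta_at_smooth_torus] h] h])
       (simp add: delta_at_eq_mollifier L)
  ultimately show ?thesis
    using L(1) green_mass_nonneg unfolding green_grad_def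
    by (intro exI[of _ "(LINT x:torus|lborel. \<bar>K x\<bar>) * L"]) auto
qed

text \<open>Ties the abstract bracket to the pointwise cross product: for smooth arguments the
  gradients converge uniformly, so the limit passes inside the integral.\<close>

lemma brak_dist_of:
  assumes f: "f \<in> smooth_torus" and g: "g \<in> smooth_torus" and \<phi>: "\<phi> \<in> smooth_torus"
  shows "brak K (dist_of f) (dist_of g) \<phi> = jac_form \<phi> (green_grad f) (green_grad g)"
proof -
  have D: "distribution (dist_of h)" if "h \<in> smooth_torus" for h :: "real^2 \<Rightarrow> real"
    by (rule distribution_dist_of[OF set_integrable_torus[OF smooth_torus_continuous[OF that]]])
  have "\<exists>L\<ge>0. \<exists>M\<ge>0. \<forall>i. (\<forall>n x. \<bar>grad (pot K (dist_of h) n) i x - green_grad h i x\<bar> \<le> L / 2 ^ n) \<and> (\<forall>x.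
      \<bar>green_grad h i x\<bar> \<le> M)"
    if h: "h \<in> smooth_torus" for h
  proof -
    obtain L where L: "\<And>i. 0 \<le> L i" "\<And>i n x. \<bar>grad (pot K (dist_of h) n) i x - green_grad h i x\<bar> \<le> L i /
        2 ^ n"
      using grad_pot_dist_of_approx[OF h] by metis
    have "\<exists>M\<ge>0. \<forall>x. \<bar>green_grad h i x\<bar> \<le> M" for i
      by (rule smooth_torus_bounded[OF green_grad_smooth_torus[OF h]]) auto
    then obtain M where M: "\<And>i. 0 \<le> M i" "\<And>i x. \<bar>green_grad h i x\<bar> \<le> M i" by metis
    have le: "L i \<le> L 1 + L 2" "M i \<le> M 1 + M 2" for i
      using exhaust_2[of i] L(1)[of 1] L(1)[of 2] M(1)[of 1] M(1)[of 2] by auto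
    have "\<bar>grad (pot K (dist_of h) n) i x - green_grad h i x\<bar> \<le> (L 1 + L 2) / 2 ^ n" for i n x
      using L(2)[of n i x] divide_right_mono[OF le(1)[of i], of "2 ^ n"] by simp
    moreover have "\<bar>green_grad h i x\<bar> \<le> M 1 + M 2" for i x
      using M(2)[of i x] le(2)[of i] by linarith
    moreover have "0 \<le> L 1 + L 2" "0 \<le> M 1 + M 2" by (simp_all add: L M)
    ultimately show ?thesis by blast
  qed
  from this[OF f] this[OF g] obtain Lf Mf Lg Mg where
    Lf: "0 \<le> Lf" "\<And>i n x. \<bar>grad (pot K (dist_of f) n) i x - green_grad f i x\<bar> \<le> Lf / 2 ^ n" and Mf: "0 \<le>
        Mf" "\<And>i x. \<bar>green_grad f i x\<bar> \<le> Mf"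
    and Lg: "0 \<le> Lg" "\<And>i n x. \<bar>grad (pot K (dist_of g) n) i x - green_grad g i x\<bar> \<le> Lg / 2 ^ n" and Mg:
        "0 \<le> Mg" "\<And>i x. \<bar>green_grad g i x\<bar> \<le> Mg"
    by metis
  define M where "M = Mf + Mg + Lg"
  define I where "I = (LINT x:torus|lborel. \<bar>\<phi> x\<bar>)"
  have bound: "\<bar>jac_form \<phi> (grad (pot K (dist_of f) n)) (grad (pot K (dist_of g) n)) - jac_form \<phi>
      (green_grad f) (green_grad g)\<bar>
      \<le> I * (4 * M * ((Lf + Lg) / 2 ^ n))" for n
    unfolding I_def
  proof (rule jac_form_perturb)
    show "\<bar>green_grad f i x\<bar> \<le> M" for i x using Mf(2)[of i x] Mg(1) Lg(1) by (simp add: M_def)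
    have "Lg / 2 ^ n \<le> Lg" using Lg(1) by (simp add: divide_le_eq mult_le_cancel_left1)
    then show "\<bar>grad (pot K (dist_of g) n) i x\<bar> \<le> M" for i x
      using Lg(2)[of n i x] Mg(2)[of i x] Mf(1) unfolding M_def by linarith
    have le: "Lf / 2 ^ n \<le> (Lf + Lg) / 2 ^ n" "Lg / 2 ^ n \<le> (Lf + Lg) / 2 ^ n"
      using Lf(1) Lg(1) by (auto intro: divide_right_mono)
    show "\<bar>grad (pot K (dist_of f) n) i x - green_grad f i x\<bar> \<le> (Lf + Lg) / 2 ^ n" for i x
      using order_trans[OF Lf(2) le(1)] .
    show "\<bar>grad (pot K (dist_of g) n) i x - green_grad g i x\<bar> \<le> (Lf + Lg) / 2 ^ n" for i x
      using order_trans[OF Lg(2) le(2)] .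
  qed (intro smooth_torus_continuous \<phi> grad_pot_continuous K D f g green_grad_smooth_torus)+
  have lim0: "(\<lambda>n. I * (4 * M * ((Lf + Lg) / 2 ^ n))) \<longlonglongrightarrow> 0"
  proof -
    have "(\<lambda>n. (I * (4 * M * (Lf + Lg))) * (1 / 2) ^ n) \<longlonglongrightarrow> (I * (4 * M * (Lf + Lg))) * 0"
      by (intro tendsto_mult tendsto_const LIMSEQ_power_zero) simp
    moreover have "(I * (4 * M * (Lf + Lg))) * (1 / 2) ^ n = I * (4 * M * ((Lf + Lg) / 2 ^ n))" for n
      by (simp add: power_divide)
    ultimately show ?thesis by simp
  qed
  have "(\<lambda>n. jac_form \<phi> (grad (pot K (dist_of f) n)) (grad (pot K (dist_of g) n)) - jac_form \<phi>
      (green_grad f) (green_grad g)) \<longlonglongrightarrow> 0"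
  proof (rule Lim_null_comparison[OF always_eventually lim0], rule allI)
    fix n
    show "norm (jac_form \<phi> (grad (pot K (dist_of f) n)) (grad (pot K (dist_of g) n)) - jac_form \<phi>
        (green_grad f) (green_grad g))
        \<le> I * (4 * M * ((Lf + Lg) / 2 ^ n))"
      using bound[of n] by (simp only: Real_Vector_Spaces.real_norm_def)
  qed
  then show ?thesis
    unfolding brak_def by (intro limI) (simp add: LIM_zero_iff)
qed

text \<open>At a fixed level the noise already occurs convolved with a smooth kernel, so a further
  mollification converges uniformly; \<open>L\<close> may depend on \<open>n\<close>.\<close>

lemma grad_pot_mollified_approx:
  assumes S: "distribution S" and k: "smooth k" "bounded {x. k x \<noteq> 0}" "(LINT x|lborel. k x) = 1"
  shows "\<exists>L\<ge>0. \<forall>c>0. \<forall>x. \<bar>grad (pot K (dist_of (dist_conv S (mollifier_at k c))) n) i x - grad (pot K S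
      n) i x\<bar> \<le> L / c"
proof -
  let ?f = "dist_conv S (partial i (delta_at n))"
  have d: "partial i (delta_at n) \<in> smooth_torus" by (intro partial_smooth_torus delta_at_smooth_torus)
  have f: "?f \<in> smooth_torus" by (rule dist_conv_smooth_torus[OF S d])
  obtain L where L: "0 \<le> L" "\<And>c x. 0 < c \<Longrightarrow> \<bar>dist_conv (dist_of (mollifier_at k c)) ?f x - ?f x\<bar> \<le> L / c"
    using conv_scaled_approx[OF f smooth_continuous[OF k(1)] k(2,3)]
    unfolding mollifier_at_def[abs_def] by blast
  have "\<bar>grad (pot K (dist_of (dist_conv S (mollifier_at k c))) n) i x - grad (pot K S n) i x\<bar>
     \<le> (LINT x:torus|lborel. \<bar>K x\<bar>) * (L / c)" if c: "0 < c" for c x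
  proof -
    have m: "mollifier_at k c \<in> smooth_torus" by (rule mollifier_at_smooth_torus[OF k(1,2) c])
    have Dm: "distribution (dist_of (mollifier_at k c))"
      by (rule distribution_dist_of[OF set_integrable_torus[OF smooth_torus_continuous[OF m]]])
    show ?thesis
      unfolding grad_def partial_pot_delta[OF K S] partial_pot_delta[OF K distribution_dist_conv[OF S
          m]] dist_conv_conv[OF S m d]
      by (rule abs_green_conv_diff_le[OF dist_conv_smooth_torus[OF Dm f] f L(2)[OF c]])
  qed
  then show ?thesis
    using L(1) green_mass_nonneg by (intro exI[of _ "(LINT x:torus|lborel. \<bar>K x\<bar>) * L"]) auto
qed

text \<open>\<open>A\<close> and \<open>B\<close> are shared by all mollifications, so one level
  \<open>n\<close> can be fixed at which all tails are below a third of \<open>e\<close>; at that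
  level the Jacobians converge as \<open>c\<close> grows.\<close>

lemma brak_mollified_tendsto:
  assumes q: "1 \<le> q" "q\<^sup>2 < 2" and S: "distribution S" "pot_bound K q S A" and T: "distribution T"
      "pot_bound K q T B"
    and k: "smooth k" "bounded {x. k x \<noteq> 0}" "(LINT x|lborel. k x) = 1"
    and Sc: "\<And>c. 0 < c \<Longrightarrow> pot_bound K q (dist_of (dist_conv S (mollifier_at k c))) A"
    and Tc: "\<And>c. 0 < c \<Longrightarrow> pot_bound K q (dist_of (dist_conv T (mollifier_at k c))) B"
    and \<phi>: "\<phi> \<in> smooth_torus"
  shows "((\<lambda>c. brak K (dist_of (dist_conv S (mollifier_at k c))) (dist_of (dist_conv T (mollifier_at k
      c))) \<phi>) \<longlongrightarrow> brak K S T \<phi>) at_top"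
proof (rule tendstoI)
  fix e :: real assume e: "0 < e"
  define S' where "S' c = dist_of (dist_conv S (mollifier_at k c))" for c
  define T' where "T' c = dist_of (dist_conv T (mollifier_at k c))" for c
  have D: "distribution (S' c)" "distribution (T' c)" if "0 < c" for c
    unfolding S'_def T'_def by (intro distribution_dist_conv S T mollifier_at_smooth_torus k that)+
  define Q where "Q = tail_const q * A * B * grad_mass \<phi>"
  have "(\<lambda>n. Q * (q\<^sup>2 / 2) ^ n) \<longlonglongrightarrow> Q * 0"
    using q by (intro tendsto_mult tendsto_const LIMSEQ_power_zero) simp
  then have "\<forall>\<^sub>F n in sequentially. Q * (q\<^sup>2 / 2) ^ n < e / 3"
    using e by (intro order_tendstoD) auto
  then obtain n where n: "Q * (q\<^sup>2 / 2) ^ n < e / 3" by (auto simp: eventually_sequentially)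
  have "\<forall>i. \<exists>L\<ge>0. \<forall>c>0. \<forall>x. \<bar>grad (pot K (S' c) n) i x - grad (pot K S n) i x\<bar> \<le> L / c"
    unfolding S'_def using grad_pot_mollified_approx[OF S(1) k] by blast
  then obtain L where L: "\<And>i. 0 \<le> L i" "\<And>i c x. 0 < c \<Longrightarrow> \<bar>grad (pot K (S' c) n) i x - grad (pot K S n) i
      x\<bar> \<le> L i / c" by metis
  have "\<forall>i. \<exists>L\<ge>0. \<forall>c>0. \<forall>x. \<bar>grad (pot K (T' c) n) i x - grad (pot K T n) i x\<bar> \<le> L / c"
    unfolding T'_def using grad_pot_mollified_approx[OF T(1) k] by blast
  then obtain L' where L': "\<And>i. 0 \<le> L' i" "\<And>i c x. 0 < c \<Longrightarrow> \<bar>grad (pot K (T' c) n) i x - grad (pot K T n)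
      i x\<bar> \<le> L' i / c" by metis
  define R where "R = L 1 + L 2 + L' 1 + L' 2"
  have R: "L i \<le> R" "L' i \<le> R" for i
    unfolding R_def using exhaust_2[of i] L(1)[of 1] L(1)[of 2] L'(1)[of 1] L'(1)[of 2] by auto
  define M where "M = (A + B) * q ^ n"
  define I where "I = (LINT x:torus|lborel. \<bar>\<phi> x\<bar>)"
  have AB: "0 \<le> A" "0 \<le> B" using S T by (auto simp: pot_bound_def)
  have near: "\<bar>jac_form \<phi> (grad (pot K (S' c) n)) (grad (pot K (T' c) n)) - jac_form \<phi> (grad (pot K S
      n)) (grad (pot K T n))\<bar>
      \<le> I * (4 * M * R) / c" if c: "0 < c" for c
  proof -
    have "\<bar>jac_form \<phi> (grad (pot K (S' c) n)) (grad (pot K (T' c) n)) - jac_form \<phi> (grad (pot K S n))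
        (grad (pot K T n))\<bar>
      \<le> I * (4 * M * (R / c))"
      unfolding I_def
    proof (rule jac_form_perturb)
      show "\<bar>grad (pot K S n) i x\<bar> \<le> M" for i x
      proof -
        have "\<bar>grad (pot K S n) i x\<bar> \<le> A * q ^ n" using S(2) by (simp add: pot_bound_def grad_def)
        also have "\<dots> \<le> M" unfolding M_def using AB q by (intro mult_right_mono) auto
        finally show ?thesis .
      qed
      show "\<bar>grad (pot K (T' c) n) i x\<bar> \<le> M" for i x
      proof -
        have "\<bar>grad (pot K (T' c) n) i x\<bar> \<le> B * q ^ n" using Tc[OF c] by (simp add: pot_bound_def
            grad_def T'_def)
        also have "\<dots> \<le> M" unfolding M_def using AB q by (intro mult_right_mono) auto
        finally show ?thesis .
      qed
      show "\<bar>grad (pot K (S' c) n) i x - grad (pot K S n) i x\<bar> \<le> R / c" for i x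
        using L(2)[OF c, of i x] divide_right_mono[OF R(1)[of i], of c] c by linarith
      show "\<bar>grad (pot K (T' c) n) i x - grad (pot K T n) i x\<bar> \<le> R / c" for i x
        using L'(2)[OF c, of i x] divide_right_mono[OF R(2)[of i], of c] c by linarith
    qed (intro smooth_torus_continuous \<phi> grad_pot_continuous K D[OF c] S T)+
    then show ?thesis by simp
  qed
  have "((\<lambda>c. I * (4 * M * R) / c) \<longlongrightarrow> 0) at_top"
    by (rule tendsto_divide_0[OF tendsto_const filterlim_at_top_imp_at_infinity[OF filterlim_ident]])
  then have "\<forall>\<^sub>F c in at_top. I * (4 * M * R) / c < e / 3"
    using e by (intro order_tendstoD) auto
  then show "\<forall>\<^sub>F c in at_top. dist (brak K (dist_of (dist_conv S (mollifier_at k c))) (dist_of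
      (dist_conv T (mollifier_at k c))) \<phi>) (brak K S T \<phi>) < e"
    using eventually_gt_at_top[of 0]
  proof eventually_elim
    case (elim c)
    have "\<bar>brak K (S' c) (T' c) \<phi> - jac_form \<phi> (grad (pot K (S' c) n)) (grad (pot K (T' c) n))\<bar> \<le> Q *
        (q\<^sup>2 / 2) ^ n"
      unfolding Q_def
      by (rule brak_limit(2)[OF K q D(1)[OF elim(2)] _ D(2)[OF elim(2)] _ \<phi>]) (use Sc Tc elim in \<open>auto
          simp: S'_def T'_def\<close>)
    moreover have "\<bar>brak K S T \<phi> - jac_form \<phi> (grad (pot K S n)) (grad (pot K T n))\<bar> \<le> Q * (q\<^sup>2 / 2) ^ n"
      unfolding Q_def by (rule brak_limit(2)[OF K q S T \<phi>])
    ultimately have "\<bar>brak K (S' c) (T' c) \<phi> - brak K S T \<phi>\<bar> < e"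
      using near[OF elim(2)] elim(1) n by linarith
    then show ?case by (simp add: dist_real_def S'_def T'_def)
  qed
qed

end

section \<open>The cross product of a regular noise\<close>

definition cbrak :: "(real^2 \<Rightarrow> real) \<Rightarrow> real functional \<Rightarrow> real functional \<Rightarrow> complex functional" where
  "cbrak K S T \<phi> = 8 * \<i> * complex_of_real (brak K S T \<phi>)"

lemma periodic2_compose: "periodic2 f \<Longrightarrow> periodic2 (\<lambda>x. g (f x))"
  by (simp add: periodic2_def)

text \<open>The cross product of a vector with its conjugate is purely imaginary, so its complex
  norm reduces to one real norm. Agreement on \<open>smooth_torus\<close> suffices because scaled
  tests lie there.\<close>

lemma complex_norm_imaginary_le:
  assumes "\<And>\<phi>. \<phi> \<in> smooth_torus \<Longrightarrow> T \<phi> = 8 * \<i> * complex_of_real (f \<phi>)" "test_bound \<alpha> f A"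
  shows "complex_norm \<alpha> T \<le> ennreal (8 * A)"
proof -
  have A: "0 \<le> A" using assms(2) by (simp add: test_bound_def)
  have "test_bound \<alpha> (\<lambda>\<phi>. Re (T \<phi>)) 0"
    unfolding test_bound_def using assms(1)[OF scaled_test_smooth_torus] by simp
  then have "real_norm \<alpha> (\<lambda>\<phi>. Re (T \<phi>)) \<le> ennreal 0" by (rule real_norm_le)
  then have re: "real_norm \<alpha> (\<lambda>\<phi>. Re (T \<phi>)) = 0" by simp
  have "test_bound \<alpha> (\<lambda>\<phi>. Im (T \<phi>)) (8 * A)"
    unfolding test_bound_def using assms(1)[OF scaled_test_smooth_torus] A test_boundD[OF assms(2)]
    by (auto simp: mult.assoc abs_mult)
  then have im: "real_norm \<alpha> (\<lambda>\<phi>. Im (T \<phi>)) \<le> ennreal (8 * A)" by (rule real_norm_le)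
  then have fin: "real_norm \<alpha> (\<lambda>\<phi>. Im (T \<phi>)) < \<infinity>" by (simp add: le_less_trans[OF _ ennreal_less_top])
  then have "complex_norm \<alpha> T = real_norm \<alpha> (\<lambda>\<phi>. Im (T \<phi>))"
    by (auto simp: complex_norm_def ennreal_hypot_def re real_sqrt_abs)
  with im show ?thesis by simp
qed

lemma is_mollifierD:
  assumes "is_mollifier \<rho>"
  shows "smooth \<rho>" "bounded {x. \<rho> x \<noteq> 0}" "\<And>x. 0 \<le> \<rho> x" "(LINT x|lborel. \<rho> x) = 1"
  using assms by (auto simp: is_mollifier_def)

lemma mollify_eq: "mollify \<rho> \<epsilon> T = dist_conv T (mollifier_at \<rho> (1 / \<epsilon>))"
proof -
  have "periodize (\<lambda>x. \<rho> ((1 / \<epsilon>) *\<^sub>R x) / \<epsilon>\<^sup>2) = mollifier_at \<rho> (1 / \<epsilon>)"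
    using periodize_cmult[of "(1 / \<epsilon>)\<^sup>2" "\<lambda>x. \<rho> ((1 / \<epsilon>) *\<^sub>R x)"]
    by (simp add: mollifier_at_def scaled_kernel_def fun_eq_iff power_divide)
  then show ?thesis by (simp add: mollify_def)
qed

lemma xi_eq:
  assumes K: "is_green K" and \<rho>: "is_mollifier \<rho>" and \<epsilon>: "0 < \<epsilon>" and W: "\<And>k. distribution (W k)"
  shows "xi K \<rho> W \<epsilon> x $ k = 2 * \<i> * (complex_of_real (green_grad K (mollify \<rho> \<epsilon> (W k)) 1 x)
     - \<i> * complex_of_real (green_grad K (mollify \<rho> \<epsilon> (W k)) 2 x))"
proof -
  let ?f = "mollify \<rho> \<epsilon> (W k)"
  have f: "?f \<in> smooth_torus"
    unfolding mollify_eq by (intro dist_conv_smooth_torus W mollifier_at_smooth_torus is_mollifierD[OF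
        \<rho>]) (use \<epsilon> in simp)
  \<comment> \<open>The sign of the distributional derivative cancels the one from differentiating
    the reflected argument.\<close>
  have eq: "green_grad K ?f i x = - dist_of K (partial i (\<lambda>y. ?f (x - y)))" for i
  proof -
    have "partial i (\<lambda>y. ?f (x - y)) = (\<lambda>y. - partial i ?f (x - y))"
      using partials_reflect[OF smooth_torusD(1)[OF f], of "[i]"] by simp
    then show ?thesis
      using distribution_minus[OF green_distribution[OF K] smooth_torus_reflect[OF
          partial_smooth_torus[OF f]]]
      by (simp add: green_grad_def[OF K] dist_conv_def)
  qed
  show ?thesis by (simp add: xi_def dist_conv_def green_dz_def dist_partial_def eq)
qed

text \<open>The factor 8 is 4 from \<open>2 * \<i>\<close> times its conjugate and 2 from
  \<open>z - cnj z = 2 * \<i> * Im z\<close>. Since \<open>j + 1\<close> and \<open>j + 2\<close>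
  are residues modulo 3, the three cases are matched after normalising numerals.\<close>

lemma ccross_cnj:
  fixes p q :: "3 \<Rightarrow> real"
  assumes "\<And>k. v $ k = 2 * \<i> * (complex_of_real (p k) - \<i> * complex_of_real (q k))"
  shows "ccross v (\<chi> k. cnj (v $ k)) $ j = 8 * \<i> * complex_of_real (p (j + 1) * q (j + 2) - q (j + 1) *
      p (j + 2))"
proof -
  have *: "v $ a * cnj (v $ b) - v $ b * cnj (v $ a) = 8 * \<i> * complex_of_real (p a * q b - q a * p b)"
      for a b
    by (simp add: assms complex_eq_iff algebra_simps)
  have three: "(3 :: 3) = 0" "(1 + 1 :: 3) = 2" "(1 + 2 :: 3) = 3" "(2 + 1 :: 3) = 3" "(2 + 2 :: 3) = 1"
      "(3 + 1 :: 3) = 1" "(3 + 2 :: 3) = 2"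
    by simp_all
  consider "j = 1" | "j = 2" | "j = 3" using exhaust_3 by blast
  then show ?thesis
    by cases (simp_all only: ccross_def vector_3 vec_lambda_beta * three(2-7))
qed

lemma dist_of_imaginary:
  fixes F \<phi> :: "real^2 \<Rightarrow> real"
  shows "dist_of (\<lambda>x. 8 * \<i> * complex_of_real (F x)) \<phi> = 8 * \<i> * complex_of_real (LINT x:torus|lborel. \<phi>
      x * F x)"
proof -
  have "dist_of (\<lambda>x. 8 * \<i> * complex_of_real (F x)) \<phi>
      = (LINT x|lborel. (8 * \<i>) * complex_of_real (indicator torus x * (\<phi> x * F x)))"
    unfolding dist_of_def set_lebesgue_integral_def by (simp add: scaleR_conv_of_real mult_ac)
  also have "\<dots> = (8 * \<i>) * (LINT x|lborel. complex_of_real (indicator torus x * (\<phi> x * F x)))"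
    by (rule integral_mult_right_zero)
  finally show ?thesis by (simp add: set_lebesgue_integral_def integral_complex_of_real del: of_real_mult)
qed

lemma distribution_mollified:
  assumes \<rho>: "is_mollifier \<rho>" and "distribution T" "0 \<le> \<epsilon>"
  shows "distribution (mollified_dist \<rho> \<epsilon> T)"
proof (cases "\<epsilon> = 0")
  case False
  then show ?thesis
    using assms(2,3) is_mollifierD[OF \<rho>]
    by (auto simp: mollified_dist_def mollify_eq intro!: distribution_dist_conv mollifier_at_smooth_torus)
qed (simp add: mollified_dist_def assms)

lemma test_bound_mollified_dist:
  assumes \<rho>: "is_mollifier \<rho>" and T: "distribution T" "test_bound \<alpha> T A" and "0 \<le> \<epsilon>"
  shows "test_bound \<alpha> (mollified_dist \<rho> \<epsilon> T) A"
proof (cases "\<epsilon> = 0")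
  case False
  then show ?thesis
    using assms(4) test_bound_mollified[OF T is_mollifierD[OF \<rho>]] by (simp add: mollified_dist_def mollify_eq)
qed (simp add: mollified_dist_def assms)

lemma theta_eps_eq:
  assumes K: "is_green K" and \<rho>: "is_mollifier \<rho>" and \<epsilon>: "0 < \<epsilon>" and W: "\<And>k. distribution (W k)" and \<phi>:
      "\<phi> \<in> smooth_torus"
  shows "theta_eps K \<rho> W \<epsilon> j \<phi> = cbrak K (mollified_dist \<rho> \<epsilon> (W (j + 1))) (mollified_dist \<rho> \<epsilon> (W (j + 2))) \<phi>"
proof -
  let ?f = "\<lambda>k. mollify \<rho> \<epsilon> (W k)"
  have f: "?f k \<in> smooth_torus" for k
    unfolding mollify_eq by (intro dist_conv_smooth_torus W mollifier_at_smooth_torus is_mollifierD[OF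
        \<rho>]) (use \<epsilon> in simp)
  have "theta_eps K \<rho> W \<epsilon> j \<phi> = dist_of (\<lambda>x. 8 * \<i> * complex_of_real
      (green_grad K (?f (j + 1)) 1 x * green_grad K (?f (j + 2)) 2 x - green_grad K (?f (j + 1)) 2 x *
          green_grad K (?f (j + 2)) 1 x)) \<phi>"
    unfolding theta_eps_def ccross_cnj[OF xi_eq[OF K \<rho> \<epsilon> W]] ..
  also have "\<dots> = 8 * \<i> * complex_of_real (jac_form \<phi> (green_grad K (?f (j + 1))) (green_grad K (?f (j + 2))))"
    unfolding dist_of_imaginary jac_form_def ..
  finally show ?thesis
    using \<epsilon> by (simp add: cbrak_def mollified_dist_def brak_dist_of[OF K f f \<phi>])
qed

lemma distribution_cbrak:
  assumes "distribution (brak K S T)" shows "distribution (cbrak K S T)"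
proof -
  obtain N C where C: "0 \<le> C" "\<forall>f\<in>smooth_torus. \<forall>b. (\<forall>is x. length is \<le> N \<longrightarrow> \<bar>partials is f x\<bar> \<le> b) \<longrightarrow>
      norm (brak K S T f) \<le> C * b"
    using distribution_bound[OF assms] by blast
  show ?thesis
    unfolding distribution_def
  proof (intro conjI ballI allI)
    show "\<exists>N C. \<forall>\<phi>\<in>smooth_torus. \<forall>b. (\<forall>is x. length is \<le> N \<longrightarrow> \<bar>partials is \<phi> x\<bar> \<le> b) \<longrightarrow> norm (cbrak K S T
        \<phi>) \<le> C * b"
    proof (intro exI[of _ N] exI[of _ "8 * C"] ballI allI impI)
      fix \<phi> :: "real^2 \<Rightarrow> real" and b
      assume "\<phi> \<in> smooth_torus" "\<forall>is x. length is \<le> N \<longrightarrow> \<bar>partials is \<phi> x\<bar> \<le> b"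
      then have "norm (brak K S T \<phi>) \<le> C * b" using C(2) by blast
      then show "norm (cbrak K S T \<phi>) \<le> 8 * C * b" by (simp add: cbrak_def norm_mult)
    qed
  qed (simp_all add: cbrak_def distribution_add[OF assms] distribution_cmult[OF assms] distrib_left
      scaleR_conv_of_real mult_ac)
qed

text \<open>The only property of a realisation that the analysis uses, so that constants cannot
  depend on the realisation. All \<delta> are included in order that one null set serves all
  \<kappa>.\<close>

definition regular_noise :: "(3 \<Rightarrow> real functional) \<Rightarrow> bool" where
  "regular_noise W \<longleftrightarrow> (\<forall>k. distribution (W k) \<and> (\<forall>\<delta>. 0 < \<delta> \<longrightarrow> \<delta> < 1 \<longrightarrow> real_norm (- 1 - \<delta>) (W k) < \<infinity>))"

context
  fixes K \<rho> :: "real^2 \<Rightarrow> real"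
  assumes K: "is_green K" and \<rho>: "is_mollifier \<rho>"
begin

text \<open>\<open>A\<close> is the same for all \<epsilon>, as the common tail in
  \<open>brak_mollified_tendsto\<close> demands.\<close>

lemma noise_pot_bound:
  assumes "0 < \<delta>" "\<delta> < 1" "regular_noise W"
  shows "\<exists>A. pot_bound K (2 powr \<delta>) (W k) A \<and> (\<forall>\<epsilon>\<ge>0. pot_bound K (2 powr \<delta>) (mollified_dist \<rho> \<epsilon> (W k)) A)"
proof -
  obtain C where C: "\<And>T A. distribution T \<Longrightarrow> test_bound (- 1 - \<delta>) T A \<Longrightarrow> pot_bound K (2 powr \<delta>) T (C * A)"
    using pot_bound_exists[OF K assms(1)] by blast
  have W: "distribution (W k)" "test_bound (- 1 - \<delta>) (W k) (enn2real (real_norm (- 1 - \<delta>) (W k)))"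
    using assms by (auto simp: regular_noise_def intro!: real_norm_test_bound)
  show ?thesis
    using C[OF W] C[OF distribution_mollified[OF \<rho> W(1)] test_bound_mollified_dist[OF \<rho> W]] by blast
qed

lemma theta_limit_cbrak:
  assumes W: "regular_noise W"
  shows "theta_limit K \<rho> W (\<lambda>j. cbrak K (W (j + 1)) (W (j + 2)))"
  unfolding theta_limit_def
proof (intro allI conjI ballI)
  fix j :: 3
  \<comment> \<open>Convergence holds for every positive exponent below 1/8; 1/16 is a choice
    independent of \<kappa>.\<close>
  define q :: real where "q = 2 powr (1 / 16)"
  have q: "1 \<le> q" "q\<^sup>2 < 2" using two_powr_facts[of "1 / 16"] by (auto simp: q_def)
  have D: "distribution (W k)" for k using W by (simp add: regular_noise_def)
  obtain A where A: "pot_bound K q (W (j + 1)) A" "\<And>\<epsilon>. 0 \<le> \<epsilon> \<Longrightarrow> pot_bound K q (mollified_dist \<rho> \<epsilon> (W (j +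
      1))) A"
    using noise_pot_bound[OF _ _ W, of "1 / 16" "j + 1"] by (auto simp: q_def)
  obtain B where B: "pot_bound K q (W (j + 2)) B" "\<And>\<epsilon>. 0 \<le> \<epsilon> \<Longrightarrow> pot_bound K q (mollified_dist \<rho> \<epsilon> (W (j +
      2))) B"
    using noise_pot_bound[OF _ _ W, of "1 / 16" "j + 2"] by (auto simp: q_def)
  show "distribution (cbrak K (W (j + 1)) (W (j + 2)))"
    by (rule distribution_cbrak[OF distribution_brak[OF K q D A(1) D B(1)]])
  fix \<phi> :: "real^2 \<Rightarrow> real" assume \<phi>: "\<phi> \<in> smooth_torus"
  let ?S = "\<lambda>c. dist_of (dist_conv (W (j + 1)) (mollifier_at \<rho> c))" and ?T = "\<lambda>c. dist_of (dist_conv (W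
      (j + 2)) (mollifier_at \<rho> c))"
  have m: "mollified_dist \<rho> (1 / c) T = dist_of (dist_conv T (mollifier_at \<rho> c))" if "0 < c" for c T
    using that by (simp add: mollified_dist_def mollify_eq)
  have "((\<lambda>c. brak K (?S c) (?T c) \<phi>) \<longlongrightarrow> brak K (W (j + 1)) (W (j + 2)) \<phi>) at_top"
  proof (rule brak_mollified_tendsto[OF K q D A(1) D B(1) is_mollifierD(1,2,4)[OF \<rho>] _ _ \<phi>])
    show "pot_bound K q (?S c) A" if "0 < c" for c using A(2)[of "1 / c"] m[OF that] that by simp
    show "pot_bound K q (?T c) B" if "0 < c" for c using B(2)[of "1 / c"] m[OF that] that by simp
  qed
  \<comment> \<open>\<open>mollifier_at\<close> is parametrised by the inverse of
    \<epsilon>.\<close>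
  from filterlim_compose[OF this filterlim_inverse_at_top_right]
  have "((\<lambda>\<epsilon>. brak K (?S (inverse \<epsilon>)) (?T (inverse \<epsilon>)) \<phi>) \<longlongrightarrow> brak K (W (j + 1)) (W (j + 2)) \<phi>) (at_right 0)" .
  then have "((\<lambda>\<epsilon>. 8 * \<i> * complex_of_real (brak K (?S (inverse \<epsilon>)) (?T (inverse \<epsilon>)) \<phi>)) \<longlongrightarrow> cbrak K (W (j
      + 1)) (W (j + 2)) \<phi>) (at_right 0)"
    unfolding cbrak_def by (intro tendsto_mult tendsto_const tendsto_of_real)
  moreover have "\<forall>\<^sub>F \<epsilon> in at_right 0. 8 * \<i> * complex_of_real (brak K (?S (inverse \<epsilon>)) (?T (inverse \<epsilon>))
      \<phi>) = theta_eps K \<rho> W \<epsilon> j \<phi>"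
    using eventually_at_right_less[of 0]
  proof eventually_elim
    case (elim \<epsilon>)
    have "mollified_dist \<rho> \<epsilon> T = dist_of (dist_conv T (mollifier_at \<rho> (inverse \<epsilon>)))" for T
      using m[of "inverse \<epsilon>" T] elim by (simp add: inverse_eq_divide)
    then show ?case by (simp add: theta_eps_eq[OF K \<rho> elim D \<phi>] cbrak_def)
  qed
  ultimately show "((\<lambda>\<epsilon>. theta_eps K \<rho> W \<epsilon> j \<phi>) \<longlongrightarrow> cbrak K (W (j + 1)) (W (j + 2)) \<phi>) (at_right 0)"
    by (rule Lim_transform_eventually)
qed

lemma theta_limit_unique:
  assumes W: "regular_noise W" and \<theta>: "theta_limit K \<rho> W \<theta>" and \<phi>: "\<phi> \<in> smooth_torus"
  shows "\<theta> j \<phi> = cbrak K (W (j + 1)) (W (j + 2)) \<phi>"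
proof -
  have 1: "((\<lambda>\<epsilon>. theta_eps K \<rho> W \<epsilon> j \<phi>) \<longlongrightarrow> \<theta> j \<phi>) (at_right 0)"
    using \<theta> \<phi> by (simp add: theta_limit_def)
  have 2: "((\<lambda>\<epsilon>. theta_eps K \<rho> W \<epsilon> j \<phi>) \<longlongrightarrow> cbrak K (W (j + 1)) (W (j + 2)) \<phi>) (at_right 0)"
    using theta_limit_cbrak[OF W] \<phi> by (simp add: theta_limit_def)
  show ?thesis by (rule tendsto_unique[OF trivial_limit_at_right_real 1 2])
qed

text \<open>At \<open>\<epsilon> = 0\<close> mollification is the identity, so one formula covers
  \<theta> and its approximations and the estimates avoid a case distinction.\<close>

lemma theta_ext_eq:
  assumes W: "regular_noise W" and \<theta>: "theta_limit K \<rho> W \<theta>" and \<phi>: "\<phi> \<in> smooth_torus" and \<epsilon>: "0 \<le> \<epsilon>"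
  shows "theta_ext K \<rho> W \<theta> \<epsilon> j \<phi> = cbrak K (mollified_dist \<rho> \<epsilon> (W (j + 1))) (mollified_dist \<rho> \<epsilon> (W (j +
      2))) \<phi>"
proof (cases "\<epsilon> = 0")
  case True
  then show ?thesis using theta_limit_unique[OF W \<theta> \<phi>] by (simp add: theta_ext_def mollified_dist_def)
next
  case False
  then show ?thesis using theta_eps_eq[OF K \<rho> _ _ \<phi>, of \<epsilon> W j] W \<epsilon> by (simp add: theta_ext_def
      regular_noise_def)
qed

text \<open>Both estimates of the theorem for one realisation, which allows the constant to be
  quantified before it.\<close>

definition theta_estimate ::
  "real \<Rightarrow> real \<Rightarrow> (3 \<Rightarrow> real functional) \<Rightarrow> (3 \<Rightarrow> complex functional) \<Rightarrow> bool" where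
  "theta_estimate \<kappa> C W \<theta> \<longleftrightarrow> (\<forall>\<epsilon>\<ge>0. \<forall>j.
    complex_norm (- \<kappa>) (theta_ext K \<rho> W \<theta> \<epsilon> j)
      \<le> ennreal C * real_norm (- 1 - \<kappa> / 4) (W (j + 1)) * real_norm (- 1 - \<kappa> / 4) (W (j + 2)) \<and>
    complex_norm (- \<kappa>) (dist_diff (theta_ext K \<rho> W \<theta> \<epsilon> j) (\<theta> j))
      \<le> ennreal C *
        (real_norm (- 1 - \<kappa> / 4) (dist_diff (mollified_dist \<rho> \<epsilon> (W (j + 1))) (W (j + 1)))
           * real_norm (- 1 - \<kappa> / 4) (W (j + 2)) +
         real_norm (- 1 - \<kappa> / 4) (dist_diff (mollified_dist \<rho> \<epsilon> (W (j + 2))) (W (j + 2)))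
           * real_norm (- 1 - \<kappa> / 4) (W (j + 1))))"

text \<open>\<open>C\<close> is fixed before \<open>W\<close>, \<theta> and \<epsilon>: it comes
  from \<open>K\<close> and \<kappa> through \<open>pot_bound_exists\<close>, and
  \<open>test_bound_mollified_dist\<close> bounds the mollified noises by the norms of the original
  ones.\<close>

lemma theta_bounds:
  assumes \<kappa>: "0 < \<kappa>" "\<kappa> < 1 / 2"
  shows "\<exists>C>0. \<forall>W \<theta>. regular_noise W \<longrightarrow> theta_limit K \<rho> W \<theta> \<longrightarrow> theta_estimate \<kappa> C W \<theta>"
proof -
  \<comment> \<open>With this choice the noises are measured in order
    \<open>- 1 - \<kappa> / 4\<close> and the bracket in order
    \<open>- (4 * \<delta>) = - \<kappa>\<close>.\<close>
  define \<delta> where "\<delta> = \<kappa> / 4"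
  have \<delta>: "0 < \<delta>" "\<delta> < 1 / 8" "- (4 * \<delta>) = - \<kappa>" "\<delta> < 1" using \<kappa> by (auto simp: \<delta>_def)
  note q = two_powr_facts[OF \<delta>(1,2), THEN conjunct1] two_powr_facts[OF \<delta>(1,2), THEN conjunct2]
  obtain C0 where C0: "0 < C0" "\<And>T A. distribution T \<Longrightarrow> test_bound (- 1 - \<delta>) T A \<Longrightarrow> pot_bound K (2 powr \<delta>)
      T (C0 * A)"
    using pot_bound_exists[OF K \<delta>(1)] by blast
  have k: "0 < tail_const (2 powr \<delta>)" unfolding tail_const_def using q by (intro divide_pos_pos) auto
  define D where "D = (8 + 16 * tail_const (2 powr \<delta>)) * C0\<^sup>2"
  have D: "0 < D" using C0 k by (simp add: D_def add_pos_pos)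
  have bb: "test_bound (- \<kappa>) (brak K S T) (D * (A * B))"
    if "distribution S" "test_bound (- 1 - \<delta>) S A" "distribution T" "test_bound (- 1 - \<delta>) T B" for S T A B
  proof -
    have "(8 + 16 * tail_const (2 powr \<delta>)) * (C0 * A * (C0 * B)) = D * (A * B)"
      by (simp add: D_def power2_eq_square)
    with brak_test_bound[OF K \<delta>(1,2) that(1) C0(2)[OF that(1,2)] that(3) C0(2)[OF that(3,4)]]
    show ?thesis unfolding \<delta>(3) by simp
  qed
  have fin: "test_bound (- 1 - \<delta>) T (enn2real (real_norm (- 1 - \<delta>) T)) \<and> ennreal (enn2real (real_norm (-
      1 - \<delta>) T)) = real_norm (- 1 - \<delta>) T"
    if "test_bound (- 1 - \<delta>) T A" for T A
  proof -
    have "real_norm (- 1 - \<delta>) T < \<infinity>" using real_norm_le[OF that] by (simp add: le_less_trans[OF _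
        ennreal_less_top])
    then show ?thesis using real_norm_test_bound by simp
  qed
  have "theta_estimate \<kappa> (8 * D) W \<theta>" if W: "regular_noise W" and \<theta>: "theta_limit K \<rho> W \<theta>" for W \<theta>
    unfolding theta_estimate_def \<delta>_def[symmetric]
  proof (intro allI impI)
    fix \<epsilon> :: real and j :: 3 assume \<epsilon>: "0 \<le> \<epsilon>"
    let ?S = "W (j + 1)" and ?T = "W (j + 2)"
    let ?S' = "mollified_dist \<rho> \<epsilon> ?S" and ?T' = "mollified_dist \<rho> \<epsilon> ?T"
    have d: "distribution ?S" "distribution ?T" "distribution ?S'" "distribution ?T'"
      using W distribution_mollified[OF \<rho> _ \<epsilon>] by (auto simp: regular_noise_def)
    define A where "A = enn2real (real_norm (- 1 - \<delta>) ?S)"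
    define B where "B = enn2real (real_norm (- 1 - \<delta>) ?T)"
    have tA: "test_bound (- 1 - \<delta>) ?S A" and tB: "test_bound (- 1 - \<delta>) ?T B"
      unfolding A_def B_def using W \<delta>(1,4) by (auto simp: regular_noise_def intro!: real_norm_test_bound)
    have eA: "real_norm (- 1 - \<delta>) ?S = ennreal A" and eB: "real_norm (- 1 - \<delta>) ?T = ennreal B"
      using fin[OF tA] fin[OF tB] by (auto simp: A_def B_def)
    have tA': "test_bound (- 1 - \<delta>) ?S' A" and tB': "test_bound (- 1 - \<delta>) ?T' B"
      using test_bound_mollified_dist[OF \<rho> _ _ \<epsilon>] d tA tB by auto
    define A' where "A' = enn2real (real_norm (- 1 - \<delta>) (dist_diff ?S' ?S))"
    define B' where "B' = enn2real (real_norm (- 1 - \<delta>) (dist_diff ?T' ?T))"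
    have dA: "test_bound (- 1 - \<delta>) (dist_diff ?S' ?S) A'" "real_norm (- 1 - \<delta>) (dist_diff ?S' ?S) =
        ennreal A'"
      using fin[OF test_bound_diff[OF tA' tA]] by (auto simp: A'_def)
    have dB: "test_bound (- 1 - \<delta>) (dist_diff ?T' ?T) B'" "real_norm (- 1 - \<delta>) (dist_diff ?T' ?T) =
        ennreal B'"
      using fin[OF test_bound_diff[OF tB' tB]] by (auto simp: B'_def)
    have nn: "0 \<le> A" "0 \<le> B" "0 \<le> A'" "0 \<le> B'" by (simp_all add: A_def B_def A'_def B'_def)
    have dd: "distribution (dist_diff ?S' ?S)" "distribution (dist_diff ?T' ?T)"
      by (intro distribution_dist_diff d)+
    have "complex_norm (- \<kappa>) (theta_ext K \<rho> W \<theta> \<epsilon> j) \<le> ennreal (8 * (D * (A * B)))"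
      by (rule complex_norm_imaginary_le[OF _ bb[OF d(3) tA' d(4) tB']])
         (simp add: theta_ext_eq[OF W \<theta> _ \<epsilon>] cbrak_def)
    also have "\<dots> = ennreal (8 * D) * real_norm (- 1 - \<delta>) ?S * real_norm (- 1 - \<delta>) ?T"
      unfolding eA eB using nn D by (simp add: ennreal_mult[symmetric] mult_ac)
    finally have 1: "complex_norm (- \<kappa>) (theta_ext K \<rho> W \<theta> \<epsilon> j)
      \<le> ennreal (8 * D) * real_norm (- 1 - \<delta>) ?S * real_norm (- 1 - \<delta>) ?T" .
    \<comment> \<open>Difference of two products with one factor exchanged at a time; the mollified
      factor \<open>?T'\<close> that remains is bounded by the norm \<open>B\<close> of
      \<open>?T\<close> itself.\<close>
    let ?d = "\<lambda>\<phi>. brak K (dist_diff ?S' ?S) ?T' \<phi> + brak K ?S (dist_diff ?T' ?T) \<phi>"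
    have "test_bound (- \<kappa>) ?d (D * (A' * B) + D * (A * B'))"
      using bb[OF dd(1) dA(1) d(4) tB'] bb[OF d(1) tA dd(2) dB(1)] unfolding test_bound_def
      by (auto simp: distrib_right intro!: order_trans[OF abs_triangle_ineq] add_mono)
    then have "complex_norm (- \<kappa>) (dist_diff (theta_ext K \<rho> W \<theta> \<epsilon> j) (\<theta> j)) \<le> ennreal (8 * (D * (A' * B)
        + D * (A * B')))"
    proof (rule complex_norm_imaginary_le[rotated])
      fix \<phi> :: "real^2 \<Rightarrow> real" assume \<phi>: "\<phi> \<in> smooth_torus"
      have "brak K (dist_diff ?S' ?S) ?T' \<phi> = brak K ?S' ?T' \<phi> - brak K ?S ?T' \<phi>"
        by (rule brak_diff_left[OF K q d(3) C0(2)[OF d(3) tA'] d(1) C0(2)[OF d(1) tA] d(4) C0(2)[OF d(4)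
            tB'] \<phi>])
      moreover have "brak K ?S (dist_diff ?T' ?T) \<phi> = brak K ?S ?T' \<phi> - brak K ?S ?T \<phi>"
        by (rule brak_diff_right[OF K q d(1) C0(2)[OF d(1) tA] d(4) C0(2)[OF d(4) tB'] d(2) C0(2)[OF
            d(2) tB] \<phi>])
      ultimately have eq: "?d \<phi> = brak K ?S' ?T' \<phi> - brak K ?S ?T \<phi>" by simp
      show "dist_diff (theta_ext K \<rho> W \<theta> \<epsilon> j) (\<theta> j) \<phi> = 8 * \<i> * complex_of_real (?d \<phi>)"
        unfolding eq
        by (simp add: dist_diff_def theta_ext_eq[OF W \<theta> \<phi> \<epsilon>] theta_limit_unique[OF W \<theta> \<phi>] cbrak_def
            right_diff_distrib)
    qed
    also have "ennreal (8 * (D * (A' * B) + D * (A * B'))) = ennreal (8 * D) * (ennreal A' * ennreal B +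
        ennreal B' * ennreal A)"
      using nn D by (simp add: ennreal_mult[symmetric] ennreal_plus[symmetric] algebra_simps del:
          ennreal_plus)
    finally show "complex_norm (- \<kappa>) (theta_ext K \<rho> W \<theta> \<epsilon> j)
      \<le> ennreal (8 * D) * real_norm (- 1 - \<delta>) ?S * real_norm (- 1 - \<delta>) ?T \<and>
      complex_norm (- \<kappa>) (dist_diff (theta_ext K \<rho> W \<theta> \<epsilon> j) (\<theta> j))
      \<le> ennreal (8 * D) * (real_norm (- 1 - \<delta>) (dist_diff ?S' ?S) * real_norm (- 1 - \<delta>) ?T +
          real_norm (- 1 - \<delta>) (dist_diff ?T' ?T) * real_norm (- 1 - \<delta>) ?S)"
      using 1 unfolding eA eB dA(2) dB(2) by simp
  qed
  then show ?thesis using D by (intro exI[of _ "8 * D"]) auto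
qed

text \<open>The smooth approximations are \<open>8 * \<i>\<close> times the Jacobians of the level
  \<open>n\<close> potentials; by \<open>brak_approx_test_bound\<close> their distance to \<theta>
  decays geometrically.\<close>

lemma theta_in_E_space:
  assumes W: "regular_noise W" and \<theta>: "theta_limit K \<rho> W \<theta>" and \<kappa>: "0 < \<kappa>" "\<kappa> < 1 / 2"
  shows "\<theta> \<in> E_space (- \<kappa>)"
proof -
  have "\<theta> j \<in> little_space (- \<kappa>)" for j
    unfolding little_space_def
  proof (intro CollectI conjI allI impI)
    define \<delta> where "\<delta> = \<kappa> / 4"
    have \<delta>: "0 < \<delta>" "\<delta> < 1 / 8" "- (4 * \<delta>) = - \<kappa>" "\<delta> < 1" using \<kappa> by (auto simp: \<delta>_def)
    let ?S = "W (j + 1)" and ?T = "W (j + 2)" and ?q = "2 powr \<delta>"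
    have d: "distribution ?S" "distribution ?T" using W by (auto simp: regular_noise_def)
    obtain A where A: "pot_bound K ?q ?S A" using noise_pot_bound[OF \<delta>(1,4) W] by blast
    obtain B where B: "pot_bound K ?q ?T B" using noise_pot_bound[OF \<delta>(1,4) W] by blast
    have \<theta>_eq: "\<theta> j \<phi> = 8 * \<i> * complex_of_real (brak K ?S ?T \<phi>)" if "\<phi> \<in> smooth_torus" for \<phi>
      using theta_limit_unique[OF W \<theta> that] by (simp add: cbrak_def)
    show "distribution (\<theta> j)" using \<theta> by (simp add: theta_limit_def)
    have "complex_norm (- \<kappa>) (\<theta> j) \<le> ennreal (8 * ((8 + 16 * tail_const ?q) * (A * B)))"
      by (rule complex_norm_imaginary_le[OF \<theta>_eq])
         (use brak_test_bound[OF K \<delta>(1,2) d(1) A d(2) B] in \<open>simp_all add: \<delta>(3)\<close>)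
    then show "complex_norm (- \<kappa>) (\<theta> j) < \<infinity>" by (simp add: le_less_trans[OF _ ennreal_less_top])
    fix e :: real assume e: "0 < e"
    let ?c = "(16 + 16 * tail_const ?q) * (A * B)"
    have "(2 ^ n) powr (- 2 * \<delta>) = (2 powr (- 2 * \<delta>)) ^ n" for n :: nat
      by (simp add: powr_powr mult_ac flip: powr_realpow)
    moreover have "2 powr (- 2 * \<delta>) < 2 powr 0" using \<delta> by (intro powr_less_mono) auto
    ultimately have "(\<lambda>n. 8 * (?c * (2 ^ n) powr (- 2 * \<delta>))) \<longlonglongrightarrow> 8 * (?c * 0)"
      by (intro tendsto_mult tendsto_const) (simp add: LIMSEQ_power_zero)
    then have "\<forall>\<^sub>F n in sequentially. 8 * (?c * (2 ^ n) powr (- 2 * \<delta>)) < e"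
      using e by (intro order_tendstoD) auto
    then obtain n where n: "8 * (?c * (2 ^ n) powr (- 2 * \<delta>)) < e" by (auto simp: eventually_sequentially)
    let ?a = "grad (pot K ?S n)" and ?b = "grad (pot K ?T n)"
    let ?F = "\<lambda>x. ?a 1 x * ?b 2 x - ?a 2 x * ?b 1 x"
    have F: "?F \<in> smooth_torus"
      unfolding grad_def by (intro smooth_torus_diff smooth_torus_mult partial_smooth_torus
          pot_smooth_torus K d)
    have bl: "bounded_linear (\<lambda>t. 8 * \<i> * complex_of_real t)"
      by (intro bounded_linear_const_mult bounded_linear_of_real)
    have g: "(\<lambda>x. 8 * \<i> * complex_of_real (?F x)) \<in> smooth_torus"
      by (rule smooth_torusI[OF smooth_bounded_linear[OF bl smooth_torusD(1)[OF F]] periodic2_compose[OF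
          smooth_torusD(2)[OF F]]])
    have "complex_norm (- \<kappa>) (dist_diff (\<theta> j) (dist_of (\<lambda>x. 8 * \<i> * complex_of_real (?F x)))) \<le> ennreal
        (8 * (?c * (2 ^ n) powr (- 2 * \<delta>)))"
    proof (rule complex_norm_imaginary_le)
      show "test_bound (- \<kappa>) (\<lambda>\<phi>. brak K ?S ?T \<phi> - jac_form \<phi> ?a ?b) (?c * (2 ^ n) powr (- 2 * \<delta>))"
        using brak_approx_test_bound[OF K \<delta>(1,2) d(1) A d(2) B, of n] by (simp add: \<delta>(3))
      fix \<phi> :: "real^2 \<Rightarrow> real" assume \<phi>: "\<phi> \<in> smooth_torus"
      show "dist_diff (\<theta> j) (dist_of (\<lambda>x. 8 * \<i> * complex_of_real (?F x))) \<phi> = 8 * \<i> * complex_of_real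
          (brak K ?S ?T \<phi> - jac_form \<phi> ?a ?b)"
        unfolding dist_diff_def \<theta>_eq[OF \<phi>] dist_of_imaginary jac_form_def by (simp add: right_diff_distrib)
    qed
    also have "\<dots> < ennreal e" using n e by (simp add: ennreal_lessI)
    finally show "\<exists>g\<in>smooth_torus. complex_norm (- \<kappa>) (dist_diff (\<theta> j) (dist_of g)) < ennreal e"
      using g by blast
  qed
  then show ?thesis by (simp add: E_space_def)
qed

end

section \<open>Norms from dyadic convolutions\<close>

text \<open>For \<open>c \<ge> 1\<close> the rescaled kernel lives in the unit ball, so the number
  of lattice translates contributing at a point is bounded independently of
  \<open>c\<close>.\<close>

lemma scaled_kernel_sup_bound:
  assumes \<psi>: "continuous_on UNIV \<psi>" "{x. \<psi> x \<noteq> 0} \<subseteq> cball 0 (1 / 2)"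
  shows "\<exists>B\<ge>0. \<forall>c\<ge>1. \<forall>x. \<bar>scaled_kernel c \<psi> x\<bar> \<le> B"
proof -
  have bd: "bounded {x. \<psi> x \<noteq> 0}" using \<psi>(2) bounded_cball bounded_subset by blast
  obtain b where b: "0 \<le> b" "\<And>x. \<bar>\<psi> x\<bar> \<le> b" using bounded_support_bounded[OF \<psi>(1) bd] by blast
  let ?N = "{n. \<exists>x\<in>torus. x + lattice_vec n \<in> cball (0 :: real^2) 1}"
  have N: "finite ?N" by (rule finite_bounded_lattice[OF bounded_cball compact_imp_bounded[OF compact_torus]])
  have "\<bar>scaled_kernel c \<psi> x\<bar> \<le> real (card ?N) * b" if c: "1 \<le> c" for c x
  proof -
    have supp: "y \<in> cball 0 1" if "\<psi> (c *\<^sub>R y) \<noteq> 0" for y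
    proof -
      have "c * norm y \<le> 1 / 2" using \<psi>(2) that c by (force simp: subset_iff)
      moreover have "1 * norm y \<le> c * norm y" using c by (intro mult_right_mono) auto
      ultimately show ?thesis by simp
    qed
    have on_torus: "\<bar>scaled_kernel c \<psi> y\<bar> \<le> real (card ?N) * b" if y: "y \<in> torus" for y
    proof -
      have "scaled_kernel c \<psi> y = (\<Sum>n\<in>?N. \<psi> (c *\<^sub>R (y + lattice_vec n)))"
        unfolding scaled_kernel_def by (rule periodize_sum[OF N]) (use supp y in blast)
      also have "\<bar>\<dots>\<bar> \<le> (\<Sum>n\<in>?N. b)" by (rule order_trans[OF sum_abs sum_mono]) (rule b(2))
      finally show ?thesis by simp
    qed
    obtain n where "x + lattice_vec n \<in> torus" using exists_lattice_torus by blast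
    from on_torus[OF this] show ?thesis
      unfolding scaled_kernel_def by (simp only: periodic2_lattice[OF periodic2_periodize])
  qed
  then show ?thesis using b(1) by (intro exI[of _ "real (card ?N) * b"]) auto
qed

text \<open>Coordinates run up to 4, just beyond pi, so that the grid covers \<open>torus\<close>.
  The mesh is the \<open>M\<close>-th power of the scale \<open>1 / 2 ^ n\<close>, with
  \<open>M\<close> still free.\<close>

definition dyadic_grid :: "nat \<Rightarrow> nat \<Rightarrow> (real^2) set" where
  "dyadic_grid M n = (\<lambda>(p, q). vector [of_int p / 2 ^ (M * n), of_int q / 2 ^ (M * n)]) `
     ({- (4 * 2 ^ (M * n))..4 * 2 ^ (M * n)} \<times> {- (4 * 2 ^ (M * n))..4 * 2 ^ (M * n) :: int})"

lemma finite_dyadic_grid: "finite (dyadic_grid M n)"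
  by (simp add: dyadic_grid_def)

lemma card_dyadic_grid_le: "real (card (dyadic_grid M n)) \<le> 81 * 4 ^ (M * n)"
proof -
  let ?m = "2 ^ (M * n) :: int"
  have "card (dyadic_grid M n) \<le> card ({- (4 * ?m)..4 * ?m} \<times> {- (4 * ?m)..4 * ?m})"
    unfolding dyadic_grid_def by (rule card_image_le) simp
  also have "\<dots> = nat (8 * ?m + 1) * nat (8 * ?m + 1)" by (simp add: card_cartesian_product)
  finally have "real (card (dyadic_grid M n)) \<le> real (nat (8 * ?m + 1)) * real (nat (8 * ?m + 1))"
    by (metis of_nat_le_iff of_nat_mult)
  also have "real (nat (8 * ?m + 1)) = 8 * 2 ^ (M * n) + 1" by simp
  also have "(8 * 2 ^ (M * n) + 1) * (8 * 2 ^ (M * n) + 1) \<le> (9 * 2 ^ (M * n)) * (9 * 2 ^ (M * n) :: real)"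
    by (intro mult_mono) auto
  also have "\<dots> = 81 * 4 ^ (M * n)" by (simp flip: power_mult_distrib)
  finally show ?thesis .
qed

lemma dyadic_grid_near:
  assumes "x \<in> torus" shows "\<exists>g\<in>dyadic_grid M n. norm (x - g) \<le> 2 / 2 ^ (M * n)"
proof -
  let ?m = "2 ^ (M * n) :: real"
  define g where "g = grid_round (1 / ?m) x"
  have "- (4 * 2 ^ (M * n)) \<le> \<lfloor>x $ i * ?m\<rfloor> \<and> \<lfloor>x $ i * ?m\<rfloor> \<le> 4 * 2 ^ (M * n)" for i
  proof -
    have "- pi \<le> x $ i" "x $ i \<le> pi" using assms by (auto simp: torus_def mem_box_cart)
    then have "- 4 \<le> x $ i" "x $ i \<le> 4" using pi_less_4 by linarith+
    then have "- 4 * ?m \<le> x $ i * ?m" "x $ i * ?m \<le> 4 * ?m" by (intro mult_right_mono; simp)+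
    then have "- (4 * ?m) \<le> x $ i * ?m" "x $ i * ?m < 4 * ?m + 1" by linarith+
    then show ?thesis by (simp only: le_floor_iff floor_le_iff) simp
  qed
  then have "g \<in> dyadic_grid M n"
    unfolding dyadic_grid_def
    by (intro image_eqI[of _ _ "(\<lfloor>x $ 1 * ?m\<rfloor>, \<lfloor>x $ 2 * ?m\<rfloor>)"]) (auto simp: g_def grid_round_def
        vec_eq_iff forall_2)
  then show ?thesis using norm_grid_round_le[of "1 / ?m" x] by (intro bexI[of _ g]) (auto simp: g_def)
qed

text \<open>Up to \<open>N\<close> powers of \<open>c\<close> come from the derivatives and two from
  the normalisation.\<close>

lemma mollifier_at_partials_bound:
  assumes \<psi>: "smooth \<psi>" "{x. \<psi> x \<noteq> 0} \<subseteq> cball 0 (1 / 2)"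
  shows "\<exists>B\<ge>0. \<forall>c\<ge>1. \<forall>x is. length is \<le> N \<longrightarrow> \<bar>partials is (mollifier_at \<psi> c) x\<bar> \<le> B * c ^ (N + 2)"
proof -
  have bd: "bounded {x. \<psi> x \<noteq> 0}" using \<psi>(2) bounded_cball bounded_subset by blast
  have supp: "{x. partials is \<psi> x \<noteq> 0} \<subseteq> cball 0 (1 / 2)" for "is"
    using partials_support[OF \<psi>(1)] closure_minimal[OF \<psi>(2) closed_cball] by blast
  have "\<exists>B\<ge>0. \<forall>is. length is \<le> N \<longrightarrow> (\<forall>c\<ge>1. \<forall>x. \<bar>scaled_kernel c (partials is \<psi>) x\<bar> \<le> B)"
  proof (rule uniform_bound_index_lists)
    show "\<exists>B\<ge>0. \<forall>c\<ge>1. \<forall>x. \<bar>scaled_kernel c (partials is \<psi>) x\<bar> \<le> B" for "is"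
      by (rule scaled_kernel_sup_bound[OF smooth_continuous[OF smooth_partials[OF \<psi>(1)]] supp])
  qed (meson order_trans)
  then obtain B where B: "0 \<le> B" "\<And>is c x. length is \<le> N \<Longrightarrow> 1 \<le> c \<Longrightarrow> \<bar>scaled_kernel c (partials is \<psi>) x\<bar> \<le> B"
    by blast
  have "\<bar>partials is (mollifier_at \<psi> c) x\<bar> \<le> B * c ^ (N + 2)" if c: "1 \<le> c" and len: "length is \<le> N" for
      c x "is"
  proof -
    have "smooth (scaled_kernel c \<psi>)" using c by (intro smooth_torusD scaled_kernel_smooth_torus \<psi> bd) simp
    then have "partials is (mollifier_at \<psi> c) x = c\<^sup>2 * (c ^ length is * scaled_kernel c (partials is \<psi>) x)"
      using c unfolding mollifier_at_def[abs_def] by (simp add: partials_cmult partials_scaled_kernel[OF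
          \<psi>(1) bd])
    then have "\<bar>partials is (mollifier_at \<psi> c) x\<bar> = c ^ (length is + 2) * \<bar>scaled_kernel c (partials is \<psi>) x\<bar>"
      using c by (simp add: abs_mult power_add power2_eq_square)
    also have "\<dots> \<le> c ^ (N + 2) * B"
      using c len B by (intro mult_mono power_increasing) auto
    finally show ?thesis by (simp add: mult.commute)
  qed
  then show ?thesis using B(1) by blast
qed

text \<open>The order of the distribution is finite but not known beforehand. It controls the
  gradient of the convolution by some power of \<open>2 ^ n\<close>, and a grid refined by the same
  power leaves a bounded error between its points; hence the hypothesis for every
  \<open>M\<close>.\<close>

lemma grid_to_uniform:
  assumes T: "distribution (T :: real functional)" and \<psi>: "smooth \<psi>" "{x. \<psi> x \<noteq> 0} \<subseteq> cball 0 (1 / 2)"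
    and grid: "\<And>M. \<exists>C. \<forall>n. \<forall>x\<in>dyadic_grid M n. \<bar>dist_conv T (mollifier_at \<psi> (2 ^ n)) x\<bar> \<le> C * real (n +
        1) * 2 ^ n"
  shows "\<exists>C\<ge>0. \<forall>n x. \<bar>dist_conv T (mollifier_at \<psi> (2 ^ n)) x\<bar> \<le> C * real (n + 1) * 2 ^ n"
proof -
  have bd: "bounded {x. \<psi> x \<noteq> 0}" using \<psi>(2) bounded_cball bounded_subset by blast
  obtain N C where C: "0 \<le> C" "\<forall>f\<in>smooth_torus. \<forall>b. (\<forall>is x. length is \<le> N \<longrightarrow> \<bar>partials is f x\<bar> \<le> b) \<longrightarrow>
      norm (T f) \<le> C * b"
    using distribution_bound[OF T] by blast
  obtain B where B: "0 \<le> B" "\<And>c x is. 1 \<le> c \<Longrightarrow> length is \<le> N + 1 \<Longrightarrow> \<bar>partials is (mollifier_at \<psi> c) x\<bar> \<le> B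
      * c ^ (N + 3)"
    using mollifier_at_partials_bound[OF \<psi>, of "N + 1"] by (auto simp: numeral_eq_Suc)
  \<comment> \<open>\<open>N + 3\<close> counts the \<open>N\<close> derivatives seen by
    \<open>T\<close>, one more for the gradient and two for the normalisation of the kernel.\<close>
  obtain D where D: "\<And>n x. x \<in> dyadic_grid (N + 3) n \<Longrightarrow> \<bar>dist_conv T (mollifier_at \<psi> (2 ^ n)) x\<bar> \<le> D *
      real (n + 1) * 2 ^ n"
    using grid[of "N + 3"] by blast
  have "\<bar>dist_conv T (mollifier_at \<psi> (2 ^ n)) x\<bar> \<le> (\<bar>D\<bar> + 4 * C * B) * real (n + 1) * 2 ^ n" for n x
  proof -
    let ?F = "dist_conv T (mollifier_at \<psi> (2 ^ n))" and ?c = "2 ^ n :: real"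
    have m: "mollifier_at \<psi> ?c \<in> smooth_torus" by (rule mollifier_at_smooth_torus[OF \<psi>(1) bd]) simp
    have F: "?F \<in> smooth_torus" by (rule dist_conv_smooth_torus[OF T m])
    have "\<bar>partial i ?F y\<bar> \<le> C * (B * ?c ^ (N + 3))" for i y
    proof -
      have pm: "partial i (mollifier_at \<psi> ?c) \<in> smooth_torus" by (rule partial_smooth_torus[OF m])
      have "norm (T (\<lambda>z. partial i (mollifier_at \<psi> ?c) (y - z))) \<le> C * (B * ?c ^ (N + 3))"
      proof (rule C(2)[rule_format, OF smooth_torus_reflect[OF pm]])
        fix "is" :: "2 list" and z assume "length is \<le> N"
        then have "\<bar>partials (is @ [i]) (mollifier_at \<psi> ?c) (y - z)\<bar> \<le> B * ?c ^ (N + 3)" by (intro B(2)) auto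
        then show "\<bar>partials is (\<lambda>z. partial i (mollifier_at \<psi> ?c) (y - z)) z\<bar> \<le> B * ?c ^ (N + 3)"
          by (simp add: partials_reflect[OF smooth_torusD(1)[OF pm]] partials_append abs_mult power_abs)
      qed
      then show ?thesis by (simp add: partial_dist_conv[OF T m] dist_conv_def)
    qed
    note lip = lipschitz_of_partials_bound[OF smooth_torusD(1)[OF F] this]
    have on_torus: "\<bar>?F y\<bar> \<le> (\<bar>D\<bar> + 4 * C * B) * real (n + 1) * 2 ^ n" if y: "y \<in> torus" for y
    proof -
      obtain g where g: "g \<in> dyadic_grid (N + 3) n" "norm (y - g) \<le> 2 / 2 ^ ((N + 3) * n)"
        using dyadic_grid_near[OF y] by blast
      have "\<bar>?F y - ?F g\<bar> \<le> 2 * (C * (B * ?c ^ (N + 3))) * (2 / 2 ^ ((N + 3) * n))"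
        using order_trans[OF lip[of y g] mult_left_mono[OF g(2)]] C(1) B(1) by simp
      also have "\<dots> = 4 * C * B" by (simp add: mult.commute[of n] flip: power_mult)
      finally have "\<bar>?F y\<bar> \<le> D * real (n + 1) * 2 ^ n + 4 * C * B * 1" using D[OF g(1)] by linarith
      also have "\<dots> \<le> \<bar>D\<bar> * (real (n + 1) * 2 ^ n) + 4 * C * B * (real (n + 1) * 2 ^ n)"
        using C(1) B(1) mult_mono[of 1 "real (n + 1)" 1 "2 ^ n :: real"]
        by (intro add_mono mult_left_mono) (auto simp: mult.assoc intro!: mult_right_mono)
      finally show ?thesis by (simp add: algebra_simps)
    qed
    obtain k where "x + lattice_vec k \<in> torus" using exists_lattice_torus by blast
    from on_torus[OF this] show ?thesis by (simp only: periodic2_lattice[OF smooth_torusD(2)[OF F]])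
  qed
  then show ?thesis using C(1) B(1) by (intro exI[of _ "\<bar>D\<bar> + 4 * C * B"]) auto
qed

lemma linear_le_geometric:
  assumes "1 < (q :: real)" shows "\<exists>C\<ge>0. \<forall>n. real (n + 1) \<le> C * q ^ n"
proof -
  have "real (n + 1) \<le> (1 + 1 / (q - 1)) * q ^ n" for n
  proof -
    have "1 + real n * (q - 1) \<le> (1 + (q - 1)) ^ n" using assms by (intro Bernoulli_inequality) auto
    then have "real n * (q - 1) \<le> q ^ n" by simp
    then have "real n \<le> q ^ n / (q - 1)" using assms by (simp add: pos_le_divide_eq)
    moreover have "1 \<le> q ^ n" using assms by simp
    ultimately show ?thesis by (simp add: algebra_simps)
  qed
  then show ?thesis using assms by (intro exI[of _ "1 + 1 / (q - 1)"]) auto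
qed

lemma laplacian_conv_swap:
  fixes u h :: "real^2 \<Rightarrow> real"
  assumes u: "u \<in> smooth_torus" and h: "h \<in> smooth_torus"
  shows "dist_conv (dist_of (laplacian u)) h = dist_conv (dist_of u) (laplacian h)"
proof -
  note cp = smooth_torus_continuous smooth_torusD(2)
  have D: "distribution (dist_of f)" if "f \<in> smooth_torus" for f :: "real^2 \<Rightarrow> real"
    by (rule distribution_dist_of[OF set_integrable_torus[OF smooth_torus_continuous[OF that]]])
  have "dist_conv (dist_of (laplacian u)) h = dist_conv (dist_of h) (laplacian u)"
    by (intro conv_commute cp laplacian_smooth_torus u h)
  also have "\<dots> = laplacian (dist_conv (dist_of h) u)" by (rule laplacian_dist_conv[OF D[OF h] u])
  also have "dist_conv (dist_of h) u = dist_conv (dist_of u) h" by (intro conv_commute cp u h)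
  also have "laplacian \<dots> = dist_conv (dist_of u) (laplacian h)" by (rule laplacian_dist_conv[OF D[OF u]
      h, symmetric])
  finally show ?thesis .
qed

lemma abs_conv_le':
  fixes f g :: "real^2 \<Rightarrow> real"
  assumes "f \<in> smooth_torus" "g \<in> smooth_torus" "\<And>x. \<bar>f x\<bar> \<le> b"
  shows "\<bar>dist_conv (dist_of f) g x\<bar> \<le> b * (LINT x:torus|lborel. \<bar>g x\<bar>)"
proof -
  have "dist_conv (dist_of f) g = dist_conv (dist_of g) f"
    by (intro conv_commute smooth_torus_continuous smooth_torusD(2) assms)
  then show ?thesis
    using abs_conv_le[OF set_integrable_torus[OF smooth_torus_continuous[OF assms(2)]]
        smooth_torus_continuous[OF assms(1)] assms(3)]
    by (simp add: mult.commute)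
qed

text \<open>Telescope \<open>delta_at n * T\<close> in \<open>n\<close> down to the scale of the test function; each increment is
  a Laplacian, which is moved onto the test function.\<close>

lemma real_norm_finite_of_dyadic:
  assumes T: "distribution (T :: real functional)" and \<delta>: "0 < \<delta>" "\<delta> < 1" and C: "0 \<le> C"
    and delta: "\<And>n x. \<bar>dist_conv T (mollifier_at delta_kernel (2 ^ n)) x\<bar> \<le> C * (2 * 2 powr \<delta>) ^ n"
    and step: "\<And>n x. \<bar>dist_conv T (mollifier_at step_kernel (2 ^ n)) x\<bar> \<le> C * (2 * 2 powr \<delta>) ^ n"
  shows "real_norm (- 1 - \<delta>) T < \<infinity>"
proof -
  define q where "q = 2 powr \<delta>"
  have q: "1 \<le> q" "q < 2"
    using \<delta> powr_less_mono[of \<delta> 1 2] by (auto simp: q_def ge_one_powr_ge_zero)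
  \<comment> \<open>\<open>4 * C\<close> bounds the term at the scale of the test. The rest is the
    tail with ratio \<open>q / 2\<close>: 32 is 8 from the mass of the Laplacian of the test times 4
    from squaring \<open>1 / l \<le> 2 * 2 ^ N\<close>.\<close>
  define E where "E = 4 * C + 32 * C / (1 - q / 2)"
  have E: "0 \<le> E" using C q by (simp add: E_def)
  have "test_bound (- 1 - \<delta>) T E"
    unfolding test_bound_def
  proof (intro conjI allI impI E)
    fix x :: "real^2" and l :: real and \<phi>
    assume l: "0 < l" "l \<le> 1" and \<phi>: "\<phi> \<in> unit_tests (nat \<lfloor>- (- 1 - \<delta>) + 1\<rfloor>)"
    \<comment> \<open>The order \<open>- 1 - \<delta>\<close> controls two derivatives of the test,
      enough for its Laplacian.\<close>
    have r: "2 \<le> nat \<lfloor>- (- 1 - \<delta>) + 1\<rfloor>" using \<delta> by (simp add: le_nat_iff le_floor_iff)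
    let ?t = "scaled_test \<phi> x l"
    let ?h = "\<lambda>y. ?t (- y)"
    have t: "?t \<in> smooth_torus" by (rule scaled_test_smooth_torus[OF \<phi> l(1)])
    have h: "?h \<in> smooth_torus" by (rule smooth_torus_uminus[OF t])
    have Th: "dist_conv T ?h \<in> smooth_torus" by (rule dist_conv_smooth_torus[OF T h])
    have mass0: "(LINT y:torus|lborel. \<bar>?h y\<bar>) \<le> 4"
      using torus_integral_reflect[of "\<lambda>y. \<bar>?t y\<bar>"] scaled_test_mass(1)[OF \<phi> l(1), of x]
        borel_measurable_abs[OF borel_measurable_continuous_onI[OF smooth_torus_continuous[OF t]]] by simp
    have mass2: "(LINT y:torus|lborel. \<bar>laplacian ?h y\<bar>) \<le> 8 / l\<^sup>2"
    proof -
      have c: "continuous_on UNIV (partial i (partial i ?t))" for i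
        by (intro smooth_torus_continuous partial_smooth_torus t)
      have cl: "continuous_on UNIV (laplacian ?t)" by (intro smooth_torus_continuous laplacian_smooth_torus t)
      have "partials [i, i] ?h y = partials [i, i] ?t (- y)" for i y
        using partials_reflect[OF smooth_torusD(1)[OF t], of "[i, i]" 0] by simp
      then have "laplacian ?h y = laplacian ?t (- y)" for y by (simp add: laplacian_def)
      then have "(LINT y:torus|lborel. \<bar>laplacian ?h y\<bar>) = (LINT y:torus|lborel. \<bar>laplacian ?t y\<bar>)"
        using torus_integral_reflect[of "\<lambda>y. \<bar>laplacian ?t y\<bar>"] borel_measurable_abs[OF
            borel_measurable_continuous_onI[OF cl]] by simp
      also have "\<dots> \<le> (LINT y:torus|lborel. \<bar>partial 1 (partial 1 ?t) y\<bar> + \<bar>partial 2 (partial 2 ?t) y\<bar>)"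
        by (intro set_integral_torus_mono set_integrable_torus continuous_intros c cl) (simp add: laplacian_2)
      also have "\<dots> = (LINT y:torus|lborel. \<bar>partial 1 (partial 1 ?t) y\<bar>) + (LINT y:torus|lborel.
          \<bar>partial 2 (partial 2 ?t) y\<bar>)"
        by (intro set_integral_add set_integrable_torus continuous_intros c)
      also have "\<dots> \<le> 4 / l\<^sup>2 + 4 / l\<^sup>2"
        using scaled_test_mass(3)[OF \<phi> l(1) r] by (intro add_mono)
      finally show ?thesis by simp
    qed
    define a where "a n = dist_conv (dist_of (delta_at n)) (dist_conv T ?h) 0" for n
    have D: "distribution (dist_of f)" if "f \<in> smooth_torus" for f :: "real^2 \<Rightarrow> real"
      by (rule distribution_dist_of[OF set_integrable_torus[OF smooth_torus_continuous[OF that]]])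
    have lap: "laplacian (step_at n) \<in> smooth_torus" for n by (rule laplacian_smooth_torus[OF
        step_at_smooth_torus])
    have inc: "\<bar>a (Suc n) - a n\<bar> \<le> (8 * C / l\<^sup>2) * (q / 2) ^ n" for n
    proof -
      let ?z = "dist_conv T (step_at n)"
      have z: "?z \<in> smooth_torus" by (rule dist_conv_smooth_torus[OF T step_at_smooth_torus])
      have "a (Suc n) - a n = dist_conv (dist_of (laplacian (step_at n))) (dist_conv T ?h) 0"
      proof -
        have "delta_at (Suc n) = (\<lambda>x. delta_at n x + laplacian (step_at n) x)"
          by (simp add: delta_at_Suc fun_eq_iff)
        moreover have "set_integrable lborel torus (\<lambda>y. dist_conv T ?h (0 - y) * f y)" if "f \<in>
            smooth_torus" for f
          by (intro set_integrable_torus continuous_intros continuous_reflect smooth_torus_continuous Th that)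
        ultimately show ?thesis
          using set_integral_add(2)[of lborel torus "\<lambda>y. dist_conv T ?h (0 - y) * delta_at n y" "\<lambda>y.
              dist_conv T ?h (0 - y) * laplacian (step_at n) y"]
            delta_at_smooth_torus lap by (simp add: a_def conv_dist_of distrib_left)
      qed
      also have "\<dots> = dist_conv (dist_of (dist_conv T (laplacian (step_at n)))) ?h 0"
        by (simp add: dist_conv_conv[OF T lap h])
      also have "\<dots> = dist_conv (dist_of ?z) (laplacian ?h) 0"
        by (simp add: laplacian_dist_conv[OF T step_at_smooth_torus] laplacian_conv_swap[OF z h])
      also have "\<bar>\<dots>\<bar> \<le> (C * (q / 2) ^ n) * (LINT y:torus|lborel. \<bar>laplacian ?h y\<bar>)"
      proof (rule abs_conv_le'[OF z laplacian_smooth_torus[OF h]])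
        fix y
        have "mollifier_at step_kernel (2 ^ n) = (\<lambda>x. (2 ^ n)\<^sup>2 * step_at n x)"
          by (simp add: mollifier_at_def step_at_def fun_eq_iff)
        then have "(2 ^ n)\<^sup>2 * \<bar>?z y\<bar> \<le> C * (2 * q) ^ n"
          using step[of n y] distribution_cmult[OF T smooth_torus_reflect[OF step_at_smooth_torus], of
              "(2 ^ n)\<^sup>2"]
          by (simp add: dist_conv_def abs_mult q_def)
        moreover have "C * (2 * q) ^ n = (2 ^ n)\<^sup>2 * (C * (q / 2) ^ n)"
          by (simp add: power_mult_distrib power_divide power2_eq_square)
        ultimately have "(2 ^ n)\<^sup>2 * \<bar>?z y\<bar> \<le> (2 ^ n)\<^sup>2 * (C * (q / 2) ^ n)" by (simp only:)
        then show "\<bar>?z y\<bar> \<le> C * (q / 2) ^ n" by (rule mult_left_le_imp_le) simp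
      qed
      also have "\<dots> \<le> (C * (q / 2) ^ n) * (8 / l\<^sup>2)"
        using C q mass2 by (intro mult_left_mono) auto
      finally show ?thesis by (simp add: mult_ac)
    qed
    have lim: "lim a = T ?t"
    proof -
      obtain L where L: "0 \<le> L" "\<And>c x. 0 < c \<Longrightarrow> \<bar>dist_conv (dist_of (mollifier_at delta_kernel c))
          (dist_conv T ?h) x - dist_conv T ?h x\<bar> \<le> L / c"
        using conv_scaled_approx[OF Th smooth_continuous[OF smooth_delta_kernel] delta_kernel_bounded
            integral_delta_kernel]
        unfolding mollifier_at_def[abs_def] by blast
      have Tt: "T ?t = dist_conv T ?h 0" by (rule dist_of_eq_conv)
      have b: "\<bar>a n - T ?t\<bar> \<le> L * (1 / 2) ^ n" for n
        using L(2)[of "2 ^ n" 0] by (simp add: a_def Tt delta_at_eq_mollifier power_divide)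
      have "(\<lambda>n. L * (1 / 2) ^ n) \<longlonglongrightarrow> L * 0" by (intro tendsto_mult tendsto_const LIMSEQ_power_zero) simp
      then have lim0: "(\<lambda>n. L * (1 / 2) ^ n) \<longlonglongrightarrow> 0" by simp
      have "(\<lambda>n. a n - T ?t) \<longlonglongrightarrow> 0"
        by (rule Lim_null_comparison[OF always_eventually lim0]) (use b in \<open>simp add:
            Real_Vector_Spaces.real_norm_def\<close>)
      then show ?thesis by (intro limI) (simp add: LIM_zero_iff)
    qed
    have "1 \<le> 1 / l" using l by simp
    then obtain N where N: "2 ^ N \<le> 1 / l" "1 / l < 2 ^ Suc N" using dyadic_scale by blast
    have 1: "\<bar>T ?t - a N\<bar> \<le> (8 * C / l\<^sup>2) / (1 - q / 2) * (q / 2) ^ N"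
      using geometric_increments_limit(2)[of a "8 * C / l\<^sup>2" "q / 2" N] inc q lim by simp
    have "1 / l\<^sup>2 = (1 / l) * (1 / l)" by (simp add: power2_eq_square)
    also have "\<dots> \<le> (2 * 2 ^ N) * (2 * 2 ^ N)" using N l by (intro mult_mono) auto
    finally have "(1 / l\<^sup>2) * (8 * C / (1 - q / 2) * (q / 2) ^ N) \<le> ((2 * 2 ^ N) * (2 * 2 ^ N)) * (8 * C
        / (1 - q / 2) * (q / 2) ^ N)"
      using C q by (intro mult_right_mono) auto
    also have "\<dots> = 32 * C / (1 - q / 2) * (2 * q) ^ N" by (simp add: power_divide power_mult_distrib)
    finally have 2: "(8 * C / l\<^sup>2) / (1 - q / 2) * (q / 2) ^ N \<le> 32 * C / (1 - q / 2) * (2 * q) ^ N" by simp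
    have "a N = dist_conv (dist_of (dist_conv T (delta_at N))) ?h 0"
      by (simp add: a_def dist_conv_conv[OF T delta_at_smooth_torus h])
    then have "\<bar>a N\<bar> \<le> (C * (2 * q) ^ N) * (LINT y:torus|lborel. \<bar>?h y\<bar>)"
      using abs_conv_le'[OF dist_conv_smooth_torus[OF T delta_at_smooth_torus] h, of N] delta by (simp
          add: delta_at_eq_mollifier q_def)
    also have "\<dots> \<le> (C * (2 * q) ^ N) * 4" using C q mass0 by (intro mult_left_mono) auto
    finally have "\<bar>T ?t\<bar> \<le> E * (2 * q) ^ N" using 1 2 unfolding E_def by (simp add: algebra_simps)
    also have "(2 * q) ^ N = (2 ^ N) powr (1 + \<delta>)"
      by (simp add: q_def powr_add power_mult_distrib powr_powr mult.commute flip: powr_realpow)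
    also have "E * (2 ^ N) powr (1 + \<delta>) \<le> E * (1 / l) powr (1 + \<delta>)"
      using E N \<delta> by (intro mult_left_mono powr_mono2) auto
    also have "(1 / l) powr (1 + \<delta>) = l powr (- 1 - \<delta>)"
      using l powr_minus_divide[of l "1 + \<delta>"] by (simp add: powr_divide)
    finally show "\<bar>T ?t\<bar> \<le> E * l powr (- 1 - \<delta>)" .
  qed
  from real_norm_le[OF this] show ?thesis by (simp add: le_less_trans[OF _ ennreal_less_top])
qed

text \<open>The factor \<open>n + 1\<close> is absorbed by the \<open>n\<close>-th power of
  \<open>2 powr \<delta>\<close> for every positive \<delta>, so one set of grid bounds yields all
  \<delta>.\<close>

lemma real_norm_finite_of_grid:
  assumes T: "distribution (T :: real functional)" and \<delta>: "0 < \<delta>" "\<delta> < 1"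
    and delta: "\<And>M. \<exists>C. \<forall>n. \<forall>x\<in>dyadic_grid M n. \<bar>dist_conv T (mollifier_at delta_kernel (2 ^ n)) x\<bar> \<le> C
        * real (n + 1) * 2 ^ n"
    and step: "\<And>M. \<exists>C. \<forall>n. \<forall>x\<in>dyadic_grid M n. \<bar>dist_conv T (mollifier_at step_kernel (2 ^ n)) x\<bar> \<le> C *
        real (n + 1) * 2 ^ n"
  shows "real_norm (- 1 - \<delta>) T < \<infinity>"
proof -
  define q where "q = 2 powr \<delta>"
  have q: "1 < q" using \<delta> by (simp add: q_def)
  obtain L where L: "0 \<le> L" "\<And>n. real (n + 1) \<le> L * q ^ n" using linear_le_geometric[OF q] by blast
  obtain C1 where C1: "0 \<le> C1" "\<And>n x. \<bar>dist_conv T (mollifier_at delta_kernel (2 ^ n)) x\<bar> \<le> C1 * real (n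
      + 1) * 2 ^ n"
    using grid_to_uniform[OF T smooth_delta_kernel delta_kernel_support delta] by blast
  obtain C2 where C2: "0 \<le> C2" "\<And>n x. \<bar>dist_conv T (mollifier_at step_kernel (2 ^ n)) x\<bar> \<le> C2 * real (n
      + 1) * 2 ^ n"
    using grid_to_uniform[OF T smooth_step_kernel step_kernel_support step] by blast
  have up: "A * real (n + 1) * 2 ^ n \<le> (C1 + C2) * L * (2 * q) ^ n" if "0 \<le> A" "A \<le> C1 + C2" for A n
  proof -
    have "A * real (n + 1) \<le> (C1 + C2) * (L * q ^ n)" using that L(1) L(2)[of n] q by (intro mult_mono) auto
    then have "A * real (n + 1) * 2 ^ n \<le> (C1 + C2) * (L * q ^ n) * 2 ^ n" by (intro mult_right_mono) auto
    then show ?thesis by (simp add: power_mult_distrib mult_ac)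
  qed
  show ?thesis
  proof (rule real_norm_finite_of_dyadic[OF T \<delta>, of "(C1 + C2) * L"])
    show "0 \<le> (C1 + C2) * L" using C1 C2 L by simp
    show "\<bar>dist_conv T (mollifier_at delta_kernel (2 ^ n)) x\<bar> \<le> (C1 + C2) * L * (2 * 2 powr \<delta>) ^ n" for n x
      using order_trans[OF C1(2) up] C1(1) C2(1) by (simp add: q_def)
    show "\<bar>dist_conv T (mollifier_at step_kernel (2 ^ n)) x\<bar> \<le> (C1 + C2) * L * (2 * 2 powr \<delta>) ^ n" for n x
      using order_trans[OF C2(2) up] C1(1) C2(1) by (simp add: q_def)
  qed
qed

section \<open>Exponential moments of white noise\<close>

text \<open>Differentiation shifts the sine by a quarter period, so a single formula gives the whole
  derivative sequence, with the cosine at index 1.\<close>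

definition trig_seq :: "nat \<Rightarrow> real \<Rightarrow> real" where
  "trig_seq n t = sin (t + real n * (pi / 2))"

lemma derivative_seq_trig: "derivative_seq trig_seq UNIV"
  unfolding derivative_seq_def
proof (intro allI ballI)
  fix n and t :: real
  have "((\<lambda>t. sin (t + real n * (pi / 2))) has_real_derivative cos (t + real n * (pi / 2))) (at t)"
    by (auto intro!: derivative_eq_intros)
  moreover have "cos (t + real n * (pi / 2)) = trig_seq (Suc n) t"
  proof -
    have eq: "t + real (Suc n) * (pi / 2) = (t + real n * (pi / 2)) + pi / 2" by (simp add:
        algebra_simps add_divide_distrib)
    show ?thesis unfolding trig_seq_def eq by (subst sin_add[of "t + real n * (pi / 2)" "pi / 2"]) simp
  qed
  ultimately show "(trig_seq n has_real_derivative trig_seq (Suc n) t) (at t)"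
    unfolding trig_seq_def[abs_def] by simp
qed

lemma trig_seq_0_1: "trig_seq 0 t = sin t" "trig_seq (Suc 0) t = cos t"
  by (simp_all add: trig_seq_def sin_add)

lemma smooth_freq: "smooth (freq k)"
  unfolding freq_def[abs_def] by (intro smooth_sum smooth_cmult smooth_coord) simp

lemma partial_freq: "partial i (freq k) = (\<lambda>x. of_int (k $ i))"
  unfolding freq_def[abs_def]
  by (subst partial_sum) (auto simp: partial_cmult smooth_coord partial_coord if_distrib intro!:
      smooth_cmult smooth_coord cong: if_cong)

lemma freq_shift: "freq k (x + axis i (2 * pi)) = freq k x + 2 * pi * of_int (k $ i)"
  by (simp add: freq_def UNIV_2 axis_def algebra_simps) (use exhaust_2[of i] in auto)

lemma freq_diff: "freq (l - k) x = freq l x - freq k x"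
  by (simp add: freq_def sum_subtractf algebra_simps)

lemma sin_freq_smooth_torus: "(\<lambda>x. sin (freq k x)) \<in> smooth_torus"
proof (rule smooth_torusI)
  show "smooth (\<lambda>x. sin (freq k x))"
    using smooth_compose[OF derivative_seq_trig smooth_freq, of k 0] by (simp add: trig_seq_0_1)
  show "periodic2 (\<lambda>x. sin (freq k x))"
    by (simp add: periodic2_def freq_shift sin_add sin_int_2pin cos_int_2pin)
qed

lemma cos_freq_smooth_torus: "(\<lambda>x. cos (freq k x)) \<in> smooth_torus"
proof (rule smooth_torusI)
  show "smooth (\<lambda>x. cos (freq k x))"
    using smooth_compose[OF derivative_seq_trig smooth_freq, of k 1] by (simp add: trig_seq_0_1)
  show "periodic2 (\<lambda>x. cos (freq k x))"
    by (simp add: periodic2_def freq_shift cos_add sin_int_2pin cos_int_2pin)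
qed

lemma partial_sin_freq: "partial i (\<lambda>x. sin (freq k x)) = (\<lambda>x. of_int (k $ i) * cos (freq k x))"
  using partial_compose[OF derivative_seq_trig smooth_freq, of k i 0] by (simp add: trig_seq_0_1
      partial_freq mult.commute)

lemma partial_cos_freq: "partial i (\<lambda>x. cos (freq k x)) = (\<lambda>x. (- of_int (k $ i)) * sin (freq k x))"
  using partial_compose[OF derivative_seq_trig smooth_freq, of k i 1]
  by (simp add: trig_seq_0_1 partial_freq mult.commute trig_seq_def[of "Suc (Suc 0)"] sin_add)

text \<open>Named as a functional so that the linearity rules for distributions apply to integrals
  of trigonometric sums.\<close>

definition tint :: "(real^2 \<Rightarrow> real) \<Rightarrow> real" where
  "tint g = (LINT x:torus|lborel. g x)"

lemma tint_distribution: "distribution (tint :: real functional)"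
proof -
  have "tint = dist_of (\<lambda>x. 1 :: real)" by (simp add: tint_def dist_of_def fun_eq_iff)
  then show ?thesis using distribution_dist_of[OF set_integrable_torus[OF continuous_on_const[of UNIV
      "1::real"]]] by simp
qed

text \<open>A nonzero mode is, up to a factor, a partial derivative of a periodic function.\<close>

lemma tint_trig_eq_0:
  assumes "k \<noteq> 0" shows "tint (\<lambda>x. cos (freq k x)) = 0" "tint (\<lambda>x. sin (freq k x)) = 0"
proof -
  obtain i where i: "k $ i \<noteq> 0" using assms by (auto simp: vec_eq_iff)
  show "tint (\<lambda>x. cos (freq k x)) = 0"
    using torus_integral_partial[OF sin_freq_smooth_torus, of i k] i by (simp add: partial_sin_freq tint_def)
  show "tint (\<lambda>x. sin (freq k x)) = 0"
    using torus_integral_partial[OF cos_freq_smooth_torus, of i k] i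
    unfolding partial_cos_freq tint_def set_integral_mult_right by simp
qed

lemma tint_nonneg: "(\<And>x. 0 \<le> g x) \<Longrightarrow> 0 \<le> tint g"
  unfolding tint_def set_lebesgue_integral_def by (rule integral_nonneg_AE) auto

definition fourier_cos :: "(real^2 \<Rightarrow> real) \<Rightarrow> int^2 \<Rightarrow> real" where
  "fourier_cos f k = tint (\<lambda>x. f x * cos (freq k x))"

definition fourier_sin :: "(real^2 \<Rightarrow> real) \<Rightarrow> int^2 \<Rightarrow> real" where
  "fourier_sin f k = tint (\<lambda>x. f x * sin (freq k x))"

text \<open>\<open>F\<close> may contain both \<open>k\<close> and \<open>- k\<close>, whose real
  modes are not orthogonal. So \<open>P\<close> is completed by \<open>R\<close> to a sum of complex
  exponentials, which are orthogonal, and dropping \<open>R\<close> leaves an inequality for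
  \<open>P\<close>.\<close>

lemma bessel_inequality:
  assumes f: "f \<in> smooth_torus" and F: "finite F"
  shows "(\<Sum>k\<in>F. (fourier_cos f k)\<^sup>2 + (fourier_sin f k)\<^sup>2) \<le> 4 * pi\<^sup>2 * tint (\<lambda>x. (f x)\<^sup>2)"
proof -
  define C where "C = fourier_cos f"
  define S where "S = fourier_sin f"
  define Q where "Q = (\<Sum>k\<in>F. (C k)\<^sup>2 + (S k)\<^sup>2)"
  define P where "P x = (\<Sum>k\<in>F. C k * cos (freq k x) + S k * sin (freq k x))" for x
  \<comment> \<open>\<open>P - \<i> * R\<close> is the sum of
    \<open>(C k - \<i> * S k) * cis (freq k x)\<close>; its squared modulus integrates to
    \<open>4 * pi\<^sup>2 * Q\<close>.\<close>
  define R where "R x = (\<Sum>k\<in>F. S k * cos (freq k x) - C k * sin (freq k x))" for x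
  note sm = cos_freq_smooth_torus sin_freq_smooth_torus
  have PR: "P \<in> smooth_torus" "R \<in> smooth_torus"
    unfolding P_def[abs_def] R_def[abs_def]
    by (intro smooth_torus_sum F smooth_torus_add smooth_torus_diff smooth_torus_cmult sm)+
  note add = distribution_add[OF tint_distribution] and cmult = distribution_cmult[OF tint_distribution]
    and diff = distribution_diff[OF tint_distribution]
  have fP: "tint (\<lambda>x. f x * P x) = Q"
  proof -
    have eq: "(\<lambda>x. f x * P x) = (\<lambda>x. \<Sum>k\<in>F. C k * (f x * cos (freq k x)) + S k * (f x * sin (freq k x)))"
      by (simp add: P_def sum_distrib_left algebra_simps)
    have "tint (\<lambda>x. f x * P x) = (\<Sum>k\<in>F. tint (\<lambda>x. C k * (f x * cos (freq k x)) + S k * (f x * sin (freq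
        k x))))"
      unfolding eq
      by (rule distribution_sum[OF F tint_distribution]) (intro smooth_torus_add smooth_torus_cmult
          smooth_torus_mult sm f)
    also have "\<dots> = Q"
      unfolding Q_def
    proof (rule sum.cong[OF refl])
      fix k
      have s: "(\<lambda>x. f x * cos (freq k x)) \<in> smooth_torus" "(\<lambda>x. f x * sin (freq k x)) \<in> smooth_torus"
        by (intro smooth_torus_mult sm f)+
      have "tint (\<lambda>x. C k * (f x * cos (freq k x)) + S k * (f x * sin (freq k x)))
          = tint (\<lambda>x. C k * (f x * cos (freq k x))) + tint (\<lambda>x. S k * (f x * sin (freq k x)))"
        by (rule add[OF smooth_torus_cmult[OF s(1)] smooth_torus_cmult[OF s(2)]])
      then show "tint (\<lambda>x. C k * (f x * cos (freq k x)) + S k * (f x * sin (freq k x))) = (C k)\<^sup>2 + (S k)\<^sup>2"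
        unfolding cmult[OF s(1)] cmult[OF s(2)] by (simp add: C_def S_def fourier_cos_def
            fourier_sin_def power2_eq_square)
    qed
    finally show ?thesis .
  qed
  have PP: "tint (\<lambda>x. P x * P x + R x * R x) = 4 * pi\<^sup>2 * Q"
  proof -
    let ?t = "\<lambda>k l x. (C k * C l + S k * S l) * cos (freq (l - k) x) + (C k * S l - S k * C l) * sin
        (freq (l - k) x)"
    have "P x * P x + R x * R x = (\<Sum>k\<in>F. \<Sum>l\<in>F. ?t k l x)" for x
      unfolding P_def R_def sum_product sum.distrib[symmetric]
      by (intro sum.cong refl) (simp add: freq_diff cos_diff sin_diff algebra_simps)
    then have "tint (\<lambda>x. P x * P x + R x * R x) = tint (\<lambda>x. \<Sum>k\<in>F. \<Sum>l\<in>F. ?t k l x)" by simp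
    also have "\<dots> = (\<Sum>k\<in>F. tint (\<lambda>x. \<Sum>l\<in>F. ?t k l x))"
      by (rule distribution_sum[OF F tint_distribution]) (intro smooth_torus_sum F smooth_torus_add
          smooth_torus_cmult sm)
    also have "\<dots> = (\<Sum>k\<in>F. \<Sum>l\<in>F. tint (?t k l))"
      by (intro sum.cong refl distribution_sum[OF F tint_distribution] smooth_torus_add smooth_torus_cmult sm)
    also have "\<dots> = (\<Sum>k\<in>F. \<Sum>l\<in>F. if l = k then 4 * pi\<^sup>2 * ((C k)\<^sup>2 + (S k)\<^sup>2) else 0)"
    proof (intro sum.cong refl)
      fix k l
      have "tint (?t k l) = (C k * C l + S k * S l) * tint (\<lambda>x. cos (freq (l - k) x)) + (C k * S l - S k
          * C l) * tint (\<lambda>x. sin (freq (l - k) x))"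
        using add[OF smooth_torus_cmult[OF sm(1)] smooth_torus_cmult[OF sm(2)], of "C k * C l + S k * S
            l" "l - k" "C k * S l - S k * C l" "l - k"]
        unfolding cmult[OF sm(1)] cmult[OF sm(2)] by simp
      moreover have "tint (\<lambda>x. 1) = 4 * pi\<^sup>2" unfolding tint_def by (simp add: set_integral_torus_const)
      ultimately show "tint (?t k l) = (if l = k then 4 * pi\<^sup>2 * ((C k)\<^sup>2 + (S k)\<^sup>2) else 0)"
        using tint_trig_eq_0[of "l - k"] by (auto simp: power2_eq_square freq_def tint_def)
    qed
    also have "\<dots> = 4 * pi\<^sup>2 * Q" using F by (simp add: Q_def sum_distrib_left)
    finally show ?thesis .
  qed
  \<comment> \<open>Minimises the upper bound, quadratic in \<open>a\<close>, for the integral of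
    \<open>(f - a * P)\<^sup>2\<close>.\<close>
  define a where "a = 1 / (4 * pi\<^sup>2)"
  have pp: "tint (\<lambda>x. P x * P x) \<le> 4 * pi\<^sup>2 * Q"
  proof -
    have "tint (\<lambda>x. P x * P x + R x * R x) = tint (\<lambda>x. P x * P x) + tint (\<lambda>x. R x * R x)"
      by (rule add) (intro smooth_torus_mult PR)+
    moreover have "0 \<le> tint (\<lambda>x. R x * R x)" by (rule tint_nonneg) simp
    ultimately show ?thesis using PP by simp
  qed
  have "0 \<le> tint (\<lambda>x. (f x - a * P x)\<^sup>2)" by (rule tint_nonneg) simp
  also have "(\<lambda>x. (f x - a * P x)\<^sup>2) = (\<lambda>x. ((f x)\<^sup>2 - (2 * a) * (f x * P x)) + a\<^sup>2 * (P x * P x))"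
    by (simp add: power2_eq_square algebra_simps)
  also have "tint \<dots> = tint (\<lambda>x. (f x)\<^sup>2 - (2 * a) * (f x * P x)) + a\<^sup>2 * tint (\<lambda>x. P x * P x)"
  proof -
    have "tint (\<lambda>x. a\<^sup>2 * (P x * P x)) = a\<^sup>2 *\<^sub>R tint (\<lambda>x. P x * P x)" by (rule cmult) (intro
        smooth_torus_mult PR)
    then show ?thesis
      by (subst add) (auto simp: power2_eq_square intro!: smooth_torus_diff smooth_torus_mult
          smooth_torus_cmult PR f smooth_torus_const)
  qed
  also have "tint (\<lambda>x. (f x)\<^sup>2 - (2 * a) * (f x * P x)) = tint (\<lambda>x. (f x)\<^sup>2) - (2 * a) * Q"
  proof -
    have "tint (\<lambda>x. (2 * a) * (f x * P x)) = (2 * a) *\<^sub>R tint (\<lambda>x. f x * P x)" by (rule cmult) (intro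
        smooth_torus_mult PR f)
    then show ?thesis
      by (subst diff) (auto simp: power2_eq_square fP intro!: smooth_torus_mult smooth_torus_cmult PR f
          smooth_torus_const)
  qed
  finally have "2 * a * Q \<le> tint (\<lambda>x. (f x)\<^sup>2) + a\<^sup>2 * tint (\<lambda>x. P x * P x)" by simp
  also have "\<dots> \<le> tint (\<lambda>x. (f x)\<^sup>2) + a\<^sup>2 * (4 * pi\<^sup>2 * Q)" by (intro add_left_mono mult_left_mono pp) simp
  also have "a\<^sup>2 * (4 * pi\<^sup>2 * Q) = a * Q" by (simp add: a_def power2_eq_square)
  finally have "a * Q \<le> tint (\<lambda>x. (f x)\<^sup>2)" by (simp add: mult.commute)
  then show ?thesis unfolding Q_def C_def S_def a_def by (simp add: field_simps)
qed

lemma nn_integral_gaussian_exp: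
  assumes "std_gaussian M X"
  shows "(\<integral>\<^sup>+\<omega>. ennreal (exp (t * X \<omega>)) \<partial>M) = ennreal (exp (t\<^sup>2 / 2))"
proof -
  have eq: "std_normal_density x * exp (t * x) = exp (t\<^sup>2 / 2) * normal_density t 1 x" for x
  proof -
    \<comment> \<open>Completing the square: the exponential factor moves the mean of the Gaussian
      to \<open>t\<close>.\<close>
    have "- x\<^sup>2 / 2 + t * x = t\<^sup>2 / 2 + (- (x - t)\<^sup>2 / 2)" by (simp add: power2_eq_square field_simps)
    then have "exp (- x\<^sup>2 / 2) * exp (t * x) = exp (t\<^sup>2 / 2) * exp (- (x - t)\<^sup>2 / 2)"
      by (simp only: exp_add[symmetric])
    then show ?thesis by (simp add: normal_density_def)
  qed
  interpret N: prob_space "density lborel (normal_density t 1)" by (rule prob_space_normal_density) simp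
  have one: "(\<integral>\<^sup>+x. ennreal (normal_density t 1 x) \<partial>lborel) = 1"
    using N.emeasure_space_1 by (simp add: emeasure_density)
  have "(\<integral>\<^sup>+\<omega>. ennreal (exp (t * X \<omega>)) \<partial>M) = (\<integral>\<^sup>+x. ennreal (std_normal_density x) * ennreal (exp (t *
      x)) \<partial>lborel)"
    by (rule distributed_nn_integral[OF assms[unfolded std_gaussian_def], symmetric]) measurable
  also have "\<dots> = (\<integral>\<^sup>+x. ennreal (exp (t\<^sup>2 / 2)) * ennreal (normal_density t 1 x) \<partial>lborel)"
    by (intro nn_integral_cong) (simp add: ennreal_mult[symmetric] eq)
  also have "\<dots> = ennreal (exp (t\<^sup>2 / 2))" by (simp add: nn_integral_cmult one)
  finally show ?thesis .
qed

lemma (in prob_space) nn_integral_complex_gaussian_exp: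
  assumes "std_complex_gaussian M X"
  shows "(\<integral>\<^sup>+\<omega>. ennreal (exp (a * Re (X \<omega>) + b * Im (X \<omega>))) \<partial>M) = ennreal (exp ((a\<^sup>2 + b\<^sup>2) / 2))"
proof -
  have iv: "indep_var borel (\<lambda>\<omega>. Re (X \<omega>)) borel (\<lambda>\<omega>. Im (X \<omega>))"
    and g: "std_gaussian M (\<lambda>\<omega>. Re (X \<omega>))" "std_gaussian M (\<lambda>\<omega>. Im (X \<omega>))"
    using assms by (auto simp: std_complex_gaussian_def)
  have "indep_var borel ((\<lambda>t. ennreal (exp (a * t))) \<circ> (\<lambda>\<omega>. Re (X \<omega>))) borel ((\<lambda>t. ennreal (exp (b *
      t))) \<circ> (\<lambda>\<omega>. Im (X \<omega>)))"
    by (rule indep_var_compose[OF iv]) measurable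
  then have "indep_vars (\<lambda>_. borel) (case_bool ((\<lambda>t. ennreal (exp (a * t))) \<circ> (\<lambda>\<omega>. Re (X \<omega>))) ((\<lambda>t.
      ennreal (exp (b * t))) \<circ> (\<lambda>\<omega>. Im (X \<omega>)))) UNIV"
    unfolding indep_var_def by (rule back_subst[of "\<lambda>N. indep_vars N _ _"]) (auto split: bool.split)
  from indep_vars_nn_integral[OF _ this]
  have "(\<integral>\<^sup>+\<omega>. ennreal (exp (a * Re (X \<omega>))) * ennreal (exp (b * Im (X \<omega>))) \<partial>M)
      = (\<integral>\<^sup>+\<omega>. ennreal (exp (a * Re (X \<omega>))) \<partial>M) * (\<integral>\<^sup>+\<omega>. ennreal (exp (b * Im (X \<omega>))) \<partial>M)"
    by (simp add: UNIV_bool mult.commute o_def)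
  then show ?thesis
    using nn_integral_gaussian_exp[OF g(1), of a] nn_integral_gaussian_exp[OF g(2), of b]
    by (simp add: ennreal_mult[symmetric] exp_add[symmetric] add_divide_distrib)
qed

definition freq_box :: "nat \<Rightarrow> (int^2) set" where
  "freq_box r = {k. k \<noteq> 0 \<and> (\<forall>i. \<bar>k $ i\<bar> \<le> int r)}"

lemma finite_freq_box: "finite (freq_box r)"
proof -
  have "freq_box r \<subseteq> (\<lambda>(p, q). vector [p, q]) ` ({- int r..int r} \<times> {- int r..int r})"
  proof
    fix k assume "k \<in> freq_box r"
    then have "\<bar>k $ i\<bar> \<le> int r" for i by (simp add: freq_box_def)
    then have "- int r \<le> k $ i \<and> k $ i \<le> int r" for i by (simp add: abs_le_iff minus_le_iff)
    then show "k \<in> (\<lambda>(p, q). vector [p, q]) ` ({- int r..int r} \<times> {- int r..int r})"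
      by (intro image_eqI[of _ _ "(k $ 1, k $ 2)"]) (auto simp: vec_eq_iff forall_2)
  qed
  then show ?thesis by (rule finite_subset) simp
qed

text \<open>Turns the unordered sum over the modes into the limit of a sequence, which measurability
  and Fatou's lemma call for.\<close>

lemma filterlim_freq_box: "filterlim freq_box (finite_subsets_at_top (UNIV - {0})) sequentially"
  unfolding filterlim_finite_subsets_at_top
proof (intro allI impI)
  fix X :: "(int^2) set" assume X: "finite X \<and> X \<subseteq> UNIV - {0}"
  define m where "m = nat (\<Sum>k\<in>X. \<bar>k $ 1\<bar> + \<bar>k $ 2\<bar>)"
  have "k \<in> freq_box r" if k: "k \<in> X" and r: "m \<le> r" for k r
  proof -
    have "\<bar>k $ 1\<bar> + \<bar>k $ 2\<bar> \<le> (\<Sum>k\<in>X. \<bar>k $ 1\<bar> + \<bar>k $ 2\<bar>)"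
      using X k by (intro member_le_sum) auto
    then have "\<bar>k $ 1\<bar> + \<bar>k $ 2\<bar> \<le> int r" using r by (simp add: m_def nat_le_iff)
    moreover have "k \<noteq> 0" using X k by blast
    ultimately show ?thesis by (auto simp: freq_box_def forall_2)
  qed
  then have "\<forall>r\<ge>m. finite (freq_box r) \<and> X \<subseteq> freq_box r \<and> freq_box r \<subseteq> UNIV - {0}"
    using finite_freq_box by (auto simp: freq_box_def)
  then show "\<forall>\<^sub>F r in sequentially. finite (freq_box r) \<and> X \<subseteq> freq_box r \<and> freq_box r \<subseteq> UNIV - {0}"
    unfolding eventually_sequentially by blast
qed

context prob_space
begin

context
  fixes \<eta>0 :: "3 \<Rightarrow> 'a \<Rightarrow> real" and \<eta> :: "int^2 \<Rightarrow> 3 \<Rightarrow> 'a \<Rightarrow> complex"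
  assumes g0: "\<And>j. std_gaussian M (\<eta>0 j)" and gk: "\<And>k j. k \<noteq> 0 \<Longrightarrow> std_complex_gaussian M (\<eta> k j)"
    and indep: "indep_vars (\<lambda>_. borel) (\<lambda>(k, j). if k = 0 then (\<lambda>\<omega>. complex_of_real (\<eta>0 j \<omega>)) else \<eta> k
        j) UNIV"
begin

definition partial_noise :: "3 \<Rightarrow> (real^2 \<Rightarrow> real) \<Rightarrow> nat \<Rightarrow> 'a \<Rightarrow> real" where
  "partial_noise j f r \<omega> = \<eta>0 j \<omega> * fourier_cos f 0 +
     (\<Sum>k\<in>freq_box r. Re (\<eta> k j \<omega>) * fourier_cos f k - Im (\<eta> k j \<omega>) * fourier_sin f k)"

lemma noise_measurable [measurable]: "random_variable borel (\<eta>0 j)" "k \<noteq> 0 \<Longrightarrow> random_variable borel (\<eta> k j)"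
proof -
  show "random_variable borel (\<eta>0 j)"
    using g0[of j] distributed_measurable unfolding std_gaussian_def by fastforce
  have "random_variable borel (case (k, j) of (k, j) \<Rightarrow> if k = 0 then (\<lambda>\<omega>. complex_of_real (\<eta>0 j \<omega>)) else
      \<eta> k j)" for k j
    using indep unfolding indep_vars_def by blast
  then show "k \<noteq> 0 \<Longrightarrow> random_variable borel (\<eta> k j)" by (metis (mono_tags, lifting) case_prod_conv)
qed

lemma partial_noise_measurable [measurable]: "random_variable borel (partial_noise j f r)"
proof -
  have [measurable]: "random_variable borel (\<eta> k j)" if "k \<in> freq_box r" for k
    using that by (intro noise_measurable) (simp add: freq_box_def)
  show ?thesis unfolding partial_noise_def[abs_def] by measurable
qed

text \<open>Independence splits the moment into Gaussian factors whose exponents add up to half the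
  sum of the squared Fourier coefficients. Bessel's inequality bounds this uniformly in the
  truncation \<open>r\<close>. The sign \<open>s\<close> prepares the bound for the absolute
  value.\<close>

lemma partial_noise_exp_moment:
  assumes f: "f \<in> smooth_torus" and s: "s\<^sup>2 = 1"
  shows "(\<integral>\<^sup>+\<omega>. ennreal (exp (s * partial_noise j f r \<omega>)) \<partial>M) \<le> ennreal (exp (2 * pi\<^sup>2 * tint (\<lambda>x. (f x)\<^sup>2)))"
proof -
  let ?F = "insert 0 (freq_box r)"
  let ?C = "fourier_cos f" and ?S = "fourier_sin f"
  let ?X = "\<lambda>(k, j). if k = 0 then (\<lambda>\<omega>. complex_of_real (\<eta>0 j \<omega>)) else \<eta> k j"
  have fin: "finite ?F" and n0: "0 \<notin> freq_box r" using finite_freq_box by (auto simp: freq_box_def)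
  have S0: "?S 0 = 0" by (simp add: fourier_sin_def freq_def tint_def)
  \<comment> \<open>The linear form of a single mode; the zero mode carries a real variable embedded
    in the complex family, so its imaginary part is left out.\<close>
  define h where "h k z = (if k = 0 then s * ?C 0 * Re z else (s * ?C k) * Re z + (- s * ?S k) * Im z)"
      for k :: "int^2" and z
  have hm: "(\<lambda>z. ennreal (exp (h k z))) \<in> borel_measurable borel" for k
    unfolding h_def by (cases "k = 0") auto
  define I where "I = (\<lambda>k. (k, j)) ` ?F"
  have I: "finite I" unfolding I_def using fin by simp
  have iv: "indep_vars (\<lambda>_. borel) (\<lambda>i \<omega>. ennreal (exp (h (fst i) (?X i \<omega>)))) I"
    by (rule indep_vars_compose2[OF indep_vars_subset[OF indep subset_UNIV]]) (use hm in auto)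
  have "(\<integral>\<^sup>+\<omega>. ennreal (exp (s * partial_noise j f r \<omega>)) \<partial>M) = (\<integral>\<^sup>+\<omega>. (\<Prod>i\<in>I. ennreal (exp (h (fst i) (?X
      i \<omega>)))) \<partial>M)"
  proof (rule nn_integral_cong)
    fix \<omega>
    have "(\<Prod>i\<in>I. ennreal (exp (h (fst i) (?X i \<omega>)))) = (\<Prod>k\<in>?F. ennreal (exp (h k (?X (k, j) \<omega>))))"
      unfolding I_def by (subst prod.reindex) (auto simp: inj_on_def)
    also have "\<dots> = ennreal (exp (\<Sum>k\<in>?F. h k (?X (k, j) \<omega>)))"
      using fin by (simp add: prod_ennreal exp_sum)
    also have "(\<Sum>k\<in>?F. h k (?X (k, j) \<omega>)) = h 0 (complex_of_real (\<eta>0 j \<omega>)) + (\<Sum>k\<in>freq_box r. h k (?X (k,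
        j) \<omega>))"
      using finite_freq_box n0 by simp
    also have "(\<Sum>k\<in>freq_box r. h k (?X (k, j) \<omega>)) = (\<Sum>k\<in>freq_box r. s * (Re (\<eta> k j \<omega>) * ?C k - Im (\<eta> k j
        \<omega>) * ?S k))"
      by (intro sum.cong refl) (auto simp: h_def freq_box_def algebra_simps)
    also have "h 0 (complex_of_real (\<eta>0 j \<omega>)) + \<dots> = s * partial_noise j f r \<omega>"
      by (simp add: h_def partial_noise_def distrib_left sum_distrib_left mult_ac)
    finally show "ennreal (exp (s * partial_noise j f r \<omega>)) = (\<Prod>i\<in>I. ennreal (exp (h (fst i) (?X i
        \<omega>))))" by simp
  qed
  also have "\<dots> = (\<Prod>i\<in>I. \<integral>\<^sup>+\<omega>. ennreal (exp (h (fst i) (?X i \<omega>))) \<partial>M)"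
    by (rule indep_vars_nn_integral[OF I iv]) simp
  also have "\<dots> = (\<Prod>k\<in>?F. \<integral>\<^sup>+\<omega>. ennreal (exp (h k (?X (k, j) \<omega>))) \<partial>M)"
    unfolding I_def by (subst prod.reindex) (auto simp: inj_on_def)
  also have "\<dots> = (\<Prod>k\<in>?F. ennreal (exp (((?C k)\<^sup>2 + (?S k)\<^sup>2) / 2)))"
  proof (intro prod.cong refl)
    fix k
    show "(\<integral>\<^sup>+\<omega>. ennreal (exp (h k (?X (k, j) \<omega>))) \<partial>M) = ennreal (exp (((?C k)\<^sup>2 + (?S k)\<^sup>2) / 2))"
    proof (cases "k = 0")
      case True
      then show ?thesis
        using nn_integral_gaussian_exp[OF g0[of j], of "s * ?C 0"] s S0 by (simp add: h_def
            power_mult_distrib)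
    next
      case False
      then show ?thesis
        using nn_integral_complex_gaussian_exp[OF gk[OF False], where a = "s * ?C k" and b = "- s * ?S k"] s
        by (simp add: h_def power_mult_distrib)
    qed
  qed
  also have "\<dots> = ennreal (exp ((\<Sum>k\<in>?F. (?C k)\<^sup>2 + (?S k)\<^sup>2) / 2))"
    using fin by (simp only: prod_ennreal exp_ge_zero exp_sum sum_divide_distrib)
  also have "\<dots> \<le> ennreal (exp (2 * pi\<^sup>2 * tint (\<lambda>x. (f x)\<^sup>2)))"
    using bessel_inequality[OF f fin] by (intro ennreal_leI) simp
  finally show ?thesis .
qed

text \<open>White noise is described by its values almost surely, without measurability of
  \<open>W\<close>. The lower limit over truncations is measurable by construction, suits Fatou's
  lemma and equals \<open>exp \<bar>w\<bar>\<close> where the series converges, see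
  \<open>noise_exp_eq\<close>.\<close>

definition noise_exp :: "3 \<Rightarrow> (real^2 \<Rightarrow> real) \<Rightarrow> 'a \<Rightarrow> ennreal" where
  "noise_exp j f \<omega> = liminf (\<lambda>r. ennreal (exp \<bar>partial_noise j f r \<omega>\<bar>))"

lemma noise_exp_measurable [measurable]: "random_variable borel (noise_exp j f)"
  unfolding noise_exp_def[abs_def] by measurable

text \<open>\<open>exp \<bar>x\<bar> \<le> exp x + exp (- x)\<close> reduces to the moments with
  both signs, whence the factor 2; Fatou's lemma passes to the limit.\<close>

lemma nn_integral_noise_exp_le:
  assumes f: "f \<in> smooth_torus" and le: "tint (\<lambda>x. (f x)\<^sup>2) \<le> 1"
  shows "(\<integral>\<^sup>+\<omega>. noise_exp j f \<omega> \<partial>M) \<le> ennreal (2 * exp (2 * pi\<^sup>2))"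
proof -
  have bound: "(\<integral>\<^sup>+\<omega>. ennreal (exp \<bar>partial_noise j f r \<omega>\<bar>) \<partial>M) \<le> ennreal (2 * exp (2 * pi\<^sup>2))" for r
  proof -
    have "(\<integral>\<^sup>+\<omega>. ennreal (exp \<bar>partial_noise j f r \<omega>\<bar>) \<partial>M)
        \<le> (\<integral>\<^sup>+\<omega>. ennreal (exp (1 * partial_noise j f r \<omega>)) + ennreal (exp (- 1 * partial_noise j f r \<omega>)) \<partial>M)"
      by (intro nn_integral_mono) (auto simp: abs_if simp flip: ennreal_plus intro!: ennreal_leI)
    also have "\<dots> = (\<integral>\<^sup>+\<omega>. ennreal (exp (1 * partial_noise j f r \<omega>)) \<partial>M) + (\<integral>\<^sup>+\<omega>. ennreal (exp (- 1 *
        partial_noise j f r \<omega>)) \<partial>M)"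
      by (rule nn_integral_add) measurable
    also have "\<dots> \<le> ennreal (exp (2 * pi\<^sup>2 * tint (\<lambda>x. (f x)\<^sup>2))) + ennreal (exp (2 * pi\<^sup>2 * tint (\<lambda>x. (f
        x)\<^sup>2)))"
      by (intro add_mono partial_noise_exp_moment f) auto
    also have "\<dots> \<le> ennreal (exp (2 * pi\<^sup>2)) + ennreal (exp (2 * pi\<^sup>2))"
      using le by (intro add_mono ennreal_leI) (auto simp: mult_le_cancel_left2)
    also have "\<dots> = ennreal (2 * exp (2 * pi\<^sup>2))" by (simp flip: ennreal_plus)
    finally show ?thesis .
  qed
  have "(\<integral>\<^sup>+\<omega>. noise_exp j f \<omega> \<partial>M) \<le> liminf (\<lambda>r. \<integral>\<^sup>+\<omega>. ennreal (exp \<bar>partial_noise j f r \<omega>\<bar>) \<partial>M)"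
    unfolding noise_exp_def by (rule nn_integral_liminf) measurable
  also have "\<dots> \<le> liminf (\<lambda>r. ennreal (2 * exp (2 * pi\<^sup>2)))"
    by (intro Liminf_mono always_eventually allI bound)
  finally show ?thesis by (simp add: Liminf_const)
qed

lemma noise_exp_eq:
  assumes f: "f \<in> smooth_torus"
    and sum: "((\<lambda>k. dist_of (\<lambda>x. Re (\<eta> k j \<omega> * cis (freq k x))) f) has_sum (w - dist_of (\<lambda>x. \<eta>0 j \<omega>) f))
        (UNIV - {0})"
  shows "noise_exp j f \<omega> = ennreal (exp \<bar>w\<bar>)"
proof -
  have s: "(\<lambda>x. f x * cos (freq k x)) \<in> smooth_torus" "(\<lambda>x. f x * sin (freq k x)) \<in> smooth_torus" for k
    by (intro smooth_torus_mult f cos_freq_smooth_torus sin_freq_smooth_torus)+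
  have mode: "dist_of (\<lambda>x. Re (\<eta> k j \<omega> * cis (freq k x))) f = Re (\<eta> k j \<omega>) * fourier_cos f k - Im (\<eta> k j
      \<omega>) * fourier_sin f k" for k
  proof -
    have "dist_of (\<lambda>x. Re (\<eta> k j \<omega> * cis (freq k x))) f
        = tint (\<lambda>x. Re (\<eta> k j \<omega>) * (f x * cos (freq k x)) - Im (\<eta> k j \<omega>) * (f x * sin (freq k x)))"
      by (simp add: dist_of_def tint_def algebra_simps)
    also have "\<dots> = tint (\<lambda>x. Re (\<eta> k j \<omega>) * (f x * cos (freq k x))) - tint (\<lambda>x. Im (\<eta> k j \<omega>) * (f x *
        sin (freq k x)))"
      by (rule distribution_diff[OF tint_distribution]) (intro smooth_torus_cmult s)+
    finally show ?thesis
      unfolding distribution_cmult[OF tint_distribution s(1)] distribution_cmult[OF tint_distribution s(2)]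
      by (simp add: fourier_cos_def fourier_sin_def)
  qed
  have zero: "dist_of (\<lambda>x. \<eta>0 j \<omega>) f = \<eta>0 j \<omega> * fourier_cos f 0"
    unfolding dist_of_def fourier_cos_def tint_def by (simp add: freq_def)
  have "((\<lambda>r. \<Sum>k\<in>freq_box r. Re (\<eta> k j \<omega>) * fourier_cos f k - Im (\<eta> k j \<omega>) * fourier_sin f k) \<longlongrightarrow> w - \<eta>0 j
      \<omega> * fourier_cos f 0) sequentially"
    using filterlim_compose[OF sum[unfolded has_sum_def mode zero] filterlim_freq_box] .
  from tendsto_add[OF tendsto_const[of "\<eta>0 j \<omega> * fourier_cos f 0"] this]
  have "(\<lambda>r. partial_noise j f r \<omega>) \<longlonglongrightarrow> w" by (simp add: partial_noise_def)
  then have "(\<lambda>r. ennreal (exp \<bar>partial_noise j f r \<omega>\<bar>)) \<longlonglongrightarrow> ennreal (exp \<bar>w\<bar>)"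
    by (intro tendsto_intros) auto
  then show ?thesis unfolding noise_exp_def by (intro lim_imp_Liminf) auto
qed

text \<open>The grid at level \<open>n\<close> has about \<open>4\<^sup>N\<^sup>n\<close> points, but the exponential moments still bound all values by a
multiple of \<open>(n + 1) 2\<^sup>n\<close>. So \<open>N\<close> can be chosen after the unknown order of the distribution, to pass
from the grid to all points.\<close>

lemma AE_grid_bound:
  assumes W: "AE \<omega> in M. distribution (W \<omega>) \<and> (\<forall>\<phi>\<in>smooth_torus.
       ((\<lambda>k. dist_of (\<lambda>x. Re (\<eta> k j \<omega> * cis (freq k x))) \<phi>) has_sum (W \<omega> \<phi> - dist_of (\<lambda>x. \<eta>0 j \<omega>) \<phi>))
           (UNIV - {0}))"
    and \<psi>: "smooth \<psi>" "{x. \<psi> x \<noteq> 0} \<subseteq> cball 0 (1 / 2)"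
  shows "AE \<omega> in M. \<exists>C. \<forall>n. \<forall>x\<in>dyadic_grid N n. \<bar>dist_conv (W \<omega>) (mollifier_at \<psi> (2 ^ n)) x\<bar> \<le> C * real
      (n + 1) * 2 ^ n"
proof -
  have bd: "bounded {x. \<psi> x \<noteq> 0}" using \<psi>(2) bounded_cball bounded_subset by blast
  have m: "mollifier_at \<psi> (2 ^ n) \<in> smooth_torus" for n by (rule mollifier_at_smooth_torus[OF \<psi>(1) bd]) simp
  obtain B where B: "0 \<le> B" "\<And>c x. 1 \<le> c \<Longrightarrow> \<bar>scaled_kernel c \<psi> x\<bar> \<le> B"
    using scaled_kernel_sup_bound[OF smooth_continuous[OF \<psi>(1)] \<psi>(2)] by blast
  define J where "J = (LINT x|lborel. \<bar>\<psi> x\<bar>)"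
  have J: "0 \<le> J" unfolding J_def by (rule integral_nonneg_AE) simp
  \<comment> \<open>Normalises the tests in mean square: the square of the mollifier integrates to
    at most its supremum \<open>4 ^ n * B\<close> times its mass bound \<open>J\<close>, which also
    explains the factor \<open>1 / 2 ^ n\<close> in \<open>f\<close>.\<close>
  define a where "a = 1 / sqrt (B * J + 1)"
  have a: "0 < a" "a\<^sup>2 * (B * J) \<le> 1"
    using B(1) J by (auto simp: a_def power_divide add_nonneg_pos divide_le_eq)
  define f where "f n x y = (a / 2 ^ n) * mollifier_at \<psi> (2 ^ n) (x - y)" for n x y
  have f: "f n x \<in> smooth_torus" for n x
    unfolding f_def[abs_def] by (intro smooth_torus_cmult smooth_torus_reflect m)
  have f1: "tint (\<lambda>y. (f n x y)\<^sup>2) \<le> 1" for n x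
  proof -
    let ?c = "2 ^ n :: real"
    let ?m = "mollifier_at \<psi> ?c"
    have cm: "continuous_on UNIV ?m" by (rule smooth_torus_continuous[OF m])
    have cf: "continuous_on UNIV (f n x)" by (rule smooth_torus_continuous[OF f])
    have c2: "continuous_on UNIV (\<lambda>y. \<bar>?m (x - y)\<bar>)" by (intro continuous_intros continuous_reflect cm)
    have "tint (\<lambda>y. (f n x y)\<^sup>2) \<le> tint (\<lambda>y. (a\<^sup>2 * B) * \<bar>?m (x - y)\<bar>)"
      unfolding tint_def
    proof (rule set_integral_torus_mono)
      show "set_integrable lborel torus (\<lambda>y. (f n x y)\<^sup>2)" by (intro set_integrable_torus
          continuous_intros cf)
      show "set_integrable lborel torus (\<lambda>y. (a\<^sup>2 * B) * \<bar>?m (x - y)\<bar>)" by (intro set_integrable_torus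
          continuous_intros c2)
      fix y
      have "(f n x y)\<^sup>2 = (a / ?c)\<^sup>2 * (\<bar>?m (x - y)\<bar> * \<bar>?m (x - y)\<bar>)"
        by (simp add: f_def power_mult_distrib power2_eq_square abs_mult_self_eq)
      also have "\<dots> \<le> (a / ?c)\<^sup>2 * ((?c\<^sup>2 * B) * \<bar>?m (x - y)\<bar>)"
        using B(2)[of ?c "x - y"] by (intro mult_left_mono mult_right_mono) (auto simp: mollifier_at_def
            abs_mult)
      also have "\<dots> = (a\<^sup>2 * B) * \<bar>?m (x - y)\<bar>" by (simp add: power_divide)
      finally show "(f n x y)\<^sup>2 \<le> (a\<^sup>2 * B) * \<bar>?m (x - y)\<bar>" .
    qed
    also have "\<dots> = (a\<^sup>2 * B) * (LINT y:torus|lborel. \<bar>?m (x - y)\<bar>)" by (simp add: tint_def)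
    also have "(LINT y:torus|lborel. \<bar>?m (x - y)\<bar>) = (LINT y:torus|lborel. \<bar>?m y\<bar>)"
      by (rule torus_integral_reflect_translate)
         (use smooth_torusD(2)[OF m] in \<open>auto intro!: continuous_intros cm simp: periodic2_def\<close>)
    also have "(a\<^sup>2 * B) * \<dots> \<le> (a\<^sup>2 * B) * J"
      using torus_integral_abs_scaled_kernel[OF smooth_continuous[OF \<psi>(1)] bd, of ?c] B(1)
      unfolding J_def mollifier_at_def by (intro mult_left_mono) auto
    also have "\<dots> \<le> 1" using a(2) by (simp add: mult.assoc)
    finally show ?thesis .
  qed
  \<comment> \<open>\<open>4 ^ (N * n)\<close> offsets the number of grid points and
    \<open>2 ^ n\<close> makes the sum over the levels converge.\<close>
  define w where "w n = 1 / (4 ^ (N * n) * 2 ^ n :: real)" for n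
  have w: "0 < w n" for n by (simp add: w_def)
  define E where "E = 2 * exp (2 * pi\<^sup>2)"
  \<comment> \<open>The expectation of this sum is finite, so almost surely one finite random number
    controls all grid values at all levels.\<close>
  define V where "V \<omega> = (\<Sum>n. \<Sum>x\<in>dyadic_grid N n. ennreal (w n) * noise_exp j (f n x) \<omega>)" for \<omega>
  have [measurable]: "V \<in> borel_measurable M" unfolding V_def[abs_def] by measurable
  have "(\<integral>\<^sup>+\<omega>. V \<omega> \<partial>M) = (\<Sum>n. \<Sum>x\<in>dyadic_grid N n. ennreal (w n) * (\<integral>\<^sup>+\<omega>. noise_exp j (f n x) \<omega> \<partial>M))"
    unfolding V_def by (subst nn_integral_suminf) (auto simp: nn_integral_sum nn_integral_cmult)
  also have "\<dots> \<le> (\<Sum>n. ennreal (81 * E * (1 / 2) ^ n))"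
  proof (rule suminf_le[OF _ summableI summableI])
    fix n
    have "(\<Sum>x\<in>dyadic_grid N n. ennreal (w n) * (\<integral>\<^sup>+\<omega>. noise_exp j (f n x) \<omega> \<partial>M)) \<le> (\<Sum>x\<in>dyadic_grid N n.
        ennreal (w n) * ennreal E)"
      unfolding E_def by (intro sum_mono mult_left_mono nn_integral_noise_exp_le f f1) simp
    also have "\<dots> = ennreal (real (card (dyadic_grid N n)) * (w n * E))"
      using w[of n] by (simp add: E_def ennreal_mult ennreal_of_nat_eq_real_of_nat)
    also have "\<dots> \<le> ennreal ((81 * 4 ^ (N * n)) * (w n * E))"
      using w[of n] card_dyadic_grid_le[of N n] by (intro ennreal_leI mult_right_mono) (auto simp: E_def)
    also have "(81 * 4 ^ (N * n)) * (w n * E) = 81 * E * (1 / 2) ^ n" by (simp add: w_def power_divide)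
    finally show "(\<Sum>x\<in>dyadic_grid N n. ennreal (w n) * (\<integral>\<^sup>+\<omega>. noise_exp j (f n x) \<omega> \<partial>M)) \<le> ennreal (81 *
        E * (1 / 2) ^ n)" .
  qed
  also have "\<dots> = ennreal (\<Sum>n. 81 * E * (1 / 2) ^ n)"
    by (rule suminf_ennreal2) (auto simp: E_def intro!: summable_mult summable_geometric)
  finally have "(\<integral>\<^sup>+\<omega>. V \<omega> \<partial>M) \<le> ennreal (\<Sum>n. 81 * E * (1 / 2) ^ n)" .
  then have "(\<integral>\<^sup>+\<omega>. V \<omega> \<partial>M) \<noteq> \<infinity>" using neq_top_trans[OF ennreal_neq_top] by simp
  then have "AE \<omega> in M. V \<omega> \<noteq> \<infinity>" by (intro nn_integral_PInf_AE) measurable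
  with W show ?thesis
  proof eventually_elim
    case (elim \<omega>)
    define v where "v = enn2real (V \<omega>)"
    have v: "V \<omega> = ennreal v" using elim(2) by (simp add: v_def less_top)
    have D: "distribution (W \<omega>)" using elim(1) by simp
    show ?case
    proof (intro exI[of _ "(\<bar>ln (max v 1)\<bar> + (2 * real N + 1)) / a"] allI ballI)
      fix n x assume x: "x \<in> dyadic_grid N n"
      have Z: "noise_exp j (f n x) \<omega> = ennreal (exp \<bar>W \<omega> (f n x)\<bar>)"
        using elim(1) f by (intro noise_exp_eq) auto
      have "ennreal (w n) * noise_exp j (f n x) \<omega> \<le> (\<Sum>x\<in>dyadic_grid N n. ennreal (w n) * noise_exp j (f
          n x) \<omega>)"
        by (rule member_le_sum[OF x]) (auto simp: finite_dyadic_grid)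
      also have "\<dots> \<le> V \<omega>"
        unfolding V_def using sum_le_suminf[OF summableI, of "{n}" "\<lambda>n. \<Sum>x\<in>dyadic_grid N n. ennreal (w
            n) * noise_exp j (f n x) \<omega>"] by simp
      finally have "ennreal (w n * exp \<bar>W \<omega> (f n x)\<bar>) \<le> ennreal v"
        unfolding Z v using w[of n] by (simp add: ennreal_mult)
      then have "w n * exp \<bar>W \<omega> (f n x)\<bar> \<le> v"
        by (simp add: v_def)
      then have "exp \<bar>W \<omega> (f n x)\<bar> \<le> v * (4 ^ (N * n) * 2 ^ n)" by (simp add: w_def divide_le_eq)
      also have "\<dots> \<le> max v 1 * (4 ^ (N * n) * 2 ^ n)" by (intro mult_right_mono) auto
      \<comment> \<open>The logarithm turns weights exponential in \<open>n\<close> into growth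
        linear in \<open>n\<close>.\<close>
      finally have "\<bar>W \<omega> (f n x)\<bar> \<le> ln (max v 1 * (4 ^ (N * n) * 2 ^ n))"
        by (subst ln_ge_iff) auto
      also have "\<dots> = ln (max v 1) + (real (N * n) * ln 4 + real n * ln 2)"
        by (simp add: ln_mult ln_realpow)
      also have "\<dots> \<le> \<bar>ln (max v 1)\<bar> * real (n + 1) + (2 * real N + 1) * real (n + 1)"
      proof -
        have "ln 4 \<le> (2 :: real)" "ln 2 \<le> (1 :: real)"
          using ln_2_less_1 ln_realpow[of 2 2] by auto
        then have "real (N * n) * ln 4 + real n * ln 2 \<le> real (N * n) * 2 + real n * 1"
          by (intro add_mono mult_left_mono) auto
        also have "\<dots> \<le> (2 * real N + 1) * real (n + 1)" by (simp add: algebra_simps)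
        moreover have "ln (max v 1) \<le> \<bar>ln (max v 1)\<bar> * real (n + 1)"
          using abs_ge_self[of "ln (max v 1)"] mult_left_mono[of 1 "real (n + 1)" "\<bar>ln (max v 1)\<bar>"] by
              linarith
        ultimately show ?thesis by linarith
      qed
      finally have le: "\<bar>W \<omega> (f n x)\<bar> \<le> (\<bar>ln (max v 1)\<bar> + (2 * real N + 1)) * real (n + 1)" by (simp
          only: distrib_right)
      have "W \<omega> (f n x) = (a / 2 ^ n) * dist_conv (W \<omega>) (mollifier_at \<psi> (2 ^ n)) x"
        unfolding f_def[abs_def] dist_conv_def real_scaleR_def[symmetric]
        by (rule distribution_cmult[OF D smooth_torus_reflect[OF m], unfolded real_scaleR_def[symmetric]])
      then have "\<bar>dist_conv (W \<omega>) (mollifier_at \<psi> (2 ^ n)) x\<bar> = \<bar>W \<omega> (f n x)\<bar> * (2 ^ n / a)"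
        using a(1) by (simp add: abs_mult)
      also have "\<dots> \<le> ((\<bar>ln (max v 1)\<bar> + (2 * real N + 1)) * real (n + 1)) * (2 ^ n / a)"
        using a(1) le by (intro mult_right_mono) auto
      finally show "\<bar>dist_conv (W \<omega>) (mollifier_at \<psi> (2 ^ n)) x\<bar> \<le> (\<bar>ln (max v 1)\<bar> + (2 * real N + 1)) /
          a * real (n + 1) * 2 ^ n"
        by simp
    qed
  qed
qed

end

end

text \<open>The order of the distribution depends on the realisation, so the grid bounds are
  collected for all \<open>N\<close> outside one null set, a countable union; the uncountably many
  \<delta> are then treated for each realisation separately.\<close>

lemma AE_regular_noise:
  assumes "white_noise_3d M W"
  shows "AE \<omega> in M. regular_noise (W \<omega>)"
proof -
  interpret prob_space M using assms by (simp add: white_noise_3d_def)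
  obtain \<eta>0 :: "3 \<Rightarrow> 'a \<Rightarrow> real" and \<eta> :: "int^2 \<Rightarrow> 3 \<Rightarrow> 'a \<Rightarrow> complex" where
    g: "\<And>j. std_gaussian M (\<eta>0 j)" "\<And>k j. k \<noteq> 0 \<Longrightarrow> std_complex_gaussian M (\<eta> k j)"
    "indep_vars (\<lambda>_. borel) (\<lambda>(k, j). if k = 0 then (\<lambda>\<omega>. complex_of_real (\<eta>0 j \<omega>)) else \<eta> k j) UNIV"
    and W: "AE \<omega> in M. \<forall>j. distribution (W \<omega> j) \<and> (\<forall>\<phi>\<in>smooth_torus.
              ((\<lambda>k. dist_of (\<lambda>x. Re (\<eta> k j \<omega> * cis (freq k x))) \<phi>) has_sum
                 (W \<omega> j \<phi> - dist_of (\<lambda>x. \<eta>0 j \<omega>) \<phi>)) (UNIV - {0}))"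
    using assms unfolding white_noise_3d_def by blast
  have Wj: "AE \<omega> in M. distribution (W \<omega> j) \<and> (\<forall>\<phi>\<in>smooth_torus.
              ((\<lambda>k. dist_of (\<lambda>x. Re (\<eta> k j \<omega> * cis (freq k x))) \<phi>) has_sum
                 (W \<omega> j \<phi> - dist_of (\<lambda>x. \<eta>0 j \<omega>) \<phi>)) (UNIV - {0}))" for j
    using W by eventually_elim blast
  have "AE \<omega> in M. \<forall>\<delta>. 0 < \<delta> \<longrightarrow> \<delta> < 1 \<longrightarrow> real_norm (- 1 - \<delta>) (W \<omega> j) < \<infinity>" for j
  proof -
    have "AE \<omega> in M. \<forall>N. \<exists>C. \<forall>n. \<forall>x\<in>dyadic_grid N n. \<bar>dist_conv (W \<omega> j) (mollifier_at delta_kernel (2 ^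
        n)) x\<bar> \<le> C * real (n + 1) * 2 ^ n"
      unfolding AE_all_countable
      by (intro allI AE_grid_bound[OF g Wj smooth_delta_kernel delta_kernel_support])
    moreover have "AE \<omega> in M. \<forall>N. \<exists>C. \<forall>n. \<forall>x\<in>dyadic_grid N n. \<bar>dist_conv (W \<omega> j) (mollifier_at
        step_kernel (2 ^ n)) x\<bar> \<le> C * real (n + 1) * 2 ^ n"
      unfolding AE_all_countable
      by (intro allI AE_grid_bound[OF g Wj smooth_step_kernel step_kernel_support])
    ultimately show ?thesis
      using Wj[of j]
    proof eventually_elim
      case (elim \<omega>)
      show ?case
        by (intro allI impI real_norm_finite_of_grid)
           (use elim(3) elim(1)[rule_format] elim(2)[rule_format] in simp_all)
    qed
  qed
  then have "AE \<omega> in M. \<forall>j. \<forall>\<delta>. 0 < \<delta> \<longrightarrow> \<delta> < 1 \<longrightarrow> real_norm (- 1 - \<delta>) (W \<omega> j) < \<infinity>"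
    by (rule eventually_all_finite)
  with W show ?thesis
    by eventually_elim (auto simp: regular_noise_def)
qed

theorem proposition4p7:
  fixes M :: "'m measure"
    and W :: "'m \<Rightarrow> 3 \<Rightarrow> real functional"
    and K \<rho> :: "real^2 \<Rightarrow> real"
  assumes "white_noise_3d M W" and "is_green K" and "is_mollifier \<rho>"
  shows "(\<exists>\<theta>. AE \<omega> in M. theta_limit K \<rho> (W \<omega>) (\<theta> \<omega>)) \<and>
    (\<forall>\<theta>. (AE \<omega> in M. theta_limit K \<rho> (W \<omega>) (\<theta> \<omega>)) \<longrightarrow>
      (AE \<omega> in M. \<forall>\<kappa>\<in>{0<..<1/2}. \<theta> \<omega> \<in> E_space (- \<kappa>)) \<and>
      (\<forall>\<kappa>\<in>{0<..<1/2}. \<exists>C::real. C > 0 \<and> (AE \<omega> in M. \<forall>\<epsilon>\<ge>0. \<forall>j::3.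
         complex_norm (- \<kappa>) (theta_ext K \<rho> (W \<omega>) (\<theta> \<omega>) \<epsilon> j)
           \<le> ennreal C * real_norm (- 1 - \<kappa> / 4) (W \<omega> (j + 1)) * real_norm (- 1 - \<kappa> / 4) (W \<omega> (j + 2)) \<and>
         complex_norm (- \<kappa>) (dist_diff (theta_ext K \<rho> (W \<omega>) (\<theta> \<omega>) \<epsilon> j) (\<theta> \<omega> j))
           \<le> ennreal C *
             (real_norm (- 1 - \<kappa> / 4) (dist_diff (mollified_dist \<rho> \<epsilon> (W \<omega> (j + 1))) (W \<omega> (j + 1)))
                * real_norm (- 1 - \<kappa> / 4) (W \<omega> (j + 2)) +
              real_norm (- 1 - \<kappa> / 4) (dist_diff (mollified_dist \<rho> \<epsilon> (W \<omega> (j + 2))) (W \<omega> (j + 2)))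
                * real_norm (- 1 - \<kappa> / 4) (W \<omega> (j + 1))))))"
  unfolding theta_estimate_def[OF assms(2,3), symmetric]
proof (intro conjI allI impI ballI)
  note reg = AE_regular_noise[OF assms(1)]
  have "AE \<omega> in M. theta_limit K \<rho> (W \<omega>) (\<lambda>j. cbrak K (W \<omega> (j + 1)) (W \<omega> (j + 2)))"
    using reg by eventually_elim (rule theta_limit_cbrak[OF assms(2,3)])
  then show "\<exists>\<theta>. AE \<omega> in M. theta_limit K \<rho> (W \<omega>) (\<theta> \<omega>)"
    by (rule exI[of _ "\<lambda>\<omega> j. cbrak K (W \<omega> (j + 1)) (W \<omega> (j + 2))"])
  \<comment> \<open>Outside a null set the noise is regular and \<theta> is a limit for the given
    realisation; uniqueness of limits makes it the bracket there, so the deterministic results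
    apply.\<close>
  fix \<theta> assume lim: "AE \<omega> in M. theta_limit K \<rho> (W \<omega>) (\<theta> \<omega>)"
  show "AE \<omega> in M. \<forall>\<kappa>\<in>{0<..<1/2}. \<theta> \<omega> \<in> E_space (- \<kappa>)"
    using reg lim by eventually_elim (simp add: theta_in_E_space[OF assms(2,3)])
  fix \<kappa> :: real assume "\<kappa> \<in> {0<..<1/2}"
  then obtain C where C: "0 < C" "\<And>W \<theta>. regular_noise W \<Longrightarrow> theta_limit K \<rho> W \<theta> \<Longrightarrow> theta_estimate K \<rho> \<kappa> C W \<theta>"
    using theta_bounds[OF assms(2,3), of \<kappa>] by auto
  have "AE \<omega> in M. theta_estimate K \<rho> \<kappa> C (W \<omega>) (\<theta> \<omega>)"
    using reg lim by eventually_elim (rule C(2))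
  with C(1) show "\<exists>C>0. AE \<omega> in M. theta_estimate K \<rho> \<kappa> C (W \<omega>) (\<theta> \<omega>)" by blast
qed

end
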